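(* Let $\nu>0$, and let $$\Lambda=\{0=\lambda_0<\lambda_1<\lambda_2<\cdots\},\qquad M=\{0=\mu_0<\mu_1<\mu_2<\cdots\}$$ be two increasing sequences that decompose $[0,\infty)$. If one of the following conditions holds, then $(\Lambda,M)$ is a uniqueness pair for the Hankel transform $H_\nu$: the only function $f\in\mathcal D_\nu$ satisfying $f(\lambda_j)=0$ and $H_\nu f(\mu_j)=0$ for all $j\ge1$ is $f=0$. 1. The pair has uniformly supercritical kinetic Dirichlet confinement, that is, $$\inf_{j\ge0}\frac{\sqrt{\kappa^{L_\nu}_{[\lambda_j,\lambda_{j+1}]}}}{\lambda_{j+1}}>1,\qquad\inf_{j\ge0}\frac{\sqrt{\kappa^{L_\nu}_{[\mu_j,\mu_{j+1}]}}}{\mu_{j+1}}>1.$$ In particular, the conclusion holds if $$\frac{\sqrt{\kappa^{L_\nu}_{[0,\lambda_1]}}}{\lambda_1}>1,\qquad\frac{\sqrt{\kappa^{L_\nu}_{[0,\mu_1]}}}{\mu_1}>1,$$ and $$\inf_{j\ge1}\frac1{\lambda_{j+1}^2}\Big[\frac{\pi^2}{(\lambda_{j+1}-\lambda_j)^2}+\inf_{r\in[\lambda_j,\lambda_{j+1}]}\frac{\nu^2-\frac14}{r^2}\Big]>1,\quad \inf_{j\ge1}\frac1{\mu_{j+1}^2}\Big[\frac{\pi^2}{(\mu_{j+1}-\mu_j)^2}+\inf_{r\in[\mu_j,\mu_{j+1}]}\frac{\nu^2-\frac14}{r^2}\Big]>1.$$ 2. The pair has uniformly supercritical Hamiltonian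 confinement energy, that is, $$\inf_{j\ge0}\frac{\sqrt{E^{D_\nu}_{[\lambda_j,\lambda_{j+1}]}}}{\lambda_{j+1}}>1,\qquad\inf_{j\ge0}\frac{\sqrt{E^{D_\nu}_{[\mu_j,\mu_{j+1}]}}}{\mu_{j+1}}>1.$$ In particular, the conclusion holds if $$\frac{\sqrt{E^{D_\nu}_{[0,\lambda_1]}}}{\lambda_1}>1,\qquad\frac{\sqrt{E^{D_\nu}_{[0,\mu_1]}}}{\mu_1}>1,$$ and $$\inf_{j\ge1}\frac1{\lambda_{j+1}^2}\Big[\frac{\pi^2}{2(\lambda_{j+1}-\lambda_j)^2}+\frac12\inf_{r\in[\lambda_j,\lambda_{j+1}]}\Big(\frac{\nu^2-\frac14}{r^2}+r^2\Big)\Big]>1,$$ $$\inf_{j\ge1}\frac1{\mu_{j+1}^2}\Big[\frac{\pi^2}{2(\mu_{j+1}-\mu_j)^2}+\frac12\inf_{r\in[\mu_j,\mu_{j+1}]}\Big(\frac{\nu^2-\frac14}{r^2}+r^2\Big)\Big]>1.$$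
   Context: The Hankel transform of order $\nu$ in the unitary convention on $L^2(\mathbb R^+)$, $\mathbb R^+=(0,\infty)$, is $$H_\nu[f](k)=\int_0^\infty f(r)J_\nu(kr)\sqrt{kr}\,dr,$$ where $J_\nu$ is the Bessel function of the first kind. It is unitary with $H_\nu^{-1}=H_\nu$. The Hankel-symmetric space is $$\mathcal D_\nu=\{f\in L^2(\mathbb R^+):\ rf\in L^2(\mathbb R^+)\ \text{and}\ rH_\nu f\in L^2(\mathbb R^+)\}.$$ Elements of $\mathcal D_\nu$ have locally continuous representatives on $(0,\infty)$, and point evaluations at positive points refer to these. $H_\nu$ maps $\mathcal D_\nu$ onto itself. The operators involved are $$L_\nu=-\frac{d^2}{dr^2}+\frac{\nu^2-\frac14}{r^2}\ (=H_\nu M_{r^2}H_\nu),\qquad D_\nu=\tfrac12(L_\nu+M_{r^2}),$$ where $M_{r^2}$ is multiplication by $r^2$ and $L_\nu$ is the Friedrichs realization on $L^2(\mathbb R^+)$. For a bounded interval $I=[a,b]\subset[0,\infty)$, $\kappa_I^{L_\nu}$ and $E_I^{D_\nu}$ denote the Dirichlet spectral floors (infima of the spectrum) of the Friedrichs realizations on $L^2(I)$ of $L_\nu$ and $D_\nu$, with ordinary Dirichlet conditions at positive endpoints and the Friedrichs boundary condition at the singular endpoint $0$ if $a=0$. Equivalently, $$\kappa_I^{L_\nu}=\inf_{0\ne g\in C_c^\infty((a,b))}\frac{\int_a^b\big(|g'|^2+\frac{\nu^2-1/4}{r^2}|g|^2\big)dr}{\int_a^b|g|^2dr},\qquad E_I^{D_\nu}=\inf_{0\ne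 g\in C_c^\infty((a,b))}\frac{\frac12\int_a^b\big(|g'|^2+\frac{\nu^2-1/4}{r^2}|g|^2+r^2|g|^2\big)dr}{\int_a^b|g|^2dr}.$$ That the sequences decompose $[0,\infty)$ means $\lambda_j\to\infty$ and $\mu_j\to\infty$. *)

theory Defs
  imports "HOL-Analysis.Analysis"
begin

text \<open>Elements of \<open>L\<^sup>2(S)\<close> are represented by functions on the real line, of which only the values
  on \<open>S\<close> matter; equality of elements is equality almost everywhere on \<open>S\<close>.\<close>

definition L2 :: "real set \<Rightarrow> (real \<Rightarrow> complex) set" where
  "L2 S = {f. set_borel_measurable lborel S f \<and> set_integrable lborel S (\<lambda>x. (cmod (f x))\<^sup>2)}"

definition L2_inner :: "real set \<Rightarrow> (real \<Rightarrow> complex) \<Rightarrow> (real \<Rightarrow> complex) \<Rightarrow> complex" where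
  "L2_inner S f g = (LINT x:S|lborel. f x * cnj (g x))"

definition L2_norm :: "real set \<Rightarrow> (real \<Rightarrow> complex) \<Rightarrow> real" where
  "L2_norm S f = sqrt (LINT x:S|lborel. (cmod (f x))\<^sup>2)"

definition L2_eq :: "real set \<Rightarrow> (real \<Rightarrow> complex) \<Rightarrow> (real \<Rightarrow> complex) \<Rightarrow> bool" where
  "L2_eq S f g \<longleftrightarrow> (AE x in lborel. x \<in> S \<longrightarrow> f x = g x)"


section \<open>The Hankel transform\<close>

text \<open>Bessel function of the first kind, for positive argument.\<close>

definition bessel_J :: "real \<Rightarrow> real \<Rightarrow> real" where
  "bessel_J \<nu> x =
     (\<Sum>m. (-1) ^ m / (fact m * Gamma (real m + \<nu> + 1)) * (x / 2) powr (2 * real m + \<nu>))"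

text \<open>A function with \<open>f\<close> and \<open>r f\<close> in \<open>L\<^sup>2(0,\<infinity>)\<close> is integrable, and \<open>J\<^sub>\<nu>(x) \<surd>x\<close> is bounded on
  \<open>(0,\<infinity>)\<close> for \<open>\<nu> > 0\<close>; so for such \<open>f\<close> (the only ones used below) the integral converges
  absolutely for every \<open>k > 0\<close> and is the unitary Hankel transform.\<close>

definition hankel :: "real \<Rightarrow> (real \<Rightarrow> complex) \<Rightarrow> real \<Rightarrow> complex" where
  "hankel \<nu> f k = (LINT r:{0<..}|lborel. f r * of_real (bessel_J \<nu> (k * r) * sqrt (k * r)))"

definition hankel_space :: "real \<Rightarrow> (real \<Rightarrow> complex) set" where
  "hankel_space \<nu> = {f. f \<in> L2 {0<..} \<and> (\<lambda>r. of_real r * f r) \<in> L2 {0<..} \<and>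
                        (\<lambda>r. of_real r * hankel \<nu> f r) \<in> L2 {0<..}}"

text \<open>Point evaluations of \<open>f\<close> and of its transform are those of the continuous representatives
  \<open>g\<close> and \<open>h\<close>.\<close>

definition hankel_uniqueness_pair :: "real \<Rightarrow> (nat \<Rightarrow> real) \<Rightarrow> (nat \<Rightarrow> real) \<Rightarrow> bool" where
  "hankel_uniqueness_pair \<nu> lam mu \<longleftrightarrow>
     (\<forall>f \<in> hankel_space \<nu>. \<forall>g h.
        continuous_on {0<..} g \<and> L2_eq {0<..} g f \<and>
        continuous_on {0<..} h \<and> L2_eq {0<..} h (hankel \<nu> f) \<and>
        (\<forall>j\<ge>1. g (lam j) = 0) \<and> (\<forall>j\<ge>1. h (mu j) = 0)
        \<longrightarrow> L2_eq {0<..} f (\<lambda>_. 0))"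


section \<open>Friedrichs realizations and spectral floors\<close>

definition vderiv :: "(real \<Rightarrow> complex) \<Rightarrow> real \<Rightarrow> complex" where
  "vderiv f x = vector_derivative f (at x)"

text \<open>\<open>C\<^sub>c\<^sup>\<infinity>((a,b))\<close>\<close>

definition test_functions :: "real \<Rightarrow> real \<Rightarrow> (real \<Rightarrow> complex) set" where
  "test_functions a b =
     {f. (\<forall>n x. (vderiv ^^ n) f differentiable (at x)) \<and>
         compact (closure {x. f x \<noteq> 0}) \<and> closure {x. f x \<noteq> 0} \<subseteq> {a<..<b}}"

text \<open>The graph of the Friedrichs extension, on \<open>L\<^sup>2(S)\<close>, of a symmetric semibounded operator \<open>A\<close>
  with domain \<open>D\<close>: the restriction of the adjoint of \<open>A\<close> to those \<open>u\<close> which lie in the domain of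
  the closure of the quadratic form \<open>\<langle>A \<phi>, \<phi>\<rangle>\<close>, \<open>\<phi> \<in> D\<close>.\<close>

definition friedrichs ::
  "real set \<Rightarrow> (real \<Rightarrow> complex) set \<Rightarrow> ((real \<Rightarrow> complex) \<Rightarrow> real \<Rightarrow> complex) \<Rightarrow>
   (real \<Rightarrow> complex) \<Rightarrow> (real \<Rightarrow> complex) \<Rightarrow> bool" where
  "friedrichs S D A u w \<longleftrightarrow>
     u \<in> L2 S \<and> w \<in> L2 S \<and>
     (\<forall>\<phi>\<in>D. L2_inner S (A \<phi>) u = L2_inner S \<phi> w) \<and>
     (\<exists>\<phi>. (\<forall>n::nat. \<phi> n \<in> D) \<and>
          (\<lambda>n. L2_norm S (\<lambda>x. \<phi> n x - u x)) \<longlonglongrightarrow> 0 \<and>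
          (\<forall>\<epsilon>>0. \<exists>N. \<forall>m\<ge>N. \<forall>n\<ge>N.
             cmod (L2_inner S (A (\<lambda>x. \<phi> m x - \<phi> n x)) (\<lambda>x. \<phi> m x - \<phi> n x)) < \<epsilon>))"

text \<open>Spectrum of the operator on \<open>L\<^sup>2(S)\<close> with graph \<open>T\<close>: the complement of the set of those \<open>z\<close>
  for which \<open>T - z\<close> maps the domain onto \<open>L\<^sup>2(S)\<close> and has a bounded inverse.\<close>

definition op_spectrum ::
  "real set \<Rightarrow> ((real \<Rightarrow> complex) \<Rightarrow> (real \<Rightarrow> complex) \<Rightarrow> bool) \<Rightarrow> complex set" where
  "op_spectrum S T = - {z.
     (\<forall>h\<in>L2 S. \<exists>u w. T u w \<and> L2_eq S (\<lambda>x. w x - z * u x) h) \<and>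
     (\<exists>C. \<forall>u w. T u w \<longrightarrow> L2_norm S u \<le> C * L2_norm S (\<lambda>x. w x - z * u x))}"

text \<open>Infimum of the (real) spectrum of the Friedrichs realization on \<open>L\<^sup>2((a,b))\<close> of the
  differential expression \<open>A\<close>.  The infimum is formed in the extended reals; it is finite
  for the operators below when \<open>0 \<le> a < b\<close> and \<open>\<nu> > 0\<close>.\<close>

definition spectral_floor ::
  "((real \<Rightarrow> complex) \<Rightarrow> real \<Rightarrow> complex) \<Rightarrow> real \<Rightarrow> real \<Rightarrow> real" where
  "spectral_floor A a b =
     real_of_ereal (INF z \<in> op_spectrum {a<..<b} (friedrichs {a<..<b} (test_functions a b) A).
                      ereal (Re z))"

definition hankel_op :: "real \<Rightarrow> (real \<Rightarrow> complex) \<Rightarrow> real \<Rightarrow> complex" where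
  "hankel_op \<nu> u r = - vderiv (vderiv u) r + of_real ((\<nu>\<^sup>2 - 1/4) / r\<^sup>2) * u r"

definition hamiltonian_op :: "real \<Rightarrow> (real \<Rightarrow> complex) \<Rightarrow> real \<Rightarrow> complex" where
  "hamiltonian_op \<nu> u r = (hankel_op \<nu> u r + of_real (r\<^sup>2) * u r) / 2"

definition kinetic_floor :: "real \<Rightarrow> real \<Rightarrow> real \<Rightarrow> real" where
  "kinetic_floor \<nu> = spectral_floor (hankel_op \<nu>)"

definition energy_floor :: "real \<Rightarrow> real \<Rightarrow> real \<Rightarrow> real" where
  "energy_floor \<nu> = spectral_floor (hamiltonian_op \<nu>)"

end

theory Submission
  imports Defs
begin

text \<open>
  With \<open>s = \<nu> + 1/2\<close> the operator \<open>L\<^sub>\<nu>\<close> factorizes as \<open>A\<^sup>* A\<close>, \<open>A g = g' - (s/r) g = r\<^sup>s (r\<^sup>-\<^sup>s g)'\<close>, and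
  \<open>A H\<^sub>\<nu> f = - H\<^sub>\<nu>\<^sub>+\<^sub>1 (r f)\<close>, so that \<open>\<parallel>A H\<^sub>\<nu> f\<parallel> \<le> \<parallel>r f\<parallel>\<close>.  If \<open>H\<^sub>\<nu> f\<close> vanishes at all \<open>\<mu>\<^sub>j\<close>, the form inequality on
  each interval \<open>[\<mu>\<^sub>j, \<mu>\<^sub>j\<^sub>+\<^sub>1]\<close> gives \<open>c \<parallel>r H\<^sub>\<nu> f\<parallel>\<^sup>2 \<le> \<parallel>A H\<^sub>\<nu> f\<parallel>\<^sup>2 \<le> \<parallel>r f\<parallel>\<^sup>2\<close> with \<open>c > 1\<close>.  Since \<open>H\<^sub>\<nu>\<close> is an
  involution, the zeros \<open>\<lambda>\<^sub>j\<close> of \<open>f\<close> give \<open>c \<parallel>r f\<parallel>\<^sup>2 \<le> \<parallel>r H\<^sub>\<nu> f\<parallel>\<^sup>2\<close> in the same way, whence \<open>f = 0\<close>.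
  The Hamiltonian condition with constant \<open>c\<close> implies the kinetic form inequality with constant
  \<open>2 c - 1\<close>, because \<open>r \<le> \<lambda>\<^sub>j\<^sub>+\<^sub>1\<close> on the \<open>j\<close>-th interval.
\<close>

section \<open>The Bessel kernel\<close>

text \<open>The floors are infima of spectra of unbounded operators, whereas the zeros of H f
  concern one function that is known only through an integral. The two meet in the variable w with g
  = r^s w: since A annihilates r^s, a Dirichlet form inequality becomes a comparison of weighted
  norms of w and w'. On the spectral side the bottom of the Rayleigh quotient is shown to lie in the
  spectrum by a resolvent argument, with approximating sequences of test functions in place of a
  closed form. On the transform side the ladder identity is kept in integrated form, because r f is
  only square-integrable and its transform is then an L2 limit rather than an integral. Norm bounds
  come from the Gaussians r^s exp(-t r^2/2), on which the transform is explicit; density and Fatou's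
  lemma carry them over. At the endpoint 0 no value of H f is prescribed: r^(-s) fails to be
  square-integrable there because s > 1/2, and this takes the place of a boundary condition.\<close>

definition bessel_coeff :: "real \<Rightarrow> nat \<Rightarrow> real" where
  "bessel_coeff \<nu> m = (-1) ^ m / (fact m * Gamma (real m + \<nu> + 1))"

text \<open>The entire factor of the Bessel function: J_\<nu>(x) is (x/2)^\<nu> times this series at
  x^2/4. Splitting off the power isolates the branch point at 0, so that differentiation is that of
  a power series.\<close>

definition bessel_series :: "real \<Rightarrow> real \<Rightarrow> real" where
  "bessel_series \<nu> z = (\<Sum>m. bessel_coeff \<nu> m * z ^ m)"

lemma Gamma_shift_ge:
  fixes \<nu> :: real assumes "\<nu> > 0"
  shows "Gamma (\<nu> + 1) \<le> Gamma (real m + \<nu> + 1)"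
proof (induction m)
  case (Suc m)
  have "Gamma (real (Suc m) + \<nu> + 1) = (real m + \<nu> + 1) * Gamma (real m + \<nu> + 1)"
    using assms by (subst Gamma_plus1 [symmetric]) (auto simp: add_ac elim!: nonpos_Ints_cases)
  moreover have "Gamma (real m + \<nu> + 1) > 0"
    using assms by (intro Gamma_real_pos) auto
  ultimately show ?case using Suc assms
    by (smt (verit) mult_le_cancel_right1 of_nat_0_le_iff)
qed simp

text \<open>Since Gamma(m+\<nu>+1) is at least Gamma(\<nu>+1), the series is dominated by an
  exponential series and converges everywhere.\<close>

lemma bessel_coeff_norm_le:
  assumes "\<nu> > 0"
  shows "\<bar>bessel_coeff \<nu> m\<bar> \<le> inverse (Gamma (\<nu> + 1)) * inverse (fact m)"
proof -
  have g: "Gamma (\<nu> + 1) > 0" using assms by (intro Gamma_real_pos) auto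
  have "\<bar>bessel_coeff \<nu> m\<bar> = inverse (Gamma (real m + \<nu> + 1)) * inverse (fact m)"
    using g Gamma_shift_ge[OF assms, of m]
    by (simp add: bessel_coeff_def abs_mult divide_simps)
  also have "\<dots> \<le> inverse (Gamma (\<nu> + 1)) * inverse (fact m)"
    using g Gamma_shift_ge[OF assms, of m] by (intro mult_right_mono le_imp_inverse_le) auto
  finally show ?thesis .
qed

lemma summable_bessel_series:
  assumes "\<nu> > 0"
  shows "summable (\<lambda>m. bessel_coeff \<nu> m * z ^ m)"
proof (rule summable_comparison_test')
  show "summable (\<lambda>m. inverse (Gamma (\<nu> + 1)) * (inverse (fact m) * \<bar>z\<bar> ^ m))"
    by (intro summable_mult summable_exp)
  show "norm (bessel_coeff \<nu> n * z ^ n) \<le> inverse (Gamma (\<nu> + 1)) * (inverse (fact n) * \<bar>z\<bar> ^ n)"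
    if "n \<ge> 0" for n
    using mult_right_mono[OF bessel_coeff_norm_le[OF assms, of n], of "\<bar>z\<bar> ^ n"]
    by (simp add: abs_mult power_abs mult_ac)
qed

lemma bessel_coeff_Suc:
  "bessel_coeff (\<nu> + 1) n = - (real (Suc n) * bessel_coeff \<nu> (Suc n))"
  by (simp add: bessel_coeff_def divide_simps add_ac)

lemma bessel_coeff_recurrence:
  assumes "\<nu> > 0"
  shows "(\<nu> + 1 + real n) * bessel_coeff (\<nu> + 1) n = bessel_coeff \<nu> n"
proof -
  have "Gamma (real n + \<nu> + 1 + 1) = (real n + \<nu> + 1) * Gamma (real n + \<nu> + 1)"
    using assms by (subst Gamma_plus1 [symmetric]) (auto simp: add_ac elim!: nonpos_Ints_cases)
  moreover have "Gamma (real n + \<nu> + 1) > 0"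
    using assms by (intro Gamma_real_pos) auto
  ultimately show ?thesis
    using assms by (simp add: bessel_coeff_def add_ac)
qed

lemma has_real_derivative_bessel_series:
  assumes "\<nu> > 0"
  shows "(bessel_series \<nu> has_real_derivative - bessel_series (\<nu> + 1) z) (at z)"
proof -
  have "((\<lambda>x. \<Sum>n. bessel_coeff \<nu> n * x ^ n) has_field_derivative
          (\<Sum>n. diffs (bessel_coeff \<nu>) n * z ^ n)) (at z)"
    by (rule termdiffs_strong_converges_everywhere) (rule summable_bessel_series[OF assms])
  moreover have "(\<Sum>n. diffs (bessel_coeff \<nu>) n * z ^ n) = - bessel_series (\<nu> + 1) z"
  proof -
    have "diffs (bessel_coeff \<nu>) n = - bessel_coeff (\<nu> + 1) n" for n
      by (simp add: diffs_def bessel_coeff_Suc)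
    then show ?thesis
      using suminf_minus[OF summable_bessel_series[of "\<nu>+1" z]] assms
      by (simp add: bessel_series_def)
  qed
  ultimately show ?thesis
    by (simp add: bessel_series_def[abs_def])
qed

text \<open>In the variable z = x^2/4 this is the three-term recurrence of Bessel functions. The
  factor n in \<open>bessel_coeff_recurrence\<close> turns the coefficient of order \<nu> + 1 into a
  shifted coefficient of order \<nu> + 2 with a minus sign, by
  \<open>bessel_coeff_Suc\<close>.\<close>

lemma bessel_series_recurrence:
  assumes "\<nu> > 0"
  shows "(\<nu> + 1) * bessel_series (\<nu> + 1) z - z * bessel_series (\<nu> + 2) z = bessel_series \<nu> z"
proof -
  have s1: "summable (\<lambda>m. bessel_coeff (\<nu> + 1) m * z ^ m)"
    using summable_bessel_series[of "\<nu>+1"] assms by simp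
  have s2: "summable (\<lambda>m. bessel_coeff (\<nu> + 2) m * z ^ m)"
    using summable_bessel_series[of "\<nu>+2"] assms by simp
  let ?g = "\<lambda>n. real n * bessel_coeff (\<nu> + 1) n * z ^ n"
  have gs: "?g (Suc n) = - z * (bessel_coeff (\<nu> + 2) n * z ^ n)" for n
    using bessel_coeff_Suc[of "\<nu>+1" n] by (simp add: add_ac)
  have "(\<lambda>n. ?g (Suc n)) sums (- z * bessel_series (\<nu> + 2) z)"
    unfolding gs bessel_series_def by (intro sums_mult summable_sums s2)
  then have g: "?g sums (- z * bessel_series (\<nu> + 2) z)"
    by (subst (asm) sums_Suc_iff) simp
  have "(\<lambda>n. (\<nu> + 1) * (bessel_coeff (\<nu> + 1) n * z ^ n) + ?g n) sums
        ((\<nu> + 1) * bessel_series (\<nu> + 1) z + (- z * bessel_series (\<nu> + 2) z))"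
    unfolding bessel_series_def[of "\<nu>+1"]
    by (intro sums_add sums_mult summable_sums s1 g)
  moreover have "(\<nu> + 1) * (bessel_coeff (\<nu> + 1) n * z ^ n) + ?g n = bessel_coeff \<nu> n * z ^ n" for n
    unfolding bessel_coeff_recurrence[OF assms, of n, symmetric] by (simp add: algebra_simps)
  ultimately show ?thesis
    by (simp add: bessel_series_def[of \<nu>] sums_iff)
qed

section \<open>The kernel of the transform: first-order relations and boundedness\<close>

definition bessel_kernel :: "real \<Rightarrow> real \<Rightarrow> real" where
  "bessel_kernel \<nu> x = (if x > 0 then bessel_J \<nu> x * sqrt x else 0)"

lemma bessel_J_eq:
  assumes "x > 0" "\<nu> > 0"
  shows "bessel_J \<nu> x = (x / 2) powr \<nu> * bessel_series \<nu> (x\<^sup>2 / 4)"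
proof -
  have "(-1) ^ m / (fact m * Gamma (real m + \<nu> + 1)) * (x / 2) powr (2 * real m + \<nu>)
        = (x / 2) powr \<nu> * (bessel_coeff \<nu> m * (x\<^sup>2 / 4) ^ m)" for m
  proof -
    have "(x / 2) powr (2 * real m) = (x / 2) ^ (2 * m)"
      using powr_realpow[of "x/2" "2*m"] assms by simp
    also have "\<dots> = (x\<^sup>2 / 4) ^ m"
      by (simp add: power_mult power_divide)
    finally show ?thesis by (simp add: powr_add bessel_coeff_def)
  qed
  then show ?thesis
    unfolding bessel_J_def bessel_series_def
    using suminf_mult[OF summable_bessel_series[OF assms(2)]] by simp
qed

lemma bessel_kernel_eq:
  assumes "x > 0" "\<nu> > 0"
  shows "bessel_kernel \<nu> x = 2 powr (- \<nu>) * x powr (\<nu> + 1/2) * bessel_series \<nu> (x\<^sup>2 / 4)"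
  using assms
  by (simp add: bessel_kernel_def bessel_J_eq powr_divide powr_add powr_minus_divide powr_half_sqrt)

text \<open>The relation J_\<nu>' = (\<nu>/x) J_\<nu> - J_(\<nu>+1); the factor sqrt x replaces
  \<nu> by \<nu> + 1/2. It is the pointwise source of the ladder identity: A applied to the kernel
  of order \<nu> gives minus the kernel of order \<nu> + 1.\<close>

lemma has_real_derivative_bessel_kernel:
  assumes "x > 0" "\<nu> > 0"
  shows "(bessel_kernel \<nu> has_real_derivative ((\<nu> + 1/2) / x * bessel_kernel \<nu> x - bessel_kernel (\<nu> + 1) x)) (at x)"
proof -
  let ?f = "\<lambda>x. 2 powr (- \<nu>) * x powr (\<nu> + 1/2) * bessel_series \<nu> (x\<^sup>2 / 4)"
  have "(?f has_real_derivative ((\<nu> + 1/2) / x * bessel_kernel \<nu> x - bessel_kernel (\<nu> + 1) x)) (at x)"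
  proof -
    have p: "x powr (\<nu> - 1/2) = x powr (\<nu> + 1/2) / x"
      using assms powr_diff[of x "\<nu>+1/2" 1] by simp
    have q: "x powr (\<nu> + 1 + 1/2) = x powr (\<nu> + 1/2) * x"
      using assms powr_add[of x "\<nu>+1/2" 1] by (simp add: algebra_simps)
    have r: "2 powr (- (\<nu> + 1)) = 2 powr (- \<nu>) / (2::real)"
      by (simp add: powr_diff powr_minus field_simps)
    define A where "A = 2 powr (- \<nu>) * x powr (\<nu> + 1/2)"
    have 1: "bessel_kernel (\<nu> + 1) x = A * x / 2 * bessel_series (\<nu> + 1) (x\<^sup>2 / 4)"
            "bessel_kernel \<nu> x = A * bessel_series \<nu> (x\<^sup>2 / 4)"
      using assms bessel_kernel_eq[of x "\<nu>+1"] bessel_kernel_eq[of x \<nu>]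
      unfolding q r A_def by simp_all
    have "(?f has_real_derivative 2 powr (- \<nu>) * ((\<nu> + 1/2) * x powr (\<nu> - 1/2)) * bessel_series \<nu> (x\<^sup>2 / 4)
            + A * (- bessel_series (\<nu> + 1) (x\<^sup>2 / 4) * (x / 2))) (at x)"
      unfolding A_def using assms
      by (auto intro!: derivative_eq_intros DERIV_chain2[OF has_real_derivative_bessel_series])
    then show ?thesis
      unfolding 1 p by (rule DERIV_cong) (use assms in \<open>simp add: A_def field_simps\<close>)
  qed
  moreover have "\<forall>\<^sub>F y in nhds x. bessel_kernel \<nu> y = ?f y"
    using eventually_nhds_in_open[of "{0<..}" x] assms
    by (auto elim!: eventually_mono simp: bessel_kernel_eq)
  ultimately show ?thesis
    by (subst DERIV_cong_ev) auto
qed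

text \<open>The adjoint relation, lowering the order. The previous lemma at order \<nu> + 1 involves
  the kernel of order \<nu> + 2, which the recurrence eliminates. The two relations then form a
  closed system whose diagonal terms are opposite.\<close>

lemma has_real_derivative_bessel_kernel_Suc:
  assumes "x > 0" "\<nu> > 0"
  shows "(bessel_kernel (\<nu> + 1) has_real_derivative (bessel_kernel \<nu> x - (\<nu> + 1/2) / x * bessel_kernel (\<nu> + 1) x)) (at x)"
proof -
  have p: "x powr (\<nu> + 1 + 1/2) = x powr (\<nu> + 1/2) * x"
          "x powr (\<nu> + 2 + 1/2) = x powr (\<nu> + 1/2) * x\<^sup>2"
    using assms powr_add[of x "\<nu>+1/2" 1] powr_add[of x "\<nu>+1/2" 2] by (simp_all add: algebra_simps)
  have r: "2 powr (- (\<nu> + 1)) = 2 powr (- \<nu>) / (2::real)" "2 powr (- (\<nu> + 2)) = 2 powr (- \<nu>) / (4::real)"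
    by (simp_all add: powr_diff powr_minus field_simps)
  have e: "(\<nu> + 1 + 1/2) / x * bessel_kernel (\<nu> + 1) x - bessel_kernel (\<nu> + 1 + 1) x
        = bessel_kernel \<nu> x - (\<nu> + 1/2) / x * bessel_kernel (\<nu> + 1) x"
  proof -
    define A where "A = 2 powr (- \<nu>) * x powr (\<nu> + 1/2)"
    have 1: "bessel_kernel (\<nu> + 1) x = A * x / 2 * bessel_series (\<nu> + 1) (x\<^sup>2 / 4)"
            "bessel_kernel (\<nu> + 1 + 1) x = A * x\<^sup>2 / 4 * bessel_series (\<nu> + 2) (x\<^sup>2 / 4)"
            "bessel_kernel \<nu> x = A * bessel_series \<nu> (x\<^sup>2 / 4)"
      using assms bessel_kernel_eq[of x "\<nu>+1"] bessel_kernel_eq[of x "\<nu>+2"] bessel_kernel_eq[of x \<nu>]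
      unfolding p r A_def by (simp_all add: add.assoc)
    show ?thesis
      unfolding 1 bessel_series_recurrence[OF assms(2), of "x\<^sup>2/4", symmetric]
      using assms by (simp add: field_simps power2_eq_square)
  qed
  show ?thesis
    using has_real_derivative_bessel_kernel[OF assms(1), of "\<nu>+1"] assms unfolding e by simp
qed

text \<open>With \<open>K\<^sub>\<nu>\<close> the kernel of order \<open>\<nu>\<close>, \<open>u = K\<^sub>\<nu>\<close> and \<open>v = K\<^sub>\<nu>\<^sub>+\<^sub>1\<close> one has \<open>(u v)' = u\<^sup>2 - v\<^sup>2\<close>, so subtracting \<open>(2 s / x) u v\<close> from the energy
  \<open>u\<^sup>2 + v\<^sup>2\<close> removes the non-integrable term of order \<open>1 / x\<close> from its derivative.\<close>

lemma bessel_kernel_bounded: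
  assumes "\<nu> > 0"
  obtains C where "C > 0" "\<And>x. \<bar>bessel_kernel \<nu> x\<bar> \<le> C"
proof -
  define s where "s = \<nu> + 1/2"
  have s: "s > 0" using assms by (simp add: s_def)
  define u where "u = bessel_kernel \<nu>"
  define v where "v = bessel_kernel (\<nu> + 1)"
  define W where "W = (\<lambda>x. (u x)\<^sup>2 + (v x)\<^sup>2 - 2 * s / x * (u x * v x))"
  \<comment> \<open>Beyond 2 s the derivative of W is at most (2 s/x^2) W. The factor exp(2 s/x),
    with logarithmic derivative -2 s/x^2, therefore makes Z nonincreasing there.\<close>
  define Z where "Z = (\<lambda>x. W x * exp (2 * s / x))"
  have du: "(u has_real_derivative (s / x * u x - v x)) (at x)" if "x > 0" for x
    using has_real_derivative_bessel_kernel[OF that assms] by (simp add: u_def v_def s_def)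
  have dv: "(v has_real_derivative (u x - s / x * v x)) (at x)" if "x > 0" for x
    using has_real_derivative_bessel_kernel_Suc[OF that assms] by (simp add: u_def v_def s_def)
  have uv: "\<bar>2 * (u x * v x)\<bar> \<le> (u x)\<^sup>2 + (v x)\<^sup>2" for x
    using sum_squares_bound[of "u x" "v x"] sum_squares_bound[of "u x" "- v x"] by (simp add: abs_if)
  \<comment> \<open>Beyond 2 s the correction term of W is at most half of u^2 + v^2, so W still
    controls the energy.\<close>
  have half: "(u x)\<^sup>2 + (v x)\<^sup>2 \<le> 2 * W x" if "x \<ge> 2 * s" for x
  proof -
    have "s / x * (2 * (u x * v x)) \<le> s / x * ((u x)\<^sup>2 + (v x)\<^sup>2)"
      using uv[of x] that s by (intro mult_left_mono) auto
    also have "\<dots> \<le> 1/2 * ((u x)\<^sup>2 + (v x)\<^sup>2)"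
      using that s by (intro mult_right_mono) (auto simp: field_simps)
    finally show ?thesis by (simp add: W_def field_simps)
  qed
  have dW: "(W has_real_derivative (2 * s / x\<^sup>2 * (u x * v x))) (at x)" if "x > 0" for x
    unfolding W_def using that
    by (auto intro!: derivative_eq_intros du dv) (simp add: field_simps power2_eq_square)
  have dZ: "\<exists>D. (Z has_real_derivative D) (at x) \<and> D \<le> 0" if "x \<ge> 2 * s" for x
  proof (intro exI conjI)
    have x: "x > 0" using that s by simp
    show "(Z has_real_derivative ((2 * s / x\<^sup>2 * (u x * v x) - 2 * s / x\<^sup>2 * W x) * exp (2 * s / x))) (at x)"
      unfolding Z_def using x
      by (auto intro!: derivative_eq_intros dW) (simp add: field_simps power2_eq_square)
    have "u x * v x \<le> W x" using uv[of x] half[OF that] by linarith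
    then have "2 * s / x\<^sup>2 * (u x * v x) \<le> 2 * s / x\<^sup>2 * W x"
      using s by (intro mult_left_mono) auto
    then show "(2 * s / x\<^sup>2 * (u x * v x) - 2 * s / x\<^sup>2 * W x) * exp (2 * s / x) \<le> 0"
      by (simp add: mult_le_0_iff)
  qed
  have big: "(u x)\<^sup>2 \<le> 2 * Z (2 * s)" if "x \<ge> 2 * s" for x
  proof -
    have "Z x \<le> Z (2 * s)"
      using that by (intro DERIV_nonpos_imp_nonincreasing[OF that]) (auto dest: dZ)
    moreover have "W x \<le> Z x"
    proof -
      have "W x \<ge> 0" using half[OF that] sum_power2_ge_zero[of "u x" "v x"] by linarith
      then show ?thesis
        unfolding Z_def using that s mult_left_mono[of 1 "exp (2 * s / x)" "W x"] by auto
    qed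
    ultimately show ?thesis using half[OF that] zero_le_power2[of "v x"] by linarith
  qed
  \<comment> \<open>The closed formula is continuous up to 0, hence bounded on the remaining
    interval [0, 2 s].\<close>
  have "continuous_on {0..2 * s} (\<lambda>x. 2 powr (- \<nu>) * x powr s * bessel_series \<nu> (x\<^sup>2 / 4))"
  proof -
    have "continuous_on UNIV (bessel_series \<nu>)"
      using has_real_derivative_bessel_series[OF assms] by (meson DERIV_isCont continuous_at_imp_continuous_on)
    then have "continuous_on {0..2 * s} (\<lambda>x. bessel_series \<nu> (x\<^sup>2 / 4))"
      by (rule continuous_on_compose2[of _ _ _ "\<lambda>x. x\<^sup>2/4"]) (auto intro!: continuous_intros)
    moreover have "continuous_on {0..2 * s} (\<lambda>x. x powr s)"
      using s by (intro continuous_on_powr') (auto intro!: continuous_intros)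
    ultimately show ?thesis by (intro continuous_on_mult continuous_on_const)
  qed
  then have "bounded ((\<lambda>x. 2 powr (- \<nu>) * x powr s * bessel_series \<nu> (x\<^sup>2 / 4)) ` {0..2 * s})"
    by (intro compact_imp_bounded compact_continuous_image) auto
  then obtain B where B: "B > 0" "\<And>x. 0 \<le> x \<Longrightarrow> x \<le> 2 * s \<Longrightarrow> \<bar>2 powr (- \<nu>) * x powr s * bessel_series \<nu> (x\<^sup>2 / 4)\<bar> \<le> B"
    by (auto simp: bounded_pos)
  define C where "C = B + sqrt (2 * Z (2 * s))"
  show ?thesis
  proof (rule that)
    have Z0: "Z (2 * s) \<ge> 0" using big[of "2 * s"] by (smt (verit) zero_le_power2)
    show "C > 0" using B Z0 by (simp add: C_def add_pos_nonneg)
    fix x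
    consider "x \<le> 0" | "0 < x" "x \<le> 2 * s" | "x \<ge> 2 * s" by linarith
    then show "\<bar>bessel_kernel \<nu> x\<bar> \<le> C"
    proof cases
      case 1 then show ?thesis using \<open>C > 0\<close> by (simp add: bessel_kernel_def)
    next
      case 2 then show ?thesis
        using B(2)[of x] real_sqrt_ge_zero[of "2 * Z (2 * s)"] Z0 bessel_kernel_eq[OF _ assms, of x]
        unfolding C_def s_def[symmetric] by linarith
    next
      case 3
      have "\<bar>u x\<bar> \<le> sqrt (2 * Z (2 * s))"
        using real_sqrt_le_mono[OF big[OF 3]] by simp
      then show ?thesis using B by (simp add: C_def u_def)
    qed
  qed
qed

lemma continuous_on_bessel_kernel:
  assumes "\<nu> > 0" shows "continuous_on {0<..} (bessel_kernel \<nu>)"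
  using has_real_derivative_bessel_kernel[OF _ assms]
  by (intro continuous_at_imp_continuous_on) (auto intro: DERIV_isCont)

lemma borel_measurable_bessel_kernel [measurable]:
  assumes "\<nu> > 0" shows "bessel_kernel \<nu> \<in> borel_measurable borel"
proof -
  have "(\<lambda>x. if x \<in> {0<..} then bessel_kernel \<nu> x else 0) \<in> borel_measurable borel"
    using continuous_on_bessel_kernel[OF assms] by (intro borel_measurable_continuous_on_if) auto
  also have "(\<lambda>x. if x \<in> {0<..} then bessel_kernel \<nu> x else 0) = bessel_kernel \<nu>"
    by (auto simp: bessel_kernel_def fun_eq_iff)
  finally show ?thesis .
qed

section \<open>Smooth bumps and square-integrable functions\<close>

text \<open>Coinduction replaces n-th derivatives: a function is smooth as soon as it belongs to a
  class of functions each of which has a derivative in the class. The closure proofs below consist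
  mainly in finding such a class.\<close>

coinductive smooth :: "(real \<Rightarrow> real) \<Rightarrow> bool" where
  smoothI: "(\<And>x. (f has_real_derivative f' x) (at x)) \<Longrightarrow> smooth f' \<Longrightarrow> smooth f"

lemma smooth_imp_deriv:
  assumes "smooth f"
  obtains f' where "\<And>x. (f has_real_derivative f' x) (at x)" "smooth f'"
  using assms by (cases rule: smooth.cases) auto

lemma smooth_isCont: "smooth f \<Longrightarrow> isCont f x"
  by (metis DERIV_isCont smooth_imp_deriv)

lemma smooth_continuous_on: "smooth f \<Longrightarrow> continuous_on S f"
  by (simp add: continuous_at_imp_continuous_on smooth_isCont)

lemma smooth_borel: "smooth f \<Longrightarrow> f \<in> borel_measurable borel"
  by (simp add: borel_measurable_continuous_onI smooth_continuous_on)

lemma smooth_const: "smooth (\<lambda>x. c)"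
proof -
  have "\<exists>c. f = (\<lambda>x. c) \<Longrightarrow> smooth f" for f :: "real \<Rightarrow> real"
    by (coinduction arbitrary: f) (auto intro!: exI[of _ "\<lambda>x. 0"] derivative_eq_intros)
  then show ?thesis by blast
qed

lemma smooth_ident: "smooth (\<lambda>x. x)"
  by (rule smoothI[OF _ smooth_const[of 1]]) (auto intro!: derivative_eq_intros)

lemma smooth_add:
  assumes "smooth f" "smooth g" shows "smooth (\<lambda>x. f x + g x)"
proof -
  have "\<exists>f g. smooth f \<and> smooth g \<and> h = (\<lambda>x. f x + g x) \<Longrightarrow> smooth h" for h
  proof (coinduction arbitrary: h)
    case smooth
    then obtain f g where fg: "smooth f" "smooth g" "h = (\<lambda>x. f x + g x)" by blast
    from smooth_imp_deriv[OF fg(1)] obtain f' where f': "\<And>x. (f has_real_derivative f' x) (at x)" "smooth f'" by metis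
    from smooth_imp_deriv[OF fg(2)] obtain g' where g': "\<And>x. (g has_real_derivative g' x) (at x)" "smooth g'" by metis
    show ?case unfolding fg
      using f' g' by (intro exI[of _ "\<lambda>x. f x + g x"] exI[of _ "\<lambda>x. f' x + g' x"])
        (auto intro!: derivative_eq_intros)
  qed
  then show ?thesis using assms by blast
qed

text \<open>Products alone are not closed under differentiation, since the product rule yields a
  sum; finite sums of products are, and serve as the class for the coinduction.\<close>

inductive smooth_products :: "(real \<Rightarrow> real) \<Rightarrow> bool" where
  mult: "smooth f \<Longrightarrow> smooth g \<Longrightarrow> smooth_products (\<lambda>x. f x * g x)"
| add: "smooth_products u \<Longrightarrow> smooth_products v \<Longrightarrow> smooth_products (\<lambda>x. u x + v x)"

lemma smooth_products_deriv:
  "smooth_products u \<Longrightarrow> \<exists>u'. (\<forall>x. (u has_real_derivative u' x) (at x)) \<and> smooth_products u'"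
proof (induction rule: smooth_products.induct)
  case (mult f g)
  from smooth_imp_deriv[OF mult(1)] obtain f' where f': "\<And>x. (f has_real_derivative f' x) (at x)" "smooth f'" by metis
  from smooth_imp_deriv[OF mult(2)] obtain g' where g': "\<And>x. (g has_real_derivative g' x) (at x)" "smooth g'" by metis
  show ?case
    using mult f' g' by (intro exI[of _ "\<lambda>x. f' x * g x + f x * g' x"])
      (auto intro!: derivative_eq_intros smooth_products.intros)
next
  case (add u v)
  then obtain u' v' where "\<forall>x. (u has_real_derivative u' x) (at x)" "smooth_products u'"
    "\<forall>x. (v has_real_derivative v' x) (at x)" "smooth_products v'" by blast
  then show ?case
    by (intro exI[of _ "\<lambda>x. u' x + v' x"]) (auto intro!: derivative_eq_intros smooth_products.intros)
qed

lemma smooth_mult: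
  assumes "smooth f" "smooth g" shows "smooth (\<lambda>x. f x * g x)"
proof -
  have "smooth_products h \<Longrightarrow> smooth h" for h
  proof (coinduction arbitrary: h)
    case smooth
    from smooth_products_deriv[OF this] obtain h'
      where "\<forall>x. (h has_real_derivative h' x) (at x)" "smooth_products h'" by blast
    then show ?case by blast
  qed
  then show ?thesis using assms smooth_products.mult by blast
qed

lemma smooth_cmult: "smooth f \<Longrightarrow> smooth (\<lambda>x. c * f x)"
  using smooth_mult[OF smooth_const] .

lemma smooth_affine:
  assumes "smooth f" shows "smooth (\<lambda>x. f (c * x + d))"
proof -
  \<comment> \<open>The scalar \<open>k\<close> belongs to the class because each differentiation
    produces a factor \<open>c\<close> by the chain rule.\<close>
  have "\<exists>k f. smooth f \<and> h = (\<lambda>x. k * f (c * x + d)) \<Longrightarrow> smooth h" for h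
  proof (coinduction arbitrary: h)
    case smooth
    then obtain k f where fg: "smooth f" "h = (\<lambda>x. k * f (c * x + d))" by blast
    from smooth_imp_deriv[OF fg(1)] obtain f' where f': "\<And>x. (f has_real_derivative f' x) (at x)" "smooth f'" by metis
    have "((\<lambda>x. k * f (c * x + d)) has_real_derivative (k * c) * f' (c * x + d)) (at x)" for x
      by (auto intro!: derivative_eq_intros DERIV_chain2[OF f'(1)])
    then show ?case unfolding fg
      using f' by (intro exI[of _ "\<lambda>x. k * f (c * x + d)"] exI[of _ "\<lambda>x. (k * c) * f' (c * x + d)"]) blast
  qed
  moreover have "\<exists>k f'. smooth f' \<and> (\<lambda>x. f (c * x + d)) = (\<lambda>x. k * f' (c * x + d))"
    using assms by (intro exI[of _ 1] exI[of _ f]) auto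
  ultimately show ?thesis by blast
qed

lemma smooth_real_polynomial_function:
  "real_polynomial_function p \<Longrightarrow> smooth (p :: real \<Rightarrow> real)"
proof (induction rule: real_polynomial_function.induct)
  case (linear f)
  then have "f = (\<lambda>x. f 1 * x)"
    by (metis bounded_linear.linear linear_cmul mult.commute mult.right_neutral real_scaleR_def)
  then show ?case using smooth_cmult[OF smooth_ident, of "f 1"] by simp
qed (auto intro: smooth_const smooth_add smooth_mult)

text \<open>The functions x^(-k) exp(-1/x), extended by 0; k = 0 is the classical smooth function
  that vanishes on a half-line. The powers of 1/x are carried along because differentiation raises
  k.\<close>

definition flat :: "nat \<Rightarrow> real \<Rightarrow> real" where
  "flat k x = (if x > 0 then (1 / x) ^ k * exp (- 1 / x) else 0)"

text \<open>With y = 1/x, a single term of the exponential series gives y^(k+2) \<le> (k+2)! exp y.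
  The exponent k + 2 is what leaves x^2 on the right, enough for the difference quotient at 0 to
  tend to 0.\<close>

lemma abs_flat_le: "\<bar>flat k x\<bar> \<le> fact (k + 2) * x\<^sup>2"
proof (cases "x > 0")
  case True
  define y where "y = 1 / x"
  have y: "y > 0" using True by (simp add: y_def)
  have "(\<Sum>n\<in>{k+2}. y ^ n /\<^sub>R fact n) \<le> exp y"
    unfolding exp_def using y summable_exp_generic[of y]
    by (intro sum_le_suminf) (auto simp: scaleR_conv_of_real)
  then have "y ^ (k + 2) \<le> fact (k + 2) * exp y"
    by (simp add: divide_simps mult_ac del: fact_Suc)
  then have "y ^ k * y\<^sup>2 \<le> fact (k + 2) * exp y"
    by (simp only: power_add)
  then have "y ^ k * exp (- y) \<le> fact (k + 2) / y\<^sup>2"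
    using y by (simp add: exp_minus divide_simps mult_ac del: fact_Suc)
  then show ?thesis using True y by (simp add: flat_def y_def field_simps del: fact_Suc)
qed (simp add: flat_def)

lemma has_real_derivative_flat:
  "(flat k has_real_derivative flat (k + 2) x - real k * flat (k + 1) x) (at x)"
proof -
  consider "x > 0" | "x < 0" | "x = 0" by linarith
  then show ?thesis
  proof cases
    case 1
    have "((\<lambda>x. (1 / x) ^ k * exp (- 1 / x)) has_real_derivative flat (k + 2) x - real k * flat (k + 1) x) (at x)"
    proof -
      have "((\<lambda>x. 1 / x) has_real_derivative - ((1 / x) * (1 / x))) (at x)"
        using 1 by (auto intro!: derivative_eq_intros)
      from DERIV_power[OF this, of k]
      have "((\<lambda>x. (1 / x) ^ k) has_real_derivative - real k * (1 / x) ^ (k + 1)) (at x)"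
      proof (rule DERIV_cong)
        have "real k * (- (y * y) * y ^ (k - Suc 0)) = - real k * y ^ (k + 1)" for y :: real
          by (cases k) (auto simp: algebra_simps)
        then show "real k * (- ((1 / x) * (1 / x)) * (1 / x) ^ (k - Suc 0)) = - real k * (1 / x) ^ (k + 1)" .
      qed
      moreover have "((\<lambda>x. exp (- 1 / x)) has_real_derivative exp (- 1 / x) * (1 / x)\<^sup>2) (at x)"
        using 1 by (auto intro!: derivative_eq_intros simp: power2_eq_square)
      ultimately have "((\<lambda>x. (1 / x) ^ k * exp (- 1 / x)) has_real_derivative
          - real k * (1 / x) ^ (k + 1) * exp (- 1 / x) + exp (- 1 / x) * (1 / x)\<^sup>2 * (1 / x) ^ k) (at x)"
        by (rule DERIV_mult)
      then show ?thesis
        by (rule DERIV_cong) (use 1 in \<open>simp add: flat_def power_add power2_eq_square mult_ac\<close>)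
    qed
    moreover have "\<forall>\<^sub>F y in nhds x. flat k y = (1 / y) ^ k * exp (- 1 / y)"
      using eventually_nhds_in_open[of "{0<..}" x] 1
      by (auto elim!: eventually_mono simp: flat_def)
    ultimately show ?thesis by (subst DERIV_cong_ev) auto
  next
    case 2
    have "\<forall>\<^sub>F y in nhds x. flat k y = 0"
      using eventually_nhds_in_open[of "{..<0}" x] 2
      by (auto elim!: eventually_mono simp: flat_def)
    then show ?thesis using 2 by (subst DERIV_cong_ev[where g = "\<lambda>_. 0"]) (auto simp: flat_def)
  next
    case 3
    have "((\<lambda>h. flat k h / h) \<longlongrightarrow> 0) (at 0)"
    proof (rule Lim_null_comparison)
      show "\<forall>\<^sub>F h in at 0. norm (flat k h / h) \<le> fact (k + 2) * \<bar>h\<bar>"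
      proof (rule eventually_at_filter[THEN iffD2], rule always_eventually, intro allI impI)
        fix h :: real assume "h \<noteq> 0"
        then show "norm (flat k h / h) \<le> fact (k + 2) * \<bar>h\<bar>"
          using abs_flat_le[of k h] by (simp add: divide_simps power2_eq_square abs_mult mult_ac del: fact_Suc)
      qed
      show "((\<lambda>h. fact (k + 2) * \<bar>h\<bar>) \<longlongrightarrow> (0::real)) (at 0)"
        by (auto intro!: tendsto_eq_intros)
    qed
    then show ?thesis using 3 by (simp add: DERIV_def flat_def)
  qed
qed

inductive flat_span :: "(real \<Rightarrow> real) \<Rightarrow> bool" where
  base: "flat_span (\<lambda>x. c * flat k x)"
| add: "flat_span u \<Longrightarrow> flat_span v \<Longrightarrow> flat_span (\<lambda>x. u x + v x)"

lemma flat_span_deriv: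
  "flat_span u \<Longrightarrow> \<exists>u'. (\<forall>x. (u has_real_derivative u' x) (at x)) \<and> flat_span u'"
proof (induction rule: flat_span.induct)
  case (base c k)
  have "flat_span (\<lambda>x. c * flat (k + 2) x + (- c * real k) * flat (k + 1) x)"
    by (intro flat_span.intros)
  then show ?case
    by (intro exI[of _ "\<lambda>x. c * flat (k + 2) x + (- c * real k) * flat (k + 1) x"])
       (auto intro!: derivative_eq_intros has_real_derivative_flat simp: algebra_simps)
next
  case (add u v)
  then obtain u' v' where "\<forall>x. (u has_real_derivative u' x) (at x)" "flat_span u'"
    "\<forall>x. (v has_real_derivative v' x) (at x)" "flat_span v'" by blast
  then show ?case
    by (intro exI[of _ "\<lambda>x. u' x + v' x"]) (auto intro!: derivative_eq_intros flat_span.intros)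
qed

lemma smooth_flat: "smooth (flat k)"
proof -
  have "flat_span h \<Longrightarrow> smooth h" for h
  proof (coinduction arbitrary: h)
    case smooth
    from flat_span_deriv[OF this] show ?case by blast
  qed
  from this[OF flat_span.base[of 1 k]] show ?thesis by simp
qed

lemma flat_0_bounds: "0 \<le> flat 0 x" "flat 0 x \<le> 1"
  by (auto simp: flat_def)

text \<open>The real-valued members of C_c^\<infinity>((a,b)). The bounds \<alpha> and \<beta> are
  not ordered: \<beta> < \<alpha> just says that w is zero, which keeps the zero function and
  closure under sums free of case distinctions.\<close>

definition bump :: "real \<Rightarrow> real \<Rightarrow> (real \<Rightarrow> real) \<Rightarrow> bool" where
  "bump a b w \<longleftrightarrow> smooth w \<and> (\<exists>\<alpha>>a. \<exists>\<beta><b. \<forall>x. x \<notin> {\<alpha>..\<beta>} \<longrightarrow> w x = 0)"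

lemma bumpI:
  "smooth w \<Longrightarrow> a < \<alpha> \<Longrightarrow> \<beta> < b \<Longrightarrow> (\<And>x. x < \<alpha> \<or> \<beta> < x \<Longrightarrow> w x = 0) \<Longrightarrow> bump a b w"
  unfolding bump_def by (metis atLeastAtMost_iff not_le)

lemma bumpE:
  assumes "bump a b w"
  obtains \<alpha> \<beta> where "a < \<alpha>" "\<beta> < b" "\<And>x. x < \<alpha> \<or> \<beta> < x \<Longrightarrow> w x = 0"
  using assms unfolding bump_def by (metis atLeastAtMost_iff not_le)

lemma bump_smooth: "bump a b w \<Longrightarrow> smooth w"
  by (simp add: bump_def)

lemma bump_zero: "bump a b w \<Longrightarrow> x \<notin> {a<..<b} \<Longrightarrow> w x = 0"
  by (force simp: bump_def)

lemma bump_add: assumes "bump a b u" "bump a b v" shows "bump a b (\<lambda>x. u x + v x)"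
proof -
  from bumpE[OF assms(1)] obtain \<alpha> \<beta> where u: "a < \<alpha>" "\<beta> < b" "\<And>x. x < \<alpha> \<or> \<beta> < x \<Longrightarrow> u x = 0" by metis
  from bumpE[OF assms(2)] obtain \<alpha>' \<beta>' where v: "a < \<alpha>'" "\<beta>' < b" "\<And>x. x < \<alpha>' \<or> \<beta>' < x \<Longrightarrow> v x = 0" by metis
  show ?thesis
    by (rule bumpI[of _ _ "min \<alpha> \<alpha>'" "max \<beta> \<beta>'"]) (use u v assms in \<open>auto simp: bump_smooth intro!: smooth_add\<close>)
qed

lemma bump_smooth_mult: "bump a b u \<Longrightarrow> smooth v \<Longrightarrow> bump a b (\<lambda>x. u x * v x)"
  unfolding bump_def using smooth_mult by (metis mult_zero_left)

lemma bump_cmult: "bump a b u \<Longrightarrow> bump a b (\<lambda>x. c * u x)"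
  using bump_smooth_mult[OF _ smooth_const[of c]] by (simp add: mult.commute)

lemma bump_diff: "bump a b u \<Longrightarrow> bump a b v \<Longrightarrow> bump a b (\<lambda>x. u x - v x)"
  using bump_add[OF _ bump_cmult[of a b v "-1"], of u] by simp

lemma bump_mono: "bump a b w \<Longrightarrow> a' \<le> a \<Longrightarrow> b \<le> b' \<Longrightarrow> bump a' b' w"
  unfolding bump_def by (meson order_le_less_trans order_less_le_trans)

text \<open>Zero within distance 1/(n+1) of both ends and tending to 1 inside. The arguments of
  \<open>flat 0\<close> are written in the form \<open>c * x + d\<close> to match
  \<open>smooth_affine\<close>.\<close>

definition cutoff :: "real \<Rightarrow> real \<Rightarrow> nat \<Rightarrow> real \<Rightarrow> real" where
  "cutoff a b n x = flat 0 (real (Suc n) * x + (- real (Suc n) * a - 1)) * flat 0 (- real (Suc n) * x + (real (Suc n) * b - 1))"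

lemma bump_cutoff: "bump a b (cutoff a b n)"
proof (rule bumpI)
  show "smooth (cutoff a b n)"
    unfolding cutoff_def[abs_def] by (intro smooth_mult smooth_affine smooth_flat)
  show "a < a + 1 / real (Suc n)" "b - 1 / real (Suc n) < b" by auto
  fix x assume "x < a + 1 / real (Suc n) \<or> b - 1 / real (Suc n) < x"
  then have "real (Suc n) * x + (- real (Suc n) * a - 1) < 0 \<or> - real (Suc n) * x + (real (Suc n) * b - 1) < 0"
    by (auto simp: field_simps)
  then show "cutoff a b n x = 0" by (auto simp: cutoff_def flat_def)
qed

lemma cutoff_bounds: "0 \<le> cutoff a b n x" "cutoff a b n x \<le> 1"
  by (auto simp: cutoff_def flat_0_bounds intro!: mult_nonneg_nonneg mult_le_one)

lemma cutoff_tendsto: assumes "a < x" "x < b" shows "(\<lambda>n. cutoff a b n x) \<longlonglongrightarrow> 1"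
proof -
  have *: "(\<lambda>n. flat 0 (real (Suc n) * c - 1)) \<longlonglongrightarrow> 1" if "c > 0" for c
  proof -
    have lim: "filterlim (\<lambda>n. real (Suc n) * c - 1) at_top sequentially"
      using filterlim_tendsto_add_at_top[OF tendsto_const[of "-1"]
          filterlim_at_top_mult_tendsto_pos[OF tendsto_const that
            filterlim_compose[OF filterlim_real_sequentially filterlim_Suc]]] by simp
    have "(\<lambda>n. exp (- inverse (real (Suc n) * c - 1))) \<longlonglongrightarrow> exp (- 0)"
      by (intro tendsto_intros tendsto_inverse_0_at_top lim)
    moreover have "\<forall>\<^sub>F n in sequentially. exp (- inverse (real (Suc n) * c - 1)) = flat 0 (real (Suc n) * c - 1)"
      using filterlim_at_top_dense[THEN iffD1, OF lim, rule_format, of 0]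
      by eventually_elim (simp add: flat_def inverse_eq_divide)
    ultimately show ?thesis by (simp add: filterlim_cong)
  qed
  have "(\<lambda>n. flat 0 (real (Suc n) * (x - a) - 1) * flat 0 (real (Suc n) * (b - x) - 1)) \<longlonglongrightarrow> 1 * 1"
    by (intro tendsto_mult *) (use assms in auto)
  then show ?thesis by (simp add: cutoff_def algebra_simps)
qed

text \<open>A measurable function is an a.e. limit of continuous ones; these are clipped to [-B, B],
  replaced by polynomials within 1/(n+1), and multiplied by cutoffs. The uniform bound B + 1, the 1
  being the polynomial error, is what later allows dominated convergence.\<close>

lemma bump_approx_bounded:
  fixes q :: "real \<Rightarrow> real"
  assumes [measurable]: "q \<in> borel_measurable borel" and B: "\<And>x. \<bar>q x\<bar> \<le> B"
  shows "\<exists>r. (\<forall>n. bump a b (r n)) \<and> (\<forall>n x. \<bar>r n x\<bar> \<le> B + 1) \<and>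
    (AE x in lborel. a < x \<and> x < b \<longrightarrow> (\<lambda>n. r n x) \<longlonglongrightarrow> q x)"
proof -
  have B0: "B \<ge> 0" using B[of 0] by simp
  have "q measurable_on UNIV"
    by (intro lebesgue_measurable_imp_measurable_on) (auto simp: measurable_completion)
  then obtain N g where N: "negligible N" "\<And>n. continuous_on UNIV (g n)"
    "\<And>x. x \<notin> N \<Longrightarrow> (\<lambda>n. g n x) \<longlonglongrightarrow> q x"
    unfolding measurable_on_def by auto
  define h where "h = (\<lambda>n x. max (- B) (min B (g n x)))"
  have hc: "continuous_on {a..b} (h n)" for n
    unfolding h_def by (intro continuous_intros continuous_on_subset[OF N(2)]) auto
  have "\<exists>p. real_polynomial_function p \<and> (\<forall>x\<in>{a..b}. \<bar>h n x - p x\<bar> < 1 / real (Suc n))" for n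
    by (rule Stone_Weierstrass_real_polynomial_function[OF _ hc, of "1 / real (Suc n)" n]) auto
  then obtain p where p: "\<And>n. real_polynomial_function (p n)"
    "\<And>n x. x \<in> {a..b} \<Longrightarrow> \<bar>h n x - p n x\<bar> < 1 / real (Suc n)" by metis
  define r where "r = (\<lambda>n x. cutoff a b n x * p n x)"
  show ?thesis
  proof (intro exI[of _ r] conjI allI)
    show bumps: "bump a b (r n)" for n
      unfolding r_def by (intro bump_smooth_mult bump_cutoff smooth_real_polynomial_function p)
    fix n x
    show "\<bar>r n x\<bar> \<le> B + 1"
    proof (cases "x \<in> {a..b}")
      case True
      have "\<bar>p n x\<bar> \<le> \<bar>h n x\<bar> + 1 / real (Suc n)" using p(2)[OF True, of n] by linarith
      also have "\<dots> \<le> B + 1" using B0 by (intro add_mono) (auto simp: h_def)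
      finally have "\<bar>p n x\<bar> \<le> B + 1" .
      then have "cutoff a b n x * \<bar>p n x\<bar> \<le> 1 * (B + 1)"
        using B0 by (intro mult_mono cutoff_bounds) auto
      then show ?thesis by (simp add: r_def abs_mult cutoff_bounds)
    next
      case False
      then show ?thesis using bump_zero[OF bumps, of x n] B0 by auto
    qed
  next
    have "AE x in lebesgue. x \<notin> N"
      using N(1) by (intro AE_not_in) (simp add: negligible_iff_null_sets)
    then have "AE x in lborel. x \<notin> N" by (simp add: AE_completion_iff)
    then show "AE x in lborel. a < x \<and> x < b \<longrightarrow> (\<lambda>n. r n x) \<longlonglongrightarrow> q x"
    proof (rule AE_mp, intro AE_I2 impI)
      fix x assume x: "x \<notin> N" "a < x \<and> x < b"
      have "(\<lambda>n. h n x) \<longlonglongrightarrow> max (- B) (min B (q x))"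
        unfolding h_def by (intro tendsto_intros N x)
      then have h: "(\<lambda>n. h n x) \<longlonglongrightarrow> q x" using B[of x] by (simp add: min_def max_def abs_le_iff split: if_splits)
      have "(\<lambda>n. p n x - h n x) \<longlonglongrightarrow> 0"
      proof (rule Lim_null_comparison)
        show "\<forall>\<^sub>F n in sequentially. norm (p n x - h n x) \<le> 1 / real (Suc n)"
          using p(2)[of x] x by (intro always_eventually) (auto simp: abs_minus_commute less_imp_le)
      qed (use LIMSEQ_inverse_real_of_nat in \<open>simp add: inverse_eq_divide\<close>)
      from tendsto_add[OF this h] have "(\<lambda>n. p n x) \<longlonglongrightarrow> q x" by simp
      from tendsto_mult[OF cutoff_tendsto[of a x b] this] x show "(\<lambda>n. r n x) \<longlonglongrightarrow> q x" by (simp add: r_def)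
    qed
  qed
qed

section \<open>Square-integrable functions: Cauchy-Schwarz, lower semicontinuity, density of
  bumps\<close>

lemma integrable_square_bound:
  fixes f g :: "'a \<Rightarrow> real"
  assumes [measurable]: "f \<in> borel_measurable M" "g \<in> borel_measurable M"
    and f: "integrable M (\<lambda>x. (f x)\<^sup>2)" and g: "integrable M (\<lambda>x. (g x)\<^sup>2)"
  shows "integrable M (\<lambda>x. f x * g x)"
proof (rule Bochner_Integration.integrable_bound)
  show "integrable M (\<lambda>x. (f x)\<^sup>2 + (g x)\<^sup>2)" using f g by simp
  have "\<bar>a * b\<bar> \<le> a\<^sup>2 + b\<^sup>2" for a b :: real
    using sum_squares_bound[of a b] sum_squares_bound[of a "-b"] zero_le_power2[of a] zero_le_power2[of b] by (simp add: abs_if)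
  then show "AE x in M. norm (f x * g x) \<le> norm ((f x)\<^sup>2 + (g x)\<^sup>2)"
    by (intro AE_I2) auto
qed simp

lemma integrable_square_lincomb:
  fixes f g :: "'a \<Rightarrow> real"
  assumes m: "f \<in> borel_measurable M" "g \<in> borel_measurable M"
    and f: "integrable M (\<lambda>x. (f x)\<^sup>2)" and g: "integrable M (\<lambda>x. (g x)\<^sup>2)"
  shows "integrable M (\<lambda>x. (f x - c * g x)\<^sup>2)"
    "(\<integral>x. (f x - c * g x)\<^sup>2 \<partial>M) = (\<integral>x. (f x)\<^sup>2 \<partial>M) - 2 * c * (\<integral>x. f x * g x \<partial>M) + c\<^sup>2 * (\<integral>x. (g x)\<^sup>2 \<partial>M)"
proof -
  have e: "(f x - c * g x)\<^sup>2 = (f x)\<^sup>2 - 2 * c * (f x * g x) + c\<^sup>2 * (g x)\<^sup>2" for x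
    by (simp add: power2_eq_square algebra_simps)
  note i = integrable_square_bound[OF m f g]
  show "integrable M (\<lambda>x. (f x - c * g x)\<^sup>2)" unfolding e using f g i by simp
  show "(\<integral>x. (f x - c * g x)\<^sup>2 \<partial>M) = (\<integral>x. (f x)\<^sup>2 \<partial>M) - 2 * c * (\<integral>x. f x * g x \<partial>M) + c\<^sup>2 * (\<integral>x. (g x)\<^sup>2 \<partial>M)"
    unfolding e using f g i by simp
qed

text \<open>Stated for numbers because it serves both the real L2 integrals and the complex form of
  \<open>form_Cauchy_Schwarz\<close>. The sign of D is deduced: were D negative, a large t would
  violate the hypothesis.\<close>

lemma quadratic_nonneg_discriminant:
  fixes A B D :: real
  assumes "\<And>t. 0 \<le> A - 2 * t * B + t\<^sup>2 * D"
  shows "B\<^sup>2 \<le> A * D"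
proof (cases "D = 0")
  case True
  have "B = 0"
  proof (rule ccontr)
    assume "B \<noteq> 0"
    then show False using assms[of "(A + 1) / (2 * B)"] True by (simp add: field_simps)
  qed
  then show ?thesis using True by simp
next
  case False
  have "D \<ge> 0"
  proof (rule ccontr)
    assume D: "\<not> D \<ge> 0"
    \<comment> \<open>Chosen so that t \<ge> 1 and t D lies below -(|A| + 2 |B| + 1); then A and -2
      t B are absorbed.\<close>
    define t where "t = (\<bar>A\<bar> + 2 * \<bar>B\<bar> + 1) / (- D) + 1"
    have "(\<bar>A\<bar> + 2 * \<bar>B\<bar> + 1) / (- D) \<ge> 0" using D by (intro divide_nonneg_pos) auto
    then have t: "t \<ge> 1" by (simp add: t_def)
    have "t * (- D) = \<bar>A\<bar> + 2 * \<bar>B\<bar> + 1 - D" using D by (simp add: t_def field_simps)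
    then have "t * (\<bar>A\<bar> + 2 * \<bar>B\<bar> + 1 + t * D) < 0" using t D by (simp add: mult_less_0_iff algebra_simps)
    moreover have "A \<le> t * \<bar>A\<bar>" using t by (smt (verit) mult_le_cancel_right1)
    moreover have "- 2 * t * B \<le> t * (2 * \<bar>B\<bar>)" using t by (simp add: mult_left_mono abs_if)
    ultimately show False using assms[of t] t by (simp add: algebra_simps power2_eq_square)
  qed
  with False have "D > 0" by simp
  then show ?thesis using assms[of "B / D"] by (simp add: field_simps power2_eq_square)
qed

lemma Cauchy_Schwarz_integral:
  fixes f g :: "'a \<Rightarrow> real"
  assumes m: "f \<in> borel_measurable M" "g \<in> borel_measurable M"
    and f: "integrable M (\<lambda>x. (f x)\<^sup>2)" and g: "integrable M (\<lambda>x. (g x)\<^sup>2)"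
  shows "(\<integral>x. f x * g x \<partial>M)\<^sup>2 \<le> (\<integral>x. (f x)\<^sup>2 \<partial>M) * (\<integral>x. (g x)\<^sup>2 \<partial>M)"
proof (rule quadratic_nonneg_discriminant)
  fix t show "0 \<le> (\<integral>x. (f x)\<^sup>2 \<partial>M) - 2 * t * (\<integral>x. f x * g x \<partial>M) + t\<^sup>2 * (\<integral>x. (g x)\<^sup>2 \<partial>M)"
    unfolding integrable_square_lincomb(2)[OF assms, symmetric] by simp
qed

lemma integral_square_triangle:
  fixes f g :: "'a \<Rightarrow> real"
  assumes m: "f \<in> borel_measurable M" "g \<in> borel_measurable M"
    and f: "integrable M (\<lambda>x. (f x)\<^sup>2)" and g: "integrable M (\<lambda>x. (g x)\<^sup>2)"
  shows "sqrt (\<integral>x. (f x + g x)\<^sup>2 \<partial>M) \<le> sqrt (\<integral>x. (f x)\<^sup>2 \<partial>M) + sqrt (\<integral>x. (g x)\<^sup>2 \<partial>M)"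
proof (rule real_le_lsqrt)
  let ?F = "\<integral>x. (f x)\<^sup>2 \<partial>M" and ?G = "\<integral>x. (g x)\<^sup>2 \<partial>M"
  have nn: "?F \<ge> 0" "?G \<ge> 0" by auto
  have "(\<integral>x. (f x + g x)\<^sup>2 \<partial>M) = ?F + 2 * (\<integral>x. f x * g x \<partial>M) + ?G"
    using integrable_square_lincomb(2)[OF assms, of "-1"] by simp
  also have "(\<integral>x. f x * g x \<partial>M) \<le> sqrt ?F * sqrt ?G"
    using real_sqrt_le_mono[OF Cauchy_Schwarz_integral[OF assms]] by (simp add: real_sqrt_mult abs_if split: if_splits)
  finally show "(\<integral>x. (f x + g x)\<^sup>2 \<partial>M) \<le> (sqrt ?F + sqrt ?G)\<^sup>2"
    using nn by (simp add: power2_sum)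
qed simp

text \<open>Fatou's lemma for the squares. The bounds \<open>c n\<close> may vary with n, so that
  approximations with errors can be used and the limit \<open>C\<close> of their bounds survives;
  integrability of the limit is part of the conclusion.\<close>

lemma fatou_square:
  fixes f :: "'a \<Rightarrow> real" and fn :: "nat \<Rightarrow> 'a \<Rightarrow> real"
  assumes [measurable]: "f \<in> borel_measurable M" "\<And>n. fn n \<in> borel_measurable M"
    and int: "\<And>n. integrable M (\<lambda>x. (fn n x)\<^sup>2)"
    and lim: "AE x in M. (\<lambda>n. fn n x) \<longlonglongrightarrow> f x"
    and bd: "\<And>n. (\<integral>x. (fn n x)\<^sup>2 \<partial>M) \<le> c n" and c: "c \<longlonglongrightarrow> C"
  shows "integrable M (\<lambda>x. (f x)\<^sup>2)" "(\<integral>x. (f x)\<^sup>2 \<partial>M) \<le> C"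
proof -
  have c0: "0 \<le> c n" for n
    by (rule order_trans[OF _ bd[of n]]) simp
  then have C0: "0 \<le> C" using c by (intro LIMSEQ_le_const[OF c]) auto
  have "(\<integral>\<^sup>+x. ennreal ((f x)\<^sup>2) \<partial>M) = (\<integral>\<^sup>+x. liminf (\<lambda>n. ennreal ((fn n x)\<^sup>2)) \<partial>M)"
    using lim
  proof (intro nn_integral_cong_AE, elim AE_mp, intro AE_I2 impI)
    fix x assume "(\<lambda>n. fn n x) \<longlonglongrightarrow> f x"
    then have L: "(\<lambda>n. ennreal ((fn n x)\<^sup>2)) \<longlonglongrightarrow> ennreal ((f x)\<^sup>2)" by (intro tendsto_ennrealI tendsto_power)
    show "ennreal ((f x)\<^sup>2) = liminf (\<lambda>n. ennreal ((fn n x)\<^sup>2))"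
      by (rule lim_imp_Liminf[symmetric, OF _ L]) simp
  qed
  also have "\<dots> \<le> liminf (\<lambda>n. \<integral>\<^sup>+x. ennreal ((fn n x)\<^sup>2) \<partial>M)"
    by (intro nn_integral_liminf) simp
  also have "\<dots> \<le> liminf (\<lambda>n. ennreal (c n))"
    using bd by (intro Liminf_mono always_eventually allI) (simp only: nn_integral_eq_integral[OF int] zero_le_power2 AE_I2 ennreal_leI)
  also have "\<dots> = ennreal C"
    using c by (intro lim_imp_Liminf tendsto_ennrealI) auto
  finally have le: "(\<integral>\<^sup>+x. ennreal ((f x)\<^sup>2) \<partial>M) \<le> ennreal C" .
  show i: "integrable M (\<lambda>x. (f x)\<^sup>2)"
    using le by (intro integrableI_nonneg) (auto simp: less_top[symmetric] top_unique)
  show "(\<integral>x. (f x)\<^sup>2 \<partial>M) \<le> C"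
    using le C0 by (simp add: nn_integral_eq_integral i)
qed

text \<open>Two approximations: truncation of the values at height k, by dominated convergence, then
  \<open>bump_approx_bounded\<close> for the truncated function. Each is made smaller than e/4
  because the square of a sum costs a factor 2.\<close>

lemma bump_approx_L2:
  fixes f :: "real \<Rightarrow> real"
  assumes f[measurable]: "f \<in> borel_measurable borel" and int: "integrable lborel (\<lambda>x. (f x)\<^sup>2)"
    and supp: "\<And>x. x \<notin> {a<..<b} \<Longrightarrow> f x = 0" and e: "e > 0"
  obtains w where "bump a b w" "(\<integral>x. (f x - w x)\<^sup>2 \<partial>lborel) < e"
proof -
  define fk where "fk = (\<lambda>k x. max (- real k) (min (real k) (f x)))"
  have [measurable]: "fk k \<in> borel_measurable borel" for k unfolding fk_def by measurable
  have fk_le: "\<bar>f x - fk k x\<bar> \<le> \<bar>f x\<bar>" "\<bar>fk k x\<bar> \<le> \<bar>f x\<bar>" "\<bar>fk k x\<bar> \<le> real k" for k x by (auto simp: fk_def)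
  have "(\<lambda>k. \<integral>x. (f x - fk k x)\<^sup>2 \<partial>lborel) \<longlonglongrightarrow> (\<integral>x. 0 \<partial>(lborel :: real measure))"
  proof (rule integral_dominated_convergence[OF _ _ int])
    show "AE x in lborel. (\<lambda>k. (f x - fk k x)\<^sup>2) \<longlonglongrightarrow> 0"
    proof (intro AE_I2 tendsto_eventually)
      fix x
      obtain N where "\<bar>f x\<bar> < real N" using reals_Archimedean2 by blast
      then show "\<forall>\<^sub>F k in sequentially. (f x - fk k x)\<^sup>2 = 0"
        by (intro eventually_sequentiallyI[of N]) (auto simp: fk_def)
    qed
    show "AE x in lborel. norm ((f x - fk k x)\<^sup>2) \<le> (f x)\<^sup>2" for k
      using fk_le(1) by (auto simp: abs_le_square_iff)
  qed simp_all
  then have "\<forall>\<^sub>F k in sequentially. (\<integral>x. (f x - fk k x)\<^sup>2 \<partial>lborel) < e / 4"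
    using e by (intro order_tendstoD(2)[where y = 0]) auto
  then obtain k :: nat where k: "(\<integral>x. (f x - fk k x)\<^sup>2 \<partial>lborel) < e / 4"
    by (auto simp: eventually_sequentially)
  obtain r where r: "\<forall>n. bump a b (r n)" "\<forall>n x. \<bar>r n x\<bar> \<le> real k + 1"
    "AE x in lborel. a < x \<and> x < b \<longrightarrow> (\<lambda>n. r n x) \<longlonglongrightarrow> fk k x"
    using bump_approx_bounded[of "fk k" "real k" a b, OF \<open>fk k \<in> borel_measurable borel\<close> fk_le(3)] by blast
  have [measurable]: "r n \<in> borel_measurable borel" for n
    by (rule smooth_borel[OF bump_smooth[OF spec[OF r(1)]]])
  \<comment> \<open>The truncated function is at most k and its approximants at most k + 1 in
    absolute value; both vanish outside (a,b).\<close>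
  let ?b = "\<lambda>x. (2 * real k + 1)\<^sup>2 * indicator {a..b} x :: real"
  have ib: "integrable lborel ?b"
    by (intro integrable_mult_right integrable_real_indicator) (auto simp: emeasure_lborel_Icc_eq)
  have dom: "(fk k x - r n x)\<^sup>2 \<le> ?b x" for n x
  proof (cases "x \<in> {a<..<b}")
    case True
    have "\<bar>fk k x - r n x\<bar> \<le> 2 * real k + 1" using fk_le(3)[of k x] spec[OF spec[OF r(2), of n], of x] by linarith
    then show ?thesis using True by (simp add: power2_le_iff_abs_le)
  next
    case False
    then show ?thesis using bump_zero[OF spec[OF r(1)] False, of n] fk_le(2)[of k x] supp[OF False] by simp
  qed
  have irn: "integrable lborel (\<lambda>x. (fk k x - r n x)\<^sup>2)" for n
    by (rule Bochner_Integration.integrable_bound[OF ib]) (use dom in \<open>auto simp: abs_mult\<close>)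
  have ifk: "integrable lborel (\<lambda>x. (f x - fk k x)\<^sup>2)"
    by (rule Bochner_Integration.integrable_bound[OF int]) (use fk_le(1) in \<open>auto simp: abs_le_square_iff\<close>)
  have "(\<lambda>n. \<integral>x. (fk k x - r n x)\<^sup>2 \<partial>lborel) \<longlonglongrightarrow> (\<integral>x. 0 \<partial>(lborel :: real measure))"
  proof (rule integral_dominated_convergence[OF _ _ ib])
    show "AE x in lborel. (\<lambda>n. (fk k x - r n x)\<^sup>2) \<longlonglongrightarrow> 0"
      using r(3)
    proof (rule AE_mp, intro AE_I2 impI)
      fix x assume x: "a < x \<and> x < b \<longrightarrow> (\<lambda>n. r n x) \<longlonglongrightarrow> fk k x"
      show "(\<lambda>n. (fk k x - r n x)\<^sup>2) \<longlonglongrightarrow> 0"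
      proof (cases "x \<in> {a<..<b}")
        case True
        then have "(\<lambda>n. (fk k x - r n x)\<^sup>2) \<longlonglongrightarrow> (fk k x - fk k x)\<^sup>2"
          using x by (intro tendsto_intros) auto
        then show ?thesis by simp
      next
        case False
        then show ?thesis using bump_zero[OF spec[OF r(1)] False] fk_le(2)[of k x] supp[OF False] by simp
      qed
    qed
    show "AE x in lborel. norm ((fk k x - r n x)\<^sup>2) \<le> ?b x" for n using dom by auto
  qed simp_all
  then have "\<forall>\<^sub>F n in sequentially. (\<integral>x. (fk k x - r n x)\<^sup>2 \<partial>lborel) < e / 4"
    using e by (intro order_tendstoD(2)[where y = 0]) auto
  then obtain n where n: "(\<integral>x. (fk k x - r n x)\<^sup>2 \<partial>lborel) < e / 4"
    by (auto simp: eventually_sequentially)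
  show ?thesis
  proof (rule that[OF spec[OF r(1)]])
    have "(\<integral>x. (f x - r n x)\<^sup>2 \<partial>lborel) \<le> (\<integral>x. 2 * (f x - fk k x)\<^sup>2 + 2 * (fk k x - r n x)\<^sup>2 \<partial>lborel)"
    proof (rule integral_mono')
      fix x
      have "0 \<le> ((f x - fk k x) - (fk k x - r n x))\<^sup>2" by simp
      then show "(f x - r n x)\<^sup>2 \<le> 2 * (f x - fk k x)\<^sup>2 + 2 * (fk k x - r n x)\<^sup>2"
        by (simp add: power2_eq_square algebra_simps)
    qed (use irn ifk in auto)
    also have "\<dots> = 2 * (\<integral>x. (f x - fk k x)\<^sup>2 \<partial>lborel) + 2 * (\<integral>x. (fk k x - r n x)\<^sup>2 \<partial>lborel)"
      using irn ifk by simp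
    also have "\<dots> < e" using k n by simp
    finally show "(\<integral>x. (f x - r n x)\<^sup>2 \<partial>lborel) < e" .
  qed
qed

section \<open>Gaussians and their Hankel transforms\<close>

text \<open>A family that the transform of order \<nu> maps into itself up to scalars, sending the
  parameter t to 1/t; t = 1 gives a fixed function.\<close>

definition gaussian :: "real \<Rightarrow> real \<Rightarrow> real \<Rightarrow> real" where
  "gaussian \<nu> t r = (if r > 0 then r powr (\<nu> + 1/2) * exp (- t * r\<^sup>2 / 2) else 0)"

text \<open>The substitution u = t r^2/2 turns the integral into Euler's integral for Gamma(a). The
  change of variables takes place for the completed measure \<open>lebesgue\<close> and is then
  moved to \<open>lborel\<close>.\<close>

lemma gaussian_moment:
  fixes a t :: real
  assumes "a > 0" "t > 0"
  shows "has_bochner_integral lborel (\<lambda>r. if r > 0 then r powr (2 * a - 1) * exp (- t * r\<^sup>2 / 2) else 0)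
           ((2 / t) powr a * Gamma a / 2)"
proof -
  define g where "g = (\<lambda>r::real. t * r\<^sup>2 / 2)"
  define f where "f = (\<lambda>u::real. u powr (a - 1) / exp u)"
  have img: "g ` {0<..} = {0<..}"
  proof (intro equalityI subsetI)
    fix u :: real assume "u \<in> {0<..}"
    then show "u \<in> g ` {0<..}" using assms by (intro image_eqI[of _ _ "sqrt (2 * u / t)"]) (auto simp: g_def)
  qed (use assms in \<open>auto simp: g_def\<close>)
  have "(f has_integral Gamma a) {0..}" unfolding f_def by (rule Gamma_integral_real[OF assms(1)])
  also have "(f has_integral Gamma a) {0..} \<longleftrightarrow> (f has_integral Gamma a) {0<..}"
  proof (rule has_integral_spike_set_eq)
    show "negligible {x \<in> {0..} - {0<..}. f x \<noteq> 0}" by (rule negligible_subset[of "{0}"]) auto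
    show "negligible {x \<in> {0<..} - {0..}. f x \<noteq> 0}" by (rule negligible_subset[of "{0}"]) auto
  qed
  finally have G: "(f has_integral Gamma a) {0<..}" .
  have "f absolutely_integrable_on g ` {0<..} \<and> integral (g ` {0<..}) f = Gamma a"
  proof
    show "f absolutely_integrable_on g ` {0<..}"
      unfolding img by (rule nonnegative_absolutely_integrable_1) (use G in \<open>auto simp: has_integral_iff f_def\<close>)
    show "integral (g ` {0<..}) f = Gamma a"
      unfolding img using G by (rule integral_unique)
  qed
  then have C: "(\<lambda>r. \<bar>t * r\<bar> * f (g r)) absolutely_integrable_on {0<..} \<and> integral {0<..} (\<lambda>r. \<bar>t * r\<bar> * f (g r)) = Gamma a"
    by (subst has_absolute_integral_change_of_variables_1'[where g = g])
       (use assms in \<open>auto simp: g_def inj_on_def intro!: derivative_eq_intros\<close>)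
  have e: "\<bar>t * r\<bar> * f (g r) = 2 * (t / 2) powr a * (r powr (2 * a - 1) * exp (- t * r\<^sup>2 / 2))" if "r > 0" for r
  proof -
    have "(t * r\<^sup>2 / 2) powr (a - 1) = (t / 2) powr (a - 1) * (r powr (2 * (a - 1)))"
    proof -
      have "(t * r\<^sup>2 / 2) powr (a - 1) = (t / 2) powr (a - 1) * (r\<^sup>2) powr (a - 1)"
        using powr_mult[of "t/2" "r\<^sup>2" "a-1"] assms by simp
      also have "(r\<^sup>2) powr (a - 1) = r powr (2 * (a - 1))"
        using that powr_powr[of r 2 "a - 1"] by simp
      finally show ?thesis .
    qed
    moreover have "r powr (2 * a - 1) = r * r powr (2 * (a - 1))"
      using that powr_add[of r 1 "2 * (a - 1)"] by (simp add: algebra_simps)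
    moreover have "(t / 2) powr a = t / 2 * (t / 2) powr (a - 1)"
      using assms powr_add[of "t/2" 1 "a - 1"] by simp
    ultimately show ?thesis using that assms
      by (simp add: f_def g_def exp_minus field_simps)
  qed
  let ?F = "\<lambda>r. if r > 0 then r powr (2 * a - 1) * exp (- t * r\<^sup>2 / 2) else 0"
  have meas: "?F \<in> borel_measurable borel" by measurable
  have meas': "(\<lambda>r. 2 * (t / 2) powr a * ?F r) \<in> borel_measurable lborel"
    unfolding measurable_lborel2 by (rule borel_measurable_times[OF borel_measurable_const meas])
  have c: "2 * (t / 2) powr a > 0" using assms by simp
  have "(\<lambda>r. 2 * (t / 2) powr a * ?F r) absolutely_integrable_on {0<..}"
  proof -
    have "set_integrable lebesgue {0<..} (\<lambda>r. \<bar>t * r\<bar> * f (g r)) = set_integrable lebesgue {0<..} (\<lambda>r. 2 * (t / 2) powr a * ?F r)"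
    proof (rule set_integrable_cong[OF refl refl])
      fix r :: real assume "r \<in> {0<..}"
      then show "\<bar>t * r\<bar> * f (g r) = 2 * (t / 2) powr a * ?F r" using e[of r] by simp
    qed
    then show ?thesis using C by blast
  qed
  then have I1: "integrable lebesgue (\<lambda>r. 2 * (t / 2) powr a * ?F r)"
    unfolding set_integrable_def
    by (rule Bochner_Integration.integrable_cong[THEN iffD1, OF refl, rotated]) (auto simp: indicator_def)
  then have I: "integrable lborel ?F"
    using c by (simp add: integrable_completion meas)
  have "(LINT r|lborel. 2 * (t / 2) powr a * ?F r) = Gamma a"
  proof -
    have "(LINT r|lborel. 2 * (t / 2) powr a * ?F r) = (LINT r|lebesgue. 2 * (t / 2) powr a * ?F r)"
      by (rule integral_completion[OF meas', symmetric])
    also have "\<dots> = (LINT r:{0<..}|lebesgue. \<bar>t * r\<bar> * f (g r))"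
      unfolding set_lebesgue_integral_def
      by (intro Bochner_Integration.integral_cong) (auto simp: indicator_def e)
    also have "\<dots> = integral {0<..} (\<lambda>r. \<bar>t * r\<bar> * f (g r))"
      using C by (intro set_lebesgue_integral_eq_integral) auto
    finally show ?thesis using C by simp
  qed
  then have "(LINT r|lborel. ?F r) = Gamma a / (2 * (t / 2) powr a)"
    using c by (simp add: field_simps)
  also have "\<dots> = (2 / t) powr a * Gamma a / 2"
    using assms by (simp add: powr_divide mult.commute)
  finally show ?thesis using I by (simp add: has_bochner_integral_iff)
qed

text \<open>Set to 0 off the open quadrant, so that integrals run over the whole line and transforms
  vanish at nonpositive arguments, matching functions extended by 0.\<close>

definition hankel_kernel :: "real \<Rightarrow> real \<Rightarrow> real \<Rightarrow> real" where
  "hankel_kernel \<nu> k r = (if k > 0 \<and> r > 0 then bessel_kernel \<nu> (k * r) else 0)"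

definition real_hankel :: "real \<Rightarrow> (real \<Rightarrow> real) \<Rightarrow> real \<Rightarrow> real" where
  "real_hankel \<nu> f k = (LINT r|lborel. f r * hankel_kernel \<nu> k r)"

text \<open>Weber's integral. The kernel is expanded in its power series and integrated term by
  term; the Gamma value of each moment cancels the Gamma in the coefficient, which leaves the
  exponential series of -k^2/(2 t).\<close>

lemma gaussian_transform:
  assumes "\<nu> > 0" "t > 0" "k > 0"
  shows "real_hankel \<nu> (gaussian \<nu> t) k = t powr (- (\<nu> + 1)) * gaussian \<nu> (1 / t) k"
proof -
  define T where "T = (\<lambda>m r. 2 powr (- \<nu>) * k powr (\<nu> + 1/2) * bessel_coeff \<nu> m * (k\<^sup>2 / 4) ^ m *
     (if r > 0 then r powr (2 * (\<nu> + real m + 1) - 1) * exp (- t * r\<^sup>2 / 2) else 0 :: real))"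
  define A where "A = 2 powr (- \<nu>) * k powr (\<nu> + 1/2) * (2 / t) powr (\<nu> + 1) / 2"
  have Gpos: "Gamma (real m + \<nu> + 1) > 0" for m using assms by (intro Gamma_real_pos) auto
  have mom: "has_bochner_integral lborel (\<lambda>r. if r > 0 then r powr (2 * (\<nu> + real m + 1) - 1) * exp (- t * r\<^sup>2 / 2) else 0)
           ((2 / t) powr (\<nu> + 1) * (2 / t) ^ m * Gamma (real m + \<nu> + 1) / 2)" for m
  proof -
    have "(2 / t) powr (\<nu> + real m + 1) = (2 / t) powr (\<nu> + 1) * (2 / t) ^ m"
      using assms powr_add[of "2/t" "\<nu> + 1" "real m"] by (simp add: powr_realpow add_ac)
    then show ?thesis using gaussian_moment[of "\<nu> + real m + 1" t] assms by (simp add: add_ac)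
  qed
  have Tint: "has_bochner_integral lborel (T m) (A * ((- k\<^sup>2 / (2 * t)) ^ m /\<^sub>R fact m))" for m
  proof -
    have "has_bochner_integral lborel (T m) (2 powr (- \<nu>) * k powr (\<nu> + 1/2) * bessel_coeff \<nu> m * (k\<^sup>2 / 4) ^ m *
          ((2 / t) powr (\<nu> + 1) * (2 / t) ^ m * Gamma (real m + \<nu> + 1) / 2))"
      unfolding T_def by (intro has_bochner_integral_mult_right mom)
    also have "2 powr (- \<nu>) * k powr (\<nu> + 1/2) * bessel_coeff \<nu> m * (k\<^sup>2 / 4) ^ m *
          ((2 / t) powr (\<nu> + 1) * (2 / t) ^ m * Gamma (real m + \<nu> + 1) / 2)
         = A * ((-1) ^ m * ((k\<^sup>2 / 4) ^ m * (2 / t) ^ m) /\<^sub>R fact m)"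
      using Gpos[of m] by (simp add: A_def bessel_coeff_def field_simps)
    also have "(-1) ^ m * ((k\<^sup>2 / 4) ^ m * (2 / t) ^ m) = (- k\<^sup>2 / (2 * t)) ^ m"
      unfolding power_mult_distrib[symmetric] by simp
    finally show ?thesis .
  qed
  \<comment> \<open>The absolute values integrate to the terms of the series of A exp(k^2/(2 t));
    this summability justifies exchanging sum and integral.\<close>
  have Tabs: "(LINT r|lborel. norm (T m r)) = A * ((k\<^sup>2 / (2 * t)) ^ m /\<^sub>R fact m)" for m
  proof -
    have "norm (T m r) = (-1) ^ m * T m r" for r
      using Gpos[of m] by (cases "even m") (auto simp: T_def bessel_coeff_def abs_mult)
    then have "(LINT r|lborel. norm (T m r)) = (-1) ^ m * (A * ((- k\<^sup>2 / (2 * t)) ^ m /\<^sub>R fact m))"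
      using Tint[of m] by (simp add: has_bochner_integral_iff)
    also have "\<dots> = A * (((-1) * (- k\<^sup>2 / (2 * t))) ^ m /\<^sub>R fact m)"
      unfolding power_mult_distrib by simp
    finally show ?thesis by simp
  qed
  have Tsums: "(\<lambda>m. T m r) sums (gaussian \<nu> t r * hankel_kernel \<nu> k r)" for r
  proof (cases "r > 0")
    case True
    have "(\<lambda>m. gaussian \<nu> t r * 2 powr (- \<nu>) * (k * r) powr (\<nu> + 1/2) * (bessel_coeff \<nu> m * ((k * r)\<^sup>2 / 4) ^ m)) sums
           (gaussian \<nu> t r * 2 powr (- \<nu>) * (k * r) powr (\<nu> + 1/2) * bessel_series \<nu> ((k * r)\<^sup>2 / 4))"
      unfolding bessel_series_def by (intro sums_mult summable_sums summable_bessel_series assms)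
    moreover have "gaussian \<nu> t r * hankel_kernel \<nu> k r = gaussian \<nu> t r * 2 powr (- \<nu>) * (k * r) powr (\<nu> + 1/2) * bessel_series \<nu> ((k * r)\<^sup>2 / 4)"
      using True assms by (simp add: hankel_kernel_def bessel_kernel_eq)
    moreover have "gaussian \<nu> t r * 2 powr (- \<nu>) * (k * r) powr (\<nu> + 1/2) * (bessel_coeff \<nu> m * ((k * r)\<^sup>2 / 4) ^ m) = T m r" for m
    proof -
      have "r powr (2 * (\<nu> + real m + 1) - 1) = r powr (\<nu> + 1/2) * r powr (\<nu> + 1/2) * (r\<^sup>2) ^ m"
      proof -
        have "r powr (2 * (\<nu> + real m + 1) - 1) = r powr ((\<nu> + 1/2) + (\<nu> + 1/2) + real (2 * m))"
          by (simp add: algebra_simps)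
        also have "\<dots> = r powr (\<nu> + 1/2) * r powr (\<nu> + 1/2) * r ^ (2 * m)"
          unfolding powr_add by (subst powr_realpow) (use True in auto)
        finally show ?thesis by (simp add: power_mult)
      qed
      then show ?thesis using True assms
        by (simp add: T_def gaussian_def powr_mult power_mult_distrib power_divide)
    qed
    ultimately show ?thesis by (simp only:)
  qed (simp add: T_def gaussian_def)
  have "(LINT r|lborel. (\<Sum>m. T m r)) = (\<Sum>m. LINT r|lborel. T m r)"
  proof (rule integral_suminf)
    show "integrable lborel (T m)" for m using Tint by (simp add: has_bochner_integral_iff)
    show "summable (\<lambda>m. LINT r|lborel. norm (T m r))"
      unfolding Tabs by (intro summable_mult summable_exp_generic)
    show "AE r in lborel. summable (\<lambda>m. norm (T m r))"
    proof (rule AE_I2)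
      fix r
      \<comment> \<open>The terms are those of an absolutely convergent power series in (k r)^2/4,
        up to a factor independent of m, which is read off from m = 0.\<close>
      have eq: "norm (T m r) = \<bar>T 0 r\<bar> / \<bar>bessel_coeff \<nu> 0\<bar> * (\<bar>bessel_coeff \<nu> m\<bar> * ((k * r)\<^sup>2 / 4) ^ m)" for m
      proof (cases "r > 0")
        case True
        have "r powr (2 * (\<nu> + real m + 1) - 1) = r powr (2 * (\<nu> + 1) - 1) * (r\<^sup>2) ^ m"
        proof -
          have "r powr (2 * (\<nu> + real m + 1) - 1) = r powr ((2 * (\<nu> + 1) - 1) + real (2 * m))"
            by (simp add: algebra_simps)
          also have "\<dots> = r powr (2 * (\<nu> + 1) - 1) * r ^ (2 * m)"
            unfolding powr_add by (subst powr_realpow) (use True in auto)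
          finally show ?thesis by (simp add: power_mult)
        qed
        moreover have "bessel_coeff \<nu> 0 \<noteq> 0" using Gpos[of 0] by (simp add: bessel_coeff_def)
        ultimately show ?thesis using True
          by (simp add: T_def abs_mult power_mult_distrib power_divide field_simps)
      qed (simp add: T_def)
      have "summable (\<lambda>m. norm (bessel_coeff \<nu> m * ((k * r)\<^sup>2 / 4) ^ m))"
        by (rule powser_insidea[OF summable_bessel_series[OF assms(1), of "(k*r)\<^sup>2 / 4 + 1"]]) simp
      then show "summable (\<lambda>m. norm (T m r))"
        unfolding eq by (intro summable_mult) (simp add: abs_mult)
    qed
  qed
  also have "(\<lambda>r. \<Sum>m. T m r) = (\<lambda>r. gaussian \<nu> t r * hankel_kernel \<nu> k r)"
    using Tsums by (auto simp: sums_iff)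
  also have "(\<Sum>m. LINT r|lborel. T m r) = (\<Sum>m. A * ((- k\<^sup>2 / (2 * t)) ^ m /\<^sub>R fact m))"
    using Tint by (simp add: has_bochner_integral_iff)
  also have "\<dots> = A * exp (- k\<^sup>2 / (2 * t))"
    unfolding exp_def by (intro suminf_mult summable_exp_generic)
  also have "\<dots> = t powr (- (\<nu> + 1)) * gaussian \<nu> (1 / t) k"
  proof -
    have "2 powr (- \<nu>) * (2 / t) powr (\<nu> + 1) / 2 = t powr (- (\<nu> + 1))"
    proof -
      have "2 powr (- \<nu>) * (2 / t) powr (\<nu> + 1) / 2 = 2 powr (- \<nu>) * (2 powr (\<nu> + 1) / t powr (\<nu> + 1)) / 2"
        using assms by (simp add: powr_divide mult.commute)
      also have "\<dots> = 1 / t powr (\<nu> + 1)"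
        by (simp add: powr_minus powr_add field_simps)
      finally show ?thesis by (simp only: powr_minus inverse_eq_divide)
    qed
    moreover have "A = k powr (\<nu> + 1/2) * (2 powr (- \<nu>) * (2 / t) powr (\<nu> + 1) / 2)"
      by (simp add: A_def)
    ultimately have "A = k powr (\<nu> + 1/2) * t powr (- (\<nu> + 1))" by (simp only:)
    then show ?thesis using assms by (simp add: gaussian_def)
  qed
  finally show ?thesis by (simp add: real_hankel_def)
qed

section \<open>Contractivity and inversion of the Hankel transform\<close>

lemma hankel_kernel_commute: "hankel_kernel \<nu> k r = hankel_kernel \<nu> r k"
  by (simp add: hankel_kernel_def mult.commute)

lemma hankel_kernel_bounded:
  assumes "\<nu> > 0"
  obtains C where "C > 0" "\<And>k r. \<bar>hankel_kernel \<nu> k r\<bar> \<le> C"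
proof -
  obtain C where C: "C > 0" "\<And>x. \<bar>bessel_kernel \<nu> x\<bar> \<le> C" using bessel_kernel_bounded[OF assms] by metis
  show ?thesis by (rule that[OF C(1)]) (use C in \<open>auto simp: hankel_kernel_def less_imp_le\<close>)
qed

lemma borel_measurable_hankel_kernel [measurable (raw)]:
  assumes "\<nu> > 0" "f \<in> borel_measurable M" "g \<in> borel_measurable M"
  shows "(\<lambda>x. hankel_kernel \<nu> (f x) (g x)) \<in> borel_measurable M"
proof -
  have [measurable]: "bessel_kernel \<nu> \<in> borel_measurable borel" by (rule borel_measurable_bessel_kernel[OF assms(1)])
  note [measurable] = assms(2,3)
  show ?thesis unfolding hankel_kernel_def by measurable
qed

lemma borel_measurable_real_hankel [measurable]:
  assumes "\<nu> > 0" and [measurable]: "f \<in> borel_measurable borel"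
  shows "real_hankel \<nu> f \<in> borel_measurable borel"
proof -
  have "(\<lambda>k. LINT r|lborel. f r * hankel_kernel \<nu> k r) \<in> borel_measurable lborel"
    using assms(1) by measurable
  then show ?thesis by (simp add: real_hankel_def[abs_def])
qed

lemma integrable_real_hankel_integrand:
  assumes "\<nu> > 0" and int: "integrable lborel f"
  shows "integrable lborel (\<lambda>r. f r * hankel_kernel \<nu> k r)"
proof -
  obtain C where C: "C > 0" "\<And>k r. \<bar>hankel_kernel \<nu> k r\<bar> \<le> C" using hankel_kernel_bounded[OF assms(1)] by metis
  have [measurable]: "f \<in> borel_measurable borel" using int by auto
  show ?thesis
  proof (rule Bochner_Integration.integrable_bound)
    show "integrable lborel (\<lambda>r. C * norm (f r))" using int by simp
    show "(\<lambda>r. f r * hankel_kernel \<nu> k r) \<in> borel_measurable lborel" using assms(1) by measurable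
    show "AE r in lborel. norm (f r * hankel_kernel \<nu> k r) \<le> norm (C * norm (f r))"
      using C(2)[of k] C(1) by (auto simp: abs_mult mult.commute[of C] intro!: mult_left_mono AE_I2)
  qed
qed

lemma real_hankel_abs_le:
  assumes "\<nu> > 0" and int: "integrable lborel f" and C: "\<And>k r. \<bar>hankel_kernel \<nu> k r\<bar> \<le> C"
  shows "\<bar>real_hankel \<nu> f k\<bar> \<le> C * (LINT r|lborel. \<bar>f r\<bar>)"
proof -
  have "\<bar>real_hankel \<nu> f k\<bar> \<le> (LINT r|lborel. \<bar>f r * hankel_kernel \<nu> k r\<bar>)"
    unfolding real_hankel_def by (rule integral_abs_bound)
  also have "\<dots> \<le> (LINT r|lborel. C * \<bar>f r\<bar>)"
  proof (rule integral_mono)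
    show "integrable lborel (\<lambda>r. \<bar>f r * hankel_kernel \<nu> k r\<bar>)"
      by (rule integrable_abs[OF integrable_real_hankel_integrand[OF assms(1) int]])
    show "integrable lborel (\<lambda>r. C * \<bar>f r\<bar>)" using int by simp
    show "\<bar>f r * hankel_kernel \<nu> k r\<bar> \<le> C * \<bar>f r\<bar>" for r
      using C[of k r] by (simp add: abs_mult mult.commute[of C] mult_left_mono)
  qed
  finally show ?thesis using int by simp
qed

lemma real_hankel_nonpos: "k \<le> 0 \<Longrightarrow> real_hankel \<nu> f k = 0"
  by (simp add: real_hankel_def hankel_kernel_def)

lemma real_hankel_cmult: "real_hankel \<nu> (\<lambda>r. c * f r) k = c * real_hankel \<nu> f k"
  by (simp add: real_hankel_def mult.assoc)

lemma real_hankel_diff: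
  assumes "\<nu> > 0" "integrable lborel f" "integrable lborel g"
  shows "real_hankel \<nu> (\<lambda>r. f r - g r) k = real_hankel \<nu> f k - real_hankel \<nu> g k"
  unfolding real_hankel_def left_diff_distrib
  by (intro Bochner_Integration.integral_diff integrable_real_hankel_integrand assms)

lemma real_hankel_sum:
  assumes "\<nu> > 0" "\<And>i. i \<in> I \<Longrightarrow> integrable lborel (f i)"
  shows "real_hankel \<nu> (\<lambda>r. \<Sum>i\<in>I. f i r) k = (\<Sum>i\<in>I. real_hankel \<nu> (f i) k)"
  unfolding real_hankel_def sum_distrib_right
  by (intro Bochner_Integration.integral_sum integrable_real_hankel_integrand assms)

text \<open>Fubini: the kernel is bounded and symmetric, so its product with f(r) and g(k) is
  integrable on the plane when f and g are integrable.\<close>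

lemma real_hankel_swap:
  assumes nu: "\<nu> > 0" and f: "integrable lborel f" and g: "integrable lborel g"
  shows "(LINT k|lborel. real_hankel \<nu> f k * g k) = (LINT r|lborel. f r * real_hankel \<nu> g r)"
proof -
  obtain C where C: "C > 0" "\<And>k r. \<bar>hankel_kernel \<nu> k r\<bar> \<le> C" using hankel_kernel_bounded[OF nu] by metis
  have [measurable]: "f \<in> borel_measurable borel" "g \<in> borel_measurable borel" using f g by auto
  let ?F = "\<lambda>(r, k). f r * hankel_kernel \<nu> k r * g k"
  have meas: "?F \<in> borel_measurable (lborel \<Otimes>\<^sub>M lborel)"
    using nu by measurable
  have inner: "integrable lborel (\<lambda>k. f r * hankel_kernel \<nu> k r * g k)" for r
    using integrable_real_hankel_integrand[OF nu g, of r] integrable_mult_right[of "f r" lborel "\<lambda>k. g k * hankel_kernel \<nu> r k"]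
    by (simp add: hankel_kernel_commute[of \<nu> _ r] mult_ac)
  have int: "integrable (lborel \<Otimes>\<^sub>M lborel) ?F"
  proof (rule lborel_pair.Fubini_integrable[OF meas])
    show "AE r in lborel. integrable lborel (\<lambda>k. ?F (r, k))" using inner by simp
    show "integrable lborel (\<lambda>r. LINT k|lborel. norm (?F (r, k)))"
    proof (rule Bochner_Integration.integrable_bound)
      show "integrable lborel (\<lambda>r. norm (f r) * (C * (LINT k|lborel. norm (g k))))" using f by simp
      show "(\<lambda>r. LINT k|lborel. norm (?F (r, k))) \<in> borel_measurable lborel"
        using nu by measurable
      show "AE r in lborel. norm (LINT k|lborel. norm (?F (r, k))) \<le> norm (norm (f r) * (C * (LINT k|lborel. norm (g k))))"
      proof (rule AE_I2)
        fix r
        have "(LINT k|lborel. norm (?F (r, k))) \<le> (LINT k|lborel. norm (f r) * (C * norm (g k)))"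
        proof (rule integral_mono)
          show "integrable lborel (\<lambda>k. norm (?F (r, k)))" using inner[of r] by simp
          show "integrable lborel (\<lambda>k. norm (f r) * (C * norm (g k)))" using g by simp
          show "norm (?F (r, k)) \<le> norm (f r) * (C * norm (g k))" for k
            using C(2)[of k r] by (simp add: abs_mult mult.assoc mult_left_mono mult_right_mono)
        qed
        then show "norm (LINT k|lborel. norm (?F (r, k))) \<le> norm (norm (f r) * (C * (LINT k|lborel. norm (g k))))"
          using C(1) by (simp add: abs_mult)
      qed
    qed
  qed
  have "(LINT k|lborel. real_hankel \<nu> f k * g k) = (LINT k|lborel. LINT r|lborel. f r * hankel_kernel \<nu> k r * g k)"
    by (simp add: real_hankel_def)
  also have "\<dots> = (LINT r|lborel. LINT k|lborel. f r * hankel_kernel \<nu> k r * g k)"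
    by (rule lborel_pair.Fubini_integral) (use int in simp)
  also have "\<dots> = (LINT r|lborel. f r * real_hankel \<nu> g r)"
    by (simp add: real_hankel_def hankel_kernel_commute[of \<nu> _ r for r] mult_ac)
  finally show ?thesis .
qed

lemma gaussian_nonneg: "0 \<le> gaussian \<nu> t r"
  by (simp add: gaussian_def)

lemma borel_measurable_gaussian [measurable]: "gaussian \<nu> t \<in> borel_measurable borel"
  unfolding gaussian_def[abs_def] by measurable

lemma integrable_gaussian:
  assumes "\<nu> > 0" "t > 0" shows "integrable lborel (gaussian \<nu> t)"
proof -
  have e: "2 * ((\<nu> + 3/2) / 2) - 1 = \<nu> + 1/2" by (simp add: field_simps)
  show ?thesis
    using gaussian_moment[of "(\<nu> + 3/2) / 2" t, unfolded e] assms
    by (simp add: has_bochner_integral_iff gaussian_def[abs_def])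
qed

text \<open>The product of two members of the family is r^(2 \<nu> + 1) exp(-(t + u) r^2/2), so its
  integral is the moment with a = \<nu> + 1.\<close>

lemma gaussian_inner:
  assumes "\<nu> > 0" "t > 0" "u > 0"
  shows "has_bochner_integral lborel (\<lambda>r. gaussian \<nu> t r * gaussian \<nu> u r) ((2 / (t + u)) powr (\<nu> + 1) * Gamma (\<nu> + 1) / 2)"
proof -
  have "gaussian \<nu> t r * gaussian \<nu> u r = (if r > 0 then r powr (2 * (\<nu> + 1) - 1) * exp (- (t + u) * r\<^sup>2 / 2) else 0)" for r
  proof (cases "r > 0")
    case True
    have "r powr (2 * (\<nu> + 1) - 1) = r powr ((\<nu> + 1/2) + (\<nu> + 1/2))" by (simp add: algebra_simps)
    also have "\<dots> = r powr (\<nu> + 1/2) * r powr (\<nu> + 1/2)" by (rule powr_add)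
    moreover have "exp (- (t + u) * r\<^sup>2 / 2) = exp (- t * r\<^sup>2 / 2) * exp (- u * r\<^sup>2 / 2)"
      unfolding exp_add[symmetric] by (simp add: field_simps)
    ultimately show ?thesis using True by (simp add: gaussian_def)
  qed (simp add: gaussian_def)
  then show ?thesis using gaussian_moment[of "\<nu> + 1" "t + u"] assms by simp
qed

lemma real_hankel_gaussian:
  assumes "\<nu> > 0" "t > 0"
  shows "real_hankel \<nu> (gaussian \<nu> t) k = t powr (- (\<nu> + 1)) * gaussian \<nu> (1 / t) k"
proof (cases "k > 0")
  case False then show ?thesis by (simp add: real_hankel_nonpos gaussian_def)
qed (rule gaussian_transform[OF assms])

lemma real_hankel_real_hankel_gaussian:
  assumes "\<nu> > 0" "t > 0"
  shows "real_hankel \<nu> (real_hankel \<nu> (gaussian \<nu> t)) k = gaussian \<nu> t k"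
proof -
  have "real_hankel \<nu> (real_hankel \<nu> (gaussian \<nu> t)) k = t powr (- (\<nu> + 1)) * ((1 / t) powr (- (\<nu> + 1)) * gaussian \<nu> t k)"
  proof -
    have "real_hankel \<nu> (gaussian \<nu> t) = (\<lambda>k. t powr (- (\<nu> + 1)) * gaussian \<nu> (1 / t) k)"
      by (rule ext) (rule real_hankel_gaussian[OF assms])
    then show ?thesis using assms real_hankel_gaussian[of \<nu> "1 / t" k] by (simp add: real_hankel_cmult)
  qed
  also have "t powr (- (\<nu> + 1)) * (1 / t) powr (- (\<nu> + 1)) = 1"
    using assms powr_mult[of t "1/t" "- (\<nu> + 1)"] by simp
  then have "t powr (- (\<nu> + 1)) * ((1 / t) powr (- (\<nu> + 1)) * gaussian \<nu> t k) = gaussian \<nu> t k"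
    unfolding mult.assoc[symmetric] by simp
  finally show ?thesis .
qed

text \<open>The parameters are the integers 1, ..., N + 1, so with y = exp(-r^2/2) the sum is
  r^(\<nu>+1/2) y p(y) for the polynomial p with coefficients \<open>a i\<close>.\<close>

definition gaussian_sum :: "real \<Rightarrow> (nat \<Rightarrow> real) \<Rightarrow> nat \<Rightarrow> real \<Rightarrow> real" where
  "gaussian_sum \<nu> a N r = (\<Sum>i\<le>N. a i * gaussian \<nu> (real (Suc i)) r)"

lemma borel_measurable_gaussian_sum [measurable]: "gaussian_sum \<nu> a N \<in> borel_measurable borel"
  unfolding gaussian_sum_def[abs_def] by measurable

lemma integrable_gaussian_sum: "\<nu> > 0 \<Longrightarrow> integrable lborel (gaussian_sum \<nu> a N)"
  unfolding gaussian_sum_def[abs_def] by (intro Bochner_Integration.integrable_sum integrable_mult_right integrable_gaussian) auto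

lemma square_sum_integral:
  fixes g :: "nat \<Rightarrow> real \<Rightarrow> real"
  assumes "\<And>i j. has_bochner_integral lborel (\<lambda>r. g i r * g j r) (m i j)"
  shows "has_bochner_integral lborel (\<lambda>r. (\<Sum>i\<le>N. a i * g i r)\<^sup>2) (\<Sum>i\<le>N. \<Sum>j\<le>N. a i * a j * m i j)"
proof -
  have "(\<Sum>i\<le>N. a i * g i r)\<^sup>2 = (\<Sum>i\<le>N. \<Sum>j\<le>N. a i * a j * (g i r * g j r))" for r
    by (simp add: power2_eq_square sum_product mult_ac)
  then show ?thesis
    using assms by (auto intro!: has_bochner_integral_sum has_bochner_integral_mult_right)
qed

text \<open>Both sides are the same quadratic form in the coefficients, because \<open>t u (1/t + 1/u) = t + u\<close>.\<close>

lemma gaussian_sum_isometry: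
  assumes "\<nu> > 0"
  shows "integrable lborel (\<lambda>r. (gaussian_sum \<nu> a N r)\<^sup>2)" "integrable lborel (\<lambda>r. (real_hankel \<nu> (gaussian_sum \<nu> a N) r)\<^sup>2)"
    "(LINT r|lborel. (real_hankel \<nu> (gaussian_sum \<nu> a N) r)\<^sup>2) = (LINT r|lborel. (gaussian_sum \<nu> a N r)\<^sup>2)"
proof -
  let ?t = "\<lambda>i. real (Suc i)"
  let ?m = "\<lambda>i j. (2 / (?t i + ?t j)) powr (\<nu> + 1) * Gamma (\<nu> + 1) / 2"
  have 1: "has_bochner_integral lborel (\<lambda>r. (gaussian_sum \<nu> a N r)\<^sup>2) (\<Sum>i\<le>N. \<Sum>j\<le>N. a i * a j * ?m i j)"
    unfolding gaussian_sum_def by (intro square_sum_integral gaussian_inner assms) auto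
  have HTe: "real_hankel \<nu> (gaussian_sum \<nu> a N) k = (\<Sum>i\<le>N. a i * (?t i powr (- (\<nu> + 1)) * gaussian \<nu> (1 / ?t i) k))" for k
    unfolding gaussian_sum_def[abs_def]
    by (subst real_hankel_sum) (auto simp: real_hankel_cmult real_hankel_gaussian assms intro!: integrable_mult_right integrable_gaussian)
  have 2: "has_bochner_integral lborel (\<lambda>r. (real_hankel \<nu> (gaussian_sum \<nu> a N) r)\<^sup>2) (\<Sum>i\<le>N. \<Sum>j\<le>N. a i * a j * ?m i j)"
    unfolding HTe
  proof (rule square_sum_integral)
    fix i j
    have "has_bochner_integral lborel (\<lambda>r. (?t i powr (- (\<nu> + 1)) * ?t j powr (- (\<nu> + 1))) * (gaussian \<nu> (1 / ?t i) r * gaussian \<nu> (1 / ?t j) r))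
       ((?t i powr (- (\<nu> + 1)) * ?t j powr (- (\<nu> + 1))) * ((2 / (1 / ?t i + 1 / ?t j)) powr (\<nu> + 1) * Gamma (\<nu> + 1) / 2))"
      by (intro has_bochner_integral_mult_right gaussian_inner assms) auto
    moreover have "(?t i powr (- (\<nu> + 1)) * ?t j powr (- (\<nu> + 1))) * (2 / (1 / ?t i + 1 / ?t j)) powr (\<nu> + 1) = (2 / (?t i + ?t j)) powr (\<nu> + 1)"
    proof -
      have "?t i powr (- (\<nu> + 1)) = (1 / ?t i) powr (\<nu> + 1)" for i
        by (simp only: powr_minus) (simp add: powr_divide inverse_eq_divide)
      then have "(?t i powr (- (\<nu> + 1)) * ?t j powr (- (\<nu> + 1))) * (2 / (1 / ?t i + 1 / ?t j)) powr (\<nu> + 1)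
          = (1 / ?t i * (1 / ?t j) * (2 / (1 / ?t i + 1 / ?t j))) powr (\<nu> + 1)"
        by (simp only: powr_mult[symmetric])
      also have "1 / ?t i * (1 / ?t j) * (2 / (1 / ?t i + 1 / ?t j)) = 2 / (?t i + ?t j)"
      proof -
        have "1 / a * (1 / b) * (2 / (1 / a + 1 / b)) = 2 / (a + b)" if "a > 0" "b > 0" for a b :: real
        proof -
          have "1 / a + 1 / b = (a + b) / (a * b)" using that by (simp add: field_simps)
          then show ?thesis using that by simp
        qed
        then show ?thesis by simp
      qed
      finally show ?thesis .
    qed
    ultimately show "has_bochner_integral lborel (\<lambda>r. ?t i powr (- (\<nu> + 1)) * gaussian \<nu> (1 / ?t i) r * (?t j powr (- (\<nu> + 1)) * gaussian \<nu> (1 / ?t j) r)) (?m i j)"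
      by (simp only: mult_ac times_divide_eq_right)
  qed
  show "integrable lborel (\<lambda>r. (gaussian_sum \<nu> a N r)\<^sup>2)" "integrable lborel (\<lambda>r. (real_hankel \<nu> (gaussian_sum \<nu> a N) r)\<^sup>2)"
    "(LINT r|lborel. (real_hankel \<nu> (gaussian_sum \<nu> a N) r)\<^sup>2) = (LINT r|lborel. (gaussian_sum \<nu> a N r)\<^sup>2)"
    using 1 2 by (auto simp: has_bochner_integral_iff)
qed

text \<open>Weierstrass approximation in the variable \<open>y = exp (- r\<^sup>2 / 2)\<close>.\<close>

lemma bump_gaussian_sum_approx:
  assumes f: "bump 0 b f" and nu: "\<nu> > 0" and e: "e > 0"
  shows "\<exists>a N. \<forall>r. \<bar>f r - gaussian_sum \<nu> a N r\<bar> \<le> e * gaussian \<nu> 1 r"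
proof -
  from bumpE[OF f] obtain \<alpha> \<beta> where ab: "0 < \<alpha>" "\<And>x. x < \<alpha> \<or> \<beta> < x \<Longrightarrow> f x = 0" by metis
  \<comment> \<open>The support is enlarged to a nondegenerate interval such that f vanishes at its
    end points and outside it; the original bounds may be out of order.\<close>
  define \<alpha>' where "\<alpha>' = \<alpha> / 2"
  define \<beta>' where "\<beta>' = max \<alpha> \<beta> + 1"
  have ab': "0 < \<alpha>'" "\<alpha>' < \<beta>'" using ab by (auto simp: \<alpha>'_def \<beta>'_def)
  have z: "f x = 0" if "x \<le> \<alpha>' \<or> \<beta>' \<le> x" for x
    by (rule ab(2)) (use that ab(1) in \<open>auto simp: \<alpha>'_def \<beta>'_def\<close>)
  define y0 where "y0 = exp (- \<beta>'\<^sup>2 / 2)"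
  define y1 where "y1 = exp (- \<alpha>'\<^sup>2 / 2)"
  have y: "0 < y0" "y0 < y1" "y1 < 1"
    using ab' by (auto simp: y0_def y1_def power_strict_mono)
  \<comment> \<open>On [y0, y1] the variable is untouched. Outside it is frozen, and \<rho>, the
    inverse of r \<mapsto> exp(-r^2/2), takes the value \<alpha>' or \<beta>', where f is zero. Thus
    \<psi> is continuous on all of [0,1] although the logarithm and the negative power are singular
    at the ends.\<close>
  define c where "c = (\<lambda>y. max y0 (min y1 y))"
  have c: "0 < c y" "c y < 1" for y using \<open>0 < y0\<close> \<open>y0 < y1\<close> \<open>y1 < 1\<close> by (auto simp: c_def)
  define \<rho> where "\<rho> = (\<lambda>y. sqrt (- 2 * ln (c y)))"
  have rho: "\<rho> y > 0" for y using c[of y] by (simp add: \<rho>_def)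
  define s where "s = \<nu> + 1/2"
  define \<psi> where "\<psi> = (\<lambda>y. f (\<rho> y) * \<rho> y powr (- s) / c y)"
  have cc: "continuous_on {0..1} c" unfolding c_def by (intro continuous_intros)
  have cr: "continuous_on {0..1} \<rho>"
    unfolding \<rho>_def using c(1) by (intro continuous_intros cc) (auto simp: less_imp_neq[symmetric])
  have cf: "continuous_on {0..1} (\<lambda>y. f (\<rho> y))"
    by (rule continuous_on_compose2[OF smooth_continuous_on[OF bump_smooth[OF f], of UNIV] cr]) auto
  have "continuous_on {0..1} \<psi>"
    unfolding \<psi>_def using c(1) rho
    by (intro continuous_on_divide continuous_on_mult continuous_on_powr cf cc cr continuous_on_const) (auto simp: less_imp_neq[symmetric])
  from Stone_Weierstrass_real_polynomial_function[OF _ this e] obtain p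
    where p: "real_polynomial_function p" "\<And>y. y \<in> {0..1} \<Longrightarrow> \<bar>\<psi> y - p y\<bar> < e" by auto
  from real_polynomial_function_imp_sum[OF p(1)] obtain a N where pa: "p = (\<lambda>x. \<Sum>i\<le>N. a i * x ^ i)" by blast
  have "\<bar>f r - gaussian_sum \<nu> a N r\<bar> \<le> e * gaussian \<nu> 1 r" for r
  proof (cases "r > 0")
    case False
    then show ?thesis using z[of r] ab' by (simp add: gaussian_sum_def gaussian_def)
  next
    case True
    define y where "y = exp (- r\<^sup>2 / 2)"
    have yy: "y \<in> {0..1}" by (simp add: y_def)
    have fr: "f r = r powr s * y * \<psi> y"
    proof -
      consider "r < \<alpha>'" | "r > \<beta>'" | "\<alpha>' \<le> r" "r \<le> \<beta>'" by linarith
      then show ?thesis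
      proof cases
        case 1
        then have "r\<^sup>2 < \<alpha>'\<^sup>2" using True by (simp add: power_strict_mono)
        then have "y > y1" by (simp add: y_def y1_def)
        then have "c y = y1" using \<open>y0 < y1\<close> by (simp add: c_def)
        then have "\<rho> y = \<alpha>'" using ab' by (simp add: \<rho>_def y1_def)
        then show ?thesis using z[of r] z[of \<alpha>'] 1 by (simp add: \<psi>_def)
      next
        case 2
        then have "\<beta>'\<^sup>2 < r\<^sup>2" using ab' by (simp add: power_strict_mono)
        then have "y < y0" by (simp add: y_def y0_def)
        then have "c y = y0" using \<open>y0 < y1\<close> by (simp add: c_def)
        then have "\<rho> y = \<beta>'" using ab' by (simp add: \<rho>_def y0_def)
        then show ?thesis using z[of r] z[of \<beta>'] 2 by (simp add: \<psi>_def)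
      next
        case 3
        then have "\<alpha>'\<^sup>2 \<le> r\<^sup>2" "r\<^sup>2 \<le> \<beta>'\<^sup>2" using ab' by (auto intro!: power_mono)
        then have "y0 \<le> y" "y \<le> y1" by (auto simp: y_def y0_def y1_def)
        then have "c y = y" by (simp add: c_def)
        then have "\<rho> y = r" using True by (simp add: \<rho>_def y_def)
        then show ?thesis using True \<open>c y = y\<close> by (simp add: \<psi>_def powr_minus y_def)
      qed
    qed
    have g1: "gaussian \<nu> 1 r = r powr s * y" using True by (simp add: gaussian_def s_def y_def)
    have "gaussian_sum \<nu> a N r = r powr s * y * p y"
    proof -
      have "gaussian \<nu> (real (Suc i)) r = r powr s * y * y ^ i" for i
      proof -
        have "y ^ Suc i = exp (real (Suc i) * (- r\<^sup>2 / 2))" unfolding y_def by (rule exp_of_nat_mult[symmetric])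
        also have "real (Suc i) * (- r\<^sup>2 / 2) = - real (Suc i) * r\<^sup>2 / 2" by (simp add: algebra_simps)
        finally have "exp (- real (Suc i) * r\<^sup>2 / 2) = y * y ^ i" by simp
        then show ?thesis using True unfolding gaussian_def s_def by (simp only: if_True mult.assoc)
      qed
      then show ?thesis by (simp add: gaussian_sum_def pa sum_distrib_left mult_ac)
    qed
    then have "f r - gaussian_sum \<nu> a N r = gaussian \<nu> 1 r * (\<psi> y - p y)" unfolding fr g1 by (simp add: algebra_simps)
    then have "\<bar>f r - gaussian_sum \<nu> a N r\<bar> = gaussian \<nu> 1 r * \<bar>\<psi> y - p y\<bar>" by (simp add: abs_mult gaussian_nonneg)
    also have "\<dots> \<le> gaussian \<nu> 1 r * e" using p(2)[OF yy] by (intro mult_left_mono gaussian_nonneg) auto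
    finally show ?thesis by (simp add: mult.commute)
  qed
  then show ?thesis by blast
qed

text \<open>A norm inequality passes to the limit when the functions converge in L2 and their
  transforms converge pointwise: the triangle inequality bounds the norms of \<open>fn n\<close>,
  and Fatou's lemma gives the bound for the limit.\<close>

lemma real_hankel_contraction_limit:
  fixes f :: "real \<Rightarrow> real" and fn :: "nat \<Rightarrow> real \<Rightarrow> real"
  assumes nu: "\<nu> > 0"
    and f: "f \<in> borel_measurable borel" "integrable lborel (\<lambda>r. (f r)\<^sup>2)"
    and fn: "\<And>n. fn n \<in> borel_measurable borel" "\<And>n. integrable lborel (\<lambda>r. (fn n r)\<^sup>2)"
    and Hn: "\<And>n. integrable lborel (\<lambda>r. (real_hankel \<nu> (fn n) r)\<^sup>2)"
      "\<And>n. (LINT r|lborel. (real_hankel \<nu> (fn n) r)\<^sup>2) \<le> (LINT r|lborel. (fn n r)\<^sup>2)"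
    and lim: "(\<lambda>n. LINT r|lborel. (fn n r - f r)\<^sup>2) \<longlonglongrightarrow> 0"
    and ptw: "\<And>k. (\<lambda>n. real_hankel \<nu> (fn n) k) \<longlonglongrightarrow> real_hankel \<nu> f k"
  shows "integrable lborel (\<lambda>r. (real_hankel \<nu> f r)\<^sup>2)" "(LINT r|lborel. (real_hankel \<nu> f r)\<^sup>2) \<le> (LINT r|lborel. (f r)\<^sup>2)"
proof -
  let ?c = "\<lambda>n. (sqrt (LINT r|lborel. (fn n r - f r)\<^sup>2) + sqrt (LINT r|lborel. (f r)\<^sup>2))\<^sup>2"
  have "?c \<longlonglongrightarrow> (sqrt 0 + sqrt (LINT r|lborel. (f r)\<^sup>2))\<^sup>2"
    by (intro tendsto_intros lim)
  then have c: "?c \<longlonglongrightarrow> (LINT r|lborel. (f r)\<^sup>2)" by simp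
  have bd: "(LINT r|lborel. (real_hankel \<nu> (fn n) r)\<^sup>2) \<le> ?c n" for n
  proof (rule order_trans[OF Hn(2)])
    have d: "(\<lambda>r. fn n r - f r) \<in> borel_measurable lborel" "integrable lborel (\<lambda>r. (fn n r - f r)\<^sup>2)"
      using integrable_square_lincomb(1)[of "fn n" lborel f 1] fn f by auto
    have "sqrt (LINT r|lborel. (fn n r)\<^sup>2) \<le> sqrt (LINT r|lborel. (fn n r - f r)\<^sup>2) + sqrt (LINT r|lborel. (f r)\<^sup>2)"
      using integral_square_triangle[OF d(1) _ d(2) f(2)] f by simp
    from power_mono[OF this, of 2] show "(LINT r|lborel. (fn n r)\<^sup>2) \<le> ?c n" by simp
  qed
  have m: "real_hankel \<nu> f \<in> borel_measurable lborel" "\<And>n. real_hankel \<nu> (fn n) \<in> borel_measurable lborel"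
    using borel_measurable_real_hankel[OF nu] f fn by auto
  show "integrable lborel (\<lambda>r. (real_hankel \<nu> f r)\<^sup>2)" "(LINT r|lborel. (real_hankel \<nu> f r)\<^sup>2) \<le> (LINT r|lborel. (f r)\<^sup>2)"
    using fatou_square[OF m Hn(1) _ bd c] ptw by auto
qed

lemma bump_square_integrable:
  assumes "bump a b w"
  shows "integrable lborel w" "integrable lborel (\<lambda>x. (w x)\<^sup>2)"
proof -
  from bumpE[OF assms] obtain \<alpha> \<beta> where ab: "a < \<alpha>" "\<beta> < b" "\<And>x. x < \<alpha> \<or> \<beta> < x \<Longrightarrow> w x = 0" by metis
  have *: "integrable lborel v" if "smooth v" "\<And>x. x < \<alpha> \<or> \<beta> < x \<Longrightarrow> v x = 0" for v
  proof -
    have "integrable lborel (\<lambda>x. indicator {\<alpha>..\<beta>} x *\<^sub>R v x)"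
      by (rule borel_integrable_compact) (auto intro: smooth_continuous_on that)
    also have "(\<lambda>x. indicator {\<alpha>..\<beta>} x *\<^sub>R v x) = v"
    proof
      fix x show "indicator {\<alpha>..\<beta>} x *\<^sub>R v x = v x"
        using that(2)[of x] by (cases "x < \<alpha> \<or> \<beta> < x") auto
    qed
    finally show ?thesis .
  qed
  show "integrable lborel w" using * bump_smooth[OF assms] ab(3) by blast
  have "smooth (\<lambda>x. (w x)\<^sup>2)" unfolding power2_eq_square by (intro smooth_mult bump_smooth[OF assms])
  then show "integrable lborel (\<lambda>x. (w x)\<^sup>2)" using *[of "\<lambda>x. (w x)\<^sup>2"] ab(3) by simp
qed

text \<open>The Gaussian sums of \<open>bump_gaussian_sum_approx\<close> approximate f with an error
  dominated by a small multiple of one fixed Gaussian. This single bound gives both convergence in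
  L2 and, through L1, pointwise convergence of the transforms.\<close>

lemma real_hankel_contraction_bump:
  assumes nu: "\<nu> > 0" and f: "bump 0 b f"
  shows "integrable lborel (\<lambda>r. (real_hankel \<nu> f r)\<^sup>2)" "(LINT r|lborel. (real_hankel \<nu> f r)\<^sup>2) \<le> (LINT r|lborel. (f r)\<^sup>2)"
proof -
  obtain C where C: "C > 0" "\<And>k r. \<bar>hankel_kernel \<nu> k r\<bar> \<le> C" using hankel_kernel_bounded[OF nu] by metis
  have "\<forall>n. \<exists>a N. \<forall>r. \<bar>f r - gaussian_sum \<nu> a N r\<bar> \<le> (1 / real (Suc n)) * gaussian \<nu> 1 r"
    by (intro allI bump_gaussian_sum_approx[OF f nu]) simp
  then obtain a N where aN: "\<And>n r. \<bar>f r - gaussian_sum \<nu> (a n) (N n) r\<bar> \<le> (1 / real (Suc n)) * gaussian \<nu> 1 r" by metis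
  let ?G = "\<lambda>n. gaussian_sum \<nu> (a n) (N n)"
  have e0: "(\<lambda>n. 1 / real (Suc n)) \<longlonglongrightarrow> 0"
    using LIMSEQ_inverse_real_of_nat by (simp add: inverse_eq_divide)
  have fm: "f \<in> borel_measurable borel" by (rule smooth_borel[OF bump_smooth[OF f]])
  note fi = bump_square_integrable[OF f]
  note gi = gaussian_sum_isometry[OF nu]
  have g1: "integrable lborel (\<lambda>r. (gaussian \<nu> 1 r)\<^sup>2)"
    using gaussian_inner[OF nu, of 1 1] by (simp add: has_bochner_integral_iff power2_eq_square)
  have lim: "(\<lambda>n. LINT r|lborel. (?G n r - f r)\<^sup>2) \<longlonglongrightarrow> 0"
  proof (rule tendsto_sandwich[OF always_eventually always_eventually tendsto_const])
    show "\<forall>n. 0 \<le> (LINT r|lborel. (?G n r - f r)\<^sup>2)" by simp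
    show "\<forall>n. (LINT r|lborel. (?G n r - f r)\<^sup>2) \<le> (1 / real (Suc n))\<^sup>2 * (LINT r|lborel. (gaussian \<nu> 1 r)\<^sup>2)"
    proof
      fix n
      have "(LINT r|lborel. (?G n r - f r)\<^sup>2) \<le> (LINT r|lborel. (1 / real (Suc n))\<^sup>2 * (gaussian \<nu> 1 r)\<^sup>2)"
      proof (rule integral_mono)
        show "integrable lborel (\<lambda>r. (?G n r - f r)\<^sup>2)"
          using integrable_square_lincomb(1)[of "?G n" lborel f 1] fm fi gi by simp
        show "integrable lborel (\<lambda>r. (1 / real (Suc n))\<^sup>2 * (gaussian \<nu> 1 r)\<^sup>2)" using g1 by simp
        show "(?G n r - f r)\<^sup>2 \<le> (1 / real (Suc n))\<^sup>2 * (gaussian \<nu> 1 r)\<^sup>2" for r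
          using power_mono[OF aN[of r n], of 2] unfolding power_mult_distrib
          by (simp add: power2_commute)
      qed
      then show "(LINT r|lborel. (?G n r - f r)\<^sup>2) \<le> (1 / real (Suc n))\<^sup>2 * (LINT r|lborel. (gaussian \<nu> 1 r)\<^sup>2)" by simp
    qed
    show "(\<lambda>n. (1 / real (Suc n))\<^sup>2 * (LINT r|lborel. (gaussian \<nu> 1 r)\<^sup>2)) \<longlonglongrightarrow> 0"
      using tendsto_mult[OF tendsto_power[OF e0, of 2] tendsto_const, of "LINT r|lborel. (gaussian \<nu> 1 r)\<^sup>2"] by simp
  qed
  have ptw: "(\<lambda>n. real_hankel \<nu> (?G n) k) \<longlonglongrightarrow> real_hankel \<nu> f k" for k
  proof (rule LIM_zero_cancel, rule Lim_null_comparison)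
    show "(\<lambda>n. C * ((1 / real (Suc n)) * (LINT r|lborel. gaussian \<nu> 1 r))) \<longlonglongrightarrow> 0"
      by (rule tendsto_mult_right_zero, rule tendsto_mult_left_zero, rule e0)
    show "\<forall>\<^sub>F n in sequentially. norm (real_hankel \<nu> (?G n) k - real_hankel \<nu> f k) \<le> C * ((1 / real (Suc n)) * (LINT r|lborel. gaussian \<nu> 1 r))"
    proof (rule always_eventually, rule allI)
      fix n
      have i: "integrable lborel (\<lambda>r. ?G n r - f r)" using fi integrable_gaussian_sum[OF nu] by simp
      have "norm (real_hankel \<nu> (?G n) k - real_hankel \<nu> f k) = \<bar>real_hankel \<nu> (\<lambda>r. ?G n r - f r) k\<bar>"
        using fi integrable_gaussian_sum[OF nu] by (simp add: real_hankel_diff nu)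
      also have "\<dots> \<le> C * (LINT r|lborel. \<bar>?G n r - f r\<bar>)" by (rule real_hankel_abs_le[OF nu i C(2)])
      also have "(LINT r|lborel. \<bar>?G n r - f r\<bar>) \<le> (LINT r|lborel. (1 / real (Suc n)) * gaussian \<nu> 1 r)"
      proof (rule integral_mono)
        show "integrable lborel (\<lambda>r. \<bar>?G n r - f r\<bar>)" using i by (rule integrable_abs)
        show "integrable lborel (\<lambda>r. (1 / real (Suc n)) * gaussian \<nu> 1 r)" using integrable_gaussian[OF nu] by simp
        show "\<bar>?G n r - f r\<bar> \<le> (1 / real (Suc n)) * gaussian \<nu> 1 r" for r
          using aN[of r n] by (simp only: abs_minus_commute)
      qed
      finally show "norm (real_hankel \<nu> (?G n) k - real_hankel \<nu> f k) \<le> C * ((1 / real (Suc n)) * (LINT r|lborel. gaussian \<nu> 1 r))"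
        using C(1) by (simp add: mult_left_mono)
    qed
  qed
  show "integrable lborel (\<lambda>r. (real_hankel \<nu> f r)\<^sup>2)" "(LINT r|lborel. (real_hankel \<nu> f r)\<^sup>2) \<le> (LINT r|lborel. (f r)\<^sup>2)"
    using real_hankel_contraction_limit[OF nu fm fi(2) _ gi(1) gi(2) _ lim ptw] gi(3) by auto
qed

text \<open>Cauchy-Schwarz against the indicator of the interval. Inside a fixed bounded interval L2
  convergence thus implies L1 convergence, and hence convergence of transforms at every
  point.\<close>

lemma integrable_of_square_bounded_support:
  fixes f :: "real \<Rightarrow> real"
  assumes f: "f \<in> borel_measurable borel" "integrable lborel (\<lambda>r. (f r)\<^sup>2)"
    and supp: "\<And>x. x \<notin> {a<..<b} \<Longrightarrow> f x = 0"
  shows "integrable lborel f" "(LINT r|lborel. \<bar>f r\<bar>)\<^sup>2 \<le> (LINT r|lborel. (f r)\<^sup>2) * \<bar>b - a\<bar>"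
proof -
  let ?i = "indicator {a<..<b} :: real \<Rightarrow> real"
  have im: "?i \<in> borel_measurable lborel" by simp
  have em: "emeasure lborel {a<..<b} < \<infinity>" by (rule emeasure_bounded_finite) simp
  have ii: "integrable lborel ?i" by (intro integrable_real_indicator em) simp
  have i2: "(\<lambda>x. (?i x)\<^sup>2) = ?i" by (auto simp: indicator_def)
  have fa: "(\<lambda>x. \<bar>f x\<bar>) \<in> borel_measurable lborel" using f(1) by measurable
  have fa2: "integrable lborel (\<lambda>x. \<bar>f x\<bar>\<^sup>2)" using f(2) by simp
  have ii2: "integrable lborel (\<lambda>x. (?i x)\<^sup>2)" unfolding i2 by (rule ii)
  have e: "(\<lambda>x. \<bar>f x\<bar> * ?i x) = (\<lambda>x. \<bar>f x\<bar>)" using supp by (force simp: indicator_def)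
  have A: "integrable lborel (\<lambda>x. \<bar>f x\<bar>)"
    using integrable_square_bound[OF fa im fa2 ii2] unfolding e .
  show "integrable lborel f"
  proof (rule integrable_norm_cancel)
    show "integrable lborel (\<lambda>x. norm (f x))" using A unfolding real_norm_def .
    show "f \<in> borel_measurable lborel" unfolding measurable_lborel2 by (rule f(1))
  qed
  have "(LINT r|lborel. ?i r) \<le> \<bar>b - a\<bar>" by (cases "a \<le> b") auto
  then have "(LINT r|lborel. (f r)\<^sup>2) * (LINT r|lborel. ?i r) \<le> (LINT r|lborel. (f r)\<^sup>2) * \<bar>b - a\<bar>"
    by (intro mult_left_mono) auto
  then show "(LINT r|lborel. \<bar>f r\<bar>)\<^sup>2 \<le> (LINT r|lborel. (f r)\<^sup>2) * \<bar>b - a\<bar>"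
    using Cauchy_Schwarz_integral[OF fa im fa2 ii2] unfolding e i2 by simp
qed

text \<open>Bounded support makes f integrable, so that its transform is given by an absolutely
  convergent integral. The bumps approximating f live in the same interval (0,b), which is what
  makes their transforms converge pointwise.\<close>

lemma real_hankel_contraction:
  assumes nu: "\<nu> > 0"
    and f: "f \<in> borel_measurable borel" "integrable lborel (\<lambda>r. (f r)\<^sup>2)"
    and supp: "\<And>x. x \<notin> {0<..<b} \<Longrightarrow> f x = 0"
  shows "integrable lborel (\<lambda>r. (real_hankel \<nu> f r)\<^sup>2)" "(LINT r|lborel. (real_hankel \<nu> f r)\<^sup>2) \<le> (LINT r|lborel. (f r)\<^sup>2)"
proof -
  obtain C where C: "C > 0" "\<And>k r. \<bar>hankel_kernel \<nu> k r\<bar> \<le> C" using hankel_kernel_bounded[OF nu] by metis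
  have "\<forall>n. \<exists>w. bump 0 b w \<and> (LINT r|lborel. (f r - w r)\<^sup>2) < 1 / real (Suc n)"
  proof
    fix n show "\<exists>w. bump 0 b w \<and> (LINT r|lborel. (f r - w r)\<^sup>2) < 1 / real (Suc n)"
      by (rule bump_approx_L2[OF f supp, where e = "1 / real (Suc n)"]) auto
  qed
  then obtain w where w: "\<And>n. bump 0 b (w n)" "\<And>n. (LINT r|lborel. (f r - w n r)\<^sup>2) < 1 / real (Suc n)" by metis
  have e0: "(\<lambda>n. 1 / real (Suc n)) \<longlonglongrightarrow> 0"
    using LIMSEQ_inverse_real_of_nat by (simp add: inverse_eq_divide)
  have wm: "w n \<in> borel_measurable borel" for n by (rule smooth_borel[OF bump_smooth[OF w(1)]])
  note wi = bump_square_integrable[OF w(1)]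
  have w2: "(LINT r|lborel. (w n r - f r)\<^sup>2) \<le> 1 / real (Suc n)" for n
    using w(2)[of n] by (simp only: power2_commute less_imp_le)
  have lim: "(\<lambda>n. LINT r|lborel. (w n r - f r)\<^sup>2) \<longlonglongrightarrow> 0"
    by (rule tendsto_sandwich[OF always_eventually always_eventually tendsto_const e0]) (use w2 in auto)
  note fi = integrable_of_square_bounded_support(1)[OF f supp]
  have ptw: "(\<lambda>n. real_hankel \<nu> (w n) k) \<longlonglongrightarrow> real_hankel \<nu> f k" for k
  proof (rule LIM_zero_cancel, rule Lim_null_comparison)
    show "(\<lambda>n. C * sqrt ((LINT r|lborel. (w n r - f r)\<^sup>2) * \<bar>b - 0\<bar>)) \<longlonglongrightarrow> 0"
    proof -
      have "(\<lambda>n. C * sqrt ((LINT r|lborel. (w n r - f r)\<^sup>2) * \<bar>b - 0\<bar>)) \<longlonglongrightarrow> C * sqrt (0 * \<bar>b - 0\<bar>)"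
        by (intro tendsto_intros lim)
      then show ?thesis by simp
    qed
    show "\<forall>\<^sub>F n in sequentially. norm (real_hankel \<nu> (w n) k - real_hankel \<nu> f k) \<le> C * sqrt ((LINT r|lborel. (w n r - f r)\<^sup>2) * \<bar>b - 0\<bar>)"
    proof (rule always_eventually, rule allI)
      fix n
      have i: "integrable lborel (\<lambda>r. w n r - f r)" using fi wi by simp
      have dm: "(\<lambda>r. w n r - f r) \<in> borel_measurable borel" using f wm by measurable
      have d2: "integrable lborel (\<lambda>r. (w n r - f r)\<^sup>2)"
        using integrable_square_lincomb(1)[of "w n" lborel f 1] f wm wi by simp
      have "norm (real_hankel \<nu> (w n) k - real_hankel \<nu> f k) = \<bar>real_hankel \<nu> (\<lambda>r. w n r - f r) k\<bar>"
        using fi wi by (simp add: real_hankel_diff nu)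
      also have "\<dots> \<le> C * (LINT r|lborel. \<bar>w n r - f r\<bar>)" by (rule real_hankel_abs_le[OF nu i C(2)])
      also have "\<dots> \<le> C * sqrt ((LINT r|lborel. (w n r - f r)\<^sup>2) * \<bar>b - 0\<bar>)"
        using C(1) integrable_of_square_bounded_support(2)[OF dm d2, of 0 b] supp bump_zero[OF w(1)]
        by (intro mult_left_mono real_le_rsqrt) auto
      finally show "norm (real_hankel \<nu> (w n) k - real_hankel \<nu> f k) \<le> C * sqrt ((LINT r|lborel. (w n r - f r)\<^sup>2) * \<bar>b - 0\<bar>)" .
    qed
  qed
  show "integrable lborel (\<lambda>r. (real_hankel \<nu> f r)\<^sup>2)" "(LINT r|lborel. (real_hankel \<nu> f r)\<^sup>2) \<le> (LINT r|lborel. (f r)\<^sup>2)"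
    using real_hankel_contraction_limit[OF nu f wm wi(2) real_hankel_contraction_bump[OF nu w(1)] lim ptw] by auto
qed

section \<open>Inversion of the transform on integrable functions\<close>

lemma integrable_mult_bounded:
  fixes u v :: "'a \<Rightarrow> real"
  assumes "integrable M v" "u \<in> borel_measurable M" "\<And>x. \<bar>u x\<bar> \<le> B"
  shows "integrable M (\<lambda>x. u x * v x)"
proof (rule Bochner_Integration.integrable_bound)
  show "integrable M (\<lambda>x. B * norm (v x))" using assms(1) by simp
  show "(\<lambda>x. u x * v x) \<in> borel_measurable M" using assms by measurable
  have "0 \<le> B" using assms(3) order_trans[OF abs_ge_zero] by blast
  then show "AE x in M. norm (u x * v x) \<le> norm (B * norm (v x))"
    using assms(3) by (auto simp: abs_mult intro!: mult_right_mono)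
qed

lemma bump_bounded:
  assumes "bump a b w"
  obtains B where "\<And>x. \<bar>w x\<bar> \<le> B"
proof -
  from bumpE[OF assms] obtain \<alpha> \<beta> where ab: "a < \<alpha>" "\<beta> < b" "\<And>x. x < \<alpha> \<or> \<beta> < x \<Longrightarrow> w x = 0" by metis
  have "bounded (w ` {\<alpha>..\<beta>})"
    by (intro compact_imp_bounded compact_continuous_image smooth_continuous_on bump_smooth[OF assms]) simp
  then obtain B where B: "B > 0" "\<And>x. x \<in> {\<alpha>..\<beta>} \<Longrightarrow> \<bar>w x\<bar> \<le> B" by (auto simp: bounded_pos)
  show ?thesis
  proof (rule that)
    fix x show "\<bar>w x\<bar> \<le> B"
      using B(1) B(2)[of x] ab(3)[of x] by (cases "x < \<alpha> \<or> \<beta> < x") auto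
  qed
qed

text \<open>A Gaussian is the transform of an integrable function, namely of its own transform, and
  transforms of integrable functions are bounded.\<close>

lemma gaussian_bounded:
  assumes nu: "\<nu> > 0" and t: "t > 0"
  obtains B where "\<And>r. \<bar>gaussian \<nu> t r\<bar> \<le> B"
proof -
  obtain C where C: "C > 0" "\<And>k r. \<bar>hankel_kernel \<nu> k r\<bar> \<le> C" using hankel_kernel_bounded[OF nu] by metis
  have "integrable lborel (real_hankel \<nu> (gaussian \<nu> t))"
    using integrable_gaussian[OF nu, of "1 / t"] t by (simp add: real_hankel_gaussian[OF nu t, THEN ext])
  from real_hankel_abs_le[OF nu this C(2), unfolded real_hankel_real_hankel_gaussian[OF nu t]] show ?thesis by (rule that)
qed

text \<open>Integrals against Gaussians determine those against bumps, because the Weierstrass error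
  is dominated by a small multiple of \<open>gaussian \<nu> 1\<close>. Bumps converging to the sign
  of w then show that |w| has integral 0 over (0,b). The hypothesis \<open>wint\<close> admits a sum
  of a bounded and an integrable function, the form in which it is applied.\<close>

lemma gaussian_orthogonal_imp_zero:
  fixes w :: "real \<Rightarrow> real"
  assumes nu: "\<nu> > 0"
    and wm: "w \<in> borel_measurable borel"
    and wint: "\<And>v B. integrable lborel v \<Longrightarrow> (\<And>x. \<bar>v x\<bar> \<le> B) \<Longrightarrow> integrable lborel (\<lambda>x. w x * v x)"
    and orth: "\<And>i. (LINT x|lborel. w x * gaussian \<nu> (real (Suc i)) x) = 0"
  shows "AE x in lborel. x > 0 \<longrightarrow> w x = 0"
proof -
  have wg: "integrable lborel (\<lambda>x. w x * gaussian \<nu> (real (Suc i)) x)" for i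
  proof -
    obtain B where "\<And>r. \<bar>gaussian \<nu> (real (Suc i)) r\<bar> \<le> B" using gaussian_bounded[OF nu, of "real (Suc i)"] by auto
    then show ?thesis by (intro wint integrable_gaussian[OF nu]) auto
  qed
  have wg1: "integrable lborel (\<lambda>x. w x * gaussian \<nu> 1 x)" using wg[of 0] by simp
  have wsum: "integrable lborel (\<lambda>x. w x * gaussian_sum \<nu> a N x)" "(LINT x|lborel. w x * gaussian_sum \<nu> a N x) = 0" for a N
  proof -
    have e: "w x * gaussian_sum \<nu> a N x = (\<Sum>i\<le>N. a i * (w x * gaussian \<nu> (real (Suc i)) x))" for x
      by (simp add: gaussian_sum_def sum_distrib_left mult_ac)
    show "integrable lborel (\<lambda>x. w x * gaussian_sum \<nu> a N x)"
      unfolding e by (intro Bochner_Integration.integrable_sum integrable_mult_right wg)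
    show "(LINT x|lborel. w x * gaussian_sum \<nu> a N x) = 0"
      unfolding e by (subst Bochner_Integration.integral_sum) (auto intro!: integrable_mult_right wg sum.neutral simp del: of_nat_Suc simp: orth)
  qed
  have wb: "integrable lborel (\<lambda>x. w x * v x)" if "bump 0 b v" for b v
    by (rule bump_bounded[OF that], rule wint[OF bump_square_integrable(1)[OF that]])
  have zero: "(LINT x|lborel. w x * v x) = 0" if v: "bump 0 b v" for b v
  proof -
    let ?K = "LINT x|lborel. \<bar>w x * gaussian \<nu> 1 x\<bar>"
    have K: "\<bar>LINT x|lborel. w x * v x\<bar> \<le> e * ?K" if e: "e > 0" for e
    proof -
      from bump_gaussian_sum_approx[OF v nu e] obtain a N where aN: "\<And>r. \<bar>v r - gaussian_sum \<nu> a N r\<bar> \<le> e * gaussian \<nu> 1 r" by blast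
      have i: "integrable lborel (\<lambda>x. w x * v x - w x * gaussian_sum \<nu> a N x)" using wb[OF v] wsum by simp
      have "(LINT x|lborel. w x * v x) = (LINT x|lborel. w x * v x - w x * gaussian_sum \<nu> a N x)"
        using wb[OF v] wsum by simp
      also have "\<bar>\<dots>\<bar> \<le> (LINT x|lborel. \<bar>w x * v x - w x * gaussian_sum \<nu> a N x\<bar>)" by (rule integral_abs_bound)
      also have "\<dots> \<le> (LINT x|lborel. e * \<bar>w x * gaussian \<nu> 1 x\<bar>)"
      proof (rule integral_mono)
        show "integrable lborel (\<lambda>x. \<bar>w x * v x - w x * gaussian_sum \<nu> a N x\<bar>)" using i by (rule integrable_abs)
        show "integrable lborel (\<lambda>x. e * \<bar>w x * gaussian \<nu> 1 x\<bar>)" using wg1 by simp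
        fix x
        have "\<bar>w x * v x - w x * gaussian_sum \<nu> a N x\<bar> = \<bar>w x\<bar> * \<bar>v x - gaussian_sum \<nu> a N x\<bar>"
          unfolding abs_mult[symmetric] by (simp add: algebra_simps)
        also have "\<dots> \<le> \<bar>w x\<bar> * (e * gaussian \<nu> 1 x)" by (intro mult_left_mono aN) simp
        finally show "\<bar>w x * v x - w x * gaussian_sum \<nu> a N x\<bar> \<le> e * \<bar>w x * gaussian \<nu> 1 x\<bar>"
          by (simp add: abs_mult gaussian_nonneg mult_ac)
      qed
      finally show ?thesis by simp
    qed
    have "?K \<ge> 0" by simp
    then have K1: "?K + 1 > 0" by linarith
    have "\<bar>LINT x|lborel. w x * v x\<bar> \<le> 0"
    proof (rule field_le_epsilon)
      fix e :: real assume "e > 0"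
      then have "e / (?K + 1) > 0" using K1 by (rule divide_pos_pos)
      from K[OF this] have "\<bar>LINT x|lborel. w x * v x\<bar> \<le> e / (?K + 1) * ?K" .
      also have "\<dots> \<le> e" using \<open>e > 0\<close> K1 by (simp add: pos_divide_le_eq mult.commute)
      finally show "\<bar>LINT x|lborel. w x * v x\<bar> \<le> 0 + e" by simp
    qed
    then show ?thesis by simp
  qed
  have "AE x in lborel. \<bar>w x\<bar> * indicator {0<..<b} x = 0" for b :: real
  proof -
    have sm: "(\<lambda>x. sgn (w x)) \<in> borel_measurable borel" using wm by measurable
    have "\<bar>sgn (w x)\<bar> \<le> 1" for x by (simp add: sgn_if)
    from bump_approx_bounded[OF sm this, of 0 b] obtain r where r: "\<forall>n. bump 0 b (r n)" "\<forall>n x. \<bar>r n x\<bar> \<le> 1 + 1"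
      "AE x in lborel. 0 < x \<and> x < b \<longrightarrow> (\<lambda>n. r n x) \<longlonglongrightarrow> sgn (w x)" by blast
    have rm: "r n \<in> borel_measurable borel" for n by (rule smooth_borel[OF bump_smooth[OF spec[OF r(1)]]])
    have iint: "integrable lborel (\<lambda>x. w x * indicator {0<..<b} x)"
    proof (rule wint[where B = 1])
      have em: "emeasure lborel {0<..<b} < \<infinity>" by (rule emeasure_bounded_finite) simp
      show "integrable lborel (indicator {0<..<b} :: real \<Rightarrow> real)" by (intro integrable_real_indicator em) simp
    qed (simp add: indicator_def)
    have dint: "integrable lborel (\<lambda>x. 2 * \<bar>w x * indicator {0<..<b} x\<bar>)" using iint by simp
    have "(\<lambda>n. LINT x|lborel. w x * r n x) \<longlonglongrightarrow> (LINT x|lborel. \<bar>w x\<bar> * indicator {0<..<b} x)"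
    proof (rule integral_dominated_convergence[OF _ _ dint])
      show "AE x in lborel. (\<lambda>n. w x * r n x) \<longlonglongrightarrow> \<bar>w x\<bar> * indicator {0<..<b} x"
        using r(3)
      proof (rule AE_mp, intro AE_I2 impI)
        fix x assume x: "0 < x \<and> x < b \<longrightarrow> (\<lambda>n. r n x) \<longlonglongrightarrow> sgn (w x)"
        show "(\<lambda>n. w x * r n x) \<longlonglongrightarrow> \<bar>w x\<bar> * indicator {0<..<b} x"
        proof (cases "x \<in> {0<..<b}")
          case True
          then have "(\<lambda>n. w x * r n x) \<longlonglongrightarrow> w x * sgn (w x)" using x by (intro tendsto_intros) auto
          then show ?thesis using True by (simp add: abs_sgn)
        next
          case False
          then show ?thesis using bump_zero[OF spec[OF r(1)] False] by simp
        qed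
      qed
      show "AE x in lborel. norm (w x * r n x) \<le> 2 * \<bar>w x * indicator {0<..<b} x\<bar>" for n
      proof (rule AE_I2)
        fix x
        show "norm (w x * r n x) \<le> 2 * \<bar>w x * indicator {0<..<b} x\<bar>"
        proof (cases "x \<in> {0<..<b}")
          case True
          have "\<bar>r n x\<bar> \<le> 2" using r(2) by simp
          from mult_left_mono[OF this abs_ge_zero[of "w x"]] True show ?thesis by (simp add: abs_mult)
        next
          case False
          then show ?thesis using bump_zero[OF spec[OF r(1)] False] by simp
        qed
      qed
      show "(\<lambda>x. w x * r n x) \<in> borel_measurable lborel" for n
        unfolding measurable_lborel2 by (intro borel_measurable_times wm rm)
      show "(\<lambda>x. \<bar>w x\<bar> * indicator {0<..<b} x) \<in> borel_measurable lborel"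
        unfolding measurable_lborel2 by (intro borel_measurable_times borel_measurable_abs wm) simp
    qed
    moreover have "(LINT x|lborel. w x * r n x) = 0" for n by (rule zero[OF spec[OF r(1)]])
    ultimately have "(\<lambda>n. 0 :: real) \<longlonglongrightarrow> (LINT x|lborel. \<bar>w x\<bar> * indicator {0<..<b} x)"
      by (simp only:)
    then have "(LINT x|lborel. \<bar>w x\<bar> * indicator {0<..<b} x) = 0"
      by (simp add: LIMSEQ_const_iff)
    moreover have "integrable lborel (\<lambda>x. \<bar>w x\<bar> * indicator {0<..<b} x)"
      using integrable_abs[OF iint] by (simp add: abs_mult)
    ultimately show ?thesis
      by (subst (asm) integral_nonneg_eq_0_iff_AE) auto
  qed
  then have "AE x in lborel. \<forall>n::nat. \<bar>w x\<bar> * indicator {0<..<real n} x = 0"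
    by (subst AE_all_countable) blast
  then show ?thesis
  proof (rule AE_mp, intro AE_I2 impI)
    fix x :: real assume x: "\<forall>n::nat. \<bar>w x\<bar> * indicator {0<..<real n} x = 0" "x > 0"
    obtain n where "x < real n" using reals_Archimedean2 by blast
    then show "w x = 0" using spec[OF x(1), of n] x(2) by simp
  qed
qed

text \<open>The difference of H H f and f is tested against Gaussians:
  \<open>real_hankel_swap\<close> moves both transforms onto the Gaussian, which the double
  transform reproduces. A priori H H f is merely bounded, so the difference is a bounded function
  minus an integrable one.\<close>

lemma real_hankel_inversion:
  assumes nu: "\<nu> > 0" and f: "integrable lborel f" and f0: "\<And>r. r \<le> 0 \<Longrightarrow> f r = 0"
    and h: "integrable lborel (real_hankel \<nu> f)"
  shows "AE x in lborel. real_hankel \<nu> (real_hankel \<nu> f) x = f x"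
proof -
  obtain C where C: "C > 0" "\<And>k r. \<bar>hankel_kernel \<nu> k r\<bar> \<le> C" using hankel_kernel_bounded[OF nu] by metis
  define w where "w = (\<lambda>x. real_hankel \<nu> (real_hankel \<nu> f) x - f x)"
  have fm: "f \<in> borel_measurable borel" using f by auto
  have HHm: "real_hankel \<nu> (real_hankel \<nu> f) \<in> borel_measurable borel" by (intro borel_measurable_real_hankel nu fm)
  have i1: "integrable lborel (\<lambda>x. real_hankel \<nu> (real_hankel \<nu> f) x * v x)" if "integrable lborel v" for v
    using integrable_mult_bounded[OF that _ real_hankel_abs_le[OF nu h C(2)]] HHm by simp
  have i2: "integrable lborel (\<lambda>x. f x * v x)" if "integrable lborel v" "\<And>x. \<bar>v x\<bar> \<le> B" for v B
    using integrable_mult_bounded[OF f _ that(2)] that(1) by (simp add: mult.commute)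
  have "AE x in lborel. x > 0 \<longrightarrow> w x = 0"
  proof (rule gaussian_orthogonal_imp_zero[OF nu])
    show "w \<in> borel_measurable borel" unfolding w_def using HHm fm by (intro borel_measurable_diff)
    show "integrable lborel (\<lambda>x. w x * v x)" if "integrable lborel v" "\<And>x. \<bar>v x\<bar> \<le> B" for v B
      unfolding w_def left_diff_distrib by (rule Bochner_Integration.integrable_diff[OF i1[OF that(1)] i2[OF that]])
    fix i
    define t where "t = real (Suc i)"
    have t: "t > 0" by (simp add: t_def)
    let ?g = "gaussian \<nu> t"
    have gi: "integrable lborel ?g" by (rule integrable_gaussian[OF nu t])
    have Hg: "integrable lborel (real_hankel \<nu> ?g)"
      using integrable_gaussian[OF nu, of "1 / t"] t by (simp add: real_hankel_gaussian[OF nu t, THEN ext])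
    obtain B where B: "\<And>r. \<bar>?g r\<bar> \<le> B" using gaussian_bounded[OF nu t] by auto
    have "(LINT x|lborel. real_hankel \<nu> (real_hankel \<nu> f) x * ?g x) = (LINT x|lborel. real_hankel \<nu> f x * real_hankel \<nu> ?g x)"
      by (rule real_hankel_swap[OF nu h gi])
    also have "\<dots> = (LINT x|lborel. f x * real_hankel \<nu> (real_hankel \<nu> ?g) x)"
      by (rule real_hankel_swap[OF nu f Hg])
    also have "\<dots> = (LINT x|lborel. f x * ?g x)" by (simp add: real_hankel_real_hankel_gaussian[OF nu t])
    finally have "(LINT x|lborel. w x * ?g x) = 0"
      unfolding w_def left_diff_distrib
      by (simp add: Bochner_Integration.integral_diff[OF i1[OF gi] i2[OF gi B]])
    then show "(LINT x|lborel. w x * gaussian \<nu> (real (Suc i)) x) = 0" by (simp add: t_def)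
  qed
  then show ?thesis
  proof (rule AE_mp, intro AE_I2 impI)
    fix x assume x: "x > 0 \<longrightarrow> w x = 0"
    show "real_hankel \<nu> (real_hankel \<nu> f) x = f x"
    proof (cases "x > 0")
      case True
      then show ?thesis using x by (simp add: w_def)
    next
      case False
      then show ?thesis using f0 by (simp add: real_hankel_nonpos)
    qed
  qed
qed

section \<open>The Hankel transform as a weighted primitive\<close>

text \<open>Along a subsequence with \<open>\<parallel>D\<^sub>k\<parallel>\<^sup>2 \<le> 8\<^sup>-\<^sup>k\<close> for the differences, the sum of the \<open>2\<^sup>k D\<^sub>k\<^sup>2\<close> is finite almost everywhere.\<close>

lemma L2_complete:
  fixes F :: "nat \<Rightarrow> 'a \<Rightarrow> real"
  assumes m: "\<And>n. F n \<in> borel_measurable M" and i: "\<And>n. integrable M (\<lambda>x. (F n x)\<^sup>2)"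
    and cauchy: "\<And>e. e > 0 \<Longrightarrow> \<exists>N. \<forall>m\<ge>N. \<forall>n\<ge>N. (LINT x|M. (F m x - F n x)\<^sup>2) < e"
  obtains G where "G \<in> borel_measurable M" "integrable M (\<lambda>x. (G x)\<^sup>2)"
    "(\<lambda>n. LINT x|M. (F n x - G x)\<^sup>2) \<longlonglongrightarrow> 0"
proof -
  note [measurable] = m
  have di: "integrable M (\<lambda>x. (F j x - F k x)\<^sup>2)" for j k
    using integrable_square_lincomb(1)[OF m m i i, of j 1 k] by simp
  have "\<forall>k. \<exists>N. \<forall>m\<ge>N. \<forall>n\<ge>N. (LINT x|M. (F m x - F n x)\<^sup>2) < (1/8) ^ k"
    by (intro allI cauchy) simp
  then obtain N where N: "\<And>k m n. m \<ge> N k \<Longrightarrow> n \<ge> N k \<Longrightarrow> (LINT x|M. (F m x - F n x)\<^sup>2) < (1/8) ^ k"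
    by metis
  \<comment> \<open>Summing the \<open>N j\<close> makes the indices monotone and at the same time
    at least \<open>N k\<close>.\<close>
  define n where "n = (\<lambda>k. \<Sum>j\<le>k. N j)"
  have nN: "N k \<le> n k" for k unfolding n_def by (rule member_le_sum) auto
  have nS: "n k \<le> n (Suc k)" for k by (simp add: n_def)
  have nmono: "n k \<le> n l" if "k \<le> l" for k l by (rule lift_Suc_mono_le[of n, OF nS that])
  define D where "D = (\<lambda>k x. F (n (Suc k)) x - F (n k) x)"
  have [measurable]: "D k \<in> borel_measurable M" for k unfolding D_def by measurable
  have Di: "integrable M (\<lambda>x. (D k x)\<^sup>2)" for k unfolding D_def by (rule di)
  have D8: "(LINT x|M. (D k x)\<^sup>2) \<le> (1/8) ^ k" for k
    unfolding D_def by (rule less_imp_le[OF N]) (use nN[of k] nS[of k] in auto)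
  have "(\<integral>\<^sup>+x. (\<Sum>k. ennreal (2 ^ k * (D k x)\<^sup>2)) \<partial>M) = (\<Sum>k. \<integral>\<^sup>+x. ennreal (2 ^ k * (D k x)\<^sup>2) \<partial>M)"
    by (rule nn_integral_suminf) simp
  also have "\<dots> \<le> (\<Sum>k. ennreal ((1/4) ^ k))"
  proof (intro suminf_le allI)
    fix k
    have "(\<integral>\<^sup>+x. ennreal (2 ^ k * (D k x)\<^sup>2) \<partial>M) = ennreal (LINT x|M. 2 ^ k * (D k x)\<^sup>2)"
      by (rule nn_integral_eq_integral) (use Di[of k] in auto)
    also have "\<dots> = ennreal (2 ^ k * (LINT x|M. (D k x)\<^sup>2))" by simp
    also have "2 ^ k * (LINT x|M. (D k x)\<^sup>2) \<le> 2 ^ k * (1/8) ^ k" by (intro mult_left_mono D8) simp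
    also have "(2::real) ^ k * (1/8) ^ k = (1/4) ^ k" unfolding power_mult_distrib[symmetric] by simp
    finally show "(\<integral>\<^sup>+x. ennreal (2 ^ k * (D k x)\<^sup>2) \<partial>M) \<le> ennreal ((1/4) ^ k)"
      by (simp add: ennreal_leI)
  qed auto
  also have "\<dots> < \<infinity>"
    by (subst suminf_ennreal2) (auto intro!: summable_geometric)
  finally have "AE x in M. (\<Sum>k. ennreal (2 ^ k * (D k x)\<^sup>2)) \<noteq> \<infinity>"
    by (intro nn_integral_PInf_AE) auto
  then have conv: "AE x in M. convergent (\<lambda>k. F (n k) x)"
  proof (rule AE_mp, intro AE_I2 impI)
    fix x assume "(\<Sum>k. ennreal (2 ^ k * (D k x)\<^sup>2)) \<noteq> \<infinity>"
    then have s: "summable (\<lambda>k. 2 ^ k * (D k x)\<^sup>2)"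
      by (intro summable_suminf_not_top) auto
    define S where "S = (\<Sum>k. 2 ^ k * (D k x)\<^sup>2)"
    \<comment> \<open>Each term of the convergent series is at most its sum S; the weight 2^k turns
      this into a geometric bound for the differences.\<close>
    have le: "\<bar>D k x\<bar> \<le> sqrt S * (sqrt (1/2)) ^ k" for k
    proof -
      have "(\<Sum>j\<in>{k}. 2 ^ j * (D j x)\<^sup>2) \<le> S" unfolding S_def by (rule sum_le_suminf[OF s]) auto
      then have "(D k x)\<^sup>2 \<le> S * (1/2) ^ k" by (simp add: field_simps)
      then have "sqrt ((D k x)\<^sup>2) \<le> sqrt (S * (1/2) ^ k)" by (rule real_sqrt_le_mono)
      then have "\<bar>D k x\<bar> \<le> sqrt (S * (1/2) ^ k)" by (simp only: real_sqrt_abs)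
      then show ?thesis by (simp only: real_sqrt_mult real_sqrt_power)
    qed
    have "summable (\<lambda>k. D k x)"
    proof (rule summable_comparison_test')
      show "summable (\<lambda>k. sqrt S * (sqrt (1/2)) ^ k)"
        by (intro summable_mult summable_geometric) (simp add: real_sqrt_lt_1_iff)
      show "norm (D k x) \<le> sqrt S * (sqrt (1/2)) ^ k" if "k \<ge> 0" for k using le[of k] by simp
    qed
    then have "convergent (\<lambda>l. \<Sum>k<l. D k x)" by (simp add: summable_iff_convergent)
    then have "convergent (\<lambda>l. F (n l) x - F (n 0) x)"
      unfolding D_def sum_lessThan_telescope[of "\<lambda>k. F (n k) x"] .
    then show "convergent (\<lambda>k. F (n k) x)" by (simp add: convergent_diff_const_right_iff)
  qed
  define G where "G = (\<lambda>x. lim (\<lambda>k. F (n k) x))"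
  have Gm[measurable]: "G \<in> borel_measurable M" unfolding G_def by (rule borel_measurable_lim_metric[OF m])
  have lim: "AE x in M. (\<lambda>k. F (n k) x) \<longlonglongrightarrow> G x"
    using conv by eventually_elim (simp add: G_def convergent_LIMSEQ_iff)
  have key: "integrable M (\<lambda>x. (F j x - G x)\<^sup>2)" "(LINT x|M. (F j x - G x)\<^sup>2) \<le> (1/8) ^ k" if "j \<ge> N k" for j k
  proof -
    have l: "AE x in M. (\<lambda>l. F j x - F (n (l + k)) x) \<longlonglongrightarrow> F j x - G x"
      using lim
    proof eventually_elim
      case (elim x)
      then show ?case by (intro tendsto_intros LIMSEQ_ignore_initial_segment)
    qed
    have b: "(LINT x|M. (F j x - F (n (l + k)) x)\<^sup>2) \<le> (1/8) ^ k" for l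
      by (rule less_imp_le[OF N[OF that]]) (use nN[of k] nmono[of k "l + k"] in auto)
    show "integrable M (\<lambda>x. (F j x - G x)\<^sup>2)" "(LINT x|M. (F j x - G x)\<^sup>2) \<le> (1/8) ^ k"
      using fatou_square[OF _ _ di l b tendsto_const] by auto
  qed
  show ?thesis
  proof (rule that[OF Gm])
    show "integrable M (\<lambda>x. (G x)\<^sup>2)"
      using integrable_square_lincomb(1)[OF m _ i key(1)[where j = "N 0" and k = 0, OF order_refl], of "N 0" 1] by simp
    show "(\<lambda>n. LINT x|M. (F n x - G x)\<^sup>2) \<longlonglongrightarrow> 0"
    proof (rule LIMSEQ_I)
      fix e :: real assume "e > 0"
      then obtain k where k: "(1/8 :: real) ^ k < e" using real_arch_pow_inv[of e "1/8"] by auto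
      have "norm ((LINT x|M. (F j x - G x)\<^sup>2) - 0) < e" if "j \<ge> N k" for j
        using key(2)[OF that] k by simp
      then show "\<exists>n0. \<forall>n\<ge>n0. norm ((LINT x|M. (F n x - G x)\<^sup>2) - 0) < e" by blast
    qed
  qed
qed

text \<open>With s = \<nu> + 1/2 and K_\<nu> the kernel of order \<nu>, the derivative of t^(-s)
  K_\<nu>(t r) is -r t^(-s) K_(\<nu>+1)(r t), because the weight cancels the term with s/t.
  Integrated over [x,y] this is itself a transform of order \<nu> + 1, so that symmetry can later
  move that transform onto r f.\<close>

lemma hankel_kernel_weighted_primitive:
  assumes nu: "\<nu> > 0" and xy: "0 < x" "x \<le> y" and r: "r > 0"
  shows "y powr (- (\<nu> + 1/2)) * hankel_kernel \<nu> y r - x powr (- (\<nu> + 1/2)) * hankel_kernel \<nu> x r =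
    r * real_hankel (\<nu> + 1) (\<lambda>t. indicator {x..y} t * - (t powr (- (\<nu> + 1/2)))) r"
proof -
  define s where "s = \<nu> + 1/2"
  have "(LINT t|lborel. (t powr (- s) * - (r * hankel_kernel (\<nu> + 1) r t)) * indicator {x..y} t) = y powr (- s) * hankel_kernel \<nu> y r - x powr (- s) * hankel_kernel \<nu> x r"
  proof (rule integral_FTC_Icc_real[OF xy(2)])
    fix t assume "x \<le> t" "t \<le> y"
    then have t: "t > 0" using xy by simp
    have tr: "t * r > 0" using t r by simp
    have "((\<lambda>t. t powr (- s) * bessel_kernel \<nu> (t * r)) has_real_derivative
        (- s * t powr (- s - 1)) * bessel_kernel \<nu> (t * r) + ((s / (t * r) * bessel_kernel \<nu> (t * r) - bessel_kernel (\<nu> + 1) (t * r)) * r) * t powr (- s)) (at t)"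
    proof (rule DERIV_mult)
      show "((\<lambda>t. t powr (- s)) has_real_derivative (- s * t powr (- s - 1))) (at t)"
        using t by (auto intro!: derivative_eq_intros)
      show "((\<lambda>t. bessel_kernel \<nu> (t * r)) has_real_derivative ((s / (t * r) * bessel_kernel \<nu> (t * r) - bessel_kernel (\<nu> + 1) (t * r)) * r)) (at t)"
        using has_real_derivative_bessel_kernel[OF tr nu] unfolding s_def
        by (rule DERIV_chain2) (auto intro!: derivative_eq_intros)
    qed
    also have "(- s * t powr (- s - 1)) * bessel_kernel \<nu> (t * r) + ((s / (t * r) * bessel_kernel \<nu> (t * r) - bessel_kernel (\<nu> + 1) (t * r)) * r) * t powr (- s)
        = t powr (- s) * - (r * bessel_kernel (\<nu> + 1) (r * t))"
      using t r powr_diff[of t "- s" 1] by (simp add: field_simps)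
    finally have d: "((\<lambda>t. t powr (- s) * bessel_kernel \<nu> (t * r)) has_real_derivative t powr (- s) * - (r * bessel_kernel (\<nu> + 1) (r * t))) (at t)" .
    have ev: "\<forall>\<^sub>F t in nhds t. t powr (- s) * hankel_kernel \<nu> t r = t powr (- s) * bessel_kernel \<nu> (t * r)"
      using eventually_nhds_in_open[of "{0<..}" t] t r by (auto elim!: eventually_mono simp: hankel_kernel_def)
    show "((\<lambda>t. t powr (- s) * hankel_kernel \<nu> t r) has_real_derivative t powr (- s) * - (r * hankel_kernel (\<nu> + 1) r t)) (at t)"
      using d t r by (subst DERIV_cong_ev[OF refl ev refl]) (simp add: hankel_kernel_def)
    have ev2: "\<forall>\<^sub>F t in nhds t. t powr (- s) * - (r * hankel_kernel (\<nu> + 1) r t) = t powr (- s) * - (r * bessel_kernel (\<nu> + 1) (r * t))"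
      using eventually_nhds_in_open[of "{0<..}" t] t r by (auto elim!: eventually_mono simp: hankel_kernel_def)
    have "isCont (\<lambda>t. bessel_kernel (\<nu> + 1) (r * t)) t"
    proof (rule isCont_o2[where f = "\<lambda>t. r * t"])
      show "isCont (bessel_kernel (\<nu> + 1)) (r * t)"
        using has_real_derivative_bessel_kernel[of "r * t" "\<nu> + 1"] t r nu by (auto intro: DERIV_isCont)
    qed (auto intro!: continuous_intros)
    then have "isCont (\<lambda>t. t powr (- s) * - (r * bessel_kernel (\<nu> + 1) (r * t))) t"
      using t by (intro continuous_intros) auto
    then show "isCont (\<lambda>t. t powr (- s) * - (r * hankel_kernel (\<nu> + 1) r t)) t"
      by (subst isCont_cong[OF ev2])
  qed
  moreover have "(LINT t|lborel. (t powr (- s) * - (r * hankel_kernel (\<nu> + 1) r t)) * indicator {x..y} t)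
     = r * (LINT t|lborel. (indicator {x..y} t * - (t powr (- s))) * hankel_kernel (\<nu> + 1) r t)"
    by (subst Bochner_Integration.integral_mult_right_zero[symmetric]) (simp add: mult_ac)
  ultimately show ?thesis unfolding real_hankel_def s_def by (simp only:)
qed

lemma integrable_powr_Icc:
  assumes "0 < x" shows "integrable lborel (\<lambda>t. indicator {x..y} t * (t powr p :: real))"
proof -
  have "integrable lborel (\<lambda>t. indicator {x..y} t *\<^sub>R (t powr p))"
    by (rule borel_integrable_compact) (use assms in \<open>auto intro!: continuous_intros\<close>)
  then show ?thesis by simp
qed

lemma square_indicator_powr: "(indicator {x..y} t * (t powr p :: real))\<^sup>2 = indicator {x..y} t * (t powr (2 * p))"
proof -
  have "(t powr p)\<^sup>2 = t powr (2 * p)" by (simp add: power2_eq_square powr_add[symmetric])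
  then show ?thesis by (simp add: indicator_def)
qed

text \<open>Integrated form of the ladder identity: F stands for -H_(\<nu>+1)(r f), and the last
  clause says that r^(-s) H_\<nu> f is a primitive of r^(-s) F. As r f is only square-integrable, F
  is obtained as an L2 limit of transforms of truncations, the contraction property providing the
  Cauchy condition.\<close>

lemma real_hankel_weighted_primitive:
  assumes nu: "\<nu> > 0" and f: "integrable lborel f" and f0: "\<And>r. r \<le> 0 \<Longrightarrow> f r = 0"
    and rf: "integrable lborel (\<lambda>r. (r * f r)\<^sup>2)"
  obtains F where "F \<in> borel_measurable borel" "integrable lborel (\<lambda>t. (F t)\<^sup>2)"
    "(LINT t|lborel. (F t)\<^sup>2) \<le> (LINT r|lborel. (r * f r)\<^sup>2)"
    "\<And>x y. 0 < x \<Longrightarrow> x \<le> y \<Longrightarrow> y powr (- (\<nu> + 1/2)) * real_hankel \<nu> f y - x powr (- (\<nu> + 1/2)) * real_hankel \<nu> f x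
       = (LINT t|lborel. (indicator {x..y} t * t powr (- (\<nu> + 1/2))) * F t)"
proof -
  define s where "s = \<nu> + 1/2"
  have nu1: "\<nu> + 1 > 0" using nu by simp
  have fm: "f \<in> borel_measurable borel" using f by auto
  \<comment> \<open>Truncation to (0,n) makes r f integrable with bounded support, the setting of
    \<open>real_hankel_contraction\<close>.\<close>
  define fn where "fn = (\<lambda>n r. indicator {0<..<real n} r * f r)"
  define u where "u = (\<lambda>n r. r * fn n r)"
  define F where "F = (\<lambda>n t. - real_hankel (\<nu> + 1) (u n) t)"
  have fnm: "fn n \<in> borel_measurable borel" for n unfolding fn_def using fm by measurable
  have um: "u n \<in> borel_measurable borel" for n unfolding u_def using fnm[of n] by measurable
  have fn_le: "\<bar>fn n r\<bar> \<le> \<bar>f r\<bar>" for n r by (simp add: fn_def indicator_def)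
  have fni: "integrable lborel (fn n)" for n
    by (rule Bochner_Integration.integrable_bound[OF f]) (use fnm fn_le in auto)
  have u_le: "\<bar>u n r\<bar> \<le> \<bar>r * f r\<bar>" for n r
    using fn_le[of n r] by (simp add: u_def abs_mult mult_left_mono)
  have u2: "integrable lborel (\<lambda>r. (u n r)\<^sup>2)" for n
  proof (rule Bochner_Integration.integrable_bound[OF rf])
    show "AE r in lborel. norm ((u n r)\<^sup>2) \<le> norm ((r * f r)\<^sup>2)"
      using u_le by (intro AE_I2) (simp add: abs_le_square_iff)
    show "(\<lambda>r. (u n r)\<^sup>2) \<in> borel_measurable lborel" using um[of n] by measurable
  qed
  have usupp: "u n r = 0" if "r \<notin> {0<..<real n}" for n r using that by (auto simp: u_def fn_def)
  have ui: "integrable lborel (u n)" for n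
    by (rule integrable_of_square_bounded_support(1)[OF um u2 usupp])
  have Fm: "F n \<in> borel_measurable borel" for n
    unfolding F_def by (intro borel_measurable_uminus borel_measurable_real_hankel nu1 um)
  have Fml: "F n \<in> borel_measurable lborel" for n unfolding measurable_lborel2 by (rule Fm)
  have du: "integrable lborel (\<lambda>r. (u m r - u n r)\<^sup>2)" for m n
    using integrable_square_lincomb(1)[of "u m" lborel "u n" 1] um u2 by simp
  have F2: "integrable lborel (\<lambda>t. (F n t)\<^sup>2)" "(LINT t|lborel. (F n t)\<^sup>2) \<le> (LINT r|lborel. (r * f r)\<^sup>2)" for n
  proof -
    show "integrable lborel (\<lambda>t. (F n t)\<^sup>2)" unfolding F_def using real_hankel_contraction(1)[OF nu1 um u2 usupp] by simp
    have "(LINT t|lborel. (F n t)\<^sup>2) \<le> (LINT r|lborel. (u n r)\<^sup>2)"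
      unfolding F_def using real_hankel_contraction(2)[OF nu1 um u2 usupp] by simp
    also have "\<dots> \<le> (LINT r|lborel. (r * f r)\<^sup>2)"
      by (rule integral_mono[OF u2 rf]) (use u_le in \<open>simp add: abs_le_square_iff\<close>)
    finally show "(LINT t|lborel. (F n t)\<^sup>2) \<le> (LINT r|lborel. (r * f r)\<^sup>2)" .
  qed
  have Fd: "(LINT t|lborel. (F m t - F n t)\<^sup>2) \<le> (LINT r|lborel. (u m r - u n r)\<^sup>2)" for m n
  proof -
    have e: "(F m t - F n t)\<^sup>2 = (real_hankel (\<nu> + 1) (\<lambda>r. u m r - u n r) t)\<^sup>2" for t
      by (simp add: F_def real_hankel_diff[OF nu1 ui ui] power2_commute)
    have "(\<lambda>r. u m r - u n r) \<in> borel_measurable borel" using um by measurable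
    moreover have "u m r - u n r = 0" if "r \<notin> {0<..<real (max m n)}" for r
    proof -
      have a: "r \<notin> {0<..<real m}" and b: "r \<notin> {0<..<real n}" using that by (auto simp: max_def split: if_splits)
      show ?thesis using usupp[OF a] usupp[OF b] by simp
    qed
    ultimately show ?thesis unfolding e
      by (rule real_hankel_contraction(2)[OF nu1 _ du])
  qed
  have ulim: "(\<lambda>n. LINT r|lborel. (u n r - r * f r)\<^sup>2) \<longlonglongrightarrow> (LINT r|(lborel :: real measure). 0)"
  proof (rule integral_dominated_convergence[OF _ _ rf])
    show "(\<lambda>r. (u n r - r * f r)\<^sup>2) \<in> borel_measurable lborel" for n using um[of n] fm by measurable
    show "AE r in lborel. (\<lambda>n. (u n r - r * f r)\<^sup>2) \<longlonglongrightarrow> 0"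
    proof (intro AE_I2 tendsto_eventually)
      fix r
      obtain n0 where "r < real n0" using reals_Archimedean2 by blast
      then show "\<forall>\<^sub>F n in sequentially. (u n r - r * f r)\<^sup>2 = 0"
        using f0[of r] by (intro eventually_sequentiallyI[of n0]) (auto simp: u_def fn_def indicator_def)
    qed
    show "AE r in lborel. norm ((u n r - r * f r)\<^sup>2) \<le> (r * f r)\<^sup>2" for n
      by (intro AE_I2) (auto simp: u_def fn_def indicator_def)
  qed simp
  have ulim0: "(\<lambda>n. LINT r|lborel. (u n r - r * f r)\<^sup>2) \<longlonglongrightarrow> 0" using ulim by simp
  have rfm: "(\<lambda>r. r * f r) \<in> borel_measurable borel" using fm by measurable
  have ud: "integrable lborel (\<lambda>r. (u n r - r * f r)\<^sup>2)" for n
    using integrable_square_lincomb(1)[of "u n" lborel "\<lambda>r. r * f r" 1] um u2 rf rfm by simp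
  have Fcauchy: "\<exists>N. \<forall>m\<ge>N. \<forall>n\<ge>N. (LINT t|lborel. (F m t - F n t)\<^sup>2) < e" if "e > 0" for e
  proof -
    have "\<forall>\<^sub>F n in sequentially. (LINT r|lborel. (u n r - r * f r)\<^sup>2) < e / 4"
      using order_tendstoD(2)[OF ulim0, of "e / 4"] that by simp
    then obtain N where N: "\<And>n. n \<ge> N \<Longrightarrow> (LINT r|lborel. (u n r - r * f r)\<^sup>2) < e / 4"
      by (auto simp: eventually_sequentially)
    have "(LINT t|lborel. (F m t - F n t)\<^sup>2) < e" if "m \<ge> N" "n \<ge> N" for m n
    proof -
      have "(LINT r|lborel. (u m r - u n r)\<^sup>2) \<le> (LINT r|lborel. 2 * (u m r - r * f r)\<^sup>2 + 2 * (u n r - r * f r)\<^sup>2)"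
      proof (rule integral_mono[OF du])
        show "integrable lborel (\<lambda>r. 2 * (u m r - r * f r)\<^sup>2 + 2 * (u n r - r * f r)\<^sup>2)" using ud by simp
        fix r
        have "(a - b)\<^sup>2 \<le> 2 * a\<^sup>2 + 2 * b\<^sup>2" for a b :: real
          using zero_le_power2[of "a + b"] by (simp add: power2_eq_square algebra_simps)
        from this[of "u m r - r * f r" "u n r - r * f r"]
        show "(u m r - u n r)\<^sup>2 \<le> 2 * (u m r - r * f r)\<^sup>2 + 2 * (u n r - r * f r)\<^sup>2" by simp
      qed
      also have "\<dots> = 2 * (LINT r|lborel. (u m r - r * f r)\<^sup>2) + 2 * (LINT r|lborel. (u n r - r * f r)\<^sup>2)" using ud by simp
      also have "\<dots> < e" using N[OF that(1)] N[OF that(2)] by simp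
      finally show ?thesis using Fd[of m n] by simp
    qed
    then show ?thesis by blast
  qed
  obtain G where G: "G \<in> borel_measurable lborel" "integrable lborel (\<lambda>x. (G x)\<^sup>2)"
    "(\<lambda>n. LINT x|lborel. (F n x - G x)\<^sup>2) \<longlonglongrightarrow> 0"
    by (rule L2_complete[OF Fml F2(1) Fcauchy])
  have Gd: "integrable lborel (\<lambda>x. (F n x - G x)\<^sup>2)" for n
    using integrable_square_lincomb(1)[OF Fml G(1) F2(1) G(2), of n 1] by simp
  show ?thesis
  proof (rule that[of G])
    show "G \<in> borel_measurable borel" using G(1) by simp
    show "integrable lborel (\<lambda>t. (G t)\<^sup>2)" by (rule G(2))
    have "sqrt (LINT t|lborel. (G t)\<^sup>2) \<le> sqrt 0 + sqrt (LINT r|lborel. (r * f r)\<^sup>2)"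
    proof (rule LIMSEQ_le_const)
      show "(\<lambda>n. sqrt (LINT x|lborel. (F n x - G x)\<^sup>2) + sqrt (LINT r|lborel. (r * f r)\<^sup>2)) \<longlonglongrightarrow> sqrt 0 + sqrt (LINT r|lborel. (r * f r)\<^sup>2)"
        by (intro tendsto_intros G(3))
      have "sqrt (LINT t|lborel. (G t)\<^sup>2) \<le> sqrt (LINT x|lborel. (F n x - G x)\<^sup>2) + sqrt (LINT r|lborel. (r * f r)\<^sup>2)" for n
      proof -
        have "sqrt (LINT t|lborel. (- (F n t - G t) + F n t)\<^sup>2) \<le> sqrt (LINT x|lborel. (- (F n x - G x))\<^sup>2) + sqrt (LINT r|lborel. (F n r)\<^sup>2)"
        proof (rule integral_square_triangle[OF _ Fml _ F2(1)])
          show "(\<lambda>t. - (F n t - G t)) \<in> borel_measurable lborel"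
            by (intro borel_measurable_uminus borel_measurable_diff Fml G(1))
          show "integrable lborel (\<lambda>t. (- (F n t - G t))\<^sup>2)" using Gd by (simp only: power2_minus)
        qed
        also have "\<dots> \<le> sqrt (LINT x|lborel. (- (F n x - G x))\<^sup>2) + sqrt (LINT r|lborel. (r * f r)\<^sup>2)"
          using F2(2) by simp
        finally show ?thesis by (simp add: power2_commute)
      qed
      then show "\<exists>N. \<forall>n\<ge>N. sqrt (LINT t|lborel. (G t)\<^sup>2) \<le> sqrt (LINT x|lborel. (F n x - G x)\<^sup>2) + sqrt (LINT r|lborel. (r * f r)\<^sup>2)" by blast
    qed
    then show "(LINT t|lborel. (G t)\<^sup>2) \<le> (LINT r|lborel. (r * f r)\<^sup>2)" by simp
    fix x y :: real assume xy: "0 < x" "x \<le> y"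
    let ?k = "\<lambda>t. indicator {x..y} t * t powr (- s)"
    have kint: "integrable lborel ?k" by (rule integrable_powr_Icc[OF xy(1)])
    have km: "?k \<in> borel_measurable lborel" using kint by simp
    have k2: "integrable lborel (\<lambda>t. (?k t)\<^sup>2)" unfolding square_indicator_powr by (rule integrable_powr_Icc[OF xy(1)])
    \<comment> \<open>For the truncations all integrals converge absolutely: the kernel identity
      turns the left side into an integral against a transform, and symmetry moves that transform
      onto \<open>u n\<close>.\<close>
    have ident: "y powr (- s) * real_hankel \<nu> (fn n) y - x powr (- s) * real_hankel \<nu> (fn n) x = (LINT t|lborel. ?k t * F n t)" for n
    proof -
      have i: "integrable lborel (\<lambda>r. fn n r * hankel_kernel \<nu> k r)" for k by (rule integrable_real_hankel_integrand[OF nu fni])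
      have "y powr (- s) * real_hankel \<nu> (fn n) y - x powr (- s) * real_hankel \<nu> (fn n) x
          = (LINT r|lborel. y powr (- s) * (fn n r * hankel_kernel \<nu> y r) - x powr (- s) * (fn n r * hankel_kernel \<nu> x r))"
        unfolding real_hankel_def using i by simp
      also have "\<dots> = (LINT r|lborel. u n r * real_hankel (\<nu> + 1) (\<lambda>t. indicator {x..y} t * - (t powr (- s))) r)"
      proof (rule Bochner_Integration.integral_cong[OF refl])
        fix r
        show "y powr (- s) * (fn n r * hankel_kernel \<nu> y r) - x powr (- s) * (fn n r * hankel_kernel \<nu> x r)
          = u n r * real_hankel (\<nu> + 1) (\<lambda>t. indicator {x..y} t * - (t powr (- s))) r"
        proof (cases "r > 0")
          case True
          have "y powr (- s) * (fn n r * hankel_kernel \<nu> y r) - x powr (- s) * (fn n r * hankel_kernel \<nu> x r) = fn n r * (y powr (- s) * hankel_kernel \<nu> y r - x powr (- s) * hankel_kernel \<nu> x r)"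
            by (simp add: algebra_simps)
          then show ?thesis using hankel_kernel_weighted_primitive[OF nu xy True] by (simp add: u_def s_def)
        qed (simp add: u_def fn_def)
      qed
      also have "\<dots> = (LINT t|lborel. real_hankel (\<nu> + 1) (u n) t * (indicator {x..y} t * - (t powr (- s))))"
        by (rule real_hankel_swap[OF nu1 ui, symmetric]) (use kint in simp)
      also have "\<dots> = (LINT t|lborel. ?k t * F n t)"
        by (simp add: F_def mult_ac)
      finally show ?thesis .
    qed
    have flim: "(\<lambda>n. real_hankel \<nu> (fn n) k) \<longlonglongrightarrow> real_hankel \<nu> f k" for k
      unfolding real_hankel_def
    proof (rule integral_dominated_convergence)
      show "integrable lborel (\<lambda>r. norm (f r * hankel_kernel \<nu> k r))" by (rule integrable_norm[OF integrable_real_hankel_integrand[OF nu f]])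
      show "(\<lambda>r. f r * hankel_kernel \<nu> k r) \<in> borel_measurable lborel" using integrable_real_hankel_integrand[OF nu f] by blast
      show "(\<lambda>r. fn n r * hankel_kernel \<nu> k r) \<in> borel_measurable lborel" for n using integrable_real_hankel_integrand[OF nu fni] by blast
      show "AE r in lborel. norm (fn n r * hankel_kernel \<nu> k r) \<le> norm (f r * hankel_kernel \<nu> k r)" for n
        using fn_le by (intro AE_I2) (simp add: abs_mult mult_right_mono)
      show "AE r in lborel. (\<lambda>n. fn n r * hankel_kernel \<nu> k r) \<longlonglongrightarrow> f r * hankel_kernel \<nu> k r"
      proof (intro AE_I2 tendsto_eventually)
        fix r
        obtain n0 where "r < real n0" using reals_Archimedean2 by blast
        then show "\<forall>\<^sub>F n in sequentially. fn n r * hankel_kernel \<nu> k r = f r * hankel_kernel \<nu> k r"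
          using f0[of r] by (intro eventually_sequentiallyI[of n0]) (auto simp: fn_def indicator_def)
      qed
    qed
    \<comment> \<open>The factor \<open>t powr (- s)\<close> is square-integrable on [x,y] since x >
      0, so L2 convergence of \<open>F n\<close> suffices.\<close>
    have rlim: "(\<lambda>n. LINT t|lborel. ?k t * F n t) \<longlonglongrightarrow> (LINT t|lborel. ?k t * G t)"
    proof (rule LIM_zero_cancel, rule Lim_null_comparison)
      show "(\<lambda>n. sqrt ((LINT t|lborel. (?k t)\<^sup>2) * (LINT t|lborel. (F n t - G t)\<^sup>2))) \<longlonglongrightarrow> 0"
        using tendsto_real_sqrt[OF tendsto_mult[OF tendsto_const G(3), of "LINT t|lborel. (?k t)\<^sup>2"]] by simp
      show "\<forall>\<^sub>F n in sequentially. norm ((LINT t|lborel. ?k t * F n t) - (LINT t|lborel. ?k t * G t)) \<le> sqrt ((LINT t|lborel. (?k t)\<^sup>2) * (LINT t|lborel. (F n t - G t)\<^sup>2))"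
      proof (rule always_eventually, rule allI)
        fix n
        have "(LINT t|lborel. ?k t * F n t) - (LINT t|lborel. ?k t * G t) = (LINT t|lborel. ?k t * (F n t - G t))"
          unfolding right_diff_distrib
          by (rule Bochner_Integration.integral_diff[symmetric]) (rule integrable_square_bound[OF km _ k2]; use Fml F2(1) G in simp)+
        moreover have "(\<lambda>t. F n t - G t) \<in> borel_measurable lborel" using Fml[of n] G(1) by (rule borel_measurable_diff)
        from Cauchy_Schwarz_integral[OF km this k2 Gd]
        have "\<bar>LINT t|lborel. ?k t * (F n t - G t)\<bar> \<le> sqrt ((LINT t|lborel. (?k t)\<^sup>2) * (LINT t|lborel. (F n t - G t)\<^sup>2))"
          by (intro real_le_rsqrt) simp
        ultimately show "norm ((LINT t|lborel. ?k t * F n t) - (LINT t|lborel. ?k t * G t)) \<le> sqrt ((LINT t|lborel. (?k t)\<^sup>2) * (LINT t|lborel. (F n t - G t)\<^sup>2))"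
          by simp
      qed
    qed
    have "(\<lambda>n. y powr (- s) * real_hankel \<nu> (fn n) y - x powr (- s) * real_hankel \<nu> (fn n) x) \<longlonglongrightarrow> y powr (- s) * real_hankel \<nu> f y - x powr (- s) * real_hankel \<nu> f x"
      by (intro tendsto_intros flim)
    then have "(\<lambda>n. LINT t|lborel. ?k t * F n t) \<longlonglongrightarrow> y powr (- s) * real_hankel \<nu> f y - x powr (- s) * real_hankel \<nu> f x"
      unfolding ident .
    from LIMSEQ_unique[OF this rlim]
    show "y powr (- (\<nu> + 1/2)) * real_hankel \<nu> f y - x powr (- (\<nu> + 1/2)) * real_hankel \<nu> f x
       = (LINT t|lborel. (indicator {x..y} t * t powr (- (\<nu> + 1/2))) * G t)"
      by (simp only: s_def)
  qed
qed

section \<open>Extending a form inequality from bumps\<close>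

lemma smooth_antiderivative:
  assumes "smooth p"
  obtains P where "\<And>x. (P has_real_derivative p x) (at x)" "smooth P"
proof -
  have "\<exists>F. \<forall>x. -\<infinity> < ereal x \<longrightarrow> ereal x < \<infinity> \<longrightarrow> (F has_vector_derivative p x) (at x)"
    by (rule einterval_antiderivative) (auto intro: smooth_isCont assms)
  then obtain P where "\<And>x. (P has_real_derivative p x) (at x)"
    by (auto simp: has_real_derivative_iff_has_vector_derivative)
  then show ?thesis using that assms smoothI by blast
qed

text \<open>Vanishing mean is exactly what makes the primitive that is zero to the right of the
  support zero to its left as well. The last clause records it as an integral from x to b, the form
  in which \<open>rayleigh_extension\<close> compares it with G.\<close>

lemma bump_antiderivative:
  assumes p: "bump a b p" and z: "(LINT x|lborel. p x) = 0"
  obtains w where "bump a b w" "\<And>x. (w has_real_derivative p x) (at x)"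
    "\<And>x. x \<le> b \<Longrightarrow> w x = - (LINT t|lborel. indicator {x..b} t * p t)"
proof -
  from bumpE[OF p] obtain \<alpha> \<beta> where ab: "a < \<alpha>" "\<beta> < b" "\<And>x. x < \<alpha> \<or> \<beta> < x \<Longrightarrow> p x = 0" by metis
  obtain P where P: "\<And>x. (P has_real_derivative p x) (at x)" "smooth P"
    using smooth_antiderivative[OF bump_smooth[OF p]] by metis
  have ftc: "(LINT t|lborel. p t * indicator {x..y} t) = P y - P x" if "x \<le> y" for x y
    by (rule integral_FTC_Icc_real[OF that P(1) smooth_isCont[OF bump_smooth[OF p]]])
  define w where "w = (\<lambda>x. P x - P b)"
  show ?thesis
  proof (rule that[of w])
    show d: "(w has_real_derivative p x) (at x)" for x
      unfolding w_def using P(1)[of x] by (auto intro!: derivative_eq_intros)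
    have right: "w x = 0" if "x > \<beta>" for x
    proof -
      have "(LINT t|lborel. p t * indicator {min x b..max x b} t) = (LINT t|(lborel :: real measure). (0::real))"
      proof (intro Bochner_Integration.integral_cong refl)
        fix t show "p t * indicator {min x b..max x b} t = 0"
          using ab(3)[of t] ab(2) that by (cases "t > \<beta>") auto
      qed
      then have "P (max x b) - P (min x b) = 0" using ftc[of "min x b" "max x b"] by simp
      then show ?thesis unfolding w_def by (auto simp: max_def min_def split: if_splits)
    qed
    have left: "w x = 0" if "x < \<alpha>" for x
    proof -
      define y where "y = max x b"
      have "(LINT t|lborel. p t * indicator {x..y} t) = (LINT t|lborel. p t)"
      proof (intro Bochner_Integration.integral_cong refl)
        fix t show "p t * indicator {x..y} t = p t"
          using ab(2) ab(3)[of t] that by (cases "t < \<alpha> \<or> \<beta> < t") (auto simp: y_def)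
      qed
      then have "P y = P x" using ftc[of x y] z by (simp add: y_def)
      moreover have "P y = P b"
      proof -
        have "w y = 0" using ab(2) by (intro right) (auto simp: y_def)
        then show ?thesis by (simp add: w_def)
      qed
      ultimately show ?thesis by (simp add: w_def)
    qed
    show "bump a b w"
      by (rule bumpI[OF smoothI[OF d bump_smooth[OF p]] ab(1,2)]) (use left right in auto)
    show "w x = - (LINT t|lborel. indicator {x..b} t * p t)" if "x \<le> b" for x
      using ftc[OF that] by (simp add: w_def mult.commute)
  qed
qed

text \<open>A bump closer in L2 to the indicator of (a,b) than the norm of that indicator cannot be
  zero; its square, divided by the integral of the square, is the required function.\<close>

lemma bump_normalized:
  assumes "a < b" obtains \<eta> where "bump a b \<eta>" "(LINT x|lborel. \<eta> x) = 1"
proof -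
  obtain w where w: "bump a b w" "(LINT x|lborel. (indicator {a<..<b} x - w x)\<^sup>2) < (b - a) / 4"
  proof (rule bump_approx_L2[of "indicator {a<..<b}" a b "(b - a) / 4"])
    have em: "emeasure lborel {a<..<b} < \<infinity>" by (rule emeasure_bounded_finite) simp
    have "integrable lborel (indicator {a<..<b} :: real \<Rightarrow> real)" by (intro integrable_real_indicator em) simp
    moreover have "(\<lambda>x. (indicator {a<..<b} x :: real)\<^sup>2) = indicator {a<..<b}" by (auto simp: indicator_def)
    ultimately show "integrable lborel (\<lambda>x. (indicator {a<..<b} x :: real)\<^sup>2)" by simp
  qed (use assms in auto)
  have wm: "w \<in> borel_measurable borel" by (rule smooth_borel[OF bump_smooth[OF w(1)]])
  have w2: "integrable lborel (\<lambda>x. (w x)\<^sup>2)" by (rule bump_square_integrable[OF w(1)])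
  let ?I = "LINT x|lborel. (w x)\<^sup>2"
  have pos: "?I > 0"
  proof (rule ccontr)
    assume "\<not> ?I > 0"
    moreover have "?I \<ge> 0" by simp
    ultimately have "?I = 0" by linarith
    then have "AE x in lborel. (w x)\<^sup>2 = 0"
      using w2 by (subst (asm) integral_nonneg_eq_0_iff_AE) auto
    then have "(LINT x|lborel. (indicator {a<..<b} x - w x)\<^sup>2) = (LINT x|lborel. indicator {a<..<b} x)"
    proof (intro integral_cong_AE)
      assume A: "AE x in lborel. (w x)\<^sup>2 = 0"
      then show "AE x in lborel. (indicator {a<..<b} x - w x)\<^sup>2 = indicator {a<..<b} x"
        by eventually_elim (simp add: indicator_def)
    qed (use wm in measurable)
    then show False using w(2) assms by simp
  qed
  show ?thesis
  proof (rule that)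
    show "bump a b (\<lambda>x. (1 / ?I) * (w x * w x))" by (intro bump_cmult bump_smooth_mult w bump_smooth[OF w(1)])
    show "(LINT x|lborel. (1 / ?I) * (w x * w x)) = 1"
      using pos w2 by (simp add: power2_eq_square)
  qed
qed

lemma bump_weight_square_integrable:
  assumes "bump a b p" "a \<ge> 0" "s > 0"
  shows "integrable lborel (\<lambda>x. (x powr s * p x)\<^sup>2)"
proof -
  have pm: "p \<in> borel_measurable borel" by (rule smooth_borel[OF bump_smooth[OF assms(1)]])
  show ?thesis
  proof (rule Bochner_Integration.integrable_bound)
    show "integrable lborel (\<lambda>x. (b powr s)\<^sup>2 * (p x)\<^sup>2)" using bump_square_integrable(2)[OF assms(1)] by simp
    show "(\<lambda>x. (x powr s * p x)\<^sup>2) \<in> borel_measurable lborel" using pm by measurable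
    show "AE x in lborel. norm ((x powr s * p x)\<^sup>2) \<le> norm ((b powr s)\<^sup>2 * (p x)\<^sup>2)"
    proof (rule AE_I2)
      fix x
      show "norm ((x powr s * p x)\<^sup>2) \<le> norm ((b powr s)\<^sup>2 * (p x)\<^sup>2)"
      proof (cases "x \<in> {a<..<b}")
        case True
        then have "(x powr s)\<^sup>2 \<le> (b powr s)\<^sup>2" using assms by (intro power_mono powr_mono2) auto
        then show ?thesis by (simp add: power_mult_distrib mult_right_mono)
      next
        case False
        then show ?thesis using bump_zero[OF assms(1) False] by simp
      qed
    qed
  qed
qed

text \<open>Scaling \<eta>(x) to \<eta>(x/k)/k keeps the integral and multiplies the weighted energy
  by k^(2 s - 1), which tends to 0 with k because s > 1/2. In terms of the order this is \<nu> >
  0.\<close>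

lemma bump_small_weight:
  assumes b: "b > 0" and s: "s > 1/2" and e: "e > 0"
  obtains \<eta> where "bump 0 b \<eta>" "(LINT x|lborel. \<eta> x) = 1" "(LINT x|lborel. (x powr s * \<eta> x)\<^sup>2) < e"
proof -
  obtain \<eta> where h: "bump 0 b \<eta>" "(LINT x|lborel. \<eta> x) = 1" using bump_normalized[OF b] by metis
  let ?A = "LINT x|lborel. (x powr s * \<eta> x)\<^sup>2"
  have sc: "(LINT x|lborel. g x) = k * (LINT x|lborel. g (k * x))" if "k > 0" for k :: real and g :: "real \<Rightarrow> real"
    using lborel_integral_real_affine[of k g 0] that by simp
  have "((\<lambda>k::real. k powr (2 * s - 1) * ?A) \<longlongrightarrow> 0 * ?A) (at_right 0)"
    by (intro tendsto_mult tendsto_const tendsto_eq_rhs[OF tendsto_powr'[OF tendsto_ident_at tendsto_const]])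
       (use s in \<open>auto simp: eventually_at_right_less less_imp_le eventually_at_filter\<close>)
  then have "\<forall>\<^sub>F k in at_right 0. k powr (2 * s - 1) * ?A < e"
    using e by (intro order_tendstoD(2)[where y = 0]) auto
  moreover have "\<forall>\<^sub>F k::real in at_right 0. 0 < k \<and> k < 1"
    using eventually_at_right_real[of 0 1] by simp
  ultimately have "\<forall>\<^sub>F k in at_right 0. 0 < k \<and> k < 1 \<and> k powr (2 * s - 1) * ?A < e"
    by eventually_elim auto
  then obtain k :: real where k: "0 < k" "k < 1" "k powr (2 * s - 1) * ?A < e"
    using eventually_happens'[of "at_right (0::real)"] by auto
  define \<zeta> where "\<zeta> = (\<lambda>x. (1 / k) * \<eta> ((1 / k) * x + 0))"
  have zk: "\<zeta> (k * x) = \<eta> x / k" for x using k by (simp add: \<zeta>_def)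
  from bumpE[OF h(1)] obtain \<alpha> \<beta> where ab: "0 < \<alpha>" "\<beta> < b" "\<And>x. x < \<alpha> \<or> \<beta> < x \<Longrightarrow> \<eta> x = 0" by metis
  show ?thesis
  proof (rule that[of \<zeta>])
    show "bump 0 b \<zeta>"
    proof (rule bumpI[of _ _ "k * \<alpha>" "max 0 \<beta>"])
      show "smooth \<zeta>" unfolding \<zeta>_def by (intro smooth_cmult smooth_affine bump_smooth[OF h(1)])
      show "0 < k * \<alpha>" using k ab by simp
      show "max 0 \<beta> < b" using ab b by simp
      fix x assume "x < k * \<alpha> \<or> max 0 \<beta> < x"
      then have "x / k < \<alpha> \<or> \<beta> < x / k"
      proof
        assume "x < k * \<alpha>"
        then have "x / k < \<alpha>" using k by (simp add: field_simps)
        then show ?thesis by simp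
      next
        assume x: "max 0 \<beta> < x"
        then have "x * k \<le> x * 1" using k by (intro mult_left_mono) auto
        then have "x \<le> x / k" using k by (simp add: field_simps)
        then show ?thesis using x by auto
      qed
      then have "\<eta> (x / k) = 0" by (rule ab(3))
      then show "\<zeta> x = 0" by (simp add: \<zeta>_def)
    qed
    show "(LINT x|lborel. \<zeta> x) = 1"
      using sc[OF k(1), of \<zeta>] k h(2) by (simp add: zk)
    have "(LINT x|lborel. (x powr s * \<zeta> x)\<^sup>2) = k * (LINT x|lborel. ((k * x) powr s * \<zeta> (k * x))\<^sup>2)"
      by (rule sc[OF k(1)])
    also have "(\<lambda>x. ((k * x) powr s * \<zeta> (k * x))\<^sup>2) = (\<lambda>x. (k powr s / k)\<^sup>2 * (x powr s * \<eta> x)\<^sup>2)"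
    proof
      fix x show "((k * x) powr s * \<zeta> (k * x))\<^sup>2 = (k powr s / k)\<^sup>2 * (x powr s * \<eta> x)\<^sup>2"
      proof (cases "x > 0")
        case True
        then show ?thesis using k by (simp add: zk powr_mult power_mult_distrib power_divide)
      next
        case False
        then have "\<eta> x = 0" using ab by auto
        then show ?thesis by (simp add: zk)
      qed
    qed
    also have "k * (LINT x|lborel. (k powr s / k)\<^sup>2 * (x powr s * \<eta> x)\<^sup>2) = k * (k powr s / k)\<^sup>2 * ?A" by simp
    also have "k * (k powr s / k)\<^sup>2 = k powr (2 * s - 1)"
    proof -
      have e: "2 * s - 1 = s + s - 1" by simp
      show ?thesis unfolding e powr_diff powr_add using k by (simp add: power2_eq_square)
    qed
    finally show "(LINT x|lborel. (x powr s * \<zeta> x)\<^sup>2) < e" using k by simp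
  qed
qed

section \<open>Weighted approximation by bumps, and extension of the form inequality\<close>

lemma square_add_le: "(x + y)\<^sup>2 \<le> 2 * x\<^sup>2 + 2 * y\<^sup>2" for x y :: real
  using zero_le_power2[of "x - y"] by (simp add: power2_eq_square algebra_simps)

lemma integral_square_add_le:
  fixes f g :: "'a \<Rightarrow> real"
  assumes "f \<in> borel_measurable M" "g \<in> borel_measurable M"
    "integrable M (\<lambda>x. (f x)\<^sup>2)" "integrable M (\<lambda>x. (g x)\<^sup>2)"
  shows "(LINT x|M. (f x + g x)\<^sup>2) \<le> 2 * (LINT x|M. (f x)\<^sup>2) + 2 * (LINT x|M. (g x)\<^sup>2)"
proof -
  have "(LINT x|M. (f x + g x)\<^sup>2) \<le> (LINT x|M. 2 * (f x)\<^sup>2 + 2 * (g x)\<^sup>2)"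
  proof (rule integral_mono)
    show "integrable M (\<lambda>x. (f x + g x)\<^sup>2)" using integrable_square_lincomb(1)[OF assms, of "-1"] by simp
    show "integrable M (\<lambda>x. 2 * (f x)\<^sup>2 + 2 * (g x)\<^sup>2)" using assms by simp
  qed (rule square_add_le)
  then show ?thesis using assms by simp
qed

text \<open>The target for the bumps is x^(-s) F, but this weight is singular at 0 when a = 0.
  Removing the part of F to the left of \<alpha> n costs little and bounds the weight; the factor
  x^s, at most b^s on the interval, then returns the error to F.\<close>

lemma weighted_bump_approx:
  fixes F :: "real \<Rightarrow> real"
  assumes ab: "0 \<le> a" "a < b" and s: "s > 0" and F: "F \<in> borel_measurable borel" "integrable lborel (\<lambda>x. (F x)\<^sup>2)"
    and e: "e > 0"
  obtains p where "bump a b p" "(LINT x|lborel. (indicator {a..b} x * F x - x powr s * p x)\<^sup>2) < e"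
proof -
  \<comment> \<open>Denominators start at 2, so that \<alpha> n < b already for n = 0.\<close>
  define \<alpha> where "\<alpha> = (\<lambda>n. a + (b - a) / real (Suc (Suc n)))"
  have al: "a < \<alpha> n" "\<alpha> n < b" for n using ab mult_right_mono[of a b "real n"] by (auto simp: \<alpha>_def field_simps)
  have alim: "\<alpha> \<longlonglongrightarrow> a"
  proof -
    have "(\<lambda>n. a + (b - a) * inverse (real (Suc (Suc n)))) \<longlonglongrightarrow> a + (b - a) * 0"
      by (intro tendsto_intros LIMSEQ_Suc[OF LIMSEQ_inverse_real_of_nat])
    then show ?thesis by (simp add: \<alpha>_def[abs_def] divide_inverse)
  qed
  let ?d = "\<lambda>n x. indicator {a..b} x * F x - indicator {\<alpha> n<..<b} x * F x"
  have dm: "?d n \<in> borel_measurable lborel" for n using F(1) by measurable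
  have ind: "(indicator {a..b} x - indicator {\<alpha> n<..<b} x :: real)\<^sup>2 \<le> 1" for n x
    using al[of n] by (auto simp: indicator_def)
  have dle: "(?d n x)\<^sup>2 \<le> (F x)\<^sup>2" for n x
  proof -
    have "(?d n x)\<^sup>2 = (indicator {a..b} x - indicator {\<alpha> n<..<b} x)\<^sup>2 * (F x)\<^sup>2"
      by (simp add: power_mult_distrib[symmetric] algebra_simps)
    also have "\<dots> \<le> 1 * (F x)\<^sup>2" by (intro mult_right_mono ind) simp
    finally show ?thesis by simp
  qed
  have d2: "integrable lborel (\<lambda>x. (?d n x)\<^sup>2)" for n
  proof (rule Bochner_Integration.integrable_bound[OF F(2)])
    show "(\<lambda>x. (?d n x)\<^sup>2) \<in> borel_measurable lborel" using dm[of n] by measurable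
    show "AE x in lborel. norm ((?d n x)\<^sup>2) \<le> norm ((F x)\<^sup>2)" using dle by (intro AE_I2) simp
  qed
  have "(\<lambda>n. LINT x|lborel. (?d n x)\<^sup>2) \<longlonglongrightarrow> (LINT x|(lborel :: real measure). (0 :: real))"
  proof (rule integral_dominated_convergence[OF _ _ F(2)])
    show "(\<lambda>x. (?d n x)\<^sup>2) \<in> borel_measurable lborel" for n using dm[of n] by measurable
    show "AE x in lborel. norm ((?d n x)\<^sup>2) \<le> (F x)\<^sup>2" for n using dle by (intro AE_I2) simp
    have "AE x in lborel. x \<noteq> a" "AE x in lborel. x \<noteq> b" by (rule AE_lborel_singleton)+
    then show "AE x in lborel. (\<lambda>n. (?d n x)\<^sup>2) \<longlonglongrightarrow> 0"
    proof eventually_elim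
      case (elim x)
      show ?case
      proof (cases "x \<in> {a<..<b}")
        case True
        then have "\<forall>\<^sub>F n in sequentially. \<alpha> n < x" using order_tendstoD(2)[OF alim, of x] by simp
        then have "\<forall>\<^sub>F n in sequentially. (?d n x)\<^sup>2 = 0"
          by eventually_elim (use True in auto)
        then show ?thesis by (rule tendsto_eventually)
      next
        case False
        then have "(?d n x)\<^sup>2 = 0" for n using elim al[of n] by (auto simp: indicator_def)
        then show ?thesis by (simp only: tendsto_const)
      qed
    qed
  qed simp
  then have "\<forall>\<^sub>F n in sequentially. (LINT x|lborel. (?d n x)\<^sup>2) < e / 4"
    using e by (intro order_tendstoD(2)[where y = 0]) auto
  then obtain n where n: "(LINT x|lborel. (?d n x)\<^sup>2) < e / 4" by (auto simp: eventually_sequentially)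
  have al0: "\<alpha> n > 0" using al[of n] ab by linarith
  have b0: "b > 0" using ab by linarith
  define q where "q = (\<lambda>x. indicator {\<alpha> n<..<b} x * (x powr (- s) * F x))"
  have qm: "q \<in> borel_measurable borel" unfolding q_def using F(1) by measurable
  have q2: "integrable lborel (\<lambda>x. (q x)\<^sup>2)"
  proof (rule Bochner_Integration.integrable_bound)
    show "integrable lborel (\<lambda>x. (\<alpha> n powr (- s))\<^sup>2 * (F x)\<^sup>2)" using F(2) by simp
    show "(\<lambda>x. (q x)\<^sup>2) \<in> borel_measurable lborel" using qm by measurable
    show "AE x in lborel. norm ((q x)\<^sup>2) \<le> norm ((\<alpha> n powr (- s))\<^sup>2 * (F x)\<^sup>2)"
    proof (rule AE_I2)
      fix x
      show "norm ((q x)\<^sup>2) \<le> norm ((\<alpha> n powr (- s))\<^sup>2 * (F x)\<^sup>2)"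
      proof (cases "x \<in> {\<alpha> n<..<b}")
        case True
        then have "x powr (- s) \<le> \<alpha> n powr (- s)" using s al0 by (intro powr_mono2') auto
        then have "(x powr (- s))\<^sup>2 \<le> (\<alpha> n powr (- s))\<^sup>2" by (intro power_mono) auto
        then show ?thesis using True by (simp add: q_def power_mult_distrib mult_right_mono)
      qed (simp add: q_def)
    qed
  qed
  have qsupp: "q x = 0" if "x \<notin> {\<alpha> n<..<b}" for x using that by (simp add: q_def)
  \<comment> \<open>The factor by which the weight x^s can enlarge the squared error is at most the
    square of \<open>b powr s\<close>.\<close>
  define e' where "e' = e / (4 * (b powr s)\<^sup>2)"
  have e': "e' > 0" using e b0 by (simp add: e'_def)
  obtain w where w: "bump (\<alpha> n) b w" "(LINT x|lborel. (q x - w x)\<^sup>2) < e'"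
    by (rule bump_approx_L2[OF qm q2 qsupp e'])
  have wb: "bump a b w" by (rule bump_mono[OF w(1)]) (use al[of n] in auto)
  have wm: "w \<in> borel_measurable borel" by (rule smooth_borel[OF bump_smooth[OF wb]])
  have qw2: "integrable lborel (\<lambda>x. (q x - w x)\<^sup>2)"
    using integrable_square_lincomb(1)[of q lborel w 1] qm wm q2 bump_square_integrable(2)[OF wb] by simp
  let ?g = "\<lambda>x. indicator {\<alpha> n<..<b} x * F x - x powr s * w x"
  have gm: "?g \<in> borel_measurable lborel" using F(1) wm by measurable
  have gle: "(?g x)\<^sup>2 \<le> (b powr s)\<^sup>2 * (q x - w x)\<^sup>2" for x
  proof (cases "x \<in> {\<alpha> n<..<b}")
    case True
    then have x: "x > 0" using al0 by auto
    then have "x powr s * x powr (- s) = 1" by (simp add: powr_minus)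
    then have "?g x = x powr s * (q x - w x)"
      using True by (simp add: q_def right_diff_distrib mult.assoc[symmetric])
    moreover have "(x powr s)\<^sup>2 \<le> (b powr s)\<^sup>2"
      using True x s by (intro power_mono powr_mono2) auto
    ultimately show ?thesis by (simp add: power_mult_distrib mult_right_mono)
  next
    case False
    then show ?thesis using bump_zero[OF w(1) False] by simp
  qed
  have g2: "integrable lborel (\<lambda>x. (?g x)\<^sup>2)"
  proof (rule Bochner_Integration.integrable_bound)
    show "integrable lborel (\<lambda>x. (b powr s)\<^sup>2 * (q x - w x)\<^sup>2)" using qw2 by simp
    show "(\<lambda>x. (?g x)\<^sup>2) \<in> borel_measurable lborel" using gm by measurable
    show "AE x in lborel. norm ((?g x)\<^sup>2) \<le> norm ((b powr s)\<^sup>2 * (q x - w x)\<^sup>2)" using gle by simp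
  qed
  have "(LINT x|lborel. (?g x)\<^sup>2) \<le> (LINT x|lborel. (b powr s)\<^sup>2 * (q x - w x)\<^sup>2)"
    by (rule integral_mono[OF g2 _ gle]) (use qw2 in simp)
  also have "\<dots> = (b powr s)\<^sup>2 * (LINT x|lborel. (q x - w x)\<^sup>2)" by simp
  also have "\<dots> \<le> (b powr s)\<^sup>2 * e'" using w(2) by (intro mult_left_mono) auto
  also have "\<dots> = e / 4" using b0 by (simp add: e'_def)
  finally have g4: "(LINT x|lborel. (?g x)\<^sup>2) \<le> e / 4" .
  show ?thesis
  proof (rule that[OF wb])
    have "(LINT x|lborel. (indicator {a..b} x * F x - x powr s * w x)\<^sup>2) = (LINT x|lborel. (?d n x + ?g x)\<^sup>2)"
      by simp
    also have "\<dots> \<le> 2 * (LINT x|lborel. (?d n x)\<^sup>2) + 2 * (LINT x|lborel. (?g x)\<^sup>2)"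
      by (rule integral_square_add_le[OF dm gm d2 g2])
    also have "\<dots> < e" using n g4 by linarith
    finally show "(LINT x|lborel. (indicator {a..b} x * F x - x powr s * w x)\<^sup>2) < e" .
  qed
qed

text \<open>For \<open>a = 0\<close> the mean can be corrected near \<open>0\<close> at arbitrarily small cost, since \<open>t powr (- s)\<close> is not
  square-integrable there; no boundary condition at \<open>0\<close> is needed.\<close>

lemma weighted_bump_approx_mean_zero:
  fixes F :: "real \<Rightarrow> real"
  assumes ab: "0 \<le> a" "a < b" and s: "s > 1/2" and F: "F \<in> borel_measurable borel" "integrable lborel (\<lambda>x. (F x)\<^sup>2)"
    and mean: "a > 0 \<Longrightarrow> (LINT t|lborel. (indicator {a..b} t * t powr (- s)) * F t) = 0"
    and e: "e > 0"
  obtains p where "bump a b p" "(LINT x|lborel. p x) = 0" "(LINT x|lborel. (indicator {a..b} x * F x - x powr s * p x)\<^sup>2) < e"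
proof -
  let ?F = "\<lambda>x. indicator {a..b} x * F x"
  have s0: "s > 0" using s by simp
  have Fm: "?F \<in> borel_measurable lborel" using F(1) by measurable
  have F2: "integrable lborel (\<lambda>x. (?F x)\<^sup>2)"
  proof (rule Bochner_Integration.integrable_bound[OF F(2)])
    show "(\<lambda>x. (?F x)\<^sup>2) \<in> borel_measurable lborel" using Fm by measurable
  qed (auto simp: indicator_def)
  have pm: "(\<lambda>x. x powr s * p x) \<in> borel_measurable lborel" if "bump a b p" for p
    using smooth_borel[OF bump_smooth[OF that]] by measurable
  note p2 = bump_weight_square_integrable[OF _ ab(1) s0]
  have err: "integrable lborel (\<lambda>x. (?F x - x powr s * p x)\<^sup>2)" if "bump a b p" for p
    using integrable_square_lincomb(1)[OF Fm pm[OF that] F2 p2[OF that], of 1] by simp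
  \<comment> \<open>Subtracting \<eta> times the mean of p restores mean zero. The price is the
    square of that mean times the weighted energy of \<eta>; the two cases below make this product
    small in different ways.\<close>
  have correct: "\<exists>p'. bump a b p' \<and> (LINT x|lborel. p' x) = 0 \<and> (LINT x|lborel. (?F x - x powr s * p' x)\<^sup>2)
      \<le> 2 * (LINT x|lborel. (?F x - x powr s * p x)\<^sup>2) + 2 * ((LINT x|lborel. p x)\<^sup>2 * (LINT x|lborel. (x powr s * \<eta> x)\<^sup>2))"
    if p: "bump a b p" and h: "bump a b \<eta>" "(LINT x|lborel. \<eta> x) = 1" for p \<eta>
  proof (intro exI conjI)
    let ?l = "LINT x|lborel. p x"
    show "bump a b (\<lambda>x. p x - ?l * \<eta> x)" by (intro bump_diff bump_cmult p h)
    show "(LINT x|lborel. p x - ?l * \<eta> x) = 0"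
      using bump_square_integrable(1)[OF p] bump_square_integrable(1)[OF h(1)] h(2) by simp
    have lh: "bump a b (\<lambda>x. ?l * \<eta> x)" by (rule bump_cmult[OF h(1)])
    have "(LINT x|lborel. (?F x - x powr s * (p x - ?l * \<eta> x))\<^sup>2) = (LINT x|lborel. ((?F x - x powr s * p x) + x powr s * (?l * \<eta> x))\<^sup>2)"
      by (simp add: algebra_simps)
    also have "\<dots> \<le> 2 * (LINT x|lborel. (?F x - x powr s * p x)\<^sup>2) + 2 * (LINT x|lborel. (x powr s * (?l * \<eta> x))\<^sup>2)"
      by (rule integral_square_add_le[OF borel_measurable_diff[OF Fm pm[OF p]] pm[OF lh] err[OF p] p2[OF lh]])
    also have "(LINT x|lborel. (x powr s * (?l * \<eta> x))\<^sup>2) = (LINT x|lborel. ?l\<^sup>2 * (x powr s * \<eta> x)\<^sup>2)"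
      by (simp add: power_mult_distrib mult_ac)
    finally show "(LINT x|lborel. (?F x - x powr s * (p x - ?l * \<eta> x))\<^sup>2)
      \<le> 2 * (LINT x|lborel. (?F x - x powr s * p x)\<^sup>2) + 2 * (?l\<^sup>2 * (LINT x|lborel. (x powr s * \<eta> x)\<^sup>2))" by simp
  qed
  show ?thesis
  proof (cases "a = 0")
    case True
    obtain p where p: "bump a b p" "(LINT x|lborel. (?F x - x powr s * p x)\<^sup>2) < e / 4"
      by (rule weighted_bump_approx[OF ab s0 F, of "e / 4"]) (use e in auto)
    let ?l = "LINT x|lborel. p x"
    have l1: "?l\<^sup>2 + 1 > 0" using zero_le_power2[of ?l] by linarith
    \<comment> \<open>The tolerance for \<eta> depends on the mean of p, so \<eta> is chosen after
      p.\<close>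
    then have e2: "e / (4 * (?l\<^sup>2 + 1)) > 0" using e by simp
    have b0: "b > 0" using ab by simp
    obtain \<eta> where h: "bump 0 b \<eta>" "(LINT x|lborel. \<eta> x) = 1" "(LINT x|lborel. (x powr s * \<eta> x)\<^sup>2) < e / (4 * (?l\<^sup>2 + 1))"
      by (rule bump_small_weight[OF b0 s e2])
    have "?l\<^sup>2 * (LINT x|lborel. (x powr s * \<eta> x)\<^sup>2) \<le> ?l\<^sup>2 * (e / (4 * (?l\<^sup>2 + 1)))"
      using h(3) by (intro mult_left_mono) auto
    also have "\<dots> \<le> e / 4" using e l1 by (simp add: divide_simps)
    finally have "2 * (LINT x|lborel. (?F x - x powr s * p x)\<^sup>2) + 2 * (?l\<^sup>2 * (LINT x|lborel. (x powr s * \<eta> x)\<^sup>2)) < e"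
      using p(2) by linarith
    moreover have "bump a b \<eta>" using h(1) True by simp
    ultimately show ?thesis using correct[OF p(1) _ h(2)] that by (meson order_le_less_trans)
  next
    case False
    then have a0: "a > 0" using ab by simp
    obtain \<eta> where h: "bump a b \<eta>" "(LINT x|lborel. \<eta> x) = 1" using bump_normalized[OF ab(2)] by metis
    let ?A = "LINT x|lborel. (x powr s * \<eta> x)\<^sup>2"
    let ?k = "\<lambda>t. indicator {a..b} t * t powr (- s)"
    have kint: "integrable lborel ?k" by (rule integrable_powr_Icc[OF a0])
    have km: "?k \<in> borel_measurable lborel" using kint by simp
    have k2: "integrable lborel (\<lambda>t. (?k t)\<^sup>2)" unfolding square_indicator_powr by (rule integrable_powr_Icc[OF a0])
    let ?K = "LINT t|lborel. (?k t)\<^sup>2"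
    have KA: "?K * ?A \<ge> 0" by simp
    then have KA1: "1 + ?K * ?A > 0" by linarith
    \<comment> \<open>For a > 0 the function \<eta> is fixed first. Since F has weighted mean zero,
      the mean of p is, up to sign, the weighted integral of the error, and Cauchy-Schwarz bounds
      its square by ?K times the squared error; the tolerance anticipates this.\<close>
    have e2: "e / (2 * (1 + ?K * ?A)) > 0" using e KA1 by simp
    obtain p where p: "bump a b p" "(LINT x|lborel. (?F x - x powr s * p x)\<^sup>2) < e / (2 * (1 + ?K * ?A))"
      by (rule weighted_bump_approx[OF ab s0 F e2])
    let ?l = "LINT x|lborel. p x" and ?E = "LINT x|lborel. (?F x - x powr s * p x)\<^sup>2"
    have kp: "?k t * (t powr s * p t) = p t" for t
    proof (cases "t \<in> {a..b}")
      case True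
      then have "t powr (- s) * t powr s = 1" using a0 by (simp add: powr_minus)
      then show ?thesis using True by (simp add: mult.assoc[symmetric])
    next
      case False
      then show ?thesis using bump_zero[OF p(1), of t] by auto
    qed
    have "(LINT t|lborel. ?k t * (?F t - t powr s * p t)) = (LINT t|lborel. ?k t * ?F t - p t)"
      by (simp only: right_diff_distrib kp)
    also have "\<dots> = (LINT t|lborel. ?k t * ?F t) - ?l"
      by (intro Bochner_Integration.integral_diff integrable_square_bound[OF km Fm k2 F2] bump_square_integrable(1)[OF p(1)])
    also have "(\<lambda>t. ?k t * ?F t) = (\<lambda>t. ?k t * F t)" by (auto simp: indicator_def)
    also have "(LINT t|lborel. ?k t * F t) = 0" by (rule mean[OF a0])
    finally have "?l\<^sup>2 = (LINT t|lborel. ?k t * (?F t - t powr s * p t))\<^sup>2" by simp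
    also have "\<dots> \<le> ?K * ?E"
      by (rule Cauchy_Schwarz_integral[OF km borel_measurable_diff[OF Fm pm[OF p(1)]] k2 err[OF p(1)]])
    finally have "?l\<^sup>2 * ?A \<le> ?K * ?E * ?A" by (intro mult_right_mono) auto
    then have "2 * ?E + 2 * (?l\<^sup>2 * ?A) \<le> 2 * (1 + ?K * ?A) * ?E" by (simp add: algebra_simps)
    also have "\<dots> < e" using p(2) KA1 by (simp add: pos_less_divide_eq mult_ac)
    finally show ?thesis using correct[OF p(1) h] that by (meson order_le_less_trans)
  qed
qed

text \<open>In terms of w = x^(-s) g the form is the squared weighted norm of w', so approximating F
  by x^s p with mean-zero bumps p means approximating by derivatives of admissible w. Their
  primitives converge pointwise to G, and Fatou's lemma transfers the inequality. \<open>Ga\<close>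
  is conditional on a > 0 because at 0 the mean of p is corrected at arbitrarily small cost.\<close>

lemma rayleigh_extension:
  fixes F G :: "real \<Rightarrow> real"
  assumes ab: "0 \<le> a" "a < b" and s: "s > 1/2" and m: "m > 0"
    and bumps: "\<And>w w'. bump a b w \<Longrightarrow> (\<And>x. (w has_real_derivative w' x) (at x)) \<Longrightarrow>
      m * (LINT x|lborel. (x powr s * w x)\<^sup>2) \<le> (LINT x|lborel. (x powr s * w' x)\<^sup>2)"
    and F: "F \<in> borel_measurable borel" "integrable lborel (\<lambda>x. (F x)\<^sup>2)"
    and G: "G \<in> borel_measurable borel"
    and prim: "\<And>x y. 0 < x \<Longrightarrow> x \<le> y \<Longrightarrow> G y - G x = (LINT t|lborel. (indicator {x..y} t * t powr (- s)) * F t)"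
    and Gb: "G b = 0" and Ga: "a > 0 \<Longrightarrow> G a = 0"
  shows "integrable lborel (\<lambda>x. (indicator {a<..<b} x * (x powr s * G x))\<^sup>2)"
    "m * (LINT x|lborel. (indicator {a<..<b} x * (x powr s * G x))\<^sup>2) \<le> (LINT x|lborel. (indicator {a..b} x * F x)\<^sup>2)"
proof -
  let ?F = "\<lambda>x. indicator {a..b} x * F x"
  have s0: "s > 0" using s by simp
  have Fm: "?F \<in> borel_measurable lborel" using F(1) by measurable
  have F2: "integrable lborel (\<lambda>x. (?F x)\<^sup>2)"
  proof (rule Bochner_Integration.integrable_bound[OF F(2)])
    show "(\<lambda>x. (?F x)\<^sup>2) \<in> borel_measurable lborel" using Fm by measurable
  qed (auto simp: indicator_def)
  have mean: "(LINT t|lborel. (indicator {a..b} t * t powr (- s)) * F t) = 0" if "a > 0"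
    using prim[of a b] that ab Gb Ga by simp
  have "\<forall>n. \<exists>p. bump a b p \<and> (LINT x|lborel. p x) = 0 \<and> (LINT x|lborel. (?F x - x powr s * p x)\<^sup>2) < 1 / real (Suc n)"
  proof
    fix n show "\<exists>p. bump a b p \<and> (LINT x|lborel. p x) = 0 \<and> (LINT x|lborel. (?F x - x powr s * p x)\<^sup>2) < 1 / real (Suc n)"
      by (rule weighted_bump_approx_mean_zero[OF ab s F mean, where e = "1 / real (Suc n)"]) auto
  qed
  from choice[OF this] obtain p where P: "\<forall>n. bump a b (p n) \<and> (LINT x|lborel. p n x) = 0 \<and>
    (LINT x|lborel. (?F x - x powr s * p n x)\<^sup>2) < 1 / real (Suc n)" by (rule exE)
  have p: "bump a b (p n)" "(LINT x|lborel. p n x) = 0"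
    "(LINT x|lborel. (?F x - x powr s * p n x)\<^sup>2) < 1 / real (Suc n)" for n
    using spec[OF P, of n] by blast+
  have "\<forall>n. \<exists>w. bump a b w \<and> (\<forall>x. (w has_real_derivative p n x) (at x)) \<and> (\<forall>x\<le>b. w x = - (LINT t|lborel. indicator {x..b} t * p n t))"
  proof
    fix n
    show "\<exists>w. bump a b w \<and> (\<forall>x. (w has_real_derivative p n x) (at x)) \<and> (\<forall>x\<le>b. w x = - (LINT t|lborel. indicator {x..b} t * p n t))"
      by (rule bump_antiderivative[OF p(1,2), of n]) blast
  qed
  from choice[OF this] obtain w where W: "\<forall>n. bump a b (w n) \<and> (\<forall>x. (w n has_real_derivative p n x) (at x)) \<and>
    (\<forall>x\<le>b. w n x = - (LINT t|lborel. indicator {x..b} t * p n t))" by (rule exE)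
  have w: "bump a b (w n)" "(w n has_real_derivative p n x) (at x)"
    "x \<le> b \<Longrightarrow> w n x = - (LINT t|lborel. indicator {x..b} t * p n t)" for n x
    using spec[OF W, of n] by blast+
  have e0: "(\<lambda>n. 1 / real (Suc n)) \<longlonglongrightarrow> 0"
    using LIMSEQ_inverse_real_of_nat by (simp add: inverse_eq_divide)
  have pm: "(\<lambda>x. x powr s * v x) \<in> borel_measurable lborel" if "bump a b v" for v
    using smooth_borel[OF bump_smooth[OF that]] by measurable
  note p2 = bump_weight_square_integrable[OF _ ab(1) s0]
  have err: "integrable lborel (\<lambda>x. (?F x - x powr s * p n x)\<^sup>2)" for n
    using integrable_square_lincomb(1)[OF Fm pm[OF p(1)] F2 p2[OF p(1)], of 1] by simp
  let ?c = "\<lambda>n. (1 / m) * (sqrt (1 / real (Suc n)) + sqrt (LINT x|lborel. (?F x)\<^sup>2))\<^sup>2"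
  have "?c \<longlonglongrightarrow> (1 / m) * (sqrt 0 + sqrt (LINT x|lborel. (?F x)\<^sup>2))\<^sup>2"
    by (intro tendsto_intros e0)
  then have c: "?c \<longlonglongrightarrow> (1 / m) * (LINT x|lborel. (?F x)\<^sup>2)" by simp
  have bd: "(LINT x|lborel. (x powr s * w n x)\<^sup>2) \<le> ?c n" for n
  proof -
    have "sqrt (LINT x|lborel. (- (?F x - x powr s * p n x) + ?F x)\<^sup>2) \<le> sqrt (LINT x|lborel. (- (?F x - x powr s * p n x))\<^sup>2) + sqrt (LINT x|lborel. (?F x)\<^sup>2)"
    proof (rule integral_square_triangle[OF _ Fm _ F2])
      show "(\<lambda>x. - (?F x - x powr s * p n x)) \<in> borel_measurable lborel"
        by (intro borel_measurable_uminus borel_measurable_diff Fm pm[OF p(1)])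
      show "integrable lborel (\<lambda>x. (- (?F x - x powr s * p n x))\<^sup>2)" using err by (simp only: power2_minus)
    qed
    also have "sqrt (LINT x|lborel. (- (?F x - x powr s * p n x))\<^sup>2) \<le> sqrt (1 / real (Suc n))"
      unfolding power2_minus by (intro real_sqrt_le_mono less_imp_le p(3))
    finally have "sqrt (LINT x|lborel. (x powr s * p n x)\<^sup>2) \<le> sqrt (1 / real (Suc n)) + sqrt (LINT x|lborel. (?F x)\<^sup>2)"
      by simp
    from power_mono[OF this, of 2]
    have "(LINT x|lborel. (x powr s * p n x)\<^sup>2) \<le> (sqrt (1 / real (Suc n)) + sqrt (LINT x|lborel. (?F x)\<^sup>2))\<^sup>2" by simp
    moreover have "m * (LINT x|lborel. (x powr s * w n x)\<^sup>2) \<le> (LINT x|lborel. (x powr s * p n x)\<^sup>2)"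
      by (rule bumps[OF w(1,2)])
    ultimately have "m * (LINT x|lborel. (x powr s * w n x)\<^sup>2) \<le> (sqrt (1 / real (Suc n)) + sqrt (LINT x|lborel. (?F x)\<^sup>2))\<^sup>2"
      by linarith
    then show ?thesis using m by (simp add: pos_le_divide_eq mult.commute)
  qed
  \<comment> \<open>Integration starts from b, where both functions vanish, and stays away from the
    singularity of the weight at 0.\<close>
  have conv: "(\<lambda>n. w n x) \<longlonglongrightarrow> G x" if x: "a < x" "x < b" for x
  proof -
    have x0: "x > 0" using x ab by simp
    let ?k = "\<lambda>t. indicator {x..b} t * t powr (- s)"
    have kint: "integrable lborel ?k" by (rule integrable_powr_Icc[OF x0])
    have km: "?k \<in> borel_measurable lborel" using kint by simp
    have k2: "integrable lborel (\<lambda>t. (?k t)\<^sup>2)" unfolding square_indicator_powr by (rule integrable_powr_Icc[OF x0])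
    have wG: "w n x - G x = (LINT t|lborel. ?k t * (?F t - t powr s * p n t))" for n
    proof -
      have kp: "?k t * (t powr s * p n t) = indicator {x..b} t * p n t" for t
      proof (cases "t \<in> {x..b}")
        case True
        then have "t powr (- s) * t powr s = 1" using x0 by (simp add: powr_minus)
        then show ?thesis using True by (simp add: mult.assoc[symmetric])
      qed simp
      have pi: "integrable lborel (\<lambda>t. indicator {x..b} t * p n t)"
        by (rule integrable_mult_bounded[OF bump_square_integrable(1)[OF p(1)], where B = 1]) (auto simp: indicator_def)
      have "(LINT t|lborel. ?k t * (?F t - t powr s * p n t)) = (LINT t|lborel. ?k t * ?F t - indicator {x..b} t * p n t)"
        by (simp only: right_diff_distrib kp)
      also have "\<dots> = (LINT t|lborel. ?k t * ?F t) - (LINT t|lborel. indicator {x..b} t * p n t)"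
        by (intro Bochner_Integration.integral_diff integrable_square_bound[OF km Fm k2 F2] pi)
      also have "(\<lambda>t. ?k t * ?F t) = (\<lambda>t. ?k t * F t)" using x by (auto simp: indicator_def)
      also have "(LINT t|lborel. ?k t * F t) = G b - G x" using prim[OF x0, of b] x by simp
      also have "(LINT t|lborel. indicator {x..b} t * p n t) = - w n x" using w(3)[of x n] x by simp
      finally show ?thesis using Gb by simp
    qed
    show ?thesis
    proof (rule LIM_zero_cancel, rule Lim_null_comparison)
      show "(\<lambda>n. sqrt ((LINT t|lborel. (?k t)\<^sup>2) * (1 / real (Suc n)))) \<longlonglongrightarrow> 0"
        using tendsto_real_sqrt[OF tendsto_mult[OF tendsto_const e0, of "LINT t|lborel. (?k t)\<^sup>2"]] by simp
      show "\<forall>\<^sub>F n in sequentially. norm (w n x - G x) \<le> sqrt ((LINT t|lborel. (?k t)\<^sup>2) * (1 / real (Suc n)))"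
      proof (rule always_eventually, rule allI)
        fix n
        have "(w n x - G x)\<^sup>2 \<le> (LINT t|lborel. (?k t)\<^sup>2) * (LINT x|lborel. (?F x - x powr s * p n x)\<^sup>2)"
          unfolding wG by (rule Cauchy_Schwarz_integral[OF km borel_measurable_diff[OF Fm pm[OF p(1)]] k2 err])
        also have "\<dots> \<le> (LINT t|lborel. (?k t)\<^sup>2) * (1 / real (Suc n))"
          by (rule mult_left_mono[OF less_imp_le[OF p(3)]]) simp
        finally show "norm (w n x - G x) \<le> sqrt ((LINT t|lborel. (?k t)\<^sup>2) * (1 / real (Suc n)))"
          by (intro real_le_rsqrt) simp
      qed
    qed
  qed
  let ?G = "\<lambda>x. indicator {a<..<b} x * (x powr s * G x)"
  have Gm: "?G \<in> borel_measurable lborel" using G by measurable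
  have lim: "AE x in lborel. (\<lambda>n. x powr s * w n x) \<longlonglongrightarrow> ?G x"
  proof (rule AE_I2)
    fix x show "(\<lambda>n. x powr s * w n x) \<longlonglongrightarrow> ?G x"
    proof (cases "x \<in> {a<..<b}")
      case True
      then show ?thesis using tendsto_mult[OF tendsto_const conv[of x], of "x powr s"] by simp
    next
      case False
      then show ?thesis using bump_zero[OF w(1) False] by simp
    qed
  qed
  note fat = fatou_square[OF Gm pm[OF w(1)] p2[OF w(1)] lim bd c]
  show "integrable lborel (\<lambda>x. (?G x)\<^sup>2)" by (rule fat(1))
  show "m * (LINT x|lborel. (?G x)\<^sup>2) \<le> (LINT x|lborel. (?F x)\<^sup>2)"
    using fat(2) m by (simp add: pos_le_divide_eq mult.commute)
qed

section \<open>Spectral floors and quadratic forms\<close>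

lemma L2_D:
  assumes "f \<in> L2 S" "S \<in> sets borel"
  shows "(\<lambda>x. indicator S x *\<^sub>R f x) \<in> borel_measurable lborel"
    "integrable lborel (\<lambda>x. (indicator S x * cmod (f x))\<^sup>2)"
    "(\<lambda>x. indicator S x * cmod (f x)) \<in> borel_measurable lborel"
proof -
  show m: "(\<lambda>x. indicator S x *\<^sub>R f x) \<in> borel_measurable lborel"
    using assms by (simp add: L2_def set_borel_measurable_def)
  have "(\<lambda>x. cmod (indicator S x *\<^sub>R f x)) \<in> borel_measurable lborel"
    by (rule measurable_compose[OF m borel_measurable_norm])
  then show "(\<lambda>x. indicator S x * cmod (f x)) \<in> borel_measurable lborel" by simp
  have "indicator S x *\<^sub>R (cmod (f x))\<^sup>2 = (indicator S x * cmod (f x))\<^sup>2" for x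
    by (simp add: indicator_def)
  then show "integrable lborel (\<lambda>x. (indicator S x * cmod (f x))\<^sup>2)"
    using assms by (simp add: L2_def set_integrable_def)
qed

lemma L2_I:
  assumes "S \<in> sets borel" "(\<lambda>x. indicator S x *\<^sub>R f x) \<in> borel_measurable lborel"
    "integrable lborel (\<lambda>x. (indicator S x * cmod (f x))\<^sup>2)"
  shows "f \<in> L2 S"
proof -
  have "indicator S x *\<^sub>R (cmod (f x))\<^sup>2 = (indicator S x * cmod (f x))\<^sup>2" for x
    by (simp add: indicator_def)
  then show ?thesis using assms by (simp add: L2_def set_integrable_def set_borel_measurable_def)
qed

lemma L2_norm_square:
  "(L2_norm S f)\<^sup>2 = (LINT x|lborel. (indicator S x * cmod (f x))\<^sup>2)"
proof -
  have "indicator S x *\<^sub>R (cmod (f x))\<^sup>2 = (indicator S x * cmod (f x))\<^sup>2" for x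
    by (simp add: indicator_def)
  then show ?thesis by (simp add: L2_norm_def set_lebesgue_integral_def)
qed

lemma L2_norm_nonneg: "0 \<le> L2_norm S f"
  by (simp add: L2_norm_def set_lebesgue_integral_def)

lemma L2_inner_integrable:
  assumes f: "f \<in> L2 S" and g: "g \<in> L2 S" and S: "S \<in> sets borel"
  shows "integrable lborel (\<lambda>x. indicator S x *\<^sub>R (f x * cnj (g x)))"
proof -
  note F = L2_D[OF f S] and G = L2_D[OF g S]
  have e: "indicator S x *\<^sub>R (f x * cnj (g x)) = (indicator S x *\<^sub>R f x) * cnj (indicator S x *\<^sub>R g x)" for x
    by (simp add: indicator_def)
  show ?thesis
  proof (rule Bochner_Integration.integrable_bound)
    show "integrable lborel (\<lambda>x. (indicator S x * cmod (f x)) * (indicator S x * cmod (g x)))"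
      by (rule integrable_square_bound[OF F(3) G(3) F(2) G(2)])
    show "(\<lambda>x. indicator S x *\<^sub>R (f x * cnj (g x))) \<in> borel_measurable lborel"
      unfolding e using F(1) G(1)
      by (intro borel_measurable_times borel_measurable_continuous_on[of cnj, OF continuous_on_cnj[OF continuous_on_id]])
    show "AE x in lborel. norm (indicator S x *\<^sub>R (f x * cnj (g x))) \<le> norm ((indicator S x * cmod (f x)) * (indicator S x * cmod (g x)))"
      by (intro AE_I2) (simp add: indicator_def norm_mult)
  qed
qed

lemma L2_inner_bound:
  assumes f: "f \<in> L2 S" and g: "g \<in> L2 S" and S: "S \<in> sets borel"
  shows "cmod (L2_inner S f g) \<le> L2_norm S f * L2_norm S g"
proof -
  note F = L2_D[OF f S] and G = L2_D[OF g S]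
  have "cmod (L2_inner S f g) \<le> (LINT x|lborel. cmod (indicator S x *\<^sub>R (f x * cnj (g x))))"
    unfolding L2_inner_def set_lebesgue_integral_def by (rule integral_norm_bound)
  also have "\<dots> = (LINT x|lborel. (indicator S x * cmod (f x)) * (indicator S x * cmod (g x)))"
    by (intro Bochner_Integration.integral_cong refl) (simp add: indicator_def norm_mult)
  finally have 1: "cmod (L2_inner S f g) \<le> (LINT x|lborel. (indicator S x * cmod (f x)) * (indicator S x * cmod (g x)))" .
  have "(cmod (L2_inner S f g))\<^sup>2 \<le> (LINT x|lborel. (indicator S x * cmod (f x)) * (indicator S x * cmod (g x)))\<^sup>2"
    by (intro power_mono 1) simp
  also have "\<dots> \<le> (LINT x|lborel. (indicator S x * cmod (f x))\<^sup>2) * (LINT x|lborel. (indicator S x * cmod (g x))\<^sup>2)"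
    by (rule Cauchy_Schwarz_integral[OF F(3) G(3) F(2) G(2)])
  also have "\<dots> = (L2_norm S f * L2_norm S g)\<^sup>2"
    by (simp only: L2_norm_square power_mult_distrib)
  finally show ?thesis
    by (rule power2_le_imp_le) (intro mult_nonneg_nonneg L2_norm_nonneg)
qed

lemma L2_inner_commute: "L2_inner S g f = cnj (L2_inner S f g)"
proof -
  have "cnj (L2_inner S f g) = (LINT x|lborel. cnj (indicator S x *\<^sub>R (f x * cnj (g x))))"
    unfolding L2_inner_def set_lebesgue_integral_def by (rule Bochner_Integration.integral_cnj[symmetric])
  also have "\<dots> = L2_inner S g f"
    unfolding L2_inner_def set_lebesgue_integral_def by (simp add: mult.commute)
  finally show ?thesis by simp
qed

lemma L2_inner_diff_left:
  assumes "f \<in> L2 S" "g \<in> L2 S" "h \<in> L2 S" "S \<in> sets borel"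
  shows "L2_inner S (\<lambda>x. f x - c * g x) h = L2_inner S f h - c * L2_inner S g h"
proof -
  have "L2_inner S (\<lambda>x. f x - c * g x) h = (LINT x|lborel. indicator S x *\<^sub>R (f x * cnj (h x)) - c * (indicator S x *\<^sub>R (g x * cnj (h x))))"
    unfolding L2_inner_def set_lebesgue_integral_def
    by (intro Bochner_Integration.integral_cong refl) (simp add: algebra_simps indicator_def)
  also have "\<dots> = L2_inner S f h - c * L2_inner S g h"
    unfolding L2_inner_def set_lebesgue_integral_def
    by (simp only: Bochner_Integration.integral_diff[OF L2_inner_integrable[OF assms(1,3,4)]
          integrable_mult_right[OF L2_inner_integrable[OF assms(2,3,4)]]] integral_mult_right_zero)
  finally show ?thesis .
qed

lemma L2_inner_diff_right:
  assumes "f \<in> L2 S" "g \<in> L2 S" "h \<in> L2 S" "S \<in> sets borel"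
  shows "L2_inner S h (\<lambda>x. f x - c * g x) = L2_inner S h f - cnj c * L2_inner S h g"
  using L2_inner_diff_left[OF assms, of c]
  by (subst (1 2 3) L2_inner_commute) simp

lemma L2_inner_self:
  assumes "f \<in> L2 S" "S \<in> sets borel"
  shows "L2_inner S f f = of_real ((L2_norm S f)\<^sup>2)"
proof -
  have "L2_inner S f f = (LINT x|lborel. complex_of_real ((indicator S x * cmod (f x))\<^sup>2))"
    unfolding L2_inner_def set_lebesgue_integral_def
  proof (intro Bochner_Integration.integral_cong refl)
    fix x show "indicator S x *\<^sub>R (f x * cnj (f x)) = complex_of_real ((indicator S x * cmod (f x))\<^sup>2)"
      by (cases "x \<in> S") (simp_all add: complex_norm_square del: of_real_power)
  qed
  also have "\<dots> = of_real (LINT x|lborel. (indicator S x * cmod (f x))\<^sup>2)"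
    by (rule integral_complex_of_real)
  finally show ?thesis by (simp only: L2_norm_square)
qed

lemma L2_diff:
  assumes f: "f \<in> L2 S" and g: "g \<in> L2 S" and S: "S \<in> sets borel"
  shows "(\<lambda>x. f x - c * g x) \<in> L2 S"
proof (rule L2_I[OF S])
  note F = L2_D[OF f S] and G = L2_D[OF g S]
  have e: "indicator S x *\<^sub>R (f x - c * g x) = indicator S x *\<^sub>R f x - c * (indicator S x *\<^sub>R g x)" for x
    by (simp add: algebra_simps)
  show m: "(\<lambda>x. indicator S x *\<^sub>R (f x - c * g x)) \<in> borel_measurable lborel"
    unfolding e using F(1) G(1) by (intro borel_measurable_diff borel_measurable_times borel_measurable_const)
  show "integrable lborel (\<lambda>x. (indicator S x * cmod (f x - c * g x))\<^sup>2)"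
  proof (rule Bochner_Integration.integrable_bound)
    show "integrable lborel (\<lambda>x. 2 * (indicator S x * cmod (f x))\<^sup>2 + 2 * ((cmod c)\<^sup>2 * (indicator S x * cmod (g x))\<^sup>2))"
      using F(2) G(2) by simp
    have "(\<lambda>x. (cmod (indicator S x *\<^sub>R (f x - c * g x)))\<^sup>2) \<in> borel_measurable lborel"
      by (intro borel_measurable_power measurable_compose[OF m borel_measurable_norm])
    then show "(\<lambda>x. (indicator S x * cmod (f x - c * g x))\<^sup>2) \<in> borel_measurable lborel" by simp
    show "AE x in lborel. norm ((indicator S x * cmod (f x - c * g x))\<^sup>2)
      \<le> norm (2 * (indicator S x * cmod (f x))\<^sup>2 + 2 * ((cmod c)\<^sup>2 * (indicator S x * cmod (g x))\<^sup>2))"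
    proof (rule AE_I2)
      fix x
      have "cmod (f x - c * g x) \<le> cmod (f x) + cmod c * cmod (g x)"
        using norm_triangle_ineq4[of "f x" "c * g x"] by (simp add: norm_mult)
      then have "(cmod (f x - c * g x))\<^sup>2 \<le> (cmod (f x) + cmod c * cmod (g x))\<^sup>2" by (intro power_mono) auto
      also have "\<dots> \<le> 2 * (cmod (f x))\<^sup>2 + 2 * (cmod c * cmod (g x))\<^sup>2"
        using zero_le_power2[of "cmod (f x) - cmod c * cmod (g x)"] by (simp add: power2_eq_square algebra_simps)
      finally show "norm ((indicator S x * cmod (f x - c * g x))\<^sup>2)
        \<le> norm (2 * (indicator S x * cmod (f x))\<^sup>2 + 2 * ((cmod c)\<^sup>2 * (indicator S x * cmod (g x))\<^sup>2))"
        by (simp add: indicator_def power_mult_distrib)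
    qed
  qed
qed

lemma L2_eq_imp:
  assumes "L2_eq S f g" "f \<in> L2 S" "g \<in> L2 S" "S \<in> sets borel"
  shows "L2_norm S f = L2_norm S g" "\<And>h. h \<in> L2 S \<Longrightarrow> L2_inner S h f = L2_inner S h g"
proof -
  have "(L2_norm S f)\<^sup>2 = (L2_norm S g)\<^sup>2"
    unfolding L2_norm_square
  proof (rule integral_cong_AE)
    show "AE x in lborel. (indicator S x * cmod (f x))\<^sup>2 = (indicator S x * cmod (g x))\<^sup>2"
      using assms(1) unfolding L2_eq_def by eventually_elim (auto simp: indicator_def)
  qed (use L2_D[OF assms(2,4)] L2_D[OF assms(3,4)] in auto)
  then show "L2_norm S f = L2_norm S g" using L2_norm_nonneg by (metis power2_eq_iff_nonneg)
  show "L2_inner S h f = L2_inner S h g" if h: "h \<in> L2 S" for h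
    unfolding L2_inner_def set_lebesgue_integral_def
  proof (rule integral_cong_AE)
    show "AE x in lborel. indicator S x *\<^sub>R (h x * cnj (f x)) = indicator S x *\<^sub>R (h x * cnj (g x))"
      using assms(1) unfolding L2_eq_def by eventually_elim (auto simp: indicator_def)
  qed (use L2_inner_integrable[OF h assms(2,4)] L2_inner_integrable[OF h assms(3,4)] in auto)
qed

text \<open>Cauchy-Schwarz for a positive semidefinite Hermitian form on a set closed under the
  single operation f - c g, abstracted as \<open>sub\<close>. It is applied to the form of A - m on
  the operator domain.\<close>

lemma form_Cauchy_Schwarz:
  fixes b :: "'f \<Rightarrow> 'f \<Rightarrow> complex" and sub :: "'f \<Rightarrow> complex \<Rightarrow> 'f \<Rightarrow> 'f"
  assumes cl: "\<And>f g c. f \<in> D \<Longrightarrow> g \<in> D \<Longrightarrow> sub f c g \<in> D"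
    and left: "\<And>f g h c. f \<in> D \<Longrightarrow> g \<in> D \<Longrightarrow> h \<in> D \<Longrightarrow> b (sub f c g) h = b f h - c * b g h"
    and herm: "\<And>f g. f \<in> D \<Longrightarrow> g \<in> D \<Longrightarrow> b g f = cnj (b f g)"
    and nonneg: "\<And>f. f \<in> D \<Longrightarrow> 0 \<le> Re (b f f)"
    and f: "f \<in> D" and g: "g \<in> D"
  shows "(cmod (b f g))\<^sup>2 \<le> Re (b f f) * Re (b g g)"
proof (cases "b f g = 0")
  case True
  then show ?thesis using nonneg f g by simp
next
  case False
  \<comment> \<open>The phase of \<open>b f g\<close>; multiplying g by it makes the cross terms
    real, so that a real parameter t suffices.\<close>
  define c where "c = b f g / of_real (cmod (b f g))"
  have c: "cnj c * b f g = of_real (cmod (b f g))" "c * cnj c = 1"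
    using False by (simp_all add: c_def complex_norm_square[symmetric] power2_eq_square mult.commute[of "cnj _"])
  show ?thesis
  proof (rule quadratic_nonneg_discriminant)
    fix t :: real
    define h where "h = sub f (of_real t * c) g"
    have h: "h \<in> D" unfolding h_def by (rule cl[OF f g])
    have 1: "b h k = b f k - of_real t * c * b g k" if "k \<in> D" for k
      unfolding h_def by (rule left[OF f g that])
    have 2: "b h h = b f h - of_real t * c * b g h" by (rule 1[OF h])
    have 3: "b f h = b f f - of_real t * cnj c * b f g"
      using herm[OF h f] 1[OF f] herm[OF f g] herm[OF f f] by simp
    have 4: "b g h = b g f - of_real t * cnj c * b g g"
      using herm[OF h g] 1[OF g] herm[OF f g] herm[OF g g] by simp
    have 5: "c * b g f = of_real (cmod (b f g))"
      using arg_cong[OF c(1), of cnj] herm[OF f g] by simp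
    have "b h h = b f f - of_real t * (cnj c * b f g) - of_real t * (c * b g f) + of_real t * of_real t * (c * cnj c) * b g g"
      unfolding 2 3 4 by (simp add: algebra_simps)
    also have "\<dots> = b f f - of_real (2 * t * cmod (b f g)) + of_real (t\<^sup>2) * b g g"
      unfolding c 5 by (simp add: power2_eq_square algebra_simps)
    finally have "Re (b h h) = Re (b f f) - 2 * t * cmod (b f g) + t\<^sup>2 * Re (b g g)" by simp
    then show "0 \<le> Re (b f f) - 2 * t * cmod (b f g) + t\<^sup>2 * Re (b g g)" using nonneg[OF h] by simp
  qed
qed

lemma L2_inner_tendsto:
  assumes f: "f \<in> L2 S" and u: "u \<in> L2 S" and un: "\<And>n. un n \<in> L2 S" and S: "S \<in> sets borel"
    and lim: "(\<lambda>n. L2_norm S (\<lambda>x. un n x - u x)) \<longlonglongrightarrow> 0"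
  shows "(\<lambda>n. L2_inner S f (un n)) \<longlonglongrightarrow> L2_inner S f u" "(\<lambda>n. L2_inner S (un n) f) \<longlonglongrightarrow> L2_inner S u f"
proof -
  show 1: "(\<lambda>n. L2_inner S f (un n)) \<longlonglongrightarrow> L2_inner S f u"
  proof (rule LIM_zero_cancel, rule Lim_null_comparison)
    show "(\<lambda>n. L2_norm S f * L2_norm S (\<lambda>x. un n x - u x)) \<longlonglongrightarrow> 0"
      by (rule tendsto_mult_right_zero[OF lim])
    show "\<forall>\<^sub>F n in sequentially. norm (L2_inner S f (un n) - L2_inner S f u) \<le> L2_norm S f * L2_norm S (\<lambda>x. un n x - u x)"
    proof (rule always_eventually, rule allI)
      fix n
      have "L2_inner S f (un n) - L2_inner S f u = L2_inner S f (\<lambda>x. un n x - u x)"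
        using L2_inner_diff_right[OF un[of n] u f S, of 1] by simp
      then show "norm (L2_inner S f (un n) - L2_inner S f u) \<le> L2_norm S f * L2_norm S (\<lambda>x. un n x - u x)"
        using L2_inner_bound[OF f _ S] L2_diff[OF un[of n] u S, of 1] by simp
    qed
  qed
  have "(\<lambda>n. cnj (L2_inner S f (un n))) \<longlonglongrightarrow> cnj (L2_inner S f u)" by (rule tendsto_cnj[OF 1])
  then show "(\<lambda>n. L2_inner S (un n) f) \<longlonglongrightarrow> L2_inner S u f" by (simp only: L2_inner_commute[of S _ f])
qed

text \<open>The infimum \<open>m\<close> of the Rayleigh quotient lies in the spectrum: otherwise solve \<open>(T - m) u = f\<close> for a
  near-minimizer \<open>f\<close>; then \<open>\<parallel>f\<parallel>\<^sup>2\<close> is the value of the form of \<open>A - m\<close> at \<open>(f, u)\<close>, and the Cauchy-Schwarz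
  inequality for this form contradicts the smallness of its value at \<open>(f, f)\<close>.\<close>

theorem friedrichs_floor_le_form:
  assumes S: "S \<in> sets borel"
    and DL: "\<And>f. f \<in> D \<Longrightarrow> f \<in> L2 S" and AL: "\<And>f. f \<in> D \<Longrightarrow> A f \<in> L2 S"
    and cl: "\<And>f g c. f \<in> D \<Longrightarrow> g \<in> D \<Longrightarrow> (\<lambda>x. f x - c * g x) \<in> D"
    and lin: "\<And>f g c. f \<in> D \<Longrightarrow> g \<in> D \<Longrightarrow> A (\<lambda>x. f x - c * g x) = (\<lambda>x. A f x - c * A g x)"
    and herm: "\<And>f g. f \<in> D \<Longrightarrow> g \<in> D \<Longrightarrow> L2_inner S (A g) f = cnj (L2_inner S (A f) g)"
    and nonneg: "\<And>f. f \<in> D \<Longrightarrow> 0 \<le> Re (L2_inner S (A f) f)"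
    and res: "\<And>z. Re z < \<kappa> \<Longrightarrow> z \<notin> op_spectrum S (friedrichs S D A)"
    and f0: "f0 \<in> D"
  shows "\<kappa> * (L2_norm S f0)\<^sup>2 \<le> Re (L2_inner S (A f0) f0)"
proof (rule ccontr)
  assume neg: "\<not> ?thesis"
  let ?N = "L2_norm S" and ?q = "\<lambda>f. Re (L2_inner S (A f) f)"
  define R where "R = {?q f / (?N f)\<^sup>2 | f. f \<in> D \<and> ?N f > 0}"
  define m where "m = Inf R"
  have N0: "?N f0 > 0"
  proof (rule ccontr)
    assume "\<not> ?N f0 > 0"
    then have "?N f0 = 0" using L2_norm_nonneg[of S f0] by linarith
    then show False using neg nonneg[OF f0] by simp
  qed
  have Rne: "R \<noteq> {}" unfolding R_def using f0 N0 by blast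
  have R0: "0 \<le> r" if "r \<in> R" for r using that nonneg unfolding R_def by auto
  have bdd: "bdd_below R" using R0 by (rule bdd_belowI)
  have m0: "0 \<le> m" unfolding m_def by (rule cInf_greatest[OF Rne R0])
  have "m \<le> ?q f0 / (?N f0)\<^sup>2" unfolding m_def by (rule cInf_lower[OF _ bdd]) (use f0 N0 in \<open>auto simp: R_def\<close>)
  also have "\<dots> < \<kappa>" using neg N0 by (simp add: pos_divide_less_eq)
  finally have mk: "m < \<kappa>" .
  have mq: "m * (?N f)\<^sup>2 \<le> ?q f" if "f \<in> D" for f
  proof (cases "?N f > 0")
    case True
    have "m \<le> ?q f / (?N f)\<^sup>2" unfolding m_def by (rule cInf_lower[OF _ bdd]) (use that True in \<open>auto simp: R_def\<close>)
    then show ?thesis using True by (simp add: pos_le_divide_eq)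
  next
    case False
    then have "?N f = 0" using L2_norm_nonneg[of S f] by linarith
    then show ?thesis using nonneg[OF that] by simp
  qed
  \<comment> \<open>The form of A - m on D, nonnegative because m is the infimum of the Rayleigh
    quotient.\<close>
  define b where "b = (\<lambda>f g. L2_inner S (A f) g - of_real m * L2_inner S f g)"
  have bself: "Re (b f f) = ?q f - m * (?N f)\<^sup>2" if "f \<in> D" for f
    by (simp add: b_def L2_inner_self[OF DL[OF that] S])
  have bnn: "0 \<le> Re (b f f)" if "f \<in> D" for f using mq[OF that] bself[OF that] by simp
  have bherm: "b g f = cnj (b f g)" if "f \<in> D" "g \<in> D" for f g
    by (simp add: b_def herm[OF that] L2_inner_commute[of S g f])
  have bleft: "b (\<lambda>x. f x - c * g x) h = b f h - c * b g h" if "f \<in> D" "g \<in> D" "h \<in> D" for f g h c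
    unfolding b_def lin[OF that(1,2)] L2_inner_diff_left[OF AL[OF that(1)] AL[OF that(2)] DL[OF that(3)] S]
      L2_inner_diff_left[OF DL[OF that(1)] DL[OF that(2)] DL[OF that(3)] S]
    by (simp add: algebra_simps)
  have CS: "(cmod (b f g))\<^sup>2 \<le> Re (b f f) * Re (b g g)" if "f \<in> D" "g \<in> D" for f g
    by (rule form_Cauchy_Schwarz[where D = D and sub = "\<lambda>f c g x. f x - c * g x", OF cl bleft bherm bnn that])
  have "of_real m \<notin> op_spectrum S (friedrichs S D A)" by (rule res) (simp add: mk)
  then obtain C where surj: "\<And>h. h \<in> L2 S \<Longrightarrow> \<exists>u w. friedrichs S D A u w \<and> L2_eq S (\<lambda>x. w x - of_real m * u x) h"
    and C: "\<And>u w. friedrichs S D A u w \<Longrightarrow> ?N u \<le> C * ?N (\<lambda>x. w x - of_real m * u x)"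
    unfolding op_spectrum_def by auto
  \<comment> \<open>Makes \<delta> (2 |C| + 1) equal to 1/2, the factor that produces the
    contradiction at the end.\<close>
  define \<delta> where "\<delta> = 1 / (2 * (2 * \<bar>C\<bar> + 1))"
  have d: "\<delta> > 0" by (simp add: \<delta>_def add_nonneg_pos)
  have "Inf R < m + \<delta>" using d by (simp add: m_def)
  then obtain r where r: "r \<in> R" "r < m + \<delta>" using cInf_lessD[OF Rne] by blast
  from r(1) obtain f where f: "f \<in> D" "?N f > 0" "r = ?q f / (?N f)\<^sup>2" unfolding R_def by blast
  have fd: "Re (b f f) \<le> \<delta> * (?N f)\<^sup>2"
  proof -
    have "?q f < (m + \<delta>) * (?N f)\<^sup>2" using r(2) f(2,3) by (simp add: pos_divide_less_eq)
    then show ?thesis unfolding bself[OF f(1)] by (simp add: algebra_simps)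
  qed
  from surj[OF DL[OF f(1)]] obtain u w where T: "friedrichs S D A u w" and eq: "L2_eq S (\<lambda>x. w x - of_real m * u x) f" by blast
  have uL: "u \<in> L2 S" and wL: "w \<in> L2 S" and adj: "\<And>g. g \<in> D \<Longrightarrow> L2_inner S (A g) u = L2_inner S g w"
    using T unfolding friedrichs_def by auto
  obtain un where un: "\<And>n. un n \<in> D" "(\<lambda>n. ?N (\<lambda>x. un n x - u x)) \<longlonglongrightarrow> 0"
    and cau: "\<And>\<epsilon>. \<epsilon> > 0 \<Longrightarrow> \<exists>N. \<forall>m\<ge>N. \<forall>n\<ge>N. cmod (L2_inner S (A (\<lambda>x. un m x - un n x)) (\<lambda>x. un m x - un n x)) < \<epsilon>"
    using T unfolding friedrichs_def by blast
  have wuL: "(\<lambda>x. w x - of_real m * u x) \<in> L2 S" by (rule L2_diff[OF wL uL S])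
  have bu: "L2_inner S (A g) u - of_real m * L2_inner S g u = L2_inner S g f" if "g \<in> D" for g
  proof -
    have "L2_inner S g (\<lambda>x. w x - of_real m * u x) = L2_inner S g w - of_real m * L2_inner S g u"
      using L2_inner_diff_right[OF wL uL DL[OF that] S, of "of_real m"] by simp
    then show ?thesis using adj[OF that] L2_eq_imp(2)[OF eq wuL DL[OF f(1)] S DL[OF that]] by simp
  qed
  have Nu: "?N u \<le> \<bar>C\<bar> * ?N f"
  proof -
    have "?N u \<le> C * ?N f" using C[OF T] L2_eq_imp(1)[OF eq wuL DL[OF f(1)] S] by simp
    also have "\<dots> \<le> \<bar>C\<bar> * ?N f" using f(2) by (intro mult_right_mono) auto
    finally show ?thesis .
  qed
  have unL: "un n \<in> L2 S" for n by (rule DL[OF un(1)])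
  \<comment> \<open>With g fixed in D the form is L2-continuous in its second argument, because A
    acts on g; the equation solved by u identifies the limit as the inner product of g with
    f.\<close>
  have blim: "(\<lambda>k. b g (un k)) \<longlonglongrightarrow> L2_inner S g f" if "g \<in> D" for g
    unfolding bu[OF that, symmetric] b_def
    by (intro tendsto_intros L2_inner_tendsto(1)[OF _ uL unL S un(2)] AL DL that)
  have N2: "(?N f)\<^sup>2 > 0" using f(2) by simp
  from cau[OF N2] obtain K where K: "\<And>m n. m \<ge> K \<Longrightarrow> n \<ge> K \<Longrightarrow> cmod (L2_inner S (A (\<lambda>x. un m x - un n x)) (\<lambda>x. un m x - un n x)) < (?N f)\<^sup>2" by blast
  \<comment> \<open>The form stays bounded along the approximating sequence: \<open>un n\<close> is
    split into \<open>un k\<close> and a difference whose form value is at most the squared norm of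
    f by the Cauchy condition. Cauchy-Schwarz bounds the second part, with half of ?B absorbed on
    the left, and k tends to infinity.\<close>
  have Bn: "Re (b (un n) (un n)) \<le> 2 * cmod (L2_inner S (un n) f) + (?N f)\<^sup>2" if n: "n \<ge> K" for n
  proof -
    let ?B = "Re (b (un n) (un n))"
    have "?B \<le> cmod (b (un n) (un k)) + (?B / 2 + (?N f)\<^sup>2 / 2)" if k: "k \<ge> K" for k
    proof -
      let ?d = "\<lambda>x. un n x - un k x"
      have dD: "?d \<in> D" using cl[OF un(1) un(1), of n 1 k] by simp
      have "b (un n) ?d = cnj (b ?d (un n))" by (rule bherm[OF dD un(1)])
      also have "b ?d (un n) = b (un n) (un n) - b (un k) (un n)" using bleft[OF un(1) un(1) un(1), of n 1 k n] by simp
      finally have dec: "b (un n) ?d = b (un n) (un n) - b (un n) (un k)"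
        using bherm[OF un(1) un(1), of n n] bherm[OF un(1) un(1), of n k] by simp
      have "Re (b ?d ?d) \<le> ?q ?d" unfolding bself[OF dD] using m0 by simp
      also have "\<dots> \<le> cmod (L2_inner S (A ?d) ?d)" by (rule complex_Re_le_cmod)
      also have "\<dots> \<le> (?N f)\<^sup>2" by (rule less_imp_le[OF K[OF n k]])
      finally have bd: "Re (b ?d ?d) \<le> (?N f)\<^sup>2" .
      have "(cmod (b (un n) ?d))\<^sup>2 \<le> ?B * Re (b ?d ?d)" by (rule CS[OF un(1) dD])
      also have "\<dots> \<le> ?B * (?N f)\<^sup>2" by (intro mult_left_mono bd bnn un)
      also have "\<dots> \<le> (?B / 2 + (?N f)\<^sup>2 / 2)\<^sup>2"
        using zero_le_power2[of "?B - (?N f)\<^sup>2"] by (simp add: power2_eq_square field_simps)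
      finally have "cmod (b (un n) ?d) \<le> ?B / 2 + (?N f)\<^sup>2 / 2"
        by (rule power2_le_imp_le) (use bnn[OF un(1)] in simp)
      moreover have "?B = Re (b (un n) (un k)) + Re (b (un n) ?d)" unfolding dec by simp
      ultimately show ?thesis
        using complex_Re_le_cmod[of "b (un n) (un k)"] complex_Re_le_cmod[of "b (un n) ?d"] by linarith
    qed
    then have "?B \<le> cmod (L2_inner S (un n) f) + (?B / 2 + (?N f)\<^sup>2 / 2)"
      by (intro LIMSEQ_le_const[OF tendsto_add[OF tendsto_norm[OF blim[OF un(1)]] tendsto_const]]) blast
    then show ?thesis by simp
  qed
  \<comment> \<open>Cauchy-Schwarz for f and \<open>un n\<close>, in the limit: the left side is the
    fourth power of the norm of f, while near-minimality of f puts the factor \<delta> on the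
    right.\<close>
  have "((?N f)\<^sup>2)\<^sup>2 \<le> \<delta> * (?N f)\<^sup>2 * (2 * cmod (L2_inner S u f) + (?N f)\<^sup>2)"
  proof (rule LIMSEQ_le)
    have "(\<lambda>n. (cmod (b f (un n)))\<^sup>2) \<longlonglongrightarrow> (cmod (L2_inner S f f))\<^sup>2"
      by (intro tendsto_intros blim f)
    moreover have "cmod (L2_inner S f f) = (?N f)\<^sup>2"
      by (simp add: L2_inner_self[OF DL[OF f(1)] S] norm_power)
    ultimately show "(\<lambda>n. (cmod (b f (un n)))\<^sup>2) \<longlonglongrightarrow> ((?N f)\<^sup>2)\<^sup>2" by simp
    show "(\<lambda>n. \<delta> * (?N f)\<^sup>2 * (2 * cmod (L2_inner S (un n) f) + (?N f)\<^sup>2)) \<longlonglongrightarrow> \<delta> * (?N f)\<^sup>2 * (2 * cmod (L2_inner S u f) + (?N f)\<^sup>2)"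
      by (intro tendsto_intros L2_inner_tendsto(2)[OF DL[OF f(1)] uL unL S un(2)])
    have "(cmod (b f (un n)))\<^sup>2 \<le> \<delta> * (?N f)\<^sup>2 * (2 * cmod (L2_inner S (un n) f) + (?N f)\<^sup>2)" if "n \<ge> K" for n
    proof -
      have "(cmod (b f (un n)))\<^sup>2 \<le> Re (b f f) * Re (b (un n) (un n))" by (rule CS[OF f(1) un(1)])
      also have "\<dots> \<le> \<delta> * (?N f)\<^sup>2 * (2 * cmod (L2_inner S (un n) f) + (?N f)\<^sup>2)"
        using d by (intro mult_mono fd Bn that bnn un) auto
      finally show ?thesis .
    qed
    then show "\<exists>N. \<forall>n\<ge>N. (cmod (b f (un n)))\<^sup>2 \<le> \<delta> * (?N f)\<^sup>2 * (2 * cmod (L2_inner S (un n) f) + (?N f)\<^sup>2)" by blast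
  qed
  also have "\<dots> \<le> \<delta> * (?N f)\<^sup>2 * ((2 * \<bar>C\<bar> + 1) * (?N f)\<^sup>2)"
  proof (rule mult_left_mono)
    have "cmod (L2_inner S u f) \<le> ?N u * ?N f" by (rule L2_inner_bound[OF uL DL[OF f(1)] S])
    also have "\<dots> \<le> (\<bar>C\<bar> * ?N f) * ?N f" by (intro mult_right_mono Nu L2_norm_nonneg)
    finally show "2 * cmod (L2_inner S u f) + (?N f)\<^sup>2 \<le> (2 * \<bar>C\<bar> + 1) * (?N f)\<^sup>2"
      by (simp add: power2_eq_square algebra_simps)
  qed (use d in simp)
  also have "\<dots> = (\<delta> * (2 * \<bar>C\<bar> + 1)) * ((?N f)\<^sup>2)\<^sup>2" by (simp add: power2_eq_square algebra_simps)
  also have "\<delta> * (2 * \<bar>C\<bar> + 1) = 1 / 2"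
  proof -
    have "2 * \<bar>C\<bar> + 1 \<noteq> 0" using abs_ge_zero[of C] by linarith
    then show ?thesis by (simp add: \<delta>_def)
  qed
  finally have "((?N f)\<^sup>2)\<^sup>2 \<le> 1 / 2 * ((?N f)\<^sup>2)\<^sup>2" .
  moreover have "((?N f)\<^sup>2)\<^sup>2 > 0" using N2 by simp
  ultimately show False by simp
qed

text \<open>A positive floor is finite, because \<open>real_of_ereal\<close> maps both infinities to \<open>0\<close>.\<close>

lemma spectral_floor_le_form:
  assumes DL: "\<And>f. f \<in> test_functions a b \<Longrightarrow> f \<in> L2 {a<..<b}"
    and AL: "\<And>f. f \<in> test_functions a b \<Longrightarrow> A f \<in> L2 {a<..<b}"
    and cl: "\<And>f g c. f \<in> test_functions a b \<Longrightarrow> g \<in> test_functions a b \<Longrightarrow> (\<lambda>x. f x - c * g x) \<in> test_functions a b"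
    and lin: "\<And>f g c. f \<in> test_functions a b \<Longrightarrow> g \<in> test_functions a b \<Longrightarrow> A (\<lambda>x. f x - c * g x) = (\<lambda>x. A f x - c * A g x)"
    and herm: "\<And>f g. f \<in> test_functions a b \<Longrightarrow> g \<in> test_functions a b \<Longrightarrow> L2_inner {a<..<b} (A g) f = cnj (L2_inner {a<..<b} (A f) g)"
    and nonneg: "\<And>f. f \<in> test_functions a b \<Longrightarrow> 0 \<le> Re (L2_inner {a<..<b} (A f) f)"
    and f: "f \<in> test_functions a b" and pos: "spectral_floor A a b > 0"
  shows "spectral_floor A a b * (L2_norm {a<..<b} f)\<^sup>2 \<le> Re (L2_inner {a<..<b} (A f) f)"
proof (rule friedrichs_floor_le_form[OF _ DL AL cl lin herm nonneg _ f])
  fix z assume z: "Re z < spectral_floor A a b"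
  let ?I = "INF z \<in> op_spectrum {a<..<b} (friedrichs {a<..<b} (test_functions a b) A). ereal (Re z)"
  have "?I = ereal (spectral_floor A a b)"
    using pos unfolding spectral_floor_def by (cases ?I) auto
  moreover have "?I \<le> ereal (Re z)" if "z \<in> op_spectrum {a<..<b} (friedrichs {a<..<b} (test_functions a b) A)"
    using that by (rule INF_lower)
  ultimately show "z \<notin> op_spectrum {a<..<b} (friedrichs {a<..<b} (test_functions a b) A)"
    using z by auto
qed simp_all

section \<open>The factorized forms on test functions\<close>

lemma test_function_deriv:
  assumes "f \<in> test_functions a b"
  shows "((vderiv ^^ n) f has_vector_derivative (vderiv ^^ Suc n) f x) (at x)"
proof -
  have "(vderiv ^^ n) f differentiable (at x)" using assms by (simp add: test_functions_def)
  then show ?thesis by (simp add: vector_derivative_works vderiv_def)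
qed

lemma vderiv_eqI: "(\<And>x. (f has_vector_derivative f' x) (at x)) \<Longrightarrow> vderiv f = f'"
  by (rule ext) (simp add: vderiv_def vector_derivative_at)

lemma vderiv_zero_outside:
  assumes "\<And>x. x \<notin> {\<alpha>..\<beta>} \<Longrightarrow> f x = 0" "x \<notin> {\<alpha>..\<beta>}"
  shows "vderiv f x = 0"
proof -
  have "(f has_vector_derivative 0) (at x)"
  proof (rule has_vector_derivative_transform_within_open)
    show "((\<lambda>x. 0) has_vector_derivative 0) (at x)" by simp
    show "open (- {\<alpha>..\<beta>})" by (intro open_Compl closed_atLeastAtMost)
  qed (use assms in auto)
  then show ?thesis by (simp add: vderiv_def vector_derivative_at)
qed

lemma test_function_support:
  assumes "f \<in> test_functions a b" "a < b"
  obtains \<alpha> \<beta> where "a < \<alpha>" "\<alpha> < \<beta>" "\<beta> < b" "\<And>n x. x \<notin> {\<alpha><..<\<beta>} \<Longrightarrow> (vderiv ^^ n) f x = 0"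
proof -
  let ?K = "closure {x. f x \<noteq> 0}"
  have K: "compact ?K" "?K \<subseteq> {a<..<b}" using assms by (auto simp: test_functions_def)
  obtain \<alpha> \<beta> where ab: "a < \<alpha>" "\<alpha> \<le> \<beta>" "\<beta> < b" "?K \<subseteq> {\<alpha>..\<beta>}"
  proof (cases "?K = {}")
    case True
    show ?thesis by (rule that[of "(a + b) / 2" "(a + b) / 2"]) (use True assms(2) in auto)
  next
    case False
    obtain \<alpha> where \<alpha>: "\<alpha> \<in> ?K" "\<forall>y\<in>?K. \<alpha> \<le> y" using compact_attains_inf[OF K(1) False] by blast
    obtain \<beta> where \<beta>: "\<beta> \<in> ?K" "\<forall>y\<in>?K. y \<le> \<beta>" using compact_attains_sup[OF K(1) False] by blast
    show ?thesis by (rule that[of \<alpha> \<beta>]) (use \<alpha> \<beta> K(2) in auto)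
  qed
  have z: "(vderiv ^^ n) f x = 0" if "x \<notin> {\<alpha>..\<beta>}" for n x
    using that
  proof (induction n arbitrary: x)
    case 0
    then have "x \<notin> ?K" using ab(4) by blast
    then show ?case using closure_subset[of "{x. f x \<noteq> 0}"] by auto
  next
    case (Suc n)
    then show ?case using vderiv_zero_outside[of \<alpha> \<beta> "(vderiv ^^ n) f" x] by simp
  qed
  \<comment> \<open>Moving halfway towards a and b makes the new bounds themselves points where all
    derivatives vanish, so that boundary terms evaluated there are zero.\<close>
  show ?thesis
    by (rule that[of "(a + \<alpha>) / 2" "(\<beta> + b) / 2"]) (use ab z in auto)
qed

lemma test_functions_common_support:
  assumes "f \<in> test_functions a b" "g \<in> test_functions a b" "a < b"
  obtains \<alpha> \<beta> where "a < \<alpha>" "\<alpha> < \<beta>" "\<beta> < b"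
    "\<And>n x. x \<notin> {\<alpha><..<\<beta>} \<Longrightarrow> (vderiv ^^ n) f x = 0" "\<And>n x. x \<notin> {\<alpha><..<\<beta>} \<Longrightarrow> (vderiv ^^ n) g x = 0"
proof -
  obtain \<alpha> \<beta> where f: "a < \<alpha>" "\<alpha> < \<beta>" "\<beta> < b" "\<And>n x. x \<notin> {\<alpha><..<\<beta>} \<Longrightarrow> (vderiv ^^ n) f x = 0"
    using test_function_support[OF assms(1,3)] by metis
  obtain \<alpha>' \<beta>' where g: "a < \<alpha>'" "\<alpha>' < \<beta>'" "\<beta>' < b" "\<And>n x. x \<notin> {\<alpha>'<..<\<beta>'} \<Longrightarrow> (vderiv ^^ n) g x = 0"
    using test_function_support[OF assms(2,3)] by metis
  show ?thesis
  proof (rule that[of "min \<alpha> \<alpha>'" "max \<beta> \<beta>'"])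
    fix n x assume "x \<notin> {min \<alpha> \<alpha>'<..<max \<beta> \<beta>'}"
    then have x: "x \<notin> {\<alpha><..<\<beta>}" "x \<notin> {\<alpha>'<..<\<beta>'}" by auto
    show "(vderiv ^^ n) f x = 0" by (rule f(4)[OF x(1)])
    show "(vderiv ^^ n) g x = 0" by (rule g(4)[OF x(2)])
  qed (use f g in auto)
qed

lemma test_function_vderiv_diff:
  assumes "f \<in> test_functions a b" "g \<in> test_functions a b"
  shows "(vderiv ^^ n) (\<lambda>x. f x - c * g x) = (\<lambda>x. (vderiv ^^ n) f x - c * (vderiv ^^ n) g x)"
proof (induction n)
  case (Suc n)
  have "vderiv (\<lambda>x. (vderiv ^^ n) f x - c * (vderiv ^^ n) g x) = (\<lambda>x. (vderiv ^^ Suc n) f x - c * (vderiv ^^ Suc n) g x)"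
    by (intro vderiv_eqI has_vector_derivative_diff has_vector_derivative_mult_right test_function_deriv[OF assms(1)] test_function_deriv[OF assms(2)])
  then show ?case using Suc by simp
qed simp

lemma test_functionsI:
  assumes "\<And>n x. (vderiv ^^ n) f differentiable (at x)" "a < \<alpha>" "\<beta> < b" "\<And>x. x \<notin> {\<alpha>..\<beta>} \<Longrightarrow> f x = 0"
  shows "f \<in> test_functions a b"
proof -
  have "closure {x. f x \<noteq> 0} \<subseteq> {\<alpha>..\<beta>}"
  proof (rule closure_minimal)
    show "{x. f x \<noteq> 0} \<subseteq> {\<alpha>..\<beta>}" using assms(4) by blast
  qed simp
  moreover from this have "compact (closure {x. f x \<noteq> 0})"
    by (meson bounded_closed_interval bounded_subset closed_closure compact_eq_bounded_closed)
  ultimately show ?thesis using assms by (auto simp: test_functions_def)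
qed

lemma test_functions_diff:
  assumes f: "f \<in> test_functions a b" and g: "g \<in> test_functions a b" and ab: "a < b"
  shows "(\<lambda>x. f x - c * g x) \<in> test_functions a b"
proof -
  obtain \<alpha> \<beta> where s: "a < \<alpha>" "\<alpha> < \<beta>" "\<beta> < b"
    "\<And>n x. x \<notin> {\<alpha><..<\<beta>} \<Longrightarrow> (vderiv ^^ n) f x = 0" "\<And>n x. x \<notin> {\<alpha><..<\<beta>} \<Longrightarrow> (vderiv ^^ n) g x = 0"
    using test_functions_common_support[OF f g ab] by metis
  show ?thesis
  proof (rule test_functionsI[OF _ s(1,3)])
    show "(vderiv ^^ n) (\<lambda>x. f x - c * g x) differentiable (at x)" for n x
      unfolding test_function_vderiv_diff[OF f g] using f g
      by (intro differentiable_diff differentiable_mult differentiable_const) (auto simp: test_functions_def)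
    show "f x - c * g x = 0" if "x \<notin> {\<alpha>..\<beta>}" for x
      using s(4)[of x 0] s(5)[of x 0] that by auto
  qed
qed

lemma continuous_compact_support_L2:
  fixes h :: "real \<Rightarrow> complex"
  assumes c: "continuous_on {\<alpha>..\<beta>} h" and s: "a < \<alpha>" "\<beta> < b" "\<And>x. x \<notin> {\<alpha><..<\<beta>} \<Longrightarrow> h x = 0"
  shows "h \<in> L2 {a<..<b}"
proof (rule L2_I)
  have e: "indicator {a<..<b} x *\<^sub>R h x = indicator {\<alpha>..\<beta>} x *\<^sub>R h x" for x
    using s(1,2) s(3)[of x] by (cases "x \<in> {\<alpha><..<\<beta>}") auto
  show "(\<lambda>x. indicator {a<..<b} x *\<^sub>R h x) \<in> borel_measurable lborel"
    unfolding e using borel_integrable_compact[OF _ c] by auto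
  have "continuous_on {\<alpha>..\<beta>} (\<lambda>x. (cmod (h x))\<^sup>2)" by (intro continuous_intros c)
  then have "integrable lborel (\<lambda>x. indicator {\<alpha>..\<beta>} x *\<^sub>R (cmod (h x))\<^sup>2)"
    by (intro borel_integrable_compact) auto
  moreover have "indicator {\<alpha>..\<beta>} x *\<^sub>R (cmod (h x))\<^sup>2 = (indicator {a<..<b} x * cmod (h x))\<^sup>2" for x
    using s(1,2) s(3)[of x] by (cases "x \<in> {\<alpha><..<\<beta>}") auto
  ultimately show "integrable lborel (\<lambda>x. (indicator {a<..<b} x * cmod (h x))\<^sup>2)" by simp
qed simp

text \<open>The first-order factor \<open>A\<close> in \<open>L\<^sub>\<nu> = A\<^sup>* A\<close>.\<close>

definition ladder :: "real \<Rightarrow> (real \<Rightarrow> complex) \<Rightarrow> real \<Rightarrow> complex" where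
  "ladder \<nu> f x = vderiv f x - of_real ((\<nu> + 1/2) / x) * f x"

lemma test_function_continuous:
  assumes "f \<in> test_functions a b"
  shows "continuous_on S f" "continuous_on S (vderiv f)" "continuous_on S (vderiv (vderiv f))"
proof -
  have "continuous_on S ((vderiv ^^ n) f)" for n
    by (intro continuous_at_imp_continuous_on ballI has_vector_derivative_continuous[OF test_function_deriv[OF assms]])
  from this[of 0] this[of 1] this[of 2]
  show "continuous_on S f" "continuous_on S (vderiv f)" "continuous_on S (vderiv (vderiv f))"
    by (simp_all add: numeral_2_eq_2)
qed

lemma test_function_L2:
  assumes f: "f \<in> test_functions a b" and ab: "0 \<le> a" "a < b"
  shows "f \<in> L2 {a<..<b}" "hankel_op \<nu> f \<in> L2 {a<..<b}" "ladder \<nu> f \<in> L2 {a<..<b}"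
    "(\<lambda>x. of_real (x\<^sup>2) * f x) \<in> L2 {a<..<b}" "(\<lambda>x. of_real x * f x) \<in> L2 {a<..<b}"
proof -
  obtain \<alpha> \<beta> where s: "a < \<alpha>" "\<alpha> < \<beta>" "\<beta> < b" "\<And>n x. x \<notin> {\<alpha><..<\<beta>} \<Longrightarrow> (vderiv ^^ n) f x = 0"
    using test_function_support[OF f ab(2)] by metis
  note z = s(4)[of _ 0] s(4)[of _ 1] s(4)[of _ 2]
  have a0: "x \<noteq> 0" if "x \<in> {\<alpha>..\<beta>}" for x using that s(1) ab by auto
  note c = test_function_continuous[OF f]
  show "f \<in> L2 {a<..<b}"
    by (rule continuous_compact_support_L2[OF c(1) s(1,3)]) (use z in auto)
  show "hankel_op \<nu> f \<in> L2 {a<..<b}"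
  proof (rule continuous_compact_support_L2[OF _ s(1,3)])
    show "continuous_on {\<alpha>..\<beta>} (hankel_op \<nu> f)" unfolding hankel_op_def
      by (intro continuous_intros c) (use a0 in auto)
  qed (use z in \<open>auto simp: hankel_op_def numeral_2_eq_2\<close>)
  show "ladder \<nu> f \<in> L2 {a<..<b}"
  proof (rule continuous_compact_support_L2[OF _ s(1,3)])
    show "continuous_on {\<alpha>..\<beta>} (ladder \<nu> f)" unfolding ladder_def
      by (intro continuous_intros c) (use a0 in auto)
  qed (use z in \<open>auto simp: ladder_def\<close>)
  show "(\<lambda>x. of_real (x\<^sup>2) * f x) \<in> L2 {a<..<b}"
    by (rule continuous_compact_support_L2[OF _ s(1,3)]) (use z in \<open>auto intro!: continuous_intros c\<close>)
  show "(\<lambda>x. of_real x * f x) \<in> L2 {a<..<b}"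
    by (rule continuous_compact_support_L2[OF _ s(1,3)]) (use z in \<open>auto intro!: continuous_intros c\<close>)
qed

text \<open>Integration by parts with boundary function (A f) times the conjugate of g, which
  vanishes at both ends of the common support interval. The potential arises from \<nu>^2 - 1/4 =
  \<sigma>^2 - \<sigma> with \<sigma> = \<nu> + 1/2. Symmetry and nonnegativity of the operator on
  test functions are read off from this identity.\<close>

lemma hankel_op_form:
  assumes f: "f \<in> test_functions a b" and g: "g \<in> test_functions a b" and ab: "0 \<le> a" "a < b"
  shows "L2_inner {a<..<b} (hankel_op \<nu> f) g = L2_inner {a<..<b} (ladder \<nu> f) (ladder \<nu> g)"
proof -
  obtain \<alpha> \<beta> where s: "a < \<alpha>" "\<alpha> < \<beta>" "\<beta> < b"
    "\<And>n x. x \<notin> {\<alpha><..<\<beta>} \<Longrightarrow> (vderiv ^^ n) f x = 0" "\<And>n x. x \<notin> {\<alpha><..<\<beta>} \<Longrightarrow> (vderiv ^^ n) g x = 0"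
    using test_functions_common_support[OF f g ab(2)] by metis
  note z = s(4)[of _ 0] s(4)[of _ 1] s(4)[of _ 2] s(5)[of _ 0] s(5)[of _ 1]
  define \<sigma> where "\<sigma> = \<nu> + 1/2"
  define f1 f2 g1 where "f1 = vderiv f" and "f2 = vderiv (vderiv f)" and "g1 = vderiv g"
  have df: "(f has_vector_derivative f1 x) (at x)" "(f1 has_vector_derivative f2 x) (at x)" "(g has_vector_derivative g1 x) (at x)" for x
    using test_function_deriv[OF f, of 0] test_function_deriv[OF f, of 1] test_function_deriv[OF g, of 0] by (simp_all add: f1_def f2_def g1_def)
  have f12: "vderiv f1 = f2" by (simp add: f1_def f2_def)
  have a0: "x > 0" if "x \<in> {\<alpha>..\<beta>}" for x using that s(1) ab by auto
  let ?P = "\<lambda>x. ladder \<nu> f x * cnj (ladder \<nu> g x)" and ?Q = "\<lambda>x. hankel_op \<nu> f x * cnj (g x)"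
  let ?\<Phi> = "\<lambda>x. (f1 x - of_real (\<sigma> / x) * f x) * cnj (g x)"
  have fc: "continuous_on S f" "continuous_on S f1" "continuous_on S f2" for S
    unfolding f1_def f2_def by (rule test_function_continuous[OF f])+
  have gc: "continuous_on S g" "continuous_on S g1" for S
    unfolding g1_def by (rule test_function_continuous[OF g])+
  have nz: "\<forall>x\<in>{\<alpha>..\<beta>}. x \<noteq> 0" using a0 by (metis less_irrefl)
  have cP: "continuous_on {\<alpha>..\<beta>} ?P"
    unfolding ladder_def f1_def[symmetric] g1_def[symmetric] by (intro continuous_intros fc gc nz)
  have cQ: "continuous_on {\<alpha>..\<beta>} ?Q"
    unfolding hankel_op_def f2_def[symmetric] by (intro continuous_intros fc gc) (use nz in auto)
  have "(LINT x|lborel. indicator {\<alpha>..\<beta>} x *\<^sub>R (?P x - ?Q x)) = ?\<Phi> \<beta> - ?\<Phi> \<alpha>"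
  proof (rule integral_FTC_Icc)
    show "\<alpha> \<le> \<beta>" using s by simp
    show "continuous_on {\<alpha>..\<beta>} (\<lambda>x. ?P x - ?Q x)" by (intro continuous_intros cP cQ)
    fix x assume x: "\<alpha> \<le> x" "x \<le> \<beta>"
    then have x0: "x > 0" using a0 by auto
    have d1: "((\<lambda>x. complex_of_real (\<sigma> / x)) has_vector_derivative of_real (- \<sigma> / x\<^sup>2)) (at x)"
    proof -
      have "((\<lambda>x. \<sigma> / x) has_real_derivative (- \<sigma> / x\<^sup>2)) (at x)"
        using x0 by (auto intro!: derivative_eq_intros simp: power2_eq_square)
      then show ?thesis by (rule has_vector_derivative_of_real)
    qed
    have d2: "((\<lambda>x. cnj (g x)) has_vector_derivative cnj (g1 x)) (at x)"
      by (rule bounded_linear.has_vector_derivative[OF bounded_linear_cnj df(3)])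
    have "(?\<Phi> has_vector_derivative ((f1 x - of_real (\<sigma> / x) * f x) * cnj (g1 x)
        + (f2 x - (of_real (\<sigma> / x) * f1 x + of_real (- \<sigma> / x\<^sup>2) * f x)) * cnj (g x))) (at x)"
      by (intro has_vector_derivative_mult has_vector_derivative_diff d1 d2 df)
    also have "((f1 x - of_real (\<sigma> / x) * f x) * cnj (g1 x)
        + (f2 x - (of_real (\<sigma> / x) * f1 x + of_real (- \<sigma> / x\<^sup>2) * f x)) * cnj (g x)) = ?P x - ?Q x"
    proof -
      have e1: "of_real ((\<nu>\<^sup>2 - 1/4) / x\<^sup>2) = (of_real (\<sigma> / x) * of_real (\<sigma> / x) + of_real (- \<sigma> / x\<^sup>2) :: complex)"
      proof -
        have "(\<nu>\<^sup>2 - 1/4) / x\<^sup>2 = (\<sigma> / x) * (\<sigma> / x) + (- \<sigma> / x\<^sup>2)"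
          using x0 by (simp add: \<sigma>_def field_simps power2_eq_square)
        then show ?thesis by (simp only: of_real_add of_real_mult)
      qed
      have e2: "cnj (g1 x - of_real (\<sigma> / x) * g x) = cnj (g1 x) - of_real (\<sigma> / x) * cnj (g x)"
        by simp
      \<comment> \<open>The cancellation is a ring identity in the values and derivatives; S stands
        for \<sigma>/x and T for its derivative.\<close>
      have gen: "(F1 - S * F) * G1 + (F2 - (S * F1 + T * F)) * G = (F1 - S * F) * (G1 - S * G) - (- F2 + (S * S + T) * F) * G"
        for F F1 F2 G G1 S T :: complex by (simp add: algebra_simps)
      show ?thesis
        unfolding ladder_def hankel_op_def \<sigma>_def[symmetric] f1_def[symmetric] g1_def[symmetric] f12 e1 e2
        by (rule gen)
    qed
    finally show "(?\<Phi> has_vector_derivative (?P x - ?Q x)) (at x within {\<alpha>..\<beta>})"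
      by (rule has_vector_derivative_at_within)
  qed
  also have "\<dots> = 0" using z by (simp add: f1_def)
  finally have "(LINT x|lborel. indicator {\<alpha>..\<beta>} x *\<^sub>R ?P x - indicator {\<alpha>..\<beta>} x *\<^sub>R ?Q x) = 0"
    by (simp only: scaleR_diff_right)
  then have "(LINT x|lborel. indicator {\<alpha>..\<beta>} x *\<^sub>R ?P x) = (LINT x|lborel. indicator {\<alpha>..\<beta>} x *\<^sub>R ?Q x)"
    by (subst (asm) Bochner_Integration.integral_diff) (auto intro!: borel_integrable_compact cP cQ)
  moreover have "indicator {\<alpha>..\<beta>} x *\<^sub>R ?P x = indicator {a<..<b} x *\<^sub>R ?P x" for x
    using s(1,3) z[of x] by (cases "x \<in> {\<alpha><..<\<beta>}") (auto simp: ladder_def)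
  moreover have "indicator {\<alpha>..\<beta>} x *\<^sub>R ?Q x = indicator {a<..<b} x *\<^sub>R ?Q x" for x
    using s(1,3) z[of x] by (cases "x \<in> {\<alpha><..<\<beta>}") auto
  ultimately show ?thesis unfolding L2_inner_def set_lebesgue_integral_def by simp
qed

lemma hankel_op_diff:
  assumes "f \<in> test_functions a b" "g \<in> test_functions a b"
  shows "hankel_op \<nu> (\<lambda>x. f x - c * g x) = (\<lambda>x. hankel_op \<nu> f x - c * hankel_op \<nu> g x)"
proof
  fix x
  have e: "vderiv (vderiv (\<lambda>x. f x - c * g x)) x = vderiv (vderiv f) x - c * vderiv (vderiv g) x"
    using test_function_vderiv_diff[OF assms, of 2 c] by (simp add: numeral_2_eq_2)
  have gen: "- (F - c * G) + K * (p - c * q) = (- F + K * p) - c * (- G + K * q)" for F G K p q :: complex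
    by (simp add: algebra_simps)
  show "hankel_op \<nu> (\<lambda>x. f x - c * g x) x = hankel_op \<nu> f x - c * hankel_op \<nu> g x"
    unfolding hankel_op_def e by (rule gen)
qed

lemma kinetic_floor_form:
  assumes f: "f \<in> test_functions a b" and ab: "0 \<le> a" "a < b" and pos: "kinetic_floor \<nu> a b > 0"
  shows "kinetic_floor \<nu> a b * (L2_norm {a<..<b} f)\<^sup>2 \<le> (L2_norm {a<..<b} (ladder \<nu> f))\<^sup>2"
proof -
  have "kinetic_floor \<nu> a b * (L2_norm {a<..<b} f)\<^sup>2 \<le> Re (L2_inner {a<..<b} (hankel_op \<nu> f) f)"
    unfolding kinetic_floor_def
  proof (rule spectral_floor_le_form)
    fix f g c assume f: "f \<in> test_functions a b"
    show "f \<in> L2 {a<..<b}" "hankel_op \<nu> f \<in> L2 {a<..<b}" by (rule test_function_L2[OF f ab])+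
    show "0 \<le> Re (L2_inner {a<..<b} (hankel_op \<nu> f) f)"
      unfolding hankel_op_form[OF f f ab] by (simp add: L2_inner_self test_function_L2[OF f ab])
    assume g: "g \<in> test_functions a b"
    show "(\<lambda>x. f x - c * g x) \<in> test_functions a b" by (rule test_functions_diff[OF f g ab(2)])
    show "hankel_op \<nu> (\<lambda>x. f x - c * g x) = (\<lambda>x. hankel_op \<nu> f x - c * hankel_op \<nu> g x)"
      by (rule hankel_op_diff[OF f g])
    show "L2_inner {a<..<b} (hankel_op \<nu> g) f = cnj (L2_inner {a<..<b} (hankel_op \<nu> f) g)"
      unfolding hankel_op_form[OF f g ab] hankel_op_form[OF g f ab] by (rule L2_inner_commute)
  qed (use f pos in \<open>simp_all add: kinetic_floor_def\<close>)
  also have "Re (L2_inner {a<..<b} (hankel_op \<nu> f) f) = (L2_norm {a<..<b} (ladder \<nu> f))\<^sup>2"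
    unfolding hankel_op_form[OF f f ab] by (simp add: L2_inner_self test_function_L2[OF f ab])
  finally show ?thesis .
qed

lemma hamiltonian_op_form:
  assumes f: "f \<in> test_functions a b" and g: "g \<in> test_functions a b" and ab: "0 \<le> a" "a < b"
  shows "L2_inner {a<..<b} (hamiltonian_op \<nu> f) g
    = (L2_inner {a<..<b} (ladder \<nu> f) (ladder \<nu> g) + L2_inner {a<..<b} (\<lambda>x. of_real x * f x) (\<lambda>x. of_real x * g x)) / 2"
    "hamiltonian_op \<nu> f \<in> L2 {a<..<b}"
proof -
  note L = test_function_L2[OF f ab] and Lg = test_function_L2(1)[OF g ab]
  \<comment> \<open>The sum and the factor 1/2 are both written with f - c g, the combination
    covered by \<open>L2_diff\<close> and \<open>L2_inner_diff_left\<close>.\<close>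
  let ?y = "\<lambda>x. hankel_op \<nu> f x - (-1) * (of_real (x\<^sup>2) * f x)"
  have yL: "?y \<in> L2 {a<..<b}" by (rule L2_diff[OF L(2,4)]) simp
  have e: "hamiltonian_op \<nu> f = (\<lambda>x. ?y x - (1/2) * ?y x)"
    by (auto simp: hamiltonian_op_def fun_eq_iff field_simps)
  show "hamiltonian_op \<nu> f \<in> L2 {a<..<b}" unfolding e by (rule L2_diff[OF yL yL]) simp
  have "L2_inner {a<..<b} (hamiltonian_op \<nu> f) g = L2_inner {a<..<b} ?y g - (1/2) * L2_inner {a<..<b} ?y g"
    unfolding e by (rule L2_inner_diff_left[OF yL yL Lg]) simp
  also have "L2_inner {a<..<b} ?y g = L2_inner {a<..<b} (hankel_op \<nu> f) g - (-1) * L2_inner {a<..<b} (\<lambda>x. of_real (x\<^sup>2) * f x) g"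
    by (rule L2_inner_diff_left[OF L(2,4) Lg]) simp
  also have "L2_inner {a<..<b} (\<lambda>x. of_real (x\<^sup>2) * f x) g = L2_inner {a<..<b} (\<lambda>x. of_real x * f x) (\<lambda>x. of_real x * g x)"
    by (simp add: L2_inner_def power2_eq_square mult_ac)
  finally show "L2_inner {a<..<b} (hamiltonian_op \<nu> f) g
    = (L2_inner {a<..<b} (ladder \<nu> f) (ladder \<nu> g) + L2_inner {a<..<b} (\<lambda>x. of_real x * f x) (\<lambda>x. of_real x * g x)) / 2"
    unfolding hankel_op_form[OF f g ab] by (simp add: field_simps)
qed

lemma energy_floor_form:
  assumes f: "f \<in> test_functions a b" and ab: "0 \<le> a" "a < b" and pos: "energy_floor \<nu> a b > 0"
  shows "energy_floor \<nu> a b * (L2_norm {a<..<b} f)\<^sup>2 \<le>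
    ((L2_norm {a<..<b} (ladder \<nu> f))\<^sup>2 + (L2_norm {a<..<b} (\<lambda>x. of_real x * f x))\<^sup>2) / 2"
proof -
  have diag: "Re (L2_inner {a<..<b} (hamiltonian_op \<nu> f) f) = ((L2_norm {a<..<b} (ladder \<nu> f))\<^sup>2 + (L2_norm {a<..<b} (\<lambda>x. of_real x * f x))\<^sup>2) / 2"
    if f: "f \<in> test_functions a b" for f
    unfolding hamiltonian_op_form(1)[OF f f ab]
    by (simp add: L2_inner_self test_function_L2[OF f ab])
  have "energy_floor \<nu> a b * (L2_norm {a<..<b} f)\<^sup>2 \<le> Re (L2_inner {a<..<b} (hamiltonian_op \<nu> f) f)"
    unfolding energy_floor_def
  proof (rule spectral_floor_le_form)
    fix f g c assume f: "f \<in> test_functions a b"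
    show "f \<in> L2 {a<..<b}" by (rule test_function_L2[OF f ab])
    show "hamiltonian_op \<nu> f \<in> L2 {a<..<b}" by (rule hamiltonian_op_form(2)[OF f f ab])
    show "0 \<le> Re (L2_inner {a<..<b} (hamiltonian_op \<nu> f) f)" unfolding diag[OF f] by simp
    assume g: "g \<in> test_functions a b"
    show "(\<lambda>x. f x - c * g x) \<in> test_functions a b" by (rule test_functions_diff[OF f g ab(2)])
    show "hamiltonian_op \<nu> (\<lambda>x. f x - c * g x) = (\<lambda>x. hamiltonian_op \<nu> f x - c * hamiltonian_op \<nu> g x)"
      by (simp add: hamiltonian_op_def hankel_op_diff[OF f g] fun_eq_iff field_simps)
    show "L2_inner {a<..<b} (hamiltonian_op \<nu> g) f = cnj (L2_inner {a<..<b} (hamiltonian_op \<nu> f) g)"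
      unfolding hamiltonian_op_form(1)[OF f g ab] hamiltonian_op_form(1)[OF g f ab]
      by (simp add: L2_inner_commute[of _ "ladder \<nu> g" "ladder \<nu> f"] L2_inner_commute[of _ "\<lambda>x. of_real x * g x" "\<lambda>x. of_real x * f x"])
  qed (use f pos in \<open>simp_all add: energy_floor_def\<close>)
  then show ?thesis unfolding diag[OF f] .
qed

section \<open>Real bumps as complex test functions\<close>

lemma smooth_vderiv:
  assumes "smooth f"
  shows "(vderiv ^^ n) (\<lambda>x. complex_of_real (f x)) differentiable (at x)"
  using assms
proof (induction n arbitrary: f)
  case 0
  obtain f' where "\<And>x. (f has_real_derivative f' x) (at x)" by (rule smooth_imp_deriv[OF 0]) blast
  then show ?case using has_vector_derivative_of_real differentiableI_vector by fastforce
next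
  case (Suc n)
  obtain f' where f': "\<And>x. (f has_real_derivative f' x) (at x)" "smooth f'" by (rule smooth_imp_deriv[OF Suc.prems]) blast
  have "vderiv (\<lambda>x. complex_of_real (f x)) = (\<lambda>x. complex_of_real (f' x))"
    by (intro vderiv_eqI has_vector_derivative_of_real f')
  then show ?case using Suc.IH[OF f'(2)] by (simp only: funpow_Suc_right o_apply)
qed

lemma DERIV_zero_outside:
  fixes w :: "real \<Rightarrow> real"
  assumes "(w has_real_derivative d) (at x)" "\<And>y. y < \<alpha> \<or> \<beta> < y \<Longrightarrow> w y = 0" "x < \<alpha> \<or> \<beta> < x"
  shows "d = 0"
proof -
  have "((\<lambda>_. 0) has_real_derivative d) (at x)"
    by (rule has_field_derivative_transform_within_open[OF assms(1) open_Un[OF open_lessThan[of \<alpha>] open_greaterThan[of \<beta>]]])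
       (use assms in auto)
  then show ?thesis using DERIV_const DERIV_unique by blast
qed

lemma bump_support_deriv:
  assumes "bump a b w" "\<And>x. (w has_real_derivative w' x) (at x)" "a < b"
  obtains \<alpha> \<beta> where "a < \<alpha>" "\<alpha> < \<beta>" "\<beta> < b" "\<And>x. x \<notin> {\<alpha><..<\<beta>} \<Longrightarrow> w x = 0" "\<And>x. x \<notin> {\<alpha><..<\<beta>} \<Longrightarrow> w' x = 0"
proof -
  from bumpE[OF assms(1)] obtain \<alpha> \<beta> where ab: "a < \<alpha>" "\<beta> < b" "\<And>x. x < \<alpha> \<or> \<beta> < x \<Longrightarrow> w x = 0" by metis
  \<comment> \<open>The points at one and two thirds of (a,b) force \<alpha>' < \<beta>' even when
    \<alpha> and \<beta> are out of order; the midpoints move strictly past the support, so that w'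
    vanishes at the new bounds too.\<close>
  define \<alpha>' \<beta>' where "\<alpha>' = min ((a + \<alpha>) / 2) ((2 * a + b) / 3)" and "\<beta>' = max ((\<beta> + b) / 2) ((a + 2 * b) / 3)"
  have ab': "a < \<alpha>'" "\<alpha>' < \<beta>'" "\<beta>' < b" "\<alpha>' < \<alpha>" "\<beta> < \<beta>'"
    using ab(1,2) assms(3) by (auto simp: \<alpha>'_def \<beta>'_def min_def max_def)
  have d0: "w' x = 0" if "x < \<alpha> \<or> \<beta> < x" for x
    by (rule DERIV_zero_outside[OF assms(2) ab(3) that])
  show ?thesis
  proof (rule that[OF ab'(1-3)])
    fix x assume "x \<notin> {\<alpha>'<..<\<beta>'}"
    then have "x < \<alpha> \<or> \<beta> < x" using ab'(4,5) by auto
    then show "w x = 0" "w' x = 0" using ab(3) d0 by auto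
  qed
qed

text \<open>The derivative of x^s w is x^(s-1) (s w + x w'), again a power times a bump, so the
  coinduction runs over all exponents and bumps at once. The singularity of the power at 0 is
  harmless because w vanishes near 0.\<close>

lemma smooth_powr_bump:
  assumes "bump 0 b w" shows "smooth (\<lambda>x. x powr s * w x)"
proof -
  have "\<exists>s w. bump 0 b w \<and> h = (\<lambda>x. x powr s * w x) \<Longrightarrow> smooth h" for h
  proof (coinduction arbitrary: h)
    case smooth
    then obtain s w where w: "bump 0 b w" "h = (\<lambda>x. x powr s * w x)" by blast
    obtain w' where w': "\<And>x. (w has_real_derivative w' x) (at x)" "smooth w'"
      by (rule smooth_imp_deriv[OF bump_smooth[OF w(1)]]) blast
    \<comment> \<open>\<open>bump_support_deriv\<close> asks for a nondegenerate interval; enlarging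
      b to at least 1 provides one whatever b is.\<close>
    define b' where "b' = max b 1"
    have wb: "bump 0 b' w" "0 < b'" using bump_mono[OF w(1)] by (auto simp: b'_def)
    obtain \<alpha> \<beta> where s: "0 < \<alpha>" "\<alpha> < \<beta>" "\<beta> < b'" "\<And>x. x \<notin> {\<alpha><..<\<beta>} \<Longrightarrow> w x = 0" "\<And>x. x \<notin> {\<alpha><..<\<beta>} \<Longrightarrow> w' x = 0"
      by (rule bump_support_deriv[OF wb(1) w'(1) wb(2)]) blast
    define v where "v = (\<lambda>x. s * w x + w' x * x)"
    have vb: "bump 0 b v"
    proof -
      from bumpE[OF w(1)] obtain \<alpha> \<beta> where ab: "0 < \<alpha>" "\<beta> < b" "\<And>x. x < \<alpha> \<or> \<beta> < x \<Longrightarrow> w x = 0" by metis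
      have d0: "w' x = 0" if "x < \<alpha> \<or> \<beta> < x" for x
        by (rule DERIV_zero_outside[OF w'(1) ab(3) that])
      have "smooth v" unfolding v_def by (intro smooth_add smooth_cmult smooth_mult smooth_ident w' bump_smooth[OF w(1)])
      then show ?thesis by (rule bumpI[OF _ ab(1,2)]) (use ab(3) d0 in \<open>auto simp: v_def\<close>)
    qed
    have d: "(h has_real_derivative x powr (s - 1) * v x) (at x)" for x
    proof (cases "x > 0")
      case True
      have "x powr s = x powr (s - 1) * x" using True powr_add[of x "s - 1" 1] by simp
      then show ?thesis unfolding w(2) v_def
        using True by (auto intro!: derivative_eq_intros w'(1) simp: algebra_simps)
    next
      case False
      have "\<forall>\<^sub>F y in nhds x. h y = 0"
        using eventually_nhds_in_open[of "{..<\<alpha>}" x] False s(1,4) by (auto elim!: eventually_mono simp: w(2))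
      moreover have "v x = 0" using s False by (auto simp: v_def)
      ultimately show ?thesis by (subst DERIV_cong_ev[of x x h "\<lambda>_. 0" _ 0]) auto
    qed
    show ?case using d vb by (intro exI[of _ h] exI[of _ "\<lambda>x. x powr (s - 1) * v x"]) auto
  qed
  then show ?thesis using assms by blast
qed

section \<open>Confinement on a single interval\<close>

lemma smooth_deriv:
  assumes "smooth w" "\<And>x. (w has_real_derivative w' x) (at x)" shows "smooth w'"
proof -
  obtain v where v: "\<And>x. (w has_real_derivative v x) (at x)" "smooth v" by (rule smooth_imp_deriv[OF assms(1)]) blast
  have "w' = v" by (rule ext) (rule DERIV_unique[OF assms(2) v(1)])
  then show ?thesis using v(2) by simp
qed

text \<open>With g = x^(\<nu>+1/2) w one has A g = x^(\<nu>+1/2) w', so this is c b^2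
  \<parallel>g\<parallel>^2 \<le> \<parallel>A g\<parallel>^2 for real test functions g on (a,b).
  The factor b^2 is the square of the right end point by which the roots of the floors are divided,
  so c = 1 is the critical value.\<close>

definition confined :: "real \<Rightarrow> real \<Rightarrow> real \<Rightarrow> real \<Rightarrow> bool" where
  "confined \<nu> a b c \<longleftrightarrow> (\<forall>w w'. bump a b w \<longrightarrow> (\<forall>x. (w has_real_derivative w' x) (at x)) \<longrightarrow>
     c * b\<^sup>2 * (LINT x|lborel. (x powr (\<nu> + 1/2) * w x)\<^sup>2) \<le> (LINT x|lborel. (x powr (\<nu> + 1/2) * w' x)\<^sup>2))"

lemma confined_mono: "confined \<nu> a b c \<Longrightarrow> c' \<le> c \<Longrightarrow> confined \<nu> a b c'"
proof -
  assume c: "confined \<nu> a b c" "c' \<le> c"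
  have "c' * b\<^sup>2 * (LINT x|lborel. (x powr (\<nu> + 1/2) * w x)\<^sup>2) \<le> c * b\<^sup>2 * (LINT x|lborel. (x powr (\<nu> + 1/2) * w x)\<^sup>2)" for w
    using c(2) by (intro mult_right_mono) auto
  then show ?thesis using c(1) unfolding confined_def by (meson order_trans)
qed

text \<open>The constant 2 c - 1 exceeds 1 exactly when c does, so both kinds of floor have the same
  threshold.\<close>

lemma confined_of_energy:
  assumes nu: "\<nu> > 0" and ab: "0 \<le> a" "a < b"
    and E: "\<And>w w'. bump a b w \<Longrightarrow> (\<And>x. (w has_real_derivative w' x) (at x)) \<Longrightarrow>
      c * b\<^sup>2 * (LINT x|lborel. (x powr (\<nu> + 1/2) * w x)\<^sup>2) \<le>
      ((LINT x|lborel. (x powr (\<nu> + 1/2) * w' x)\<^sup>2) + (LINT x|lborel. (x * (x powr (\<nu> + 1/2) * w x))\<^sup>2)) / 2"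
  shows "confined \<nu> a b (2 * c - 1)"
  unfolding confined_def
proof (intro allI impI)
  fix w w' assume w: "bump a b w" "\<forall>x. (w has_real_derivative w' x) (at x)"
  let ?\<phi> = "\<lambda>x. x powr (\<nu> + 1/2) * w x"
  have s0: "\<nu> + 1/2 > 0" using nu by simp
  have i: "integrable lborel (\<lambda>x. (?\<phi> x)\<^sup>2)" by (rule bump_weight_square_integrable[OF w(1) ab(1) s0])
  have "bump a b (\<lambda>x. w x * x)" by (rule bump_smooth_mult[OF w(1) smooth_ident])
  from bump_weight_square_integrable[OF this ab(1) s0]
  have i2: "integrable lborel (\<lambda>x. (x * ?\<phi> x)\<^sup>2)" by (simp add: mult_ac)
  have "(LINT x|lborel. (x * ?\<phi> x)\<^sup>2) \<le> (LINT x|lborel. b\<^sup>2 * (?\<phi> x)\<^sup>2)"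
  proof (rule integral_mono[OF i2])
    show "integrable lborel (\<lambda>x. b\<^sup>2 * (?\<phi> x)\<^sup>2)" using i by simp
    fix x
    show "(x * ?\<phi> x)\<^sup>2 \<le> b\<^sup>2 * (?\<phi> x)\<^sup>2"
    proof (cases "x \<in> {a<..<b}")
      case True
      then have "x\<^sup>2 \<le> b\<^sup>2" using ab by (intro power_mono) auto
      then show ?thesis by (simp only: power_mult_distrib[of x "?\<phi> x"] mult_right_mono zero_le_power2)
    next
      case False
      then show ?thesis using bump_zero[OF w(1) False] by simp
    qed
  qed
  then have "(LINT x|lborel. (x * ?\<phi> x)\<^sup>2) \<le> b\<^sup>2 * (LINT x|lborel. (?\<phi> x)\<^sup>2)" by simp
  moreover have "c * b\<^sup>2 * (LINT x|lborel. (?\<phi> x)\<^sup>2) \<le>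
      ((LINT x|lborel. (x powr (\<nu> + 1/2) * w' x)\<^sup>2) + (LINT x|lborel. (x * ?\<phi> x)\<^sup>2)) / 2"
    by (rule E[OF w(1)]) (use w(2) in blast)
  moreover have "(2 * c - 1) * B * P \<le> Q" if "X \<le> B * P" "c * B * P \<le> (Q + X) / 2" for B P Q X :: real
    using that by (simp add: algebra_simps)
  ultimately show "(2 * c - 1) * b\<^sup>2 * (LINT x|lborel. (?\<phi> x)\<^sup>2) \<le> (LINT x|lborel. (x powr (\<nu> + 1/2) * w' x)\<^sup>2)"
    by blast
qed

text \<open>Since A annihilates x^(\<nu>+1/2), it acts on the product by differentiating w alone.
  The lemma translates the norms in the form inequalities for complex test functions into the real
  integrals of \<open>confined\<close>.\<close>

lemma bump_test_function:
  fixes \<nu> :: real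
  assumes w: "bump a b w" "\<And>x. (w has_real_derivative w' x) (at x)" and ab: "0 \<le> a" "a < b"
  defines "f \<equiv> \<lambda>x. complex_of_real (x powr (\<nu> + 1/2) * w x)"
  shows "f \<in> test_functions a b"
    "(L2_norm {a<..<b} f)\<^sup>2 = (LINT x|lborel. (x powr (\<nu> + 1/2) * w x)\<^sup>2)"
    "(L2_norm {a<..<b} (ladder \<nu> f))\<^sup>2 = (LINT x|lborel. (x powr (\<nu> + 1/2) * w' x)\<^sup>2)"
    "(L2_norm {a<..<b} (\<lambda>x. of_real x * f x))\<^sup>2 = (LINT x|lborel. (x * (x powr (\<nu> + 1/2) * w x))\<^sup>2)"
proof -
  obtain \<alpha> \<beta> where s: "a < \<alpha>" "\<alpha> < \<beta>" "\<beta> < b" "\<And>x. x \<notin> {\<alpha><..<\<beta>} \<Longrightarrow> w x = 0" "\<And>x. x \<notin> {\<alpha><..<\<beta>} \<Longrightarrow> w' x = 0"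
    using bump_support_deriv[OF w ab(2)] by metis
  have out: "w x = 0" "w' x = 0" if "x \<notin> {a<..<b}" for x
    using s(1,2,3) that by (auto intro!: s(4,5))
  have sm: "smooth (\<lambda>x. x powr (\<nu> + 1/2) * w x)"
    by (rule smooth_powr_bump[OF bump_mono[OF w(1) ab(1) order_refl]])
  show "f \<in> test_functions a b"
    unfolding f_def
    by (rule test_functionsI[OF smooth_vderiv[OF sm] s(1,3)]) (use s(4) in auto)
  have ind: "(indicator {a<..<b} x * cmod (complex_of_real u))\<^sup>2 = u\<^sup>2" if "x \<notin> {a<..<b} \<Longrightarrow> u = 0" for u x
    using that by (cases "x \<in> {a<..<b}") auto
  show "(L2_norm {a<..<b} f)\<^sup>2 = (LINT x|lborel. (x powr (\<nu> + 1/2) * w x)\<^sup>2)"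
    unfolding L2_norm_square f_def by (subst ind) (auto simp: out)
  show "(L2_norm {a<..<b} (\<lambda>x. of_real x * f x))\<^sup>2 = (LINT x|lborel. (x * (x powr (\<nu> + 1/2) * w x))\<^sup>2)"
    unfolding L2_norm_square f_def of_real_mult[symmetric] by (subst ind) (auto simp: out)
  have lad: "ladder \<nu> f x = complex_of_real (x powr (\<nu> + 1/2) * w' x)" for x
  proof (cases "x > 0")
    case True
    have "((\<lambda>x. x powr (\<nu> + 1/2) * w x) has_real_derivative ((\<nu> + 1/2) / x * (x powr (\<nu> + 1/2) * w x) + x powr (\<nu> + 1/2) * w' x)) (at x)"
    proof (rule DERIV_cong[OF DERIV_mult[OF _ w(2)]])
      show "((\<lambda>x. x powr (\<nu> + 1/2)) has_real_derivative (\<nu> + 1/2) * x powr (\<nu> + 1/2 - 1)) (at x)"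
        using True by (rule has_real_derivative_powr)
      show "(\<nu> + 1/2) * x powr (\<nu> + 1/2 - 1) * w x + w' x * x powr (\<nu> + 1/2) = (\<nu> + 1/2) / x * (x powr (\<nu> + 1/2) * w x) + x powr (\<nu> + 1/2) * w' x"
        unfolding powr_diff using True by simp
    qed
    from has_vector_derivative_of_real[OF this]
    have "vderiv f x = of_real ((\<nu> + 1/2) / x * (x powr (\<nu> + 1/2) * w x) + x powr (\<nu> + 1/2) * w' x)"
      unfolding f_def vderiv_def by (rule vector_derivative_at)
    then show ?thesis unfolding ladder_def f_def of_real_mult[symmetric] of_real_diff[symmetric] by simp
  next
    case False
    then have x: "x \<notin> {\<alpha>..\<beta>}" "x \<notin> {\<alpha><..<\<beta>}" using s(1) ab by auto
    have "vderiv f x = 0" by (rule vderiv_zero_outside[OF _ x(1)]) (use s(4) in \<open>auto simp: f_def\<close>)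
    then show ?thesis using s(4,5)[OF x(2)] by (simp add: ladder_def f_def)
  qed
  show "(L2_norm {a<..<b} (ladder \<nu> f))\<^sup>2 = (LINT x|lborel. (x powr (\<nu> + 1/2) * w' x)\<^sup>2)"
    unfolding L2_norm_square lad by (subst ind) (auto simp: out)
qed

lemma sqrt_divide_gt:
  assumes "sqrt k / b > c" "b > 0" "c > 0"
  shows "k > 0" "c\<^sup>2 * b\<^sup>2 \<le> k"
proof -
  have "sqrt k > c * b" using assms by (simp add: field_simps)
  moreover have "c * b > 0" using assms by simp
  ultimately have k: "sqrt k > 0" "c * b < sqrt k" by linarith+
  then show k0: "k > 0" by simp
  have "(c * b)\<^sup>2 \<le> (sqrt k)\<^sup>2" using k \<open>c * b > 0\<close> by (intro power_mono) auto
  then show "c\<^sup>2 * b\<^sup>2 \<le> k" using k0 by (simp add: power_mult_distrib)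
qed

lemma confined_kinetic_floor:
  assumes ab: "0 \<le> a" "a < b" and c: "c > 0" "sqrt (kinetic_floor \<nu> a b) / b > c"
  shows "confined \<nu> a b (c\<^sup>2)"
  unfolding confined_def
proof (intro allI impI)
  fix w w' assume w: "bump a b w" "\<forall>x. (w has_real_derivative w' x) (at x)"
  have b0: "b > 0" using ab by simp
  note k = sqrt_divide_gt[OF c(2) b0 c(1)]
  note t = bump_test_function[OF w(1) spec[OF w(2)] ab, of \<nu>]
  have "c\<^sup>2 * b\<^sup>2 * (LINT x|lborel. (x powr (\<nu> + 1/2) * w x)\<^sup>2) \<le> kinetic_floor \<nu> a b * (LINT x|lborel. (x powr (\<nu> + 1/2) * w x)\<^sup>2)"
    by (rule mult_right_mono[OF k(2)]) simp
  also have "\<dots> \<le> (LINT x|lborel. (x powr (\<nu> + 1/2) * w' x)\<^sup>2)"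
    using kinetic_floor_form[OF t(1) ab k(1)] unfolding t(2,3) .
  finally show "c\<^sup>2 * b\<^sup>2 * (LINT x|lborel. (x powr (\<nu> + 1/2) * w x)\<^sup>2) \<le> (LINT x|lborel. (x powr (\<nu> + 1/2) * w' x)\<^sup>2)" .
qed

lemma confined_energy_floor:
  assumes nu: "\<nu> > 0" and ab: "0 \<le> a" "a < b" and c: "c > 0" "sqrt (energy_floor \<nu> a b) / b > c"
  shows "confined \<nu> a b (2 * c\<^sup>2 - 1)"
proof (rule confined_of_energy[OF nu ab])
  fix w w' assume w: "bump a b w" "\<And>x. (w has_real_derivative w' x) (at x)"
  have b0: "b > 0" using ab by simp
  note k = sqrt_divide_gt[OF c(2) b0 c(1)]
  note t = bump_test_function[OF w ab, of \<nu>]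
  have "c\<^sup>2 * b\<^sup>2 * (LINT x|lborel. (x powr (\<nu> + 1/2) * w x)\<^sup>2) \<le> energy_floor \<nu> a b * (LINT x|lborel. (x powr (\<nu> + 1/2) * w x)\<^sup>2)"
    by (rule mult_right_mono[OF k(2)]) simp
  also have "\<dots> \<le> ((LINT x|lborel. (x powr (\<nu> + 1/2) * w' x)\<^sup>2) + (LINT x|lborel. (x * (x powr (\<nu> + 1/2) * w x))\<^sup>2)) / 2"
    using energy_floor_form[OF t(1) ab k(1)] unfolding t(2,3,4) .
  finally show "c\<^sup>2 * b\<^sup>2 * (LINT x|lborel. (x powr (\<nu> + 1/2) * w x)\<^sup>2) \<le>
    ((LINT x|lborel. (x powr (\<nu> + 1/2) * w' x)\<^sup>2) + (LINT x|lborel. (x * (x powr (\<nu> + 1/2) * w x))\<^sup>2)) / 2" .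
qed

text \<open>Ground state substitution with the first Dirichlet eigenfunction \<open>sin (\<pi> (x - a) / (b - a))\<close>, whose
  logarithmic derivative is \<open>cc\<close>.\<close>

lemma bump_form_lower_bound:
  assumes w: "bump a b w" "\<And>x. (w has_real_derivative w' x) (at x)" and ab: "0 < a" "a < b"
    and c0: "\<And>x. x \<in> {a..b} \<Longrightarrow> c0 \<le> (\<nu>\<^sup>2 - 1/4) / x\<^sup>2 + \<rho> * x\<^sup>2"
    and nu: "\<nu> > 0"
  shows "(pi\<^sup>2 / (b - a)\<^sup>2 + c0) * (LINT x|lborel. (x powr (\<nu> + 1/2) * w x)\<^sup>2) \<le>
    (LINT x|lborel. (x powr (\<nu> + 1/2) * w' x)\<^sup>2) + \<rho> * (LINT x|lborel. (x * (x powr (\<nu> + 1/2) * w x))\<^sup>2)"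
proof -
  define s where "s = \<nu> + 1/2"
  have s0: "s > 0" using nu by (simp add: s_def)
  obtain \<alpha> \<beta> where su: "a < \<alpha>" "\<alpha> < \<beta>" "\<beta> < b" "\<And>x. x \<notin> {\<alpha><..<\<beta>} \<Longrightarrow> w x = 0" "\<And>x. x \<notin> {\<alpha><..<\<beta>} \<Longrightarrow> w' x = 0"
    using bump_support_deriv[OF w ab(2)] by metis
  have sw: "smooth w" and sw': "smooth w'" using bump_smooth[OF w(1)] smooth_deriv[OF _ w(2)] by blast+
  define k where "k = pi / (b - a)"
  have k0: "k > 0" using ab by (simp add: k_def)
  have sin0: "sin (k * (x - a)) > 0" if "x \<in> {\<alpha>..\<beta>}" for x
  proof (rule sin_gt_zero)
    show "0 < k * (x - a)" using k0 that su by simp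
    have "k * (x - a) < k * (b - a)" using k0 that su by (intro mult_strict_left_mono) auto
    then show "k * (x - a) < pi" using ab by (simp add: k_def)
  qed
  define cc where "cc = (\<lambda>x. k * cos (k * (x - a)) / sin (k * (x - a)))"
  define \<phi> where "\<phi> = (\<lambda>x. x powr s * w x)"
  define e where "e = (\<lambda>x. x powr s * w' x)"
  define p where "p = (\<lambda>x. s / x * \<phi> x + e x)"
  have xpos: "x > 0" if "x \<in> {\<alpha>..\<beta>}" for x using that su ab by auto
  have dphi: "(\<phi> has_real_derivative p x) (at x)" if "x \<in> {\<alpha>..\<beta>}" for x
    unfolding \<phi>_def p_def e_def
  proof (rule DERIV_cong[OF DERIV_mult[OF _ w(2)]])
    show "((\<lambda>x. x powr s) has_real_derivative s * x powr (s - 1)) (at x)"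
      using xpos[OF that] by (rule has_real_derivative_powr)
    show "s * x powr (s - 1) * w x + w' x * x powr s = s / x * (x powr s * w x) + x powr s * w' x"
      unfolding powr_diff using xpos[OF that] by simp
  qed
  have dcc: "(cc has_real_derivative (- (k\<^sup>2 + (cc x)\<^sup>2))) (at x)" if "x \<in> {\<alpha>..\<beta>}" for x
  proof -
    have "(cc has_real_derivative ((k * (- sin (k * (x - a)) * k)) * sin (k * (x - a)) - k * cos (k * (x - a)) * (cos (k * (x - a)) * k)) / (sin (k * (x - a)) * sin (k * (x - a)))) (at x)"
      unfolding cc_def using sin0[OF that]
      by (intro DERIV_divide) (auto intro!: derivative_eq_intros)
    then show ?thesis
      by (rule DERIV_cong) (use sin0[OF that] in \<open>simp add: cc_def field_simps power2_eq_square\<close>)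
  qed
  \<comment> \<open>The subtracted s/x accounts for the difference between \<phi>' and e, so that
    the cross terms containing it cancel; \<Psi> vanishes at \<alpha> and \<beta> together with
    \<phi>.\<close>
  let ?\<Psi> = "\<lambda>x. (\<phi> x * \<phi> x) * (cc x - s / x)"
  let ?\<Psi>' = "\<lambda>x. (p x * \<phi> x + p x * \<phi> x) * (cc x - s / x) + (- (k\<^sup>2 + (cc x)\<^sup>2) - (- s / x\<^sup>2)) * (\<phi> x * \<phi> x)"
  let ?E = "\<lambda>x. (e x)\<^sup>2 + \<rho> * (x * \<phi> x)\<^sup>2 - (k\<^sup>2 + c0) * (\<phi> x)\<^sup>2"
  \<comment> \<open>The difference of the two sides is the square (p - cc \<phi>)^2 plus \<phi>^2
    times the excess of the potential over c0; the term k^2 comes from the Riccati equation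
    \<open>dcc\<close>.\<close>
  have le: "?\<Psi>' x \<le> ?E x" if x: "x \<in> {\<alpha>..\<beta>}" for x
  proof -
    have x0: "x > 0" by (rule xpos[OF x])
    have "c0 \<le> (\<nu>\<^sup>2 - 1/4) / x\<^sup>2 + \<rho> * x\<^sup>2" by (rule c0) (use x su in auto)
    also have "(\<nu>\<^sup>2 - 1/4) / x\<^sup>2 = s\<^sup>2 / x\<^sup>2 - s / x\<^sup>2"
      using x0 by (simp add: s_def field_simps power2_eq_square)
    finally have "0 \<le> s\<^sup>2 / x\<^sup>2 - s / x\<^sup>2 + \<rho> * x\<^sup>2 - c0" by simp
    then have "0 \<le> (p x - cc x * \<phi> x)\<^sup>2 + (s\<^sup>2 / x\<^sup>2 - s / x\<^sup>2 + \<rho> * x\<^sup>2 - c0) * (\<phi> x)\<^sup>2"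
      by (intro add_nonneg_nonneg mult_nonneg_nonneg) auto
    also have "\<dots> = ?E x - ?\<Psi>' x"
    proof -
      have ex: "e x = p x - (s / x) * \<phi> x" by (simp add: p_def)
      have gen: "(P - C * F)\<^sup>2 + (S\<^sup>2 - T + R * x\<^sup>2 - c0) * F\<^sup>2
        = ((P - S * F)\<^sup>2 + R * (x * F)\<^sup>2 - (k\<^sup>2 + c0) * F\<^sup>2) - ((P * F + P * F) * (C - S) + (- (k\<^sup>2 + C\<^sup>2) - (- T)) * (F * F))"
        for P C F S T R :: real by (simp add: power2_eq_square algebra_simps)
      show ?thesis unfolding ex using gen[of "p x" "cc x" "\<phi> x" "s / x" "s / x\<^sup>2" \<rho>] by (simp add: power_divide)
    qed
    finally show ?thesis by simp
  qed
  have cphi: "continuous_on {\<alpha>..\<beta>} \<phi>" by (rule continuous_at_imp_continuous_on) (use DERIV_isCont[OF dphi] in blast)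
  have ccc: "continuous_on {\<alpha>..\<beta>} cc" by (rule continuous_at_imp_continuous_on) (use DERIV_isCont[OF dcc] in blast)
  have nz: "\<forall>x\<in>{\<alpha>..\<beta>}. x \<noteq> 0" using xpos by (metis less_irrefl)
  have ce: "continuous_on {\<alpha>..\<beta>} e" unfolding e_def
    by (intro continuous_on_mult continuous_on_powr continuous_on_id continuous_on_const smooth_continuous_on[OF sw'] nz)
  have cp: "continuous_on {\<alpha>..\<beta>} p" unfolding p_def by (intro continuous_intros cphi ce nz)
  have c1: "continuous_on {\<alpha>..\<beta>} ?\<Psi>'" by (intro continuous_intros cphi cp ccc) (use nz in auto)
  have c2: "continuous_on {\<alpha>..\<beta>} ?E" by (intro continuous_intros cphi ce)
  have "(LINT x|lborel. indicator {\<alpha>..\<beta>} x *\<^sub>R ?\<Psi>' x) = ?\<Psi> \<beta> - ?\<Psi> \<alpha>"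
  proof (rule integral_FTC_Icc[OF _ _ c1])
    show "\<alpha> \<le> \<beta>" using su by simp
    fix x assume "\<alpha> \<le> x" "x \<le> \<beta>"
    then have x: "x \<in> {\<alpha>..\<beta>}" by simp
    have d: "((\<lambda>x. s / x) has_real_derivative (- s / x\<^sup>2)) (at x)"
      using xpos[OF x] by (auto intro!: derivative_eq_intros simp: power2_eq_square)
    have "(?\<Psi> has_real_derivative ?\<Psi>' x) (at x)"
      by (rule DERIV_mult[OF DERIV_mult[OF dphi[OF x] dphi[OF x]] DERIV_diff[OF dcc[OF x] d]])
    then show "(?\<Psi> has_vector_derivative ?\<Psi>' x) (at x within {\<alpha>..\<beta>})"
      by (simp add: has_real_derivative_iff_has_vector_derivative has_vector_derivative_at_within)
  qed
  also have "\<dots> = 0" using su(4)[of \<alpha>] su(4)[of \<beta>] by (simp add: \<phi>_def)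
  finally have z: "(LINT x|lborel. indicator {\<alpha>..\<beta>} x *\<^sub>R ?\<Psi>' x) = 0" .
  have "(LINT x|lborel. indicator {\<alpha>..\<beta>} x *\<^sub>R ?\<Psi>' x) \<le> (LINT x|lborel. indicator {\<alpha>..\<beta>} x *\<^sub>R ?E x)"
  proof (rule integral_mono)
    show "integrable lborel (\<lambda>x. indicator {\<alpha>..\<beta>} x *\<^sub>R ?\<Psi>' x)" by (rule borel_integrable_compact[OF compact_Icc c1])
    show "integrable lborel (\<lambda>x. indicator {\<alpha>..\<beta>} x *\<^sub>R ?E x)" by (rule borel_integrable_compact[OF compact_Icc c2])
    show "indicator {\<alpha>..\<beta>} x *\<^sub>R ?\<Psi>' x \<le> indicator {\<alpha>..\<beta>} x *\<^sub>R ?E x" for x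
      using le[of x] by (cases "x \<in> {\<alpha>..\<beta>}") auto
  qed
  also have "(\<lambda>x. indicator {\<alpha>..\<beta>} x *\<^sub>R ?E x) = ?E"
  proof
    fix x show "indicator {\<alpha>..\<beta>} x *\<^sub>R ?E x = ?E x"
      using su(4,5)[of x] by (cases "x \<in> {\<alpha>..\<beta>}") (auto simp: \<phi>_def e_def)
  qed
  also have "(LINT x|lborel. ?E x) = (LINT x|lborel. (e x)\<^sup>2) + \<rho> * (LINT x|lborel. (x * \<phi> x)\<^sup>2) - (k\<^sup>2 + c0) * (LINT x|lborel. (\<phi> x)\<^sup>2)"
  proof -
    have a0: "0 \<le> a" using ab by simp
    have i1: "integrable lborel (\<lambda>x. (\<phi> x)\<^sup>2)" unfolding \<phi>_def by (rule bump_weight_square_integrable[OF w(1) a0 s0])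
    have "bump a b (\<lambda>x. w x * x)" by (rule bump_smooth_mult[OF w(1) smooth_ident])
    from bump_weight_square_integrable[OF this a0 s0]
    have i2: "integrable lborel (\<lambda>x. (x * \<phi> x)\<^sup>2)" by (simp add: \<phi>_def mult_ac)
    have "bump a b w'" by (rule bumpI[OF sw' su(1,3)]) (use su(5) in auto)
    then have i3: "integrable lborel (\<lambda>x. (e x)\<^sup>2)" unfolding e_def by (rule bump_weight_square_integrable[OF _ a0 s0])
    show ?thesis using i1 i2 i3 by simp
  qed
  finally have "(k\<^sup>2 + c0) * (LINT x|lborel. (\<phi> x)\<^sup>2) \<le> (LINT x|lborel. (e x)\<^sup>2) + \<rho> * (LINT x|lborel. (x * \<phi> x)\<^sup>2)"
    unfolding z by simp
  then show ?thesis by (simp add: k_def \<phi>_def e_def s_def power_divide)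
qed

text \<open>An infimum of reals is a lower bound only for a family bounded below. For \<nu> < 1/2
  the term with 1/r^2 is negative, but a > 0 keeps the potential above -1/(4 a^2).\<close>

lemma potential_INF_le:
  fixes a b :: real
  assumes "0 < a" "x \<in> {a..b}" "\<rho> \<ge> 0"
  shows "(INF r\<in>{a..b}. (\<nu>\<^sup>2 - 1/4) / r\<^sup>2 + \<rho> * r\<^sup>2) \<le> (\<nu>\<^sup>2 - 1/4) / x\<^sup>2 + \<rho> * x\<^sup>2"
proof (rule cINF_lower[OF _ assms(2)])
  show "bdd_below ((\<lambda>r. (\<nu>\<^sup>2 - 1/4) / r\<^sup>2 + \<rho> * r\<^sup>2) ` {a..b})"
  proof (rule bdd_belowI2)
    fix r assume r: "r \<in> {a..b}"
    have "a\<^sup>2 \<le> r\<^sup>2" using assms r by (intro power_mono) auto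
    then have "(1/4) / r\<^sup>2 \<le> (1/4) / a\<^sup>2" using assms r by (intro divide_left_mono) auto
    moreover have "(\<nu>\<^sup>2 - 1/4) / r\<^sup>2 = \<nu>\<^sup>2 / r\<^sup>2 - (1/4) / r\<^sup>2" by (simp add: diff_divide_distrib)
    moreover have "0 \<le> \<nu>\<^sup>2 / r\<^sup>2" "0 \<le> \<rho> * r\<^sup>2" using assms by auto
    ultimately show "- ((1/4) / a\<^sup>2) \<le> (\<nu>\<^sup>2 - 1/4) / r\<^sup>2 + \<rho> * r\<^sup>2" by linarith
  qed
qed

lemma confined_kinetic_local:
  assumes nu: "\<nu> > 0" and ab: "0 < a" "a < b"
    and c: "1 / b\<^sup>2 * (pi\<^sup>2 / (b - a)\<^sup>2 + (INF r\<in>{a..b}. (\<nu>\<^sup>2 - 1/4) / r\<^sup>2)) > c"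
  shows "confined \<nu> a b c"
  unfolding confined_def
proof (intro allI impI)
  fix w w' assume w: "bump a b w" "\<forall>x. (w has_real_derivative w' x) (at x)"
  let ?I = "INF r\<in>{a..b}. (\<nu>\<^sup>2 - 1/4) / r\<^sup>2"
  have I: "?I \<le> (\<nu>\<^sup>2 - 1/4) / x\<^sup>2 + 0 * x\<^sup>2" if "x \<in> {a..b}" for x
    using potential_INF_le[OF ab(1) that, of 0 \<nu>] by simp
  have "c * b\<^sup>2 \<le> pi\<^sup>2 / (b - a)\<^sup>2 + ?I" using c ab by (simp add: field_simps)
  then have "c * b\<^sup>2 * (LINT x|lborel. (x powr (\<nu> + 1/2) * w x)\<^sup>2) \<le> (pi\<^sup>2 / (b - a)\<^sup>2 + ?I) * (LINT x|lborel. (x powr (\<nu> + 1/2) * w x)\<^sup>2)"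
    by (rule mult_right_mono) simp
  also have "\<dots> \<le> (LINT x|lborel. (x powr (\<nu> + 1/2) * w' x)\<^sup>2)"
    using bump_form_lower_bound[OF w(1) spec[OF w(2)] ab I nu] by simp
  finally show "c * b\<^sup>2 * (LINT x|lborel. (x powr (\<nu> + 1/2) * w x)\<^sup>2) \<le> (LINT x|lborel. (x powr (\<nu> + 1/2) * w' x)\<^sup>2)" .
qed

lemma confined_energy_local:
  assumes nu: "\<nu> > 0" and ab: "0 < a" "a < b"
    and c: "1 / b\<^sup>2 * (pi\<^sup>2 / (2 * (b - a)\<^sup>2) + 1/2 * (INF r\<in>{a..b}. (\<nu>\<^sup>2 - 1/4) / r\<^sup>2 + r\<^sup>2)) > c"
  shows "confined \<nu> a b (2 * c - 1)"
proof (rule confined_of_energy[OF nu less_imp_le[OF ab(1)] ab(2)])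
  fix w w' assume w: "bump a b w" "\<And>x. (w has_real_derivative w' x) (at x)"
  let ?I = "INF r\<in>{a..b}. (\<nu>\<^sup>2 - 1/4) / r\<^sup>2 + r\<^sup>2"
  have I: "?I \<le> (\<nu>\<^sup>2 - 1/4) / x\<^sup>2 + 1 * x\<^sup>2" if "x \<in> {a..b}" for x
    using potential_INF_le[OF ab(1) that, of 1 \<nu>] by simp
  have "c * b\<^sup>2 \<le> (pi\<^sup>2 / (b - a)\<^sup>2 + ?I) / 2" using c ab by (simp add: field_simps)
  then have "c * b\<^sup>2 * (LINT x|lborel. (x powr (\<nu> + 1/2) * w x)\<^sup>2) \<le> (pi\<^sup>2 / (b - a)\<^sup>2 + ?I) / 2 * (LINT x|lborel. (x powr (\<nu> + 1/2) * w x)\<^sup>2)"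
    by (rule mult_right_mono) simp
  also have "\<dots> \<le> ((LINT x|lborel. (x powr (\<nu> + 1/2) * w' x)\<^sup>2) + (LINT x|lborel. (x * (x powr (\<nu> + 1/2) * w x))\<^sup>2)) / 2"
    using bump_form_lower_bound[OF w ab I nu] by simp
  finally show "c * b\<^sup>2 * (LINT x|lborel. (x powr (\<nu> + 1/2) * w x)\<^sup>2) \<le>
     ((LINT x|lborel. (x powr (\<nu> + 1/2) * w' x)\<^sup>2) + (LINT x|lborel. (x * (x powr (\<nu> + 1/2) * w x))\<^sup>2)) / 2" .
qed

section \<open>Uniqueness\<close>

text \<open>On each interval \<open>rayleigh_extension\<close> bounds the norm of x^(\<nu>+1/2) G,
  and since x is at most the right end point there, the factor b^2 of \<open>confined\<close>
  becomes the weight x^2. The pieces are added up to \<open>lam n\<close>, with one constant c for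
  all, and Fatou's lemma lets n tend to infinity.\<close>

lemma confined_seq_bound:
  fixes lam :: "nat \<Rightarrow> real" and F G :: "real \<Rightarrow> real"
  assumes nu: "\<nu> > 0" and c: "c > 0"
    and lam: "lam 0 = 0" "strict_mono lam" "filterlim lam at_top sequentially"
    and conf: "\<And>j. confined \<nu> (lam j) (lam (Suc j)) c"
    and F: "F \<in> borel_measurable borel" "integrable lborel (\<lambda>x. (F x)\<^sup>2)"
    and G: "G \<in> borel_measurable borel"
    and prim: "\<And>x y. 0 < x \<Longrightarrow> x \<le> y \<Longrightarrow> G y - G x = (LINT t|lborel. (indicator {x..y} t * t powr (- (\<nu> + 1/2))) * F t)"
    and zero: "\<And>j. j \<ge> 1 \<Longrightarrow> G (lam j) = 0"
  shows "c * (LINT x|lborel. (indicator {0<..} x * (x * (x powr (\<nu> + 1/2) * G x)))\<^sup>2) \<le> (LINT x|lborel. (F x)\<^sup>2)"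
proof -
  define X where "X = (\<lambda>x. x * (x powr (\<nu> + 1/2) * G x))"
  have Xm: "X \<in> borel_measurable borel" unfolding X_def using G by measurable
  have less: "lam j < lam (Suc j)" for j using lam(2) by (simp add: strict_mono_def)
  have nonneg: "0 \<le> lam j" for j
    using lam(1) strict_mono_mono[OF lam(2)] by (metis le0 monoD)
  have iF: "integrable lborel (\<lambda>x. (indicator A x * F x)\<^sup>2)" if "A \<in> sets borel" for A
  proof (rule Bochner_Integration.integrable_bound[OF F(2)])
    show "(\<lambda>x. (indicator A x * F x)\<^sup>2) \<in> borel_measurable lborel" using F(1) that by measurable
  qed (auto simp: indicator_def)
  have piece: "integrable lborel (\<lambda>x. (indicator {lam j<..<lam (Suc j)} x * X x)\<^sup>2) \<and>
      c * (LINT x|lborel. (indicator {lam j<..<lam (Suc j)} x * X x)\<^sup>2) \<le> (LINT x|lborel. (indicator {lam j..lam (Suc j)} x * F x)\<^sup>2)" for j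
  proof -
    let ?a = "lam j" and ?b = "lam (Suc j)"
    let ?Y = "\<lambda>x. indicator {?a<..<?b} x * (x powr (\<nu> + 1/2) * G x)"
    have b0: "?b > 0" using less[of j] nonneg[of j] by linarith
    have m: "c * ?b\<^sup>2 > 0" using c b0 by simp
    have s: "\<nu> + 1/2 > 1/2" using nu by simp
    have bumps: "c * ?b\<^sup>2 * (LINT x|lborel. (x powr (\<nu> + 1/2) * w x)\<^sup>2) \<le> (LINT x|lborel. (x powr (\<nu> + 1/2) * w' x)\<^sup>2)"
      if "bump ?a ?b w" "\<And>x. (w has_real_derivative w' x) (at x)" for w w'
      using conf[of j] that unfolding confined_def by blast
    \<comment> \<open>On the first interval the left end point is 0 and nothing is asserted.\<close>
    have Ga: "G ?a = 0" if "?a > 0"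
      using that lam(1) zero[of j] by (cases j) auto
    have Gb: "G ?b = 0" by (rule zero) simp
    note R = rayleigh_extension[OF nonneg less s m bumps F G prim Gb Ga]
    have le: "(indicator {?a<..<?b} x * X x)\<^sup>2 \<le> ?b\<^sup>2 * (?Y x)\<^sup>2" for x
    proof (cases "x \<in> {?a<..<?b}")
      case True
      then have "x\<^sup>2 \<le> ?b\<^sup>2" using nonneg[of j] by (intro power_mono) auto
      then have "x\<^sup>2 * (x powr (\<nu> + 1/2) * G x)\<^sup>2 \<le> ?b\<^sup>2 * (x powr (\<nu> + 1/2) * G x)\<^sup>2" by (rule mult_right_mono) simp
      then show ?thesis using True by (simp add: X_def power_mult_distrib)
    qed simp
    have iY: "integrable lborel (\<lambda>x. ?b\<^sup>2 * (?Y x)\<^sup>2)" by (rule integrable_mult_right[OF R(1)])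
    have iX: "integrable lborel (\<lambda>x. (indicator {?a<..<?b} x * X x)\<^sup>2)"
    proof (rule Bochner_Integration.integrable_bound[OF iY])
      show "(\<lambda>x. (indicator {?a<..<?b} x * X x)\<^sup>2) \<in> borel_measurable lborel" using Xm by measurable
      show "AE x in lborel. norm ((indicator {?a<..<?b} x * X x)\<^sup>2) \<le> norm (?b\<^sup>2 * (?Y x)\<^sup>2)"
        using le by (intro AE_I2) simp
    qed
    have "(LINT x|lborel. (indicator {?a<..<?b} x * X x)\<^sup>2) \<le> (LINT x|lborel. ?b\<^sup>2 * (?Y x)\<^sup>2)"
      by (rule integral_mono[OF iX iY le])
    then have "c * (LINT x|lborel. (indicator {?a<..<?b} x * X x)\<^sup>2) \<le> c * (LINT x|lborel. ?b\<^sup>2 * (?Y x)\<^sup>2)"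
      using c by (intro mult_left_mono) auto
    also have "\<dots> = c * ?b\<^sup>2 * (LINT x|lborel. (?Y x)\<^sup>2)" by simp
    also have "\<dots> \<le> (LINT x|lborel. (indicator {?a..?b} x * F x)\<^sup>2)" by (rule R(2))
    finally show ?thesis using iX by blast
  qed
  have partial: "integrable lborel (\<lambda>x. (indicator {0<..<lam n} x * X x)\<^sup>2) \<and>
      c * (LINT x|lborel. (indicator {0<..<lam n} x * X x)\<^sup>2) \<le> (LINT x|lborel. (indicator {0..lam n} x * F x)\<^sup>2)" for n
  proof (induction n)
    case 0
    then show ?case by (simp add: lam(1))
  next
    case (Suc n)
    let ?a = "lam n" and ?b = "lam (Suc n)"
    \<comment> \<open>Open pieces miss their common end point and closed ones count it twice, so
      additivity holds almost everywhere.\<close>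
    have AE: "AE x in lborel. x \<noteq> ?a" by (rule AE_lborel_singleton)
    have X2: "AE x in lborel. (indicator {0<..<?b} x * X x)\<^sup>2 = (indicator {0<..<?a} x * X x)\<^sup>2 + (indicator {?a<..<?b} x * X x)\<^sup>2"
      using AE by eventually_elim (use nonneg[of n] less[of n] in \<open>auto simp: indicator_def\<close>)
    have F2: "AE x in lborel. (indicator {0..?b} x * F x)\<^sup>2 = (indicator {0..?a} x * F x)\<^sup>2 + (indicator {?a..?b} x * F x)\<^sup>2"
      using AE by eventually_elim (use nonneg[of n] less[of n] in \<open>auto simp: indicator_def\<close>)
    have mX: "(\<lambda>x. (indicator A x * X x)\<^sup>2) \<in> borel_measurable lborel" if "A \<in> sets borel" for A using Xm that by measurable
    have mF: "(\<lambda>x. (indicator A x * F x)\<^sup>2) \<in> borel_measurable lborel" if "A \<in> sets borel" for A using F(1) that by measurable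
    have iS: "integrable lborel (\<lambda>x. (indicator {0<..<?a} x * X x)\<^sup>2 + (indicator {?a<..<?b} x * X x)\<^sup>2)"
      using Suc piece[of n] by simp
    have i: "integrable lborel (\<lambda>x. (indicator {0<..<?b} x * X x)\<^sup>2)"
      by (rule integrable_cong_AE_imp[OF iS mX]) (use X2 in auto)
    have "(LINT x|lborel. (indicator {0<..<?b} x * X x)\<^sup>2) = (LINT x|lborel. (indicator {0<..<?a} x * X x)\<^sup>2 + (indicator {?a<..<?b} x * X x)\<^sup>2)"
      by (rule integral_cong_AE[OF mX borel_measurable_add[OF mX mX] X2]) auto
    also have "\<dots> = (LINT x|lborel. (indicator {0<..<?a} x * X x)\<^sup>2) + (LINT x|lborel. (indicator {?a<..<?b} x * X x)\<^sup>2)"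
      using Suc piece[of n] by simp
    finally have "c * (LINT x|lborel. (indicator {0<..<?b} x * X x)\<^sup>2) \<le>
      (LINT x|lborel. (indicator {0..?a} x * F x)\<^sup>2) + (LINT x|lborel. (indicator {?a..?b} x * F x)\<^sup>2)"
      using Suc piece[of n] by (simp add: distrib_left)
    also have "\<dots> = (LINT x|lborel. (indicator {0..?a} x * F x)\<^sup>2 + (indicator {?a..?b} x * F x)\<^sup>2)"
      by (rule Bochner_Integration.integral_add[symmetric]) (auto intro!: iF)
    also have "\<dots> = (LINT x|lborel. (indicator {0..?b} x * F x)\<^sup>2)"
      by (rule integral_cong_AE[OF mF borel_measurable_add[OF mF mF] F2, symmetric]) auto
    finally show ?case using i by blast
  qed
  have bd: "(LINT x|lborel. (indicator {0<..<lam n} x * X x)\<^sup>2) \<le> (1 / c) * (LINT x|lborel. (F x)\<^sup>2)" for n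
  proof -
    have "(LINT x|lborel. (indicator {0..lam n} x * F x)\<^sup>2) \<le> (LINT x|lborel. (F x)\<^sup>2)"
      by (rule integral_mono[OF iF F(2)]) (auto simp: indicator_def)
    then show ?thesis using partial[of n] c by (simp add: field_simps)
  qed
  have lim: "AE x in lborel. (\<lambda>n. indicator {0<..<lam n} x * X x) \<longlonglongrightarrow> indicator {0<..} x * X x"
  proof (rule AE_I2, rule tendsto_eventually)
    fix x
    have "\<forall>\<^sub>F n in sequentially. x < lam n" using lam(3) by (simp add: filterlim_at_top_dense)
    then show "\<forall>\<^sub>F n in sequentially. indicator {0<..<lam n} x * X x = indicator {0<..} x * X x"
      by eventually_elim (auto simp: indicator_def)
  qed
  have "(LINT x|lborel. (indicator {0<..} x * X x)\<^sup>2) \<le> (1 / c) * (LINT x|lborel. (F x)\<^sup>2)"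
  proof (rule fatou_square(2)[OF _ _ _ lim bd tendsto_const])
    show "(\<lambda>x. indicator {0<..} x * X x) \<in> borel_measurable lborel" using Xm by measurable
    show "(\<lambda>x. indicator {0<..<lam n} x * X x) \<in> borel_measurable lborel" for n using Xm by measurable
    show "integrable lborel (\<lambda>x. (indicator {0<..<lam n} x * X x)\<^sup>2)" for n using partial by blast
  qed
  then show ?thesis using c by (simp add: field_simps X_def)
qed

lemma integrable_inverse_1_plus_square_nonneg:
  "integrable lborel (\<lambda>x::real. indicator {0..} x * (1 / (1 + x\<^sup>2)))"
proof (rule integrableI_nonneg)
  have p: "1 + x\<^sup>2 > 0" for x :: real using zero_le_power2[of x] by linarith
  have "(\<integral>\<^sup>+x. ennreal (1 / (1 + x\<^sup>2)) * indicator {0..} x \<partial>lborel) = ennreal (pi / 2 - arctan 0)"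
  proof (rule nn_integral_FTC_atLeast)
    show "(\<lambda>x::real. 1 / (1 + x\<^sup>2)) \<in> borel_measurable borel" by measurable
    show "DERIV arctan x :> 1 / (1 + x\<^sup>2)" for x
      using DERIV_arctan[of x] by (simp add: inverse_eq_divide)
    show "0 \<le> 1 / (1 + x\<^sup>2)" for x :: real using p[of x] by (simp add: less_imp_le)
    show "(arctan \<longlongrightarrow> pi / 2) at_top" by (rule tendsto_arctan_at_top)
  qed
  moreover have "(\<integral>\<^sup>+x. ennreal (indicator {0..} x * (1 / (1 + x\<^sup>2))) \<partial>lborel) = (\<integral>\<^sup>+x. ennreal (1 / (1 + x\<^sup>2)) * indicator {0..} x \<partial>(lborel :: real measure))"
    by (intro nn_integral_cong) (auto simp: indicator_def)
  ultimately show "(\<integral>\<^sup>+x. ennreal (indicator {0..} x * (1 / (1 + x\<^sup>2))) \<partial>(lborel :: real measure)) < \<infinity>" by simp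
  show "AE x in lborel. 0 \<le> indicator {0..} x * (1 / (1 + x\<^sup>2) :: real)"
    using p by (intro AE_I2) (auto simp: indicator_def less_imp_le)
qed measurable

text \<open>With A = 1 + r^2 the inequality 2 |f| \<le> 1/A + A f^2 dominates |f| by integrable
  terms, since A f^2 = f^2 + (r f)^2.\<close>

lemma integrable_of_weighted_squares:
  fixes f :: "real \<Rightarrow> real"
  assumes f: "f \<in> borel_measurable borel" "integrable lborel (\<lambda>r. (f r)\<^sup>2)" "integrable lborel (\<lambda>r. (r * f r)\<^sup>2)"
    and f0: "\<And>r. r \<le> 0 \<Longrightarrow> f r = 0"
  shows "integrable lborel f"
proof (rule Bochner_Integration.integrable_bound)
  show "integrable lborel (\<lambda>r. indicator {0..} r * (1 / (1 + r\<^sup>2)) + ((f r)\<^sup>2 + (r * f r)\<^sup>2))"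
    by (intro Bochner_Integration.integrable_add integrable_inverse_1_plus_square_nonneg f)
  show "AE r in lborel. norm (f r) \<le> norm (indicator {0..} r * (1 / (1 + r\<^sup>2)) + ((f r)\<^sup>2 + (r * f r)\<^sup>2))"
  proof (rule AE_I2)
    fix r
    show "norm (f r) \<le> norm (indicator {0..} r * (1 / (1 + r\<^sup>2)) + ((f r)\<^sup>2 + (r * f r)\<^sup>2))"
    proof (cases "r > 0")
      case True
      define A where "A = 1 + r\<^sup>2"
      have A: "A > 0" unfolding A_def using zero_le_power2[of r] by linarith
      have "0 \<le> (1 - A * \<bar>f r\<bar>)\<^sup>2" by simp
      then have "2 * (A * \<bar>f r\<bar>) \<le> 1 + A * (A * (f r)\<^sup>2)" by (simp add: power2_eq_square algebra_simps)
      then have "2 * \<bar>f r\<bar> \<le> 1 / A + A * (f r)\<^sup>2" using A by (simp add: field_simps power2_eq_square)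
      moreover have "0 \<le> 1 / A" "0 \<le> A * (f r)\<^sup>2" using A by auto
      ultimately have "\<bar>f r\<bar> \<le> 1 / A + A * (f r)\<^sup>2" "0 \<le> 1 / A + A * (f r)\<^sup>2" by linarith+
      moreover have "A * (f r)\<^sup>2 = (f r)\<^sup>2 + (r * f r)\<^sup>2" by (simp add: A_def power_mult_distrib algebra_simps)
      ultimately show ?thesis using True by (simp add: A_def)
    qed (simp add: f0)
  qed
qed (use f in simp)

text \<open>Zeros are prescribed for continuous representatives. For H f this is
  \<open>real_hankel \<nu> f\<close> itself; for f it is H H f, which agrees with f almost
  everywhere. Hence \<open>zl\<close> and \<open>zm\<close> speak of these transforms, conditionally
  on facts such as integrability that only the proof establishes.\<close>

lemma real_hankel_uniqueness_real:
  fixes f :: "real \<Rightarrow> real" and lam mu :: "nat \<Rightarrow> real"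
  assumes nu: "\<nu> > 0" and c: "c > 1"
    and lam: "lam 0 = 0" "strict_mono lam" "filterlim lam at_top sequentially" "\<And>j. confined \<nu> (lam j) (lam (Suc j)) c"
    and mu: "mu 0 = 0" "strict_mono mu" "filterlim mu at_top sequentially" "\<And>j. confined \<nu> (mu j) (mu (Suc j)) c"
    and f: "f \<in> borel_measurable borel" "integrable lborel (\<lambda>r. (f r)\<^sup>2)" "integrable lborel (\<lambda>r. (r * f r)\<^sup>2)"
    and f0: "\<And>r. r \<le> 0 \<Longrightarrow> f r = 0"
    and h: "integrable lborel (\<lambda>k. (k * real_hankel \<nu> f k)\<^sup>2)"
    and zl: "integrable lborel (real_hankel \<nu> f) \<Longrightarrow> AE x in lborel. real_hankel \<nu> (real_hankel \<nu> f) x = f x \<Longrightarrow> \<forall>j\<ge>1. real_hankel \<nu> (real_hankel \<nu> f) (lam j) = 0"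
    and zm: "integrable lborel f \<Longrightarrow> \<forall>j\<ge>1. real_hankel \<nu> f (mu j) = 0"
  shows "AE r in lborel. f r = 0"
proof -
  have c0: "c > 0" using c by simp
  have fi: "integrable lborel f" by (rule integrable_of_weighted_squares[OF f f0])
  obtain C where C: "C > 0" "\<And>k r. \<bar>hankel_kernel \<nu> k r\<bar> \<le> C" using hankel_kernel_bounded[OF nu] by metis
  have hm: "real_hankel \<nu> f \<in> borel_measurable borel" by (rule borel_measurable_real_hankel[OF nu f(1)])
  \<comment> \<open>On (0,1) the transform is bounded, and from 1 on it is dominated by k times
    itself, which is square-integrable by hypothesis.\<close>
  have h2: "integrable lborel (\<lambda>k. (real_hankel \<nu> f k)\<^sup>2)"
  proof (rule Bochner_Integration.integrable_bound)
    let ?B = "C * (LINT r|lborel. \<bar>f r\<bar>)"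
    have B: "\<bar>real_hankel \<nu> f k\<bar> \<le> ?B" for k by (rule real_hankel_abs_le[OF nu fi C(2)])
    have em: "emeasure lborel {0<..<1::real} < \<infinity>" by (rule emeasure_bounded_finite) simp
    show "integrable lborel (\<lambda>k. ?B\<^sup>2 * indicator {0<..<1} k + (k * real_hankel \<nu> f k)\<^sup>2)"
      by (intro Bochner_Integration.integrable_add h integrable_mult_right integrable_real_indicator em) simp
    show "(\<lambda>k. (real_hankel \<nu> f k)\<^sup>2) \<in> borel_measurable lborel" using hm by measurable
    show "AE k in lborel. norm ((real_hankel \<nu> f k)\<^sup>2) \<le> norm (?B\<^sup>2 * indicator {0<..<1} k + (k * real_hankel \<nu> f k)\<^sup>2)"
    proof (rule AE_I2)
      fix k :: real
      consider "k \<le> 0" | "0 < k" "k < 1" | "k \<ge> 1" by linarith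
      then show "norm ((real_hankel \<nu> f k)\<^sup>2) \<le> norm (?B\<^sup>2 * indicator {0<..<1} k + (k * real_hankel \<nu> f k)\<^sup>2)"
      proof cases
        case 1 then show ?thesis by (simp add: real_hankel_nonpos)
      next
        case 2
        have "\<bar>real_hankel \<nu> f k\<bar>\<^sup>2 \<le> ?B\<^sup>2" by (rule power_mono[OF B]) simp
        then have "(real_hankel \<nu> f k)\<^sup>2 + 0 \<le> ?B\<^sup>2 + (k * real_hankel \<nu> f k)\<^sup>2" by (intro add_mono) simp_all
        then show ?thesis using 2 by simp
      next
        case 3
        then have "1 * (real_hankel \<nu> f k)\<^sup>2 \<le> k\<^sup>2 * (real_hankel \<nu> f k)\<^sup>2" by (intro mult_right_mono) auto
        then show ?thesis using 3 by (simp add: power_mult_distrib)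
      qed
    qed
  qed
  have hi: "integrable lborel (real_hankel \<nu> f)" by (rule integrable_of_weighted_squares[OF hm h2 h real_hankel_nonpos])
  have inv: "AE x in lborel. real_hankel \<nu> (real_hankel \<nu> f) x = f x" by (rule real_hankel_inversion[OF nu fi f0 hi])
  have Gm: "(\<lambda>x. x powr (- (\<nu> + 1/2)) * v x) \<in> borel_measurable borel" if "v \<in> borel_measurable borel" for v :: "real \<Rightarrow> real"
    using that by measurable
  \<comment> \<open>The weights introduced by the substitution cancel on (0, \<infinity>), and both
    sides vanish elsewhere.\<close>
  have can: "(LINT x|lborel. (indicator {0<..} x * (x * (x powr (\<nu> + 1/2) * (x powr (- (\<nu> + 1/2)) * real_hankel \<nu> v x))))\<^sup>2)
      = (LINT x|lborel. (x * real_hankel \<nu> v x)\<^sup>2)" for v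
  proof (rule Bochner_Integration.integral_cong[OF refl])
    fix x :: real
    show "(indicator {0<..} x * (x * (x powr (\<nu> + 1/2) * (x powr (- (\<nu> + 1/2)) * real_hankel \<nu> v x))))\<^sup>2 = (x * real_hankel \<nu> v x)\<^sup>2"
    proof (cases "x > 0")
      case True
      then have "x powr (\<nu> + 1/2) * x powr (- (\<nu> + 1/2)) = 1" by (simp only: powr_add[symmetric]) simp
      then have E: "x powr (\<nu> + 1/2) * (x powr (- (\<nu> + 1/2)) * real_hankel \<nu> v x) = real_hankel \<nu> v x" unfolding mult.assoc[symmetric] by simp
      show ?thesis unfolding E using True by simp
    qed (simp add: real_hankel_nonpos)
  qed
  \<comment> \<open>One statement serves both halves: f with the sequence \<open>mu\<close>, and H f
    with the sequence \<open>lam\<close>.\<close>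
  have half: "c * (LINT x|lborel. (x * real_hankel \<nu> v x)\<^sup>2) \<le> (LINT r|lborel. (r * v r)\<^sup>2)"
    if v: "integrable lborel v" "\<And>r. r \<le> 0 \<Longrightarrow> v r = 0" "integrable lborel (\<lambda>r. (r * v r)\<^sup>2)"
      and seq: "sq 0 = 0" "strict_mono sq" "filterlim sq at_top sequentially" "\<And>j. confined \<nu> (sq j) (sq (Suc j)) c"
      and z: "\<forall>j\<ge>1. real_hankel \<nu> v (sq j) = 0" for v and sq :: "nat \<Rightarrow> real"
  proof -
    have vm: "v \<in> borel_measurable borel" using v(1) by auto
    show ?thesis
    proof (rule real_hankel_weighted_primitive[OF nu v])
      fix F
      assume F: "F \<in> borel_measurable borel" "integrable lborel (\<lambda>t. (F t)\<^sup>2)"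
        "(LINT t|lborel. (F t)\<^sup>2) \<le> (LINT r|lborel. (r * v r)\<^sup>2)"
        "\<And>x y. 0 < x \<Longrightarrow> x \<le> y \<Longrightarrow> y powr (- (\<nu> + 1/2)) * real_hankel \<nu> v y - x powr (- (\<nu> + 1/2)) * real_hankel \<nu> v x
           = (LINT t|lborel. (indicator {x..y} t * t powr (- (\<nu> + 1/2))) * F t)"
      have "c * (LINT x|lborel. (indicator {0<..} x * (x * (x powr (\<nu> + 1/2) * (x powr (- (\<nu> + 1/2)) * real_hankel \<nu> v x))))\<^sup>2) \<le> (LINT x|lborel. (F x)\<^sup>2)"
      proof (rule confined_seq_bound[OF nu c0 seq F(1,2) Gm[OF borel_measurable_real_hankel[OF nu vm]] F(4)])
        fix j :: nat assume "j \<ge> 1"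
        then show "sq j powr (- (\<nu> + 1/2)) * real_hankel \<nu> v (sq j) = 0" using z by simp
      qed
      then show "c * (LINT x|lborel. (x * real_hankel \<nu> v x)\<^sup>2) \<le> (LINT r|lborel. (r * v r)\<^sup>2)"
        unfolding can using F(3) by linarith
    qed
  qed
  have 1: "c * (LINT x|lborel. (x * real_hankel \<nu> f x)\<^sup>2) \<le> (LINT r|lborel. (r * f r)\<^sup>2)"
    by (rule half[OF fi f0 f(3) mu zm[OF fi]])
  have 2: "c * (LINT x|lborel. (x * real_hankel \<nu> (real_hankel \<nu> f) x)\<^sup>2) \<le> (LINT r|lborel. (r * real_hankel \<nu> f r)\<^sup>2)"
    by (rule half[OF hi real_hankel_nonpos h lam zl[OF hi inv]])
  have "(LINT x|lborel. (x * real_hankel \<nu> (real_hankel \<nu> f) x)\<^sup>2) = (LINT x|lborel. (x * f x)\<^sup>2)"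
  proof (rule integral_cong_AE)
    show "AE x in lborel. (x * real_hankel \<nu> (real_hankel \<nu> f) x)\<^sup>2 = (x * f x)\<^sup>2" using inv by eventually_elim simp
    show "(\<lambda>x. (x * real_hankel \<nu> (real_hankel \<nu> f) x)\<^sup>2) \<in> borel_measurable lborel"
      using borel_measurable_real_hankel[OF nu hm] by measurable
    show "(\<lambda>x. (x * f x)\<^sup>2) \<in> borel_measurable lborel" using f(1) by measurable
  qed
  with 2 have 3: "c * (LINT x|lborel. (x * f x)\<^sup>2) \<le> (LINT r|lborel. (r * real_hankel \<nu> f r)\<^sup>2)" by simp
  \<comment> \<open>The two halves combine to c^2 I \<le> I, where I is the integral of (x f)^2; c >
    1 forces I = 0.\<close>
  have "c * (c * (LINT x|lborel. (x * f x)\<^sup>2)) \<le> (LINT x|lborel. (x * f x)\<^sup>2)"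
    using mult_left_mono[OF 3 less_imp_le[OF c0]] 1 by linarith
  moreover have "(LINT x|lborel. (x * f x)\<^sup>2) = 0" if "c * (c * (LINT x|lborel. (x * f x)\<^sup>2)) \<le> (LINT x|lborel. (x * f x)\<^sup>2)"
  proof (rule ccontr)
    let ?I = "LINT x|lborel. (x * f x)\<^sup>2"
    assume "?I \<noteq> 0"
    moreover have "?I \<ge> 0" by simp
    ultimately have I: "?I > 0" by linarith
    then have "1 * ?I < c * ?I" using c by (intro mult_strict_right_mono) auto
    moreover from I have "1 * (c * ?I) < c * (c * ?I)" using c by (intro mult_strict_right_mono) auto
    ultimately show False using that by linarith
  qed
  ultimately have "(LINT x|lborel. (x * f x)\<^sup>2) = 0" by blast
  then have "AE x in lborel. (x * f x)\<^sup>2 = 0"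
    using f(3) by (subst (asm) integral_nonneg_eq_0_iff_AE) auto
  then show ?thesis
  proof eventually_elim
    case (elim x)
    then show ?case using f0[of x] by (cases "x = 0") auto
  qed
qed

section \<open>Continuous representatives and complex-valued functions\<close>

lemma continuous_on_real_hankel:
  assumes nu: "\<nu> > 0" and f: "integrable lborel f"
  shows "continuous_on {0<..} (real_hankel \<nu> f)"
proof (rule continuous_on_sequentiallyI)
  fix u and k :: real assume u: "\<forall>n. u n \<in> {0<..}" "k \<in> {0<..}" "u \<longlonglongrightarrow> k"
  obtain C where C: "C > 0" "\<And>k r. \<bar>hankel_kernel \<nu> k r\<bar> \<le> C" using hankel_kernel_bounded[OF nu] by metis
  have w: "integrable lborel (\<lambda>r. C * norm (f r))" using f by simp
  show "(\<lambda>n. real_hankel \<nu> f (u n)) \<longlonglongrightarrow> real_hankel \<nu> f k"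
    unfolding real_hankel_def
  proof (rule integral_dominated_convergence[OF _ _ w])
    have m: "(\<lambda>r. f r * hankel_kernel \<nu> q r) \<in> borel_measurable lborel" for q using integrable_real_hankel_integrand[OF nu f] by blast
    show "(\<lambda>r. f r * hankel_kernel \<nu> k r) \<in> borel_measurable lborel" "\<And>n. (\<lambda>r. f r * hankel_kernel \<nu> (u n) r) \<in> borel_measurable lborel"
      by (rule m)+
    show "AE r in lborel. norm (f r * hankel_kernel \<nu> (u n) r) \<le> C * norm (f r)" for n
      using C(2) by (intro AE_I2) (simp add: abs_mult mult.commute[of C] mult_left_mono)
    show "AE r in lborel. (\<lambda>n. f r * hankel_kernel \<nu> (u n) r) \<longlonglongrightarrow> f r * hankel_kernel \<nu> k r"
    proof (rule AE_I2)
      fix r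
      show "(\<lambda>n. f r * hankel_kernel \<nu> (u n) r) \<longlonglongrightarrow> f r * hankel_kernel \<nu> k r"
      proof (cases "r > 0")
        case True
        have "isCont (bessel_kernel \<nu>) (k * r)"
          using has_real_derivative_bessel_kernel[OF _ nu, of "k * r"] True u(2) by (auto intro: DERIV_isCont)
        moreover have "(\<lambda>n. u n * r) \<longlonglongrightarrow> k * r" by (intro tendsto_intros u)
        ultimately have "(\<lambda>n. bessel_kernel \<nu> (u n * r)) \<longlonglongrightarrow> bessel_kernel \<nu> (k * r)" by (rule isCont_tendsto_compose)
        then show ?thesis using True u(1,2) by (auto simp: hankel_kernel_def intro!: tendsto_mult)
      qed (simp add: hankel_kernel_def)
    qed
  qed
qed

text \<open>The set where two continuous functions differ is open, so if nonempty it contains an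
  interval of positive measure.\<close>

lemma AE_eq_continuous_imp_eq:
  fixes u v :: "real \<Rightarrow> real"
  assumes u: "continuous_on {0<..} u" and v: "continuous_on {0<..} v"
    and ae: "AE x in lborel. x > 0 \<longrightarrow> u x = v x" and x: "x > 0"
  shows "u x = v x"
proof (rule ccontr)
  assume ne: "u x \<noteq> v x"
  let ?U = "{0<..} \<inter> (\<lambda>x. u x - v x) -` (- {0})"
  have "open ?U"
    by (rule continuous_open_preimage[OF continuous_on_diff[OF u v]]) auto
  moreover have "x \<in> ?U" using ne x by simp
  ultimately obtain e where e: "e > 0" "ball x e \<subseteq> ?U" by (meson open_contains_ball)
  have "AE y in lborel. y \<notin> {x - e<..<x + e}"
    using ae by eventually_elim (use e(2) in \<open>auto simp: ball_eq_greaterThanLessThan\<close>)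
  then have "emeasure lborel {x - e<..<x + e} = 0"
    by (intro AE_iff_measurable[THEN iffD1, rotated 2]) auto
  then show False using e(1) by simp
qed

text \<open>The kernel is real, so real and imaginary parts commute with the transform; P stands for
  either part, and one uniqueness argument covers both.\<close>

lemma hankel_real_part:
  fixes P :: "complex \<Rightarrow> real"
  assumes P: "P = Re \<or> P = Im" and k: "k > 0" and nu: "\<nu> > 0"
    and i: "integrable lborel (\<lambda>r. indicator {0<..} r * Re (f r))" "integrable lborel (\<lambda>r. indicator {0<..} r * Im (f r))"
  shows "P (hankel \<nu> f k) = real_hankel \<nu> (\<lambda>r. indicator {0<..} r * P (f r)) k"
proof -
  let ?u = "\<lambda>r. indicator {0<..} r * Re (f r) * hankel_kernel \<nu> k r" and ?v = "\<lambda>r. indicator {0<..} r * Im (f r) * hankel_kernel \<nu> k r"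
  have iu: "integrable lborel ?u" and iv: "integrable lborel ?v" by (intro integrable_real_hankel_integrand nu i)+
  have "hankel \<nu> f k = (LINT r|lborel. complex_of_real (?u r) + \<i> * complex_of_real (?v r))"
    unfolding hankel_def set_lebesgue_integral_def
  proof (rule Bochner_Integration.integral_cong[OF refl])
    fix r
    show "indicator {0<..} r *\<^sub>R (f r * complex_of_real (bessel_J \<nu> (k * r) * sqrt (k * r))) = complex_of_real (?u r) + \<i> * complex_of_real (?v r)"
    proof (cases "r > 0")
      case True
      then have "hankel_kernel \<nu> k r = bessel_J \<nu> (k * r) * sqrt (k * r)" using k by (simp add: hankel_kernel_def bessel_kernel_def)
      then show ?thesis using True by (simp only: complex_eq_iff) simp
    qed simp
  qed
  also have "\<dots> = complex_of_real (LINT r|lborel. ?u r) + \<i> * complex_of_real (LINT r|lborel. ?v r)"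
    by (simp only: Bochner_Integration.integral_add[OF integrable_of_real[OF iu] integrable_mult_right[OF integrable_of_real[OF iv]]]
        integral_mult_right_zero integral_complex_of_real)
  finally have "hankel \<nu> f k = complex_of_real (LINT r|lborel. ?u r) + \<i> * complex_of_real (LINT r|lborel. ?v r)" .
  then show ?thesis using P by (auto simp: real_hankel_def)
qed

text \<open>Real and imaginary parts are treated by \<open>real_hankel_uniqueness_real\<close>. The
  point values of the given representatives g and h are transferred to the transforms by uniqueness
  of continuous representatives, with inversion linking g to the double transform.\<close>

lemma hankel_uniqueness_of_confined:
  fixes lam mu :: "nat \<Rightarrow> real"
  assumes nu: "\<nu> > 0" and c: "c > 1"
    and lam: "lam 0 = 0" "strict_mono lam" "filterlim lam at_top sequentially" "\<And>j. confined \<nu> (lam j) (lam (Suc j)) c"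
    and mu: "mu 0 = 0" "strict_mono mu" "filterlim mu at_top sequentially" "\<And>j. confined \<nu> (mu j) (mu (Suc j)) c"
  shows "hankel_uniqueness_pair \<nu> lam mu"
  unfolding hankel_uniqueness_pair_def
proof (intro ballI allI impI, elim conjE)
  fix f g h
  assume f: "f \<in> hankel_space \<nu>" and g: "continuous_on {0<..} g" "L2_eq {0<..} g f"
    and h: "continuous_on {0<..} h" "L2_eq {0<..} h (hankel \<nu> f)"
    and zg: "\<forall>j\<ge>1. g (lam j) = 0" and zh: "\<forall>j\<ge>1. h (mu j) = 0"
  have S: "{0<..} \<in> sets (borel :: real measure)" by simp
  have f1: "f \<in> L2 {0<..}" and f2: "(\<lambda>r. of_real r * f r) \<in> L2 {0<..}" and f3: "(\<lambda>r. of_real r * hankel \<nu> f r) \<in> L2 {0<..}"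
    using f by (simp_all add: hankel_space_def)
  have pos: "lam j > 0" "mu j > 0" if "j \<ge> 1" for j
    using that lam(1,2) mu(1,2) strict_monoD[of lam 0 j] strict_monoD[of mu 0 j] by auto
  have parts: "integrable lborel (\<lambda>r. indicator {0<..} r * P (f r)) \<and> (\<lambda>r. indicator {0<..} r * P (f r)) \<in> borel_measurable borel \<and>
      integrable lborel (\<lambda>r. (indicator {0<..} r * P (f r))\<^sup>2) \<and> integrable lborel (\<lambda>r. (r * (indicator {0<..} r * P (f r)))\<^sup>2)"
    if P: "P = Re \<or> P = Im" for P
  proof -
    let ?p = "\<lambda>r. indicator {0<..} r * P (f r)"
    have Pm: "P \<in> borel_measurable borel" using P by auto
    have Pc: "\<bar>P z\<bar> \<le> cmod z" for z using P by (auto simp: abs_Re_le_cmod abs_Im_le_cmod)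
    have e: "?p r = P (indicator {0<..} r *\<^sub>R f r)" for r using P by (auto simp: indicator_def)
    have m: "?p \<in> borel_measurable borel"
      unfolding e using measurable_compose[OF L2_D(1)[OF f1 S] Pm] by simp
    have i1: "integrable lborel (\<lambda>r. (?p r)\<^sup>2)"
    proof (rule Bochner_Integration.integrable_bound[OF L2_D(2)[OF f1 S]])
      show "(\<lambda>r. (?p r)\<^sup>2) \<in> borel_measurable lborel" using m by measurable
      show "AE r in lborel. norm ((?p r)\<^sup>2) \<le> norm ((indicator {0<..} r * cmod (f r))\<^sup>2)"
        using power_mono[OF Pc, of _ 2] by (intro AE_I2) (auto simp: indicator_def)
    qed
    have i2: "integrable lborel (\<lambda>r. (r * ?p r)\<^sup>2)"
    proof (rule Bochner_Integration.integrable_bound[OF L2_D(2)[OF f2 S]])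
      show "(\<lambda>r. (r * ?p r)\<^sup>2) \<in> borel_measurable lborel" using m by measurable
      show "AE r in lborel. norm ((r * ?p r)\<^sup>2) \<le> norm ((indicator {0<..} r * cmod (of_real r * f r))\<^sup>2)"
        using power_mono[OF Pc, of _ 2] by (intro AE_I2) (auto simp: indicator_def norm_mult power_mult_distrib intro!: mult_left_mono)
    qed
    have "integrable lborel ?p" by (rule integrable_of_weighted_squares[OF m i1 i2]) simp
    then show ?thesis using m i1 i2 by blast
  qed
  have zero: "AE r in lborel. indicator {0<..} r * P (f r) = 0" if P: "P = Re \<or> P = Im" for P
  proof -
    let ?p = "\<lambda>r. indicator {0<..} r * P (f r)"
    note PR = parts[OF P]
    have Pc: "\<bar>P z\<bar> \<le> cmod z" for z using P by (auto simp: abs_Re_le_cmod abs_Im_le_cmod)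
    have Pcont: "continuous_on UNIV P" using P by (auto intro: continuous_intros)
    have P0: "P 0 = 0" using P by auto
    have Pr: "P (of_real k * z) = k * P z" for k z using P by auto
    have H: "real_hankel \<nu> ?p k = P (hankel \<nu> f k)" if "k > 0" for k
      by (rule hankel_real_part[OF P that nu, symmetric]) (use parts in auto)
    show ?thesis
    proof (rule real_hankel_uniqueness_real[OF nu c lam mu])
      show "?p \<in> borel_measurable borel" "integrable lborel (\<lambda>r. (?p r)\<^sup>2)" "integrable lborel (\<lambda>r. (r * ?p r)\<^sup>2)" using PR by blast+
      show "?p r = 0" if "r \<le> 0" for r using that by simp
      show "integrable lborel (\<lambda>k. (k * real_hankel \<nu> ?p k)\<^sup>2)"
      proof (rule Bochner_Integration.integrable_bound[OF L2_D(2)[OF f3 S]])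
        show "(\<lambda>k. (k * real_hankel \<nu> ?p k)\<^sup>2) \<in> borel_measurable lborel"
        proof -
          have "?p \<in> borel_measurable borel" using PR by blast
          from borel_measurable_real_hankel[OF nu this] show ?thesis by measurable
        qed
        show "AE k in lborel. norm ((k * real_hankel \<nu> ?p k)\<^sup>2) \<le> norm ((indicator {0<..} k * cmod (of_real k * hankel \<nu> f k))\<^sup>2)"
        proof (rule AE_I2)
          fix k :: real
          show "norm ((k * real_hankel \<nu> ?p k)\<^sup>2) \<le> norm ((indicator {0<..} k * cmod (of_real k * hankel \<nu> f k))\<^sup>2)"
          proof (cases "k > 0")
            case True
            have "\<bar>P (of_real k * hankel \<nu> f k)\<bar>\<^sup>2 \<le> (cmod (of_real k * hankel \<nu> f k))\<^sup>2" by (rule power_mono[OF Pc]) simp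
            then show ?thesis using True by (simp add: Pr H)
          qed (simp add: real_hankel_nonpos)
        qed
      qed
      show "\<forall>j\<ge>1. real_hankel \<nu> ?p (mu j) = 0" if pi: "integrable lborel ?p"
      proof (intro allI impI)
        fix j :: nat assume j: "j \<ge> 1"
        have "P (h (mu j)) = real_hankel \<nu> ?p (mu j)"
        proof (rule AE_eq_continuous_imp_eq[OF _ continuous_on_real_hankel[OF nu pi] _ pos(2)[OF j]])
          show "continuous_on {0<..} (\<lambda>x. P (h x))" by (rule continuous_on_compose2[OF Pcont h(1)]) simp
          show "AE x in lborel. x > 0 \<longrightarrow> P (h x) = real_hankel \<nu> ?p x"
            using h(2) unfolding L2_eq_def by eventually_elim (simp add: H)
        qed
        then show "real_hankel \<nu> ?p (mu j) = 0" using zh j P0 by simp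
      qed
      show "\<forall>j\<ge>1. real_hankel \<nu> (real_hankel \<nu> ?p) (lam j) = 0"
        if hi: "integrable lborel (real_hankel \<nu> ?p)" and inv: "AE x in lborel. real_hankel \<nu> (real_hankel \<nu> ?p) x = ?p x"
      proof (intro allI impI)
        fix j :: nat assume j: "j \<ge> 1"
        have "P (g (lam j)) = real_hankel \<nu> (real_hankel \<nu> ?p) (lam j)"
        proof (rule AE_eq_continuous_imp_eq[OF _ continuous_on_real_hankel[OF nu hi] _ pos(1)[OF j]])
          show "continuous_on {0<..} (\<lambda>x. P (g x))" by (rule continuous_on_compose2[OF Pcont g(1)]) simp
          show "AE x in lborel. x > 0 \<longrightarrow> P (g x) = real_hankel \<nu> (real_hankel \<nu> ?p) x"
            using inv g(2) unfolding L2_eq_def by eventually_elim simp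
        qed
        then show "real_hankel \<nu> (real_hankel \<nu> ?p) (lam j) = 0" using zg j P0 by simp
      qed
    qed
  qed
  have "AE r in lborel. indicator {0<..} r * Re (f r) = 0" "AE r in lborel. indicator {0<..} r * Im (f r) = 0"
    by (rule zero, simp)+
  then show "L2_eq {0<..} f (\<lambda>_. 0)"
    unfolding L2_eq_def by eventually_elim (auto simp: complex_eq_iff)
qed

text \<open>In the extended reals the infimum is a lower bound whether or not the family is bounded;
  a real number strictly between 1 and the infimum serves as uniform constant.\<close>

lemma INF_gt_1_imp_bound:
  fixes q :: "'i \<Rightarrow> real"
  assumes "(INF j\<in>I. ereal (q j)) > 1"
  shows "\<exists>c>1. \<forall>j\<in>I. q j > c"
proof -
  obtain c :: real where c: "1 < ereal c" "ereal c < (INF j\<in>I. ereal (q j))"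
    using ereal_dense2[OF assms] by (auto simp: one_ereal_def)
  have "c < q j" if "j \<in> I" for j
    using less_le_trans[OF c(2) INF_lower[OF that]] by simp
  then show ?thesis using c(1) by (auto simp: one_ereal_def)
qed

theorem corollary3p11:
  fixes \<nu> :: real and lam mu :: "nat \<Rightarrow> real"
  assumes "\<nu> > 0"
    and "lam 0 = 0" and "strict_mono lam" and "filterlim lam at_top sequentially"
    and "mu 0 = 0" and "strict_mono mu" and "filterlim mu at_top sequentially"
    and "((INF j. ereal (sqrt (kinetic_floor \<nu> (lam j) (lam (Suc j))) / lam (Suc j))) > 1 \<and>
        (INF j. ereal (sqrt (kinetic_floor \<nu> (mu j) (mu (Suc j))) / mu (Suc j))) > 1) \<or>
       (sqrt (kinetic_floor \<nu> 0 (lam 1)) / lam 1 > 1 \<and>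
        sqrt (kinetic_floor \<nu> 0 (mu 1)) / mu 1 > 1 \<and>
        (INF j\<in>{1..}. ereal (1 / (lam (Suc j))\<^sup>2 *
            (pi\<^sup>2 / (lam (Suc j) - lam j)\<^sup>2 +
             (INF r\<in>{lam j..lam (Suc j)}. (\<nu>\<^sup>2 - 1/4) / r\<^sup>2)))) > 1 \<and>
        (INF j\<in>{1..}. ereal (1 / (mu (Suc j))\<^sup>2 *
            (pi\<^sup>2 / (mu (Suc j) - mu j)\<^sup>2 +
             (INF r\<in>{mu j..mu (Suc j)}. (\<nu>\<^sup>2 - 1/4) / r\<^sup>2)))) > 1) \<or>
       ((INF j. ereal (sqrt (energy_floor \<nu> (lam j) (lam (Suc j))) / lam (Suc j))) > 1 \<and>
        (INF j. ereal (sqrt (energy_floor \<nu> (mu j) (mu (Suc j))) / mu (Suc j))) > 1) \<or>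
       (sqrt (energy_floor \<nu> 0 (lam 1)) / lam 1 > 1 \<and>
        sqrt (energy_floor \<nu> 0 (mu 1)) / mu 1 > 1 \<and>
        (INF j\<in>{1..}. ereal (1 / (lam (Suc j))\<^sup>2 *
            (pi\<^sup>2 / (2 * (lam (Suc j) - lam j)\<^sup>2) +
             1/2 * (INF r\<in>{lam j..lam (Suc j)}. (\<nu>\<^sup>2 - 1/4) / r\<^sup>2 + r\<^sup>2)))) > 1 \<and>
        (INF j\<in>{1..}. ereal (1 / (mu (Suc j))\<^sup>2 *
            (pi\<^sup>2 / (2 * (mu (Suc j) - mu j)\<^sup>2) +
             1/2 * (INF r\<in>{mu j..mu (Suc j)}. (\<nu>\<^sup>2 - 1/4) / r\<^sup>2 + r\<^sup>2)))) > 1)"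
  shows "hankel_uniqueness_pair \<nu> lam mu"
proof -
  note nu = assms(1)
  define sequence where "sequence = (\<lambda>s :: nat \<Rightarrow> real. s 0 = 0 \<and> strict_mono s)"
  define conf where "conf = (\<lambda>s :: nat \<Rightarrow> real. \<exists>c>1. \<forall>j. confined \<nu> (s j) (s (Suc j)) c)"
  have ab: "0 \<le> s j" "s j < s (Suc j)" "s (Suc j) > 0" and pos: "j \<in> {1..} \<Longrightarrow> 0 < s j" if "sequence s" for s j
  proof -
    have s: "s 0 = 0" "strict_mono s" using that by (simp_all add: sequence_def)
    show "0 \<le> s j" using s(1) strict_mono_mono[OF s(2)] by (metis le0 monoD)
    show "s j < s (Suc j)" using s(2) by (simp add: strict_mono_def)
    show "s (Suc j) > 0" using s(1) strict_monoD[OF s(2), of 0 "Suc j"] by simp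
    show "0 < s j" if "j \<in> {1..}" using s(1) strict_monoD[OF s(2), of 0 j] that by simp
  qed
  have sq: "1 < c\<^sup>2" if "1 < c" for c :: real using that by (simp add: one_less_power)
  \<comment> \<open>The local criteria concern j \<ge> 1. The first interval, which touches the
    singularity of the potential at 0, is supplied by its floor, and the smaller of the two
    constants works throughout.\<close>
  have join: "conf s"
    if s: "sequence s" and c: "c0 > 1" "c1 > 1" and 0: "confined \<nu> 0 (s 1) c0"
      and 1: "\<And>j. j \<in> {1..} \<Longrightarrow> confined \<nu> (s j) (s (Suc j)) c1" for s c0 c1
    unfolding conf_def
  proof (intro exI conjI allI)
    show "min c0 c1 > 1" using c by simp
    fix j show "confined \<nu> (s j) (s (Suc j)) (min c0 c1)"
    proof (cases j)
      case 0
      then show ?thesis using confined_mono[OF \<open>confined \<nu> 0 (s 1) c0\<close>, of "min c0 c1"] s by (simp add: sequence_def)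
    next
      case (Suc i)
      then show ?thesis using confined_mono[OF 1[of j], of "min c0 c1"] by simp
    qed
  qed
  have K: "conf s" if s: "sequence s" and I: "(INF j. ereal (sqrt (kinetic_floor \<nu> (s j) (s (Suc j))) / s (Suc j))) > 1" for s
  proof -
    from INF_gt_1_imp_bound[OF I] obtain c where C: "c > 1" "\<forall>j\<in>UNIV. sqrt (kinetic_floor \<nu> (s j) (s (Suc j))) / s (Suc j) > c" by blast
    note c = C(1) C(2)[THEN bspec, OF UNIV_I]
    have "confined \<nu> (s j) (s (Suc j)) (c\<^sup>2)" for j
      by (rule confined_kinetic_floor[OF ab(1,2)[OF s] _ c(2)]) (use c(1) in simp)
    then show ?thesis unfolding conf_def using sq[OF c(1)] by blast
  qed
  have E: "conf s" if s: "sequence s" and I: "(INF j. ereal (sqrt (energy_floor \<nu> (s j) (s (Suc j))) / s (Suc j))) > 1" for s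
  proof -
    from INF_gt_1_imp_bound[OF I] obtain c where C: "c > 1" "\<forall>j\<in>UNIV. sqrt (energy_floor \<nu> (s j) (s (Suc j))) / s (Suc j) > c" by blast
    note c = C(1) C(2)[THEN bspec, OF UNIV_I]
    have "confined \<nu> (s j) (s (Suc j)) (2 * c\<^sup>2 - 1)" for j
      by (rule confined_energy_floor[OF nu ab(1,2)[OF s] _ c(2)]) (use c(1) in simp)
    moreover have "2 * c\<^sup>2 - 1 > 1" using sq[OF c(1)] by simp
    ultimately show ?thesis unfolding conf_def by blast
  qed
  have KL: "conf s" if s: "sequence s" and 0: "sqrt (kinetic_floor \<nu> 0 (s 1)) / s 1 > 1"
    and I: "(INF j\<in>{1..}. ereal (1 / (s (Suc j))\<^sup>2 * (pi\<^sup>2 / (s (Suc j) - s j)\<^sup>2 + (INF r\<in>{s j..s (Suc j)}. (\<nu>\<^sup>2 - 1/4) / r\<^sup>2)))) > 1" for s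
  proof -
    from INF_gt_1_imp_bound[OF I] obtain c where C: "c > 1" "\<forall>j\<in>{1..}. 1 / (s (Suc j))\<^sup>2 * (pi\<^sup>2 / (s (Suc j) - s j)\<^sup>2 + (INF r\<in>{s j..s (Suc j)}. (\<nu>\<^sup>2 - 1/4) / r\<^sup>2)) > c" by blast
    note c = C(1) C(2)[THEN bspec]
    \<comment> \<open>The strict inequality on the first interval leaves room for a constant d > 1;
      its square is the confinement constant because the floor stands under a root.\<close>
    obtain d where d: "1 < d" "d < sqrt (kinetic_floor \<nu> 0 (s 1)) / s 1" using dense[OF 0] by blast
    have s1: "0 < s 1" using ab(3)[OF s, of 0] by simp
    show ?thesis
    proof (rule join[OF s sq[OF d(1)] c(1)])
      show "confined \<nu> 0 (s 1) (d\<^sup>2)" by (rule confined_kinetic_floor[OF order_refl s1 _ d(2)]) (use d(1) in simp)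
      show "confined \<nu> (s j) (s (Suc j)) c" if "j \<in> {1..}" for j
        by (rule confined_kinetic_local[OF nu pos[OF s that] ab(2)[OF s] c(2)[OF that]])
    qed
  qed
  have EL: "conf s" if s: "sequence s" and 0: "sqrt (energy_floor \<nu> 0 (s 1)) / s 1 > 1"
    and I: "(INF j\<in>{1..}. ereal (1 / (s (Suc j))\<^sup>2 * (pi\<^sup>2 / (2 * (s (Suc j) - s j)\<^sup>2) + 1/2 * (INF r\<in>{s j..s (Suc j)}. (\<nu>\<^sup>2 - 1/4) / r\<^sup>2 + r\<^sup>2)))) > 1" for s
  proof -
    from INF_gt_1_imp_bound[OF I] obtain c where C: "c > 1" "\<forall>j\<in>{1..}. 1 / (s (Suc j))\<^sup>2 * (pi\<^sup>2 / (2 * (s (Suc j) - s j)\<^sup>2) + 1/2 * (INF r\<in>{s j..s (Suc j)}. (\<nu>\<^sup>2 - 1/4) / r\<^sup>2 + r\<^sup>2)) > c" by blast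
    note c = C(1) C(2)[THEN bspec]
    obtain d where d: "1 < d" "d < sqrt (energy_floor \<nu> 0 (s 1)) / s 1" using dense[OF 0] by blast
    have s1: "0 < s 1" using ab(3)[OF s, of 0] by simp
    have c2: "2 * c - 1 > 1" and d2: "2 * d\<^sup>2 - 1 > 1" using c(1) sq[OF d(1)] by simp_all
    show ?thesis
    proof (rule join[OF s d2 c2])
      show "confined \<nu> 0 (s 1) (2 * d\<^sup>2 - 1)" by (rule confined_energy_floor[OF nu order_refl s1 _ d(2)]) (use d(1) in simp)
      show "confined \<nu> (s j) (s (Suc j)) (2 * c - 1)" if "j \<in> {1..}" for j
        by (rule confined_energy_local[OF nu pos[OF s that] ab(2)[OF s] c(2)[OF that]])
    qed
  qed
  have sl: "sequence lam" and sm: "sequence mu" using assms by (simp_all add: sequence_def)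
  have "conf lam \<and> conf mu"
    using assms(8) K[OF sl] K[OF sm] KL[OF sl] KL[OF sm] E[OF sl] E[OF sm] EL[OF sl] EL[OF sm] by argo
  then obtain c d where c: "c > 1" "\<And>j. confined \<nu> (lam j) (lam (Suc j)) c" and d: "d > 1" "\<And>j. confined \<nu> (mu j) (mu (Suc j)) d"
    unfolding conf_def by blast
  show ?thesis
  proof (rule hankel_uniqueness_of_confined[OF nu _ assms(2-4) _ assms(5-7)])
    show "min c d > 1" using c d by simp
    show "confined \<nu> (lam j) (lam (Suc j)) (min c d)" "confined \<nu> (mu j) (mu (Suc j)) (min c d)" for j
      using confined_mono[OF c(2)] confined_mono[OF d(2)] by simp_all
  qed
qed

end
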